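(* The $\mathrm{LTLf}^+$ synthesis problem is in 2EXPTIME, and the $\mathrm{PPLTL}^+$ synthesis problem is in EXPTIME (measured in the size of the input formula).
   Context: $AP$ is a fixed finite nonempty set of atoms partitioned as $X\cup Y$ (agent-controlled $X$, environment-controlled $Y$); $\Sigma=2^{AP}$. LTLf (future operators $X,U$ over finite traces, evaluated at the first position) and PPLTL (past operators $Y,S$ over finite traces, evaluated at the last position) are the standard temporal logics on finite traces; $[\Phi]$ is the set of nonempty finite traces satisfying $\Phi$. For a set $Z$ of finite traces: $\forall Z$ / $\exists Z$ / $\exists^\infty Z$ / $\forall^\infty Z$ is the set of infinite traces all / some / infinitely many / all but finitely many of whose nonempty finite prefixes lie in $Z$. $\mathrm{LTLf}^+$ (resp. $\mathrm{PPLTL}^+$) formulas: $\Psi::=\forall\Phi\mid\exists\Phi\mid\exists^\infty\Phi\mid\forall^\infty\Phi\mid\Psi\vee\Psi\mid\Psi\wedge\Psi\mid\neg\Psi$ with $\Phi$ in LTLf (resp. PPLTL), $[\mathbb{Q}\Phi]=\mathbb{Q}[\Phi]$, Boolean connectives set-theoretic on infinite traces. A strategy is a function $\sigma:(2^Y)^*\to2^X$; an outcome of $\sigma$ is an infinite trace $\tau$ over $2^{AP}$ with $\tau_0\cap X=\sigma(\varepsilon)$ and $\tau_i\cap X=\sigma((\tau_0\cap Y)\cdots(\tau_{i-1}\cap Y))$ for $i>0$. The synthesis problem asks, given $\Psi$, whether there is a strategy all of whose outcomes lie in $[\Psi]$, and if so to return a finite representation of one. *)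

theory Defs
  imports Complex_Main "HOL-Library.Landau_Symbols"
begin

text \<open>Tape cells hold letters of the (problem) alphabet, a blank, or machine-specific work symbols.\<close>

datatype 's cell = Blank | Letter 's | Work nat

datatype move = Move_Left | Stay | Move_Right

text \<open>A tape is two-way infinite: the position of the head together with the contents.\<close>

type_synonym 's tape = "int \<times> (int \<Rightarrow> 's cell)"

type_synonym 's tm_config = "nat \<times> 's tape list"

record 's tm =
  tm_tapes :: nat
  tm_symbols :: "'s cell set"
  tm_states :: "nat set"
  tm_start :: nat
  tm_accept :: nat
  tm_reject :: nat
  tm_delta :: "nat \<Rightarrow> 's cell list \<Rightarrow> nat \<times> ('s cell \<times> move) list"

definition tm_over :: "'s set \<Rightarrow> 's tm \<Rightarrow> bool" where
  "tm_over A M \<longleftrightarrow>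
     tm_tapes M \<ge> 1 \<and>
     finite (tm_symbols M) \<and> Blank \<in> tm_symbols M \<and> Letter ` A \<subseteq> tm_symbols M \<and>
     finite (tm_states M) \<and> {tm_start M, tm_accept M, tm_reject M} \<subseteq> tm_states M \<and>
     tm_accept M \<noteq> tm_reject M \<and>
     (\<forall>q\<in>tm_states M. \<forall>cs\<in>lists (tm_symbols M). length cs = tm_tapes M \<longrightarrow>
        (case tm_delta M q cs of (q', acts) \<Rightarrow>
           q' \<in> tm_states M \<and> length acts = tm_tapes M \<and> fst ` set acts \<subseteq> tm_symbols M))"

definition tape_content :: "'s list \<Rightarrow> int \<Rightarrow> 's cell" where
  "tape_content w i = (if 0 \<le> i \<and> i < int (length w) then Letter (w ! nat i) else Blank)"

text \<open>The input is on the first tape, all other tapes are blank.\<close>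

definition tm_init :: "'s tm \<Rightarrow> 's list \<Rightarrow> 's tm_config" where
  "tm_init M w =
     (tm_start M, (0, tape_content w) # replicate (tm_tapes M - 1) (0, tape_content []))"

fun head_shift :: "move \<Rightarrow> int" where
  "head_shift Move_Left = -1"
| "head_shift Stay = 0"
| "head_shift Move_Right = 1"

fun tape_act :: "'s cell \<times> move \<Rightarrow> 's tape \<Rightarrow> 's tape" where
  "tape_act (s, m) (i, f) = (i + head_shift m, f(i := s))"

text \<open>Accepting and rejecting configurations are left unchanged by a step.\<close>

fun tm_step :: "'s tm \<Rightarrow> 's tm_config \<Rightarrow> 's tm_config" where
  "tm_step M (q, tps) =
     (if q = tm_accept M \<or> q = tm_reject M then (q, tps)
      else case tm_delta M q (map (\<lambda>(i, f). f i) tps) of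
             (q', acts) \<Rightarrow> (q', map2 tape_act acts tps))"

definition tm_run :: "'s tm \<Rightarrow> 's list \<Rightarrow> nat \<Rightarrow> 's tm_config" where
  "tm_run M w t = (tm_step M ^^ t) (tm_init M w)"

text \<open>Since halting configurations are fixed points, being in the accepting (rejecting) state after
  \<open>f n\<close> steps means having halted there within \<open>f n\<close> steps.\<close>

definition decides_in_time :: "'s tm \<Rightarrow> 's set \<Rightarrow> 's list set \<Rightarrow> (nat \<Rightarrow> nat) \<Rightarrow> bool" where
  "decides_in_time M A L f \<longleftrightarrow>
     (\<forall>w\<in>lists A. fst (tm_run M w (f (length w))) = (if w \<in> L then tm_accept M else tm_reject M))"

text \<open>A search problem is a language \<open>L\<close> of positive instances with a relation \<open>R\<close> between instances
  and admissible answers. A machine for it decides \<open>L\<close> and, on every positive instance, halts with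
  (exactly) an admissible answer on its last tape.\<close>

definition solves_in_time ::
  "'s tm \<Rightarrow> 's set \<Rightarrow> 's list set \<Rightarrow> ('s list \<Rightarrow> 's list \<Rightarrow> bool) \<Rightarrow> (nat \<Rightarrow> nat) \<Rightarrow> bool" where
  "solves_in_time M A L R f \<longleftrightarrow>
     decides_in_time M A L f \<and>
     (\<forall>w\<in>lists A. w \<in> L \<longrightarrow>
        (\<exists>v. R w v \<and> snd (last (snd (tm_run M w (f (length w))))) = tape_content v))"

definition DTIME :: "'s set \<Rightarrow> (nat \<Rightarrow> real) \<Rightarrow> 's list set set" where
  "DTIME A T = {L. L \<subseteq> lists A \<and>
     (\<exists>M f. tm_over A M \<and> (\<lambda>n. real (f n)) \<in> O(T) \<and> decides_in_time M A L f)}"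

definition search_DTIME ::
  "'s set \<Rightarrow> (nat \<Rightarrow> real) \<Rightarrow> ('s list set \<times> ('s list \<Rightarrow> 's list \<Rightarrow> bool)) set" where
  "search_DTIME A T = {(L, R). L \<subseteq> lists A \<and>
     (\<exists>M f. tm_over A M \<and> (\<lambda>n. real (f n)) \<in> O(T) \<and> solves_in_time M A L R f)}"

definition EXPTIME :: "'s set \<Rightarrow> 's list set set" where
  "EXPTIME A = (\<Union>k. DTIME A (\<lambda>n. 2 ^ (n ^ k)))"

definition TWO_EXPTIME :: "'s set \<Rightarrow> 's list set set" where
  "TWO_EXPTIME A = (\<Union>k. DTIME A (\<lambda>n. 2 ^ (2 ^ (n ^ k))))"

definition search_EXPTIME ::
  "'s set \<Rightarrow> ('s list set \<times> ('s list \<Rightarrow> 's list \<Rightarrow> bool)) set" where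
  "search_EXPTIME A = (\<Union>k. search_DTIME A (\<lambda>n. 2 ^ (n ^ k)))"

definition search_TWO_EXPTIME ::
  "'s set \<Rightarrow> ('s list set \<times> ('s list \<Rightarrow> 's list \<Rightarrow> bool)) set" where
  "search_TWO_EXPTIME A = (\<Union>k. search_DTIME A (\<lambda>n. 2 ^ (2 ^ (n ^ k))))"

datatype 'a ltlf =
    LAtom 'a
  | LNot "'a ltlf"
  | LOr "'a ltlf" "'a ltlf"
  | LAnd "'a ltlf" "'a ltlf"
  | LNext "'a ltlf"
  | LUntil "'a ltlf" "'a ltlf"

datatype 'a ppltl =
    PAtom 'a
  | PNot "'a ppltl"
  | POr "'a ppltl" "'a ppltl"
  | PAnd "'a ppltl" "'a ppltl"
  | PYesterday "'a ppltl"
  | PSince "'a ppltl" "'a ppltl"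

text \<open>Satisfaction at a position \<open>i < length t\<close> of the trace \<open>t\<close>. Next and Yesterday are strong: they
  are false at the last and at the first position, respectively.\<close>

fun ltlf_sat :: "'a set list \<Rightarrow> nat \<Rightarrow> 'a ltlf \<Rightarrow> bool" where
  "ltlf_sat t i (LAtom p) \<longleftrightarrow> p \<in> t ! i"
| "ltlf_sat t i (LNot \<phi>) \<longleftrightarrow> \<not> ltlf_sat t i \<phi>"
| "ltlf_sat t i (LOr \<phi> \<psi>) \<longleftrightarrow> ltlf_sat t i \<phi> \<or> ltlf_sat t i \<psi>"
| "ltlf_sat t i (LAnd \<phi> \<psi>) \<longleftrightarrow> ltlf_sat t i \<phi> \<and> ltlf_sat t i \<psi>"
| "ltlf_sat t i (LNext \<phi>) \<longleftrightarrow> Suc i < length t \<and> ltlf_sat t (Suc i) \<phi>"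
| "ltlf_sat t i (LUntil \<phi> \<psi>) \<longleftrightarrow>
     (\<exists>j. i \<le> j \<and> j < length t \<and> ltlf_sat t j \<psi> \<and> (\<forall>k. i \<le> k \<and> k < j \<longrightarrow> ltlf_sat t k \<phi>))"

fun ppltl_sat :: "'a set list \<Rightarrow> nat \<Rightarrow> 'a ppltl \<Rightarrow> bool" where
  "ppltl_sat t i (PAtom p) \<longleftrightarrow> p \<in> t ! i"
| "ppltl_sat t i (PNot \<phi>) \<longleftrightarrow> \<not> ppltl_sat t i \<phi>"
| "ppltl_sat t i (POr \<phi> \<psi>) \<longleftrightarrow> ppltl_sat t i \<phi> \<or> ppltl_sat t i \<psi>"
| "ppltl_sat t i (PAnd \<phi> \<psi>) \<longleftrightarrow> ppltl_sat t i \<phi> \<and> ppltl_sat t i \<psi>"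
| "ppltl_sat t i (PYesterday \<phi>) \<longleftrightarrow> 0 < i \<and> ppltl_sat t (i - 1) \<phi>"
| "ppltl_sat t i (PSince \<phi> \<psi>) \<longleftrightarrow>
     (\<exists>j. j \<le> i \<and> ppltl_sat t j \<psi> \<and> (\<forall>k. j < k \<and> k \<le> i \<longrightarrow> ppltl_sat t k \<phi>))"

definition finite_traces :: "'a set \<Rightarrow> 'a set list set" where
  "finite_traces AP = {t. t \<noteq> [] \<and> set t \<subseteq> Pow AP}"

definition ltlf_lang :: "'a set \<Rightarrow> 'a ltlf \<Rightarrow> 'a set list set" where
  "ltlf_lang AP \<phi> = {t \<in> finite_traces AP. ltlf_sat t 0 \<phi>}"

definition ppltl_lang :: "'a set \<Rightarrow> 'a ppltl \<Rightarrow> 'a set list set" where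
  "ppltl_lang AP \<phi> = {t \<in> finite_traces AP. ppltl_sat t (length t - 1) \<phi>}"

datatype prefix_quantifier = All_Prefixes | Some_Prefix | Inf_Many_Prefixes | Almost_All_Prefixes

text \<open>The argument \<open>'f\<close> is the type of formulas of the underlying logic on finite traces.\<close>

datatype 'f plus =
    Quant prefix_quantifier 'f
  | Or_plus "'f plus" "'f plus"
  | And_plus "'f plus" "'f plus"
  | Not_plus "'f plus"

definition infinite_traces :: "'a set \<Rightarrow> (nat \<Rightarrow> 'a set) set" where
  "infinite_traces AP = {\<tau>. \<forall>i. \<tau> i \<subseteq> AP}"

definition nonempty_prefixes :: "(nat \<Rightarrow> 'a set) \<Rightarrow> 'a set list set" where
  "nonempty_prefixes \<tau> = {map \<tau> [0..<n] | n. n > 0}"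

fun quant_lang ::
  "'a set \<Rightarrow> prefix_quantifier \<Rightarrow> 'a set list set \<Rightarrow> (nat \<Rightarrow> 'a set) set" where
  "quant_lang AP All_Prefixes Z = {\<tau> \<in> infinite_traces AP. \<forall>t\<in>nonempty_prefixes \<tau>. t \<in> Z}"
| "quant_lang AP Some_Prefix Z = {\<tau> \<in> infinite_traces AP. \<exists>t\<in>nonempty_prefixes \<tau>. t \<in> Z}"
| "quant_lang AP Inf_Many_Prefixes Z = {\<tau> \<in> infinite_traces AP. infinite {t \<in> nonempty_prefixes \<tau>. t \<in> Z}}"
| "quant_lang AP Almost_All_Prefixes Z = {\<tau> \<in> infinite_traces AP. finite {t \<in> nonempty_prefixes \<tau>. t \<notin> Z}}"

fun plus_lang ::
  "('f \<Rightarrow> 'a set list set) \<Rightarrow> 'a set \<Rightarrow> 'f plus \<Rightarrow> (nat \<Rightarrow> 'a set) set" where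
  "plus_lang lang AP (Quant Q \<phi>) = quant_lang AP Q (lang \<phi>)"
| "plus_lang lang AP (Or_plus \<Psi>1 \<Psi>2) = plus_lang lang AP \<Psi>1 \<union> plus_lang lang AP \<Psi>2"
| "plus_lang lang AP (And_plus \<Psi>1 \<Psi>2) = plus_lang lang AP \<Psi>1 \<inter> plus_lang lang AP \<Psi>2"
| "plus_lang lang AP (Not_plus \<Psi>) = infinite_traces AP - plus_lang lang AP \<Psi>"

definition ltlf_plus_lang :: "'a set \<Rightarrow> 'a ltlf plus \<Rightarrow> (nat \<Rightarrow> 'a set) set" where
  "ltlf_plus_lang AP = plus_lang (ltlf_lang AP) AP"

definition ppltl_plus_lang :: "'a set \<Rightarrow> 'a ppltl plus \<Rightarrow> (nat \<Rightarrow> 'a set) set" where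
  "ppltl_plus_lang AP = plus_lang (ppltl_lang AP) AP"

definition ltlf_plus_over :: "'a set \<Rightarrow> 'a ltlf plus set" where
  "ltlf_plus_over AP = {\<Psi>. \<forall>\<phi>\<in>set_plus \<Psi>. set_ltlf \<phi> \<subseteq> AP}"

definition ppltl_plus_over :: "'a set \<Rightarrow> 'a ppltl plus set" where
  "ppltl_plus_over AP = {\<Psi>. \<forall>\<phi>\<in>set_plus \<Psi>. set_ppltl \<phi> \<subseteq> AP}"

text \<open>Functions from words over \<open>Pow Y\<close> to \<open>Pow X\<close>; values on other arguments are irrelevant.\<close>

definition strategy :: "'a set \<Rightarrow> 'a set \<Rightarrow> ('a set list \<Rightarrow> 'a set) \<Rightarrow> bool" where
  "strategy X Y \<sigma> \<longleftrightarrow> (\<forall>u\<in>lists (Pow Y). \<sigma> u \<subseteq> X)"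

definition outcomes :: "'a set \<Rightarrow> 'a set \<Rightarrow> ('a set list \<Rightarrow> 'a set) \<Rightarrow> (nat \<Rightarrow> 'a set) set" where
  "outcomes X Y \<sigma> =
     {\<tau> \<in> infinite_traces (X \<union> Y). \<forall>i. \<tau> i \<inter> X = \<sigma> (map (\<lambda>j. \<tau> j \<inter> Y) [0..<i])}"

definition winning_strategy ::
  "'a set \<Rightarrow> 'a set \<Rightarrow> (nat \<Rightarrow> 'a set) set \<Rightarrow> ('a set list \<Rightarrow> 'a set) \<Rightarrow> bool" where
  "winning_strategy X Y W \<sigma> \<longleftrightarrow> strategy X Y \<sigma> \<and> outcomes X Y \<sigma> \<subseteq> W"

text \<open>A finite-state transducer is given by its table. States are the indices of the list, with initial
  state \<open>0\<close>. The entry of a state consists of its output (a subset of \<open>X\<close>) and of its outgoing edges,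
  labelled by subsets of \<open>Y\<close>; subsets are written as lists. The output depends on the state
  only, as the agent moves before the environment.\<close>

type_synonym 'a transducer = "('a list \<times> ('a list \<times> nat) list) list"

definition transducer :: "'a set \<Rightarrow> 'a set \<Rightarrow> 'a transducer \<Rightarrow> bool" where
  "transducer X Y D \<longleftrightarrow>
     D \<noteq> [] \<and>
     (\<forall>(out, edges)\<in>set D.
        set out \<subseteq> X \<and>
        (\<forall>(ys, q)\<in>set edges. set ys \<subseteq> Y \<and> q < length D) \<and>
        (\<forall>V\<subseteq>Y. \<exists>!q. \<exists>ys. (ys, q) \<in> set edges \<and> set ys = V))"

definition transducer_step :: "'a transducer \<Rightarrow> nat \<Rightarrow> 'a set \<Rightarrow> nat" where
  "transducer_step D q V = (THE q'. \<exists>ys. (ys, q') \<in> set (snd (D ! q)) \<and> set ys = V)"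

definition transducer_strategy :: "'a transducer \<Rightarrow> 'a set list \<Rightarrow> 'a set" where
  "transducer_strategy D u = set (fst (D ! foldl (transducer_step D) 0 u))"

datatype 'a letter =
    A_Atom 'a
  | A_Not | A_Or | A_And
  | A_Next | A_Until | A_Yesterday | A_Since
  | A_Quant prefix_quantifier
  | A_State | A_Edge | A_Tick

definition letters :: "'a set \<Rightarrow> 'a letter set" where
  "letters AP = {l. set_letter l \<subseteq> AP}"

text \<open>The set of atoms is fixed and finite, so each atom is a single letter. Formulas are written in
  Polish notation with one letter per node of the syntax tree, so that the length of the word is the
  size of the formula.\<close>

fun ltlf_code :: "'a ltlf \<Rightarrow> 'a letter list" where
  "ltlf_code (LAtom p) = [A_Atom p]"
| "ltlf_code (LNot \<phi>) = A_Not # ltlf_code \<phi>"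
| "ltlf_code (LOr \<phi> \<psi>) = A_Or # ltlf_code \<phi> @ ltlf_code \<psi>"
| "ltlf_code (LAnd \<phi> \<psi>) = A_And # ltlf_code \<phi> @ ltlf_code \<psi>"
| "ltlf_code (LNext \<phi>) = A_Next # ltlf_code \<phi>"
| "ltlf_code (LUntil \<phi> \<psi>) = A_Until # ltlf_code \<phi> @ ltlf_code \<psi>"

fun ppltl_code :: "'a ppltl \<Rightarrow> 'a letter list" where
  "ppltl_code (PAtom p) = [A_Atom p]"
| "ppltl_code (PNot \<phi>) = A_Not # ppltl_code \<phi>"
| "ppltl_code (POr \<phi> \<psi>) = A_Or # ppltl_code \<phi> @ ppltl_code \<psi>"
| "ppltl_code (PAnd \<phi> \<psi>) = A_And # ppltl_code \<phi> @ ppltl_code \<psi>"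
| "ppltl_code (PYesterday \<phi>) = A_Yesterday # ppltl_code \<phi>"
| "ppltl_code (PSince \<phi> \<psi>) = A_Since # ppltl_code \<phi> @ ppltl_code \<psi>"

fun plus_code :: "('f \<Rightarrow> 'a letter list) \<Rightarrow> 'f plus \<Rightarrow> 'a letter list" where
  "plus_code code (Quant Q \<phi>) = A_Quant Q # code \<phi>"
| "plus_code code (Or_plus \<Psi>1 \<Psi>2) = A_Or # plus_code code \<Psi>1 @ plus_code code \<Psi>2"
| "plus_code code (And_plus \<Psi>1 \<Psi>2) = A_And # plus_code code \<Psi>1 @ plus_code code \<Psi>2"
| "plus_code code (Not_plus \<Psi>) = A_Not # plus_code code \<Psi>"

text \<open>Target states are written in unary.\<close>

definition edge_code :: "'a list \<times> nat \<Rightarrow> 'a letter list" where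
  "edge_code e = A_Edge # map A_Atom (fst e) @ replicate (snd e) A_Tick"

definition state_code :: "'a list \<times> ('a list \<times> nat) list \<Rightarrow> 'a letter list" where
  "state_code s = A_State # map A_Atom (fst s) @ concat (map edge_code (snd s))"

definition transducer_code :: "'a transducer \<Rightarrow> 'a letter list" where
  "transducer_code D = concat (map state_code D)"

lemma finite_letters:
  assumes "finite AP"
  shows "finite (letters AP)"
proof -
  have "letters AP \<subseteq> A_Atom ` AP \<union> {A_Not, A_Or, A_And, A_Next, A_Until, A_Yesterday, A_Since,
      A_State, A_Edge, A_Tick} \<union>
      A_Quant ` {All_Prefixes, Some_Prefix, Inf_Many_Prefixes, Almost_All_Prefixes}"
  proof
    fix l
    assume "l \<in> letters AP"
    then show "l \<in> A_Atom ` AP \<union> {A_Not, A_Or, A_And, A_Next, A_Until, A_Yesterday, A_Since,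
      A_State, A_Edge, A_Tick} \<union>
      A_Quant ` {All_Prefixes, Some_Prefix, Inf_Many_Prefixes, Almost_All_Prefixes}"
      by (cases l) (auto simp: letters_def image_iff intro: prefix_quantifier.exhaust)
  qed
  then show ?thesis
    using assms by (auto intro: finite_subset)
qed

lemma ltlf_code_append_inject:
  "ltlf_code \<phi> @ r = ltlf_code \<psi> @ s \<longleftrightarrow> \<phi> = \<psi> \<and> r = s"
proof (induction \<phi> arbitrary: \<psi> r s)
  case (LAtom p) show ?case by (cases \<psi>) auto
next
  case (LNot \<phi>) then show ?case by (cases \<psi>) auto
next
  case (LOr \<phi>1 \<phi>2) then show ?case by (cases \<psi>) auto
next
  case (LAnd \<phi>1 \<phi>2) then show ?case by (cases \<psi>) auto
next
  case (LNext \<phi>) then show ?case by (cases \<psi>) auto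
next
  case (LUntil \<phi>1 \<phi>2) then show ?case by (cases \<psi>) auto
qed

lemma ppltl_code_append_inject:
  "ppltl_code \<phi> @ r = ppltl_code \<psi> @ s \<longleftrightarrow> \<phi> = \<psi> \<and> r = s"
proof (induction \<phi> arbitrary: \<psi> r s)
  case (PAtom p) show ?case by (cases \<psi>) auto
next
  case (PNot \<phi>) then show ?case by (cases \<psi>) auto
next
  case (POr \<phi>1 \<phi>2) then show ?case by (cases \<psi>) auto
next
  case (PAnd \<phi>1 \<phi>2) then show ?case by (cases \<psi>) auto
next
  case (PYesterday \<phi>) then show ?case by (cases \<psi>) auto
next
  case (PSince \<phi>1 \<phi>2) then show ?case by (cases \<psi>) auto
qed

lemma plus_code_append_inject:
  assumes "\<And>\<phi> \<psi> r s. code \<phi> @ r = code \<psi> @ s \<longleftrightarrow> \<phi> = \<psi> \<and> r = s"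
  shows "plus_code code \<Phi> @ r = plus_code code \<Psi> @ s \<longleftrightarrow> \<Phi> = \<Psi> \<and> r = s"
proof (induction \<Phi> arbitrary: \<Psi> r s)
  case (Quant Q \<phi>) show ?case by (cases \<Psi>) (auto simp: assms)
next
  case (Or_plus \<Phi>1 \<Phi>2) then show ?case by (cases \<Psi>) auto
next
  case (And_plus \<Phi>1 \<Phi>2) then show ?case by (cases \<Psi>) auto
next
  case (Not_plus \<Phi>) then show ?case by (cases \<Psi>) auto
qed

lemma inj_ltlf_plus_code: "inj (plus_code ltlf_code)"
  using plus_code_append_inject[OF ltlf_code_append_inject, of _ "[]" _ "[]"]
  by (auto intro!: injI)

lemma inj_ppltl_plus_code: "inj (plus_code ppltl_code)"
  using plus_code_append_inject[OF ppltl_code_append_inject, of _ "[]" _ "[]"]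
  by (auto intro!: injI)

lemma map_Atom_append_inject:
  assumes "r = [] \<or> (\<forall>p. hd r \<noteq> A_Atom p)" "s = [] \<or> (\<forall>p. hd s \<noteq> A_Atom p)"
  shows "map A_Atom xs @ r = map A_Atom ys @ s \<longleftrightarrow> xs = ys \<and> r = s"
  using assms
proof (induction xs arbitrary: ys)
  case Nil then show ?case by (cases ys) auto
next
  case (Cons x xs) then show ?case by (cases ys) auto
qed

lemma replicate_Tick_append_inject:
  assumes "r = [] \<or> hd r \<noteq> A_Tick" "s = [] \<or> hd s \<noteq> A_Tick"
  shows "replicate m A_Tick @ r = replicate n A_Tick @ s \<longleftrightarrow> m = n \<and> r = s"
  using assms
proof (induction m arbitrary: n)
  case 0 then show ?case by (cases n) auto
next
  case (Suc m) then show ?case by (cases n) auto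
qed

lemma edge_code_append_inject:
  assumes "r = [] \<or> hd r \<in> {A_Edge, A_State}" "s = [] \<or> hd s \<in> {A_Edge, A_State}"
  shows "edge_code e @ r = edge_code e' @ s \<longleftrightarrow> e = e' \<and> r = s"
proof -
  have *: "replicate k A_Tick @ t = [] \<or> (\<forall>p. hd (replicate k A_Tick @ t) \<noteq> A_Atom p)"
    if "t = [] \<or> hd t \<in> {A_Edge, A_State}" for k and t :: "'a letter list"
    using that by (cases k) auto
  show ?thesis
    using assms map_Atom_append_inject[OF *[OF assms(1)] *[OF assms(2)]]
      replicate_Tick_append_inject[of r s]
    by (auto simp: edge_code_def prod_eq_iff)
qed

lemma edges_code_append_inject:
  assumes "r = [] \<or> hd r = A_State" "s = [] \<or> hd s = A_State"
  shows "concat (map edge_code es) @ r = concat (map edge_code es') @ s \<longleftrightarrow> es = es' \<and> r = s"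
  using assms
proof (induction es arbitrary: es')
  case Nil then show ?case by (cases es') (auto simp: edge_code_def)
next
  case (Cons e es)
  have *: "concat (map edge_code fs) @ t = [] \<or>
      hd (concat (map edge_code fs) @ t) \<in> {A_Edge, A_State}"
    if "t = [] \<or> hd t = A_State" for fs :: "('a list \<times> nat) list" and t
    using that by (cases fs) (auto simp: edge_code_def)
  show ?case
  proof (cases es')
    case Nil
    then show ?thesis using Cons.prems by (auto simp: edge_code_def)
  next
    case (Cons f fs)
    then show ?thesis
      using Cons.IH[OF Cons.prems, of fs]
        edge_code_append_inject[OF *[OF Cons.prems(1)] *[OF Cons.prems(2)], of e es f fs]
      by auto
  qed
qed

lemma state_code_append_inject:
  assumes "r = [] \<or> hd r = A_State" "s = [] \<or> hd s = A_State"
  shows "state_code a @ r = state_code b @ s \<longleftrightarrow> a = b \<and> r = s"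
proof -
  have *: "concat (map edge_code fs) @ t = [] \<or>
      (\<forall>p. hd (concat (map edge_code fs) @ t) \<noteq> A_Atom p)"
    if "t = [] \<or> hd t = A_State" for fs :: "('a list \<times> nat) list" and t
    using that by (cases fs) (auto simp: edge_code_def)
  show ?thesis
    using map_Atom_append_inject[OF *[OF assms(1)] *[OF assms(2)]]
      edges_code_append_inject[OF assms]
    by (auto simp: state_code_def prod_eq_iff)
qed

lemma inj_transducer_code: "inj transducer_code"
proof (rule injI)
  fix D E :: "'a transducer"
  assume "transducer_code D = transducer_code E"
  then show "D = E"
  proof (induction D arbitrary: E)
    case Nil then show ?case by (cases E) (auto simp: transducer_code_def state_code_def)
  next
    case (Cons d D)
    have *: "transducer_code F = [] \<or> hd (transducer_code F) = A_State" for F :: "'a transducer"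
      by (cases F) (auto simp: transducer_code_def state_code_def)
    show ?case
    proof (cases E)
      case Nil
      then show ?thesis using Cons.prems by (auto simp: transducer_code_def state_code_def)
    next
      case (Cons e E')
      then show ?thesis
        using Cons.IH[of E'] Cons.prems state_code_append_inject[OF *[of D] *[of E'], of d e]
        by (auto simp: transducer_code_def)
    qed
  qed
qed

definition realizable_words ::
  "('f \<Rightarrow> 'a letter list) \<Rightarrow> 'f set \<Rightarrow> ('f \<Rightarrow> (nat \<Rightarrow> 'a set) set) \<Rightarrow> 'a set \<Rightarrow> 'a set \<Rightarrow>
   'a letter list set" where
  "realizable_words code F lang X Y =
     {code \<Psi> | \<Psi>. \<Psi> \<in> F \<and> (\<exists>\<sigma>. winning_strategy X Y (lang \<Psi>) \<sigma>)}"

definition strategy_answers ::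
  "('f \<Rightarrow> 'a letter list) \<Rightarrow> 'f set \<Rightarrow> ('f \<Rightarrow> (nat \<Rightarrow> 'a set) set) \<Rightarrow> 'a set \<Rightarrow> 'a set \<Rightarrow>
   'a letter list \<Rightarrow> 'a letter list \<Rightarrow> bool" where
  "strategy_answers code F lang X Y w v \<longleftrightarrow>
     (\<exists>\<Psi> D. \<Psi> \<in> F \<and> w = code \<Psi> \<and> v = transducer_code D \<and> transducer X Y D \<and>
        winning_strategy X Y (lang \<Psi>) (transducer_strategy D))"

definition ltlf_plus_realizability :: "'a set \<Rightarrow> 'a set \<Rightarrow> 'a letter list set" where
  "ltlf_plus_realizability X Y =
     realizable_words (plus_code ltlf_code) (ltlf_plus_over (X \<union> Y)) (ltlf_plus_lang (X \<union> Y)) X Y"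

definition ltlf_plus_synthesis ::
  "'a set \<Rightarrow> 'a set \<Rightarrow> 'a letter list set \<times> ('a letter list \<Rightarrow> 'a letter list \<Rightarrow> bool)" where
  "ltlf_plus_synthesis X Y =
     (ltlf_plus_realizability X Y,
      strategy_answers (plus_code ltlf_code) (ltlf_plus_over (X \<union> Y)) (ltlf_plus_lang (X \<union> Y)) X Y)"

definition ppltl_plus_realizability :: "'a set \<Rightarrow> 'a set \<Rightarrow> 'a letter list set" where
  "ppltl_plus_realizability X Y =
     realizable_words (plus_code ppltl_code) (ppltl_plus_over (X \<union> Y)) (ppltl_plus_lang (X \<union> Y)) X Y"

definition ppltl_plus_synthesis ::
  "'a set \<Rightarrow> 'a set \<Rightarrow> 'a letter list set \<times> ('a letter list \<Rightarrow> 'a letter list \<Rightarrow> bool)" where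
  "ppltl_plus_synthesis X Y =
     (ppltl_plus_realizability X Y,
      strategy_answers (plus_code ppltl_code) (ppltl_plus_over (X \<union> Y)) (ppltl_plus_lang (X \<union> Y)) X Y)"

end

(* The truth values of all subformulas at the last position of a growing trace are updated letter by
   letter, so they form the state of a deterministic monitor for PPLTL formulas. LTLf formulas are past
   formulas of the reversed trace; their monitor keeps the function that maps truth values before the
   reversed trace to those after it, which costs another exponential. Marking the quantifier nodes whose
   formula is seen satisfied (or violated) turns the formula on infinite traces into a Boolean condition
   on the set of nodes marked infinitely often, and a latest appearance record turns this into a parity
   condition with linearly many levels. The parity game is replaced by a safety game: one counter per
   level counts the bad events of that level since the last event of larger level, and the agent loses
   once a counter exceeds the number of states. If no counter ever overflows, the parity condition holds.
   If the environment can force an overflow, then on the way it closes a cycle whose largest level is bad;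
   by forgetting each such cycle it can go on forever and violates the parity condition. The reachable
   part of the safety game has exponential (for LTLf doubly exponential) size, and a winning region yields
   a transducer. The running time is measured on Turing machines that simulate stack programs working on
   serialised binary trees, so that it suffices that every function involved is computed by a program
   in time polynomial in the size of the game. *)

theory Submission
  imports Defs "HOL-Library.Infinite_Set"
begin

section \<open>Turing machines from stack programs\<close>

text \<open>A determinacy theorem for parity games is avoided. A position outside the winning region
  of the safety game only has a finite rank, and from this rank alone the environment assembles an
  infinite play against an arbitrary agent strategy. The capacity of a counter is the number of base
  states because, as long as no bad cycle has been closed, the bad events counted at one level are
  pairwise distinct states, so an overflow contradicts the pigeonhole principle. For a formula of
  length n there are n + 1 counters. With about 2^s base states the safety game therefore has about
  2^(s n) positions: the passage from parity to safety only multiplies the exponent by a linear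
  factor. Running times must refer to concrete machines although the algorithms are exponential.
  Polynomial time is therefore measured in the size of the argument plus a parameter, which is later
  instantiated by the bound on the size of the game. Both logics then share one algorithm and one
  time analysis, and differ only in the monitor and its size.\<close>

datatype 's com =
    Push nat "'s cell"
  | Put nat "'s cell"
  | Pop nat
  | Out "'s cell"
  | Seq "'s com" "'s com" (infixr \<open>;;\<close> 55)
  | Cond nat "'s cell \<Rightarrow> bool" "'s com" "'s com"
  | Loop nat "'s cell \<Rightarrow> bool" "'s com"

fun top_cell :: "'s cell list \<Rightarrow> 's cell" where
  "top_cell [] = Blank"
| "top_cell (s # l) = s"

text \<open>The costs are exact numbers of machine steps. A \<open>Push\<close> costs two, since the
  head has to move left before the symbol is written; \<open>Put\<close> is this second half. It has
  no rule because it only arises as an intermediate continuation. Tape 7 is the append-only output,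
  the other tapes are stacks.\<close>

inductive exec :: "'s com \<Rightarrow> (nat \<Rightarrow> 's cell list) \<Rightarrow> nat \<Rightarrow> (nat \<Rightarrow> 's cell list) \<Rightarrow> bool" where
  exec_Push: "exec (Push i s) \<sigma> 2 (\<sigma>(i := s # \<sigma> i))"
| exec_Pop: "exec (Pop i) \<sigma> 1 (\<sigma>(i := tl (\<sigma> i)))"
| exec_Out: "exec (Out s) \<sigma> 1 (\<sigma>(7 := \<sigma> 7 @ [s]))"
| exec_Seq: "exec a \<sigma> t \<sigma>' \<Longrightarrow> exec b \<sigma>' t' \<sigma>'' \<Longrightarrow> exec (a ;; b) \<sigma> (Suc (t + t')) \<sigma>''"
| exec_CondT: "P (top_cell (\<sigma> i)) \<Longrightarrow> exec a \<sigma> t \<sigma>' \<Longrightarrow> exec (Cond i P a b) \<sigma> (Suc t) \<sigma>'"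
| exec_CondF: "\<not> P (top_cell (\<sigma> i)) \<Longrightarrow> exec b \<sigma> t \<sigma>' \<Longrightarrow> exec (Cond i P a b) \<sigma> (Suc t) \<sigma>'"
| exec_LoopF: "\<not> P (top_cell (\<sigma> i)) \<Longrightarrow> exec (Loop i P a) \<sigma> 1 \<sigma>"
| exec_LoopT: "P (top_cell (\<sigma> i)) \<Longrightarrow> exec a \<sigma> t \<sigma>' \<Longrightarrow> exec (Loop i P a) \<sigma>' t' \<sigma>'' \<Longrightarrow>
    exec (Loop i P a) \<sigma> (Suc (t + t')) \<sigma>''"

text \<open>A stack grows to the left, with the head on its topmost symbol.\<close>

definition stack_tape :: "'s cell list \<Rightarrow> 's tape \<Rightarrow> bool" where
  "stack_tape l tp \<longleftrightarrow> snd tp =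
     (\<lambda>j. if fst tp \<le> j \<and> j < fst tp + int (length l) then l ! nat (j - fst tp) else Blank)"

definition output_tape :: "'s cell list \<Rightarrow> 's tape \<Rightarrow> bool" where
  "output_tape l tp \<longleftrightarrow> fst tp = int (length l) \<and> snd tp =
     (\<lambda>j. if 0 \<le> j \<and> j < int (length l) then l ! nat j else Blank)"

definition represents :: "'s tape list \<Rightarrow> (nat \<Rightarrow> 's cell list) \<Rightarrow> bool" where
  "represents tps \<sigma> \<longleftrightarrow> length tps = 8 \<and> (\<forall>i<7. stack_tape (\<sigma> i) (tps ! i)) \<and> output_tape (\<sigma> 7) (tps ! 7)"

definition idle :: "'s cell list \<Rightarrow> ('s cell \<times> move) list" where
  "idle cs = map (\<lambda>c. (c, Stay)) cs"

text \<open>The control states of the machine are continuations: lists of commands still to be executed.\<close>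

fun cont_step :: "'s com list \<Rightarrow> 's cell list \<Rightarrow> 's com list \<times> ('s cell \<times> move) list" where
  "cont_step [] cs = ([], idle cs)"
| "cont_step (Push i s # k) cs = (Put i s # k, (idle cs)[i := (cs ! i, Move_Left)])"
| "cont_step (Put i s # k) cs = (k, (idle cs)[i := (s, Stay)])"
| "cont_step (Pop i # k) cs = (k, (idle cs)[i := (Blank, Move_Right)])"
| "cont_step (Out s # k) cs = (k, (idle cs)[7 := (s, Move_Right)])"
| "cont_step ((a ;; b) # k) cs = (a # b # k, idle cs)"
| "cont_step (Cond i P a b # k) cs = ((if P (cs ! i) then a else b) # k, idle cs)"
| "cont_step (Loop i P a # k) cs = (if P (cs ! i) then a # Loop i P a # k else k, idle cs)"

definition cont_move :: "'s com list \<times> 's tape list \<Rightarrow> 's com list \<times> 's tape list" where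
  "cont_move c = (case cont_step (fst c) (map (\<lambda>(i, f). f i) (snd c)) of
     (k, acts) \<Rightarrow> (k, map2 tape_act acts (snd c)))"

text \<open>Every continuation met while \<open>c\<close> runs in front of \<open>k\<close> lies in
  this set. It is finite, as a loop returns to itself as a continuation instead of being unfolded,
  and so the machine has a finite control.\<close>

fun conts :: "'s com \<Rightarrow> 's com list \<Rightarrow> 's com list set" where
  "conts (Push i s) k = {Push i s # k, Put i s # k}"
| "conts (a ;; b) k = {(a ;; b) # k} \<union> conts a (b # k) \<union> conts b k"
| "conts (Cond i P a b) k = {Cond i P a b # k} \<union> conts a k \<union> conts b k"
| "conts (Loop i P a) k = {Loop i P a # k} \<union> conts a (Loop i P a # k)"
| "conts c k = {c # k}"

fun com_over :: "'s cell set \<Rightarrow> 's com \<Rightarrow> bool" where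
  "com_over G (Push i s) \<longleftrightarrow> i < 7 \<and> s \<in> G"
| "com_over G (Put i s) \<longleftrightarrow> i < 7 \<and> s \<in> G"
| "com_over G (Pop i) \<longleftrightarrow> i < 7"
| "com_over G (Out s) \<longleftrightarrow> s \<in> G"
| "com_over G (a ;; b) \<longleftrightarrow> com_over G a \<and> com_over G b"
| "com_over G (Cond i P a b) \<longleftrightarrow> i < 7 \<and> com_over G a \<and> com_over G b"
| "com_over G (Loop i P a) \<longleftrightarrow> i < 7 \<and> com_over G a"

lemma finite_conts: "finite (conts c k)"
  by (induction c arbitrary: k) auto

lemma conts_self: "c # k \<in> conts c k"
  by (cases c) auto

lemma conts_step: "l \<in> conts c k \<Longrightarrow> fst (cont_step l cs) \<in> insert k (conts c k)"
proof (induction c arbitrary: k l)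
  case (Seq a b)
  then have "l = (a ;; b) # k \<or> l \<in> conts a (b # k) \<or> l \<in> conts b k" by simp
  then show ?case using Seq.IH(1)[of l "b # k"] Seq.IH(2)[of l k] conts_self[of a "b # k"] conts_self[of b k]
    by auto
next
  case (Cond i P a b)
  then have "l = Cond i P a b # k \<or> l \<in> conts a k \<or> l \<in> conts b k" by simp
  then show ?case using Cond.IH(1)[of l k] Cond.IH(2)[of l k] conts_self[of a k] conts_self[of b k]
    by auto
next
  case (Loop i P a)
  then have "l = Loop i P a # k \<or> l \<in> conts a (Loop i P a # k)" by simp
  then show ?case using Loop.IH[of l "Loop i P a # k"] conts_self[of a "Loop i P a # k"]
    by (auto split: if_splits)
qed auto

lemma conts_over:
  "l \<in> conts c k \<Longrightarrow> com_over G c \<Longrightarrow> \<forall>c'\<in>set k. com_over G c' \<Longrightarrow> \<forall>c'\<in>set l. com_over G c'"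
proof (induction c arbitrary: k l)
  case (Seq a b)
  then have "l = (a ;; b) # k \<or> l \<in> conts a (b # k) \<or> l \<in> conts b k" by simp
  then show ?case using Seq.IH(1)[of l "b # k"] Seq.IH(2)[of l k] Seq.prems by auto
next
  case (Cond i P a b)
  then have "l = Cond i P a b # k \<or> l \<in> conts a k \<or> l \<in> conts b k" by simp
  then show ?case using Cond.IH(1)[of l k] Cond.IH(2)[of l k] Cond.prems by auto
next
  case (Loop i P a)
  then have "l = Loop i P a # k \<or> l \<in> conts a (Loop i P a # k)" by simp
  then show ?case using Loop.IH[of l "Loop i P a # k"] Loop.prems by auto
qed auto

lemma cont_step_acts:
  assumes "\<forall>c\<in>set l. com_over G c" "set cs \<subseteq> G" "Blank \<in> G" "length cs = 8"
  shows "length (snd (cont_step l cs)) = 8 \<and> fst ` set (snd (cont_step l cs)) \<subseteq> G"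
proof -
  have idle: "fst ` set (idle cs) \<subseteq> G" "length (idle cs) = 8" using assms(2,4) by (auto simp: idle_def)
  have upd: "fst ` set ((idle cs)[i := (s, m)]) \<subseteq> G" if "s \<in> G" for i s m
  proof -
    have "fst ` set ((idle cs)[i := (s, m)]) \<subseteq> fst ` insert (s, m) (set (idle cs))"
      by (intro image_mono set_update_subset_insert)
    then show ?thesis using idle that by auto
  qed
  have nth: "cs ! i \<in> G" if "i < 7" for i using assms(2,4) that nth_mem[of i cs] by auto
  show ?thesis
  proof (cases l)
    case (Cons c k)
    then show ?thesis using assms(1,3) idle upd nth by (cases c) auto
  qed (use idle in auto)
qed

lemma map2_tape_act_idle:
  "map2 tape_act (idle (map (\<lambda>(i, f). f i) tps)) tps = tps"
  by (induction tps) (auto simp: idle_def)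

lemma tape_act_eq: "tape_act a tp = (fst tp + head_shift (snd a), (snd tp)(fst tp := fst a))"
  by (cases a; cases tp) simp

lemma map2_tape_act_update:
  assumes "j < length tps"
  shows "map2 tape_act ((idle (map (\<lambda>(i, f). f i) tps))[j := a]) tps = tps[j := tape_act a (tps ! j)]"
proof -
  have "map2 tape_act ((idle (map (\<lambda>(i, f). f i) tps))[j := a]) tps =
      map (case_prod tape_act) ((zip (idle (map (\<lambda>(i, f). f i) tps)) tps)[j := (a, tps ! j)])"
    by (simp add: update_zip)
  also have "\<dots> = tps[j := tape_act a (tps ! j)]"
    by (simp add: map_update map2_tape_act_idle)
  finally show ?thesis .
qed

lemma cont_move_simps:
  "i < length tps \<Longrightarrow> cont_move (Push i s # k, tps) =
     (Put i s # k, tps[i := (fst (tps ! i) - 1, snd (tps ! i))])"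
  "i < length tps \<Longrightarrow> cont_move (Put i s # k, tps) =
     (k, tps[i := (fst (tps ! i), (snd (tps ! i))(fst (tps ! i) := s))])"
  "i < length tps \<Longrightarrow> cont_move (Pop i # k, tps) =
     (k, tps[i := (fst (tps ! i) + 1, (snd (tps ! i))(fst (tps ! i) := Blank))])"
  "7 < length tps \<Longrightarrow> cont_move (Out s # k, tps) =
     (k, tps[7 := (fst (tps ! 7) + 1, (snd (tps ! 7))(fst (tps ! 7) := s))])"
     apply (simp_all add: cont_move_def map2_tape_act_update split_beta del: tape_act.simps)
     apply (simp_all add: tape_act_eq)
  done

lemma stack_tape_top: "stack_tape l tp \<Longrightarrow> snd tp (fst tp) = top_cell l"
  by (cases l) (auto simp: stack_tape_def)

lemma stack_tape_push:
  assumes "stack_tape l tp"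
  shows "stack_tape (s # l) (fst tp - 1, (snd tp)(fst tp - 1 := s))"
proof -
  have "(s # l) ! nat (j - (fst tp - 1)) = l ! nat (j - fst tp)" if "fst tp \<le> j" for j
  proof -
    have "nat (j - (fst tp - 1)) = Suc (nat (j - fst tp))" using that by simp
    then show ?thesis by simp
  qed
  then show ?thesis using assms by (auto simp: stack_tape_def fun_eq_iff)
qed

lemma stack_tape_pop: "stack_tape l tp \<Longrightarrow> stack_tape (tl l) (fst tp + 1, (snd tp)(fst tp := Blank))"
proof (cases l)
  case (Cons s l')
  assume a: "stack_tape l tp"
  have "l ! nat (j - fst tp) = l' ! nat (j - (fst tp + 1))" if "fst tp < j" for j
  proof -
    have "nat (j - fst tp) = Suc (nat (j - (fst tp + 1)))" using that by simp
    then show ?thesis using Cons by simp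
  qed
  then show ?thesis using a Cons by (auto simp: stack_tape_def fun_eq_iff)
qed (auto simp: stack_tape_def fun_eq_iff)

lemma output_tape_append: "output_tape l tp \<Longrightarrow> output_tape (l @ [s]) (fst tp + 1, (snd tp)(fst tp := s))"
  by (auto simp: output_tape_def fun_eq_iff nth_append)

lemma represents_top:
  "represents tps \<sigma> \<Longrightarrow> i < 7 \<Longrightarrow> map (\<lambda>(i, f). f i) tps ! i = top_cell (\<sigma> i)"
  by (auto simp: represents_def split_beta stack_tape_top)

text \<open>Induction on the execution. The continuation \<open>k\<close> and the tapes are
  arbitrary, because the first command of a sequence runs with the second one pushed in front of
  \<open>k\<close>.\<close>

lemma exec_cont_move:
  assumes "exec c \<sigma> t \<sigma>'" "com_over G c" "represents tps \<sigma>"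
  shows "\<exists>tps'. represents tps' \<sigma>' \<and> (cont_move ^^ t) (c # k, tps) = (k, tps')"
  using assms
proof (induction arbitrary: k tps rule: exec.induct)
  case (exec_Push i s \<sigma>)
  let ?tp = "tps ! i"
  let ?tps = "tps[i := (fst ?tp - 1, (snd ?tp)(fst ?tp - 1 := s))]"
  have i: "i < 7" "length tps = 8" using exec_Push by (auto simp: represents_def)
  have "represents ?tps (\<sigma>(i := s # \<sigma> i))"
    using exec_Push i by (auto simp: represents_def nth_list_update intro: stack_tape_push)
  moreover have "(cont_move ^^ 2) (Push i s # k, tps) = (k, ?tps)"
    using i by (simp add: numeral_2_eq_2 cont_move_simps)
  ultimately show ?case by blast
next
  case (exec_Pop i \<sigma>)
  let ?tp = "tps ! i"
  let ?tps = "tps[i := (fst ?tp + 1, (snd ?tp)(fst ?tp := Blank))]"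
  have i: "i < 7" "length tps = 8" using exec_Pop by (auto simp: represents_def)
  have "represents ?tps (\<sigma>(i := tl (\<sigma> i)))"
    using exec_Pop i by (auto simp: represents_def nth_list_update intro: stack_tape_pop)
  moreover have "(cont_move ^^ 1) (Pop i # k, tps) = (k, ?tps)"
    using i by (simp add: cont_move_simps)
  ultimately show ?case by blast
next
  case (exec_Out s \<sigma>)
  let ?tp = "tps ! 7"
  let ?tps = "tps[7 := (fst ?tp + 1, (snd ?tp)(fst ?tp := s))]"
  have i: "length tps = 8" using exec_Out by (auto simp: represents_def)
  have "represents ?tps (\<sigma>(7 := \<sigma> 7 @ [s]))"
    using exec_Out i by (auto simp: represents_def nth_list_update intro: output_tape_append)
  moreover have "(cont_move ^^ 1) (Out s # k, tps) = (k, ?tps)"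
    using i by (simp add: cont_move_simps)
  ultimately show ?case by blast
next
  case (exec_Seq a \<sigma> t \<sigma>' b t' \<sigma>'')
  obtain tps' where 1: "represents tps' \<sigma>'" "(cont_move ^^ t) (a # b # k, tps) = (b # k, tps')"
    using exec_Seq by fastforce
  obtain tps'' where 2: "represents tps'' \<sigma>''" "(cont_move ^^ t') (b # k, tps') = (k, tps'')"
    using exec_Seq 1 by fastforce
  have "cont_move ((a ;; b) # k, tps) = (a # b # k, tps)"
    by (simp add: cont_move_def map2_tape_act_idle)
  then have "(cont_move ^^ Suc (t + t')) ((a ;; b) # k, tps) = (k, tps'')"
    using 1 2 by (simp add: funpow_swap1 funpow_add add.commute[of t t'])
  then show ?case using 2 by blast
next
  case (exec_CondT P \<sigma> i a t \<sigma>' b)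
  then have "cont_move (Cond i P a b # k, tps) = (a # k, tps)"
    by (simp add: cont_move_def map2_tape_act_idle represents_top)
  then show ?case using exec_CondT by (simp add: funpow_swap1)
next
  case (exec_CondF P \<sigma> i b t \<sigma>' a)
  then have "cont_move (Cond i P a b # k, tps) = (b # k, tps)"
    by (simp add: cont_move_def map2_tape_act_idle represents_top)
  then show ?case using exec_CondF by (simp add: funpow_swap1)
next
  case (exec_LoopF P \<sigma> i a)
  then have "cont_move (Loop i P a # k, tps) = (k, tps)"
    by (simp add: cont_move_def map2_tape_act_idle represents_top)
  then show ?case using exec_LoopF by auto
next
  case (exec_LoopT P \<sigma> i a t \<sigma>' t' \<sigma>'')
  obtain tps' where 1: "represents tps' \<sigma>'"
    "(cont_move ^^ t) (a # Loop i P a # k, tps) = (Loop i P a # k, tps')"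
    using exec_LoopT by fastforce
  obtain tps'' where 2: "represents tps'' \<sigma>''" "(cont_move ^^ t') (Loop i P a # k, tps') = (k, tps'')"
    using exec_LoopT 1 by fastforce
  have "cont_move (Loop i P a # k, tps) = (a # Loop i P a # k, tps)"
    using exec_LoopT by (simp add: cont_move_def map2_tape_act_idle represents_top)
  then have "(cont_move ^^ Suc (t + t')) (Loop i P a # k, tps) = (k, tps'')"
    using 1 2 by (simp add: funpow_swap1 funpow_add add.commute[of t t'])
  then show ?case using 2 by blast
qed

definition com_conts :: "'s com \<Rightarrow> 's com list set" where
  "com_conts c = insert [] (conts c [])"

text \<open>Machine states are natural numbers, so the finitely many continuations are numbered by
  some injection. The shift by 2 in \<open>cont_state\<close> keeps 0 and 1 free for accepting and
  rejecting.\<close>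

definition cont_code :: "'s com \<Rightarrow> 's com list \<Rightarrow> nat" where
  "cont_code c = (SOME g. inj_on g (com_conts c))"

definition cont_state :: "'s com \<Rightarrow> 's com list \<Rightarrow> nat" where
  "cont_state c k = cont_code c k + 2"

definition state_cont :: "'s com \<Rightarrow> nat \<Rightarrow> 's com list" where
  "state_cont c q = inv_into (com_conts c) (cont_state c) q"

text \<open>When the continuation is empty, the verdict is read off the top of the main stack, tape
  6: \<open>Work 3\<close> is the leading symbol of the encoding of \<open>True\<close>.\<close>

definition com_tm :: "'s cell set \<Rightarrow> 's com \<Rightarrow> 's tm" where
  "com_tm G c = \<lparr>tm_tapes = 8, tm_symbols = G, tm_states = {0, 1} \<union> cont_state c ` com_conts c,
     tm_start = cont_state c [c], tm_accept = 0, tm_reject = 1,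
     tm_delta = (\<lambda>q cs. if q < 2 then (q, idle cs) else
       if state_cont c q = [] then (if cs ! 6 = Work 3 then 0 else 1, idle cs)
       else map_prod (cont_state c) id (cont_step (state_cont c q) cs))\<rparr>"

lemma inj_cont_state: "inj_on (cont_state c) (com_conts c)"
proof -
  have "finite (com_conts c)" by (simp add: com_conts_def finite_conts)
  then have "\<exists>g :: _ \<Rightarrow> nat. inj_on g (com_conts c)" using finite_imp_inj_to_nat_seg by metis
  then have "inj_on (cont_code c) (com_conts c)" unfolding cont_code_def by (rule someI_ex)
  then show ?thesis by (simp add: inj_on_def cont_state_def)
qed

lemma state_cont [simp]: "k \<in> com_conts c \<Longrightarrow> state_cont c (cont_state c k) = k"
  by (simp add: state_cont_def inj_cont_state)

lemma com_conts_step: "k \<in> com_conts c \<Longrightarrow> fst (cont_step k cs) \<in> com_conts c"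
  using conts_step[of k c "[]"] by (auto simp: com_conts_def)

lemma tm_over_com_tm:
  assumes "finite G" "Blank \<in> G" "Letter ` A \<subseteq> G" "com_over G c"
  shows "tm_over A (com_tm G c)"
proof -
  have fin: "finite (com_conts c)" by (simp add: com_conts_def finite_conts)
  have start: "[c] \<in> com_conts c" by (simp add: com_conts_def conts_self)
  have delta: "case tm_delta (com_tm G c) q cs of (q', acts) \<Rightarrow>
      q' \<in> tm_states (com_tm G c) \<and> length acts = 8 \<and> fst ` set acts \<subseteq> G"
    if "q \<in> tm_states (com_tm G c)" "cs \<in> lists G" "length cs = 8" for q cs
  proof (cases "q < 2")
    case True
    then show ?thesis using that by (auto simp: com_tm_def idle_def)
  next
    case False
    then have "q \<in> cont_state c ` com_conts c" using that(1) by (auto simp: com_tm_def)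
    then obtain k where k: "k \<in> com_conts c" "q = cont_state c k" by blast
    have over: "\<forall>c'\<in>set k. com_over G c'"
      using k(1) conts_over[of k c "[]"] assms(4) by (auto simp: com_conts_def)
    have "length (snd (cont_step k cs)) = 8 \<and> fst ` set (snd (cont_step k cs)) \<subseteq> G"
      using cont_step_acts[OF over] that assms(2) by blast
    then show ?thesis
      using that k False com_conts_step[OF k(1), of cs]
      by (auto simp: com_tm_def idle_def split_beta)
  qed
  show ?thesis
    using assms fin start delta by (auto simp: tm_over_def com_tm_def)
qed

lemma tm_step_cont_move:
  assumes "k \<in> com_conts c" "k \<noteq> []" "cont_move (k, tps) = (k', tps')"
  shows "tm_step (com_tm G c) (cont_state c k, tps) = (cont_state c k', tps') \<and> k' \<in> com_conts c"
proof -
  have "\<not> cont_state c k < 2" "cont_state c k \<noteq> 0" "cont_state c k \<noteq> 1" by (auto simp: cont_state_def)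
  then show ?thesis
    using assms com_conts_step[OF assms(1), of "map (\<lambda>(i, f). f i) tps"]
    by (auto simp: com_tm_def cont_move_def split_beta)
qed

text \<open>The empty continuation idles under \<open>cont_move\<close> but halts in the machine, so
  only the moves up to the first empty continuation are matched; hence
  \<open>t' \<le> t\<close>.\<close>

lemma tm_step_cont_moves:
  assumes "k \<in> com_conts c" "(cont_move ^^ t) (k, tps) = ([], tps')"
  shows "\<exists>t'\<le>t. (tm_step (com_tm G c) ^^ t') (cont_state c k, tps) = (cont_state c [], tps')"
  using assms
proof (induction t arbitrary: k tps)
  case (Suc t)
  have idle: "cont_move ([], tps) = ([], tps)" for tps
    by (simp add: cont_move_def map2_tape_act_idle)
  show ?case
  proof (cases "k = []")
    case True
    have "(cont_move ^^ m) ([], tps) = ([], tps)" for m by (induction m) (auto simp: idle)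
    then have "tps = tps'" using Suc.prems True by (metis prod.inject)
    then show ?thesis using True by (intro exI[of _ 0]) auto
  next
    case False
    obtain k1 tps1 where 1: "cont_move (k, tps) = (k1, tps1)" by fastforce
    then have "(cont_move ^^ t) (k1, tps1) = ([], tps')"
      using Suc.prems(2) by (simp add: funpow_swap1)
    moreover have s: "tm_step (com_tm G c) (cont_state c k, tps) = (cont_state c k1, tps1)" "k1 \<in> com_conts c"
      using tm_step_cont_move[OF Suc.prems(1) False 1] by auto
    ultimately obtain t' where "t' \<le> t"
      "(tm_step (com_tm G c) ^^ t') (cont_state c k1, tps1) = (cont_state c [], tps')"
      using Suc.IH by blast
    then show ?thesis using s by (intro exI[of _ "Suc t'"]) (simp add: funpow_swap1 del: tm_step.simps)
  qed
qed auto

text \<open>After the program has ended, one more step turns the empty continuation into a halting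
  state. This is why the inequality \<open>t < T\<close> is strict.\<close>

lemma tm_run_com_tm:
  assumes "com_over G c" "exec c ((\<lambda>_. [])(0 := map Letter w)) t \<sigma>" "t < T"
  shows "\<exists>tps. represents tps \<sigma> \<and>
    tm_run (com_tm G c) w T = (if top_cell (\<sigma> 6) = Work 3 then 0 else 1, tps)"
proof -
  let ?M = "com_tm G c"
  let ?tps = "snd (tm_init ?M w)"
  have "stack_tape (((\<lambda>_. [])(0 := map Letter w)) i) (?tps ! i)" if "i < 7" for i
    using that by (cases i) (auto simp: tm_init_def com_tm_def stack_tape_def tape_content_def fun_eq_iff)
  then have "represents ?tps ((\<lambda>_. [])(0 := map Letter w))"
    by (auto simp: represents_def tm_init_def com_tm_def output_tape_def tape_content_def fun_eq_iff)
  then obtain tps where tps: "represents tps \<sigma>" "(cont_move ^^ t) ([c], ?tps) = ([], tps)"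
    using exec_cont_move[OF assms(2,1)] by blast
  have start: "[c] \<in> com_conts c" "[] \<in> com_conts c" by (auto simp: com_conts_def conts_self)
  obtain t' where t': "t' \<le> t" "(tm_step ?M ^^ t') (cont_state c [c], ?tps) = (cont_state c [], tps)"
    using tm_step_cont_moves[OF start(1) tps(2)] by blast
  let ?q = "if top_cell (\<sigma> 6) = Work 3 then 0 else 1 :: nat"
  have "tm_step ?M (cont_state c [], tps) = (?q, tps)"
    using state_cont[OF start(2)] represents_top[OF tps(1), of 6]
    by (simp add: com_tm_def map2_tape_act_idle cont_state_def[of c "[]"])
  then have 1: "(tm_step ?M ^^ Suc t') (cont_state c [c], ?tps) = (?q, tps)" using t' by simp
  have fix_q: "tm_step ?M (?q, tps) = (?q, tps)" by (simp add: com_tm_def)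
  have 2: "(tm_step ?M ^^ m) (?q, tps) = (?q, tps)" for m
    by (induction m) (simp_all only: funpow.simps id_apply comp_apply fix_q)
  obtain m where m: "T = m + Suc t'"
    using assms(3) t'(1) by (metis Suc_leI add.commute le_Suc_ex le_less_trans)
  have "tm_init ?M w = (cont_state c [c], ?tps)" by (simp add: tm_init_def com_tm_def)
  then have "tm_run ?M w T = (?q, tps)"
    unfolding tm_run_def m funpow_add comp_apply using 1 2 by metis
  then show ?thesis using tps(1) by blast
qed

section \<open>Stack programs on binary trees\<close>

datatype tree = Leaf | Node tree tree

abbreviation bit0 :: "'s cell" where "bit0 \<equiv> Work 2"
abbreviation bit1 :: "'s cell" where "bit1 \<equiv> Work 3"
abbreviation mark :: "'s cell" where "mark \<equiv> Work 4"

definition nonblank :: "'s cell \<Rightarrow> bool" where "nonblank s \<longleftrightarrow> s \<noteq> Blank"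

text \<open>Polish notation is a prefix code: a stack of trees needs no separators, and the end of a
  tree is found by counting the subtrees still open.\<close>

fun tree_code :: "tree \<Rightarrow> 's cell list" where
  "tree_code Leaf = [bit0]"
| "tree_code (Node a b) = bit1 # tree_code a @ tree_code b"

fun tree_size :: "tree \<Rightarrow> nat" where
  "tree_size Leaf = 1"
| "tree_size (Node a b) = Suc (tree_size a + tree_size b)"

lemma length_tree_code [simp]: "length (tree_code d) = tree_size d"
  by (induction d) auto

lemma tree_size_pos [simp]: "0 < tree_size d"
  by (cases d) auto

lemma set_tree_code: "set (tree_code d) \<subseteq> {bit0, bit1}"
  by (induction d) auto

lemma tree_code_append_inject: "tree_code a @ r = tree_code b @ s \<longleftrightarrow> a = b \<and> r = s"
proof (induction a arbitrary: b r s)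
  case Leaf then show ?case by (cases b) auto
next
  case (Node a1 a2) then show ?case by (cases b) auto
qed

lemma inj_tree_code: "tree_code a = tree_code b \<longleftrightarrow> a = b"
  using tree_code_append_inject[of a "[]" b "[]"] by simp

abbreviation work_symbols :: "'s cell set" where "work_symbols \<equiv> {bit0, bit1, mark}"

text \<open>Moves the topmost tree of a stack to tape 2, reversing its code. Tape 5 counts in unary the
  subtrees that are still to be read.\<close>

abbreviation collect_loop :: "nat \<Rightarrow> 's com" where
  "collect_loop i \<equiv> Loop 5 nonblank (Cond i (\<lambda>s. s = bit1)
     (Pop i ;; Push 2 bit1 ;; Push 5 mark) (Pop i ;; Push 2 bit0 ;; Pop 5))"

definition collect :: "nat \<Rightarrow> 's com" where
  "collect i = Push 5 mark ;; collect_loop i"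

text \<open>The run of the same loop on what follows \<open>d\<close> is a hypothesis. Both subtrees
  of a node are consumed by iterations of one single loop, so the induction has to prepend the work
  for a subtree to a run at hand. Each symbol costs at most 9 steps.\<close>

lemma collect_loop_exec:
  assumes "i \<notin> {2, 5}" "\<sigma> i = tree_code d @ r" "\<sigma> 5 = mark # cs"
    "exec (collect_loop i) (\<sigma>(i := r, 2 := rev (tree_code d) @ \<sigma> 2, 5 := cs)) t \<sigma>'"
  shows "\<exists>t'\<le>t + 9 * tree_size d. exec (collect_loop i) \<sigma> t' \<sigma>'"
  using assms
proof (induction d arbitrary: \<sigma> r cs t)
  case Leaf
  let ?\<sigma> = "((\<sigma>(i := tl (\<sigma> i)))(2 := bit0 # (\<sigma>(i := tl (\<sigma> i))) 2))"
  have "exec (Cond i (\<lambda>s. s = bit1) (Pop i ;; Push 2 bit1 ;; Push 5 mark) (Pop i ;; Push 2 bit0 ;; Pop 5))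
      \<sigma> (Suc (Suc (1 + Suc (2 + 1)))) (?\<sigma>(5 := tl (?\<sigma> 5)))"
    using Leaf.prems by (intro exec_CondF exec_Seq[OF exec_Pop exec_Seq[OF exec_Push exec_Pop]]) simp
  moreover have "?\<sigma>(5 := tl (?\<sigma> 5)) = \<sigma>(i := r, 2 := rev (tree_code Leaf) @ \<sigma> 2, 5 := cs)"
    using Leaf.prems by (auto simp: fun_eq_iff)
  moreover have "nonblank (top_cell (\<sigma> 5))" using Leaf.prems(3) by (simp add: nonblank_def)
  ultimately have "exec (collect_loop i) \<sigma> (Suc (Suc (Suc (1 + Suc (2 + 1))) + t)) \<sigma>'"
    using exec_LoopT[OF _ _ Leaf.prems(4)] by metis
  then show ?case by (intro exI[of _ "Suc (Suc (Suc (1 + Suc (2 + 1))) + t)"]) simp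
next
  case (Node a b)
  let ?a = "\<sigma>(i := tree_code a @ tree_code b @ r, 2 := bit1 # \<sigma> 2, 5 := mark # mark # cs)"
  let ?b = "\<sigma>(i := tree_code b @ r, 2 := rev (tree_code a) @ bit1 # \<sigma> 2, 5 := mark # cs)"
  have i: "i \<noteq> 2" "i \<noteq> 5" using Node.prems by auto
  have eq: "?b(i := r, 2 := rev (tree_code b) @ ?b 2, 5 := cs) =
      \<sigma>(i := r, 2 := rev (tree_code (Node a b)) @ \<sigma> 2, 5 := cs)"
    using i by (auto simp: fun_eq_iff)
  have "exec (collect_loop i) (?b(i := r, 2 := rev (tree_code b) @ ?b 2, 5 := cs)) t \<sigma>'"
    unfolding eq by (rule Node.prems(4))
  then have "\<exists>t'\<le>t + 9 * tree_size b. exec (collect_loop i) ?b t' \<sigma>'"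
    by (rule Node.IH(2)[OF Node.prems(1), rotated 2]) (use i in auto)
  then obtain t1 where t1: "t1 \<le> t + 9 * tree_size b" "exec (collect_loop i) ?b t1 \<sigma>'" by blast
  have eq: "?a(i := tree_code b @ r, 2 := rev (tree_code a) @ ?a 2, 5 := mark # cs) = ?b"
    using i by (auto simp: fun_eq_iff)
  have "exec (collect_loop i) (?a(i := tree_code b @ r, 2 := rev (tree_code a) @ ?a 2, 5 := mark # cs)) t1 \<sigma>'"
    unfolding eq by (rule t1(2))
  then have "\<exists>t'\<le>t1 + 9 * tree_size a. exec (collect_loop i) ?a t' \<sigma>'"
    by (rule Node.IH(1)[OF Node.prems(1), rotated 2]) (use i in auto)
  then obtain t2 where t2: "t2 \<le> t1 + 9 * tree_size a" "exec (collect_loop i) ?a t2 \<sigma>'" by blast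
  let ?\<sigma> = "((\<sigma>(i := tl (\<sigma> i)))(2 := bit1 # (\<sigma>(i := tl (\<sigma> i))) 2))"
  have "exec (Cond i (\<lambda>s. s = bit1) (Pop i ;; Push 2 bit1 ;; Push 5 mark) (Pop i ;; Push 2 bit0 ;; Pop 5))
      \<sigma> (Suc (Suc (1 + Suc (2 + 2)))) (?\<sigma>(5 := mark # (?\<sigma> 5)))"
    using Node.prems by (intro exec_CondT exec_Seq[OF exec_Pop exec_Seq[OF exec_Push exec_Push]]) simp
  moreover have "?\<sigma>(5 := mark # (?\<sigma> 5)) = ?a"
    using Node.prems by (auto simp: fun_eq_iff)
  moreover have "nonblank (top_cell (\<sigma> 5))" using Node.prems(3) by (simp add: nonblank_def)
  ultimately have "exec (collect_loop i) \<sigma> (Suc (Suc (Suc (1 + Suc (2 + 2))) + t2)) \<sigma>'"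
    using exec_LoopT[OF _ _ t2(2)] by metis
  then show ?case using t1 t2 by (intro exI[of _ "Suc (Suc (Suc (1 + Suc (2 + 2))) + t2)"]) simp
qed

lemma collect_exec:
  assumes "i \<notin> {2, 5}" "\<sigma> i = tree_code d @ r" "\<sigma> 5 = []"
  shows "\<exists>t\<le>9 * tree_size d + 4. exec (collect i) \<sigma> t (\<sigma>(i := r, 2 := rev (tree_code d) @ \<sigma> 2))"
proof -
  let ?\<sigma> = "\<sigma>(5 := mark # \<sigma> 5)"
  have eq: "?\<sigma>(i := r, 2 := rev (tree_code d) @ ?\<sigma> 2, 5 := []) = \<sigma>(i := r, 2 := rev (tree_code d) @ \<sigma> 2)"
    using assms by (auto simp: fun_eq_iff)
  have "exec (collect_loop i) (\<sigma>(i := r, 2 := rev (tree_code d) @ \<sigma> 2)) 1 (\<sigma>(i := r, 2 := rev (tree_code d) @ \<sigma> 2))"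
    using assms by (intro exec_LoopF) (auto simp: nonblank_def)
  then obtain t where t: "t \<le> 1 + 9 * tree_size d"
    "exec (collect_loop i) ?\<sigma> t (\<sigma>(i := r, 2 := rev (tree_code d) @ \<sigma> 2))"
    using collect_loop_exec[of i ?\<sigma> d r "[]" 1, unfolded eq] assms by auto
  have "exec (collect i) \<sigma> (Suc (2 + t)) (\<sigma>(i := r, 2 := rev (tree_code d) @ \<sigma> 2))"
    unfolding collect_def using t by (intro exec_Seq[OF exec_Push]) auto
  then show ?thesis using t(1) by (intro exI[of _ "Suc (2 + t)"]) auto
qed

definition push_all :: "nat list \<Rightarrow> 's cell list \<Rightarrow> (nat \<Rightarrow> 's cell list) \<Rightarrow> nat \<Rightarrow> 's cell list" where
  "push_all js l \<sigma> j = (if j \<in> set js then l @ \<sigma> j else \<sigma> j)"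

fun emit_symbol :: "nat list \<Rightarrow> 's cell \<Rightarrow> 's com" where
  "emit_symbol [] s = Pop 2"
| "emit_symbol (j # js) s = Push j s ;; emit_symbol js s"

definition emit :: "nat list \<Rightarrow> 's com" where
  "emit js = Loop 2 nonblank (Cond 2 (\<lambda>s. s = bit1) (emit_symbol js bit1) (emit_symbol js bit0))"

lemma emit_symbol_exec:
  "2 \<notin> set js \<Longrightarrow> distinct js \<Longrightarrow>
   exec (emit_symbol js s) \<sigma> (3 * length js + 1) ((push_all js [s] \<sigma>)(2 := tl (\<sigma> 2)))"
proof (induction js arbitrary: \<sigma>)
  case Nil
  have eq: "(push_all [] [s] \<sigma>)(2 := tl (\<sigma> 2)) = \<sigma>(2 := tl (\<sigma> 2))" by (auto simp: push_all_def fun_eq_iff)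
  have "exec (emit_symbol [] s) \<sigma> (3 * length ([] :: nat list) + 1) (\<sigma>(2 := tl (\<sigma> 2)))"
    using exec_Pop[of 2 \<sigma>] by simp
  then show ?case by (simp only: eq)
next
  case (Cons j js)
  let ?\<sigma> = "\<sigma>(j := s # \<sigma> j)"
  have "exec (emit_symbol (j # js) s) \<sigma> (Suc (2 + (3 * length js + 1)))
      ((push_all js [s] ?\<sigma>)(2 := tl (?\<sigma> 2)))"
    unfolding emit_symbol.simps by (rule exec_Seq[OF exec_Push Cons.IH]) (use Cons.prems in auto)
  moreover have "(push_all js [s] ?\<sigma>)(2 := tl (?\<sigma> 2)) = (push_all (j # js) [s] \<sigma>)(2 := tl (\<sigma> 2))"
    using Cons.prems by (auto simp: push_all_def fun_eq_iff)
  moreover have "Suc (2 + (3 * length js + 1)) = 3 * length (j # js) + 1" by simp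
  ultimately show ?case by (simp only:)
qed

lemma emit_exec:
  assumes "2 \<notin> set js" "distinct js" "\<sigma> 2 = rev l" "set l \<subseteq> {bit0, bit1}"
  shows "exec (emit js) \<sigma> (length l * (3 * length js + 3) + 1) ((push_all js l \<sigma>)(2 := []))"
  using assms(3,4)
proof (induction l arbitrary: \<sigma> rule: rev_induct)
  case Nil
  have eq: "(push_all js [] \<sigma>)(2 := []) = \<sigma>" using Nil by (auto simp: push_all_def fun_eq_iff)
  show ?case unfolding eq using exec_LoopF[of nonblank \<sigma> 2] Nil by (auto simp: nonblank_def emit_def)
next
  case (snoc s l)
  let ?\<sigma> = "(push_all js [s] \<sigma>)(2 := tl (\<sigma> 2))"
  have "exec (Cond 2 (\<lambda>s. s = bit1) (emit_symbol js bit1) (emit_symbol js bit0)) \<sigma>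
      (Suc (3 * length js + 1)) ?\<sigma>"
  proof (cases "s = bit1")
    case True
    then show ?thesis using snoc.prems emit_symbol_exec[OF assms(1,2), of s \<sigma>]
      by (intro exec_CondT) simp_all
  next
    case False
    then have "s = bit0" using snoc.prems by auto
    then show ?thesis using snoc.prems emit_symbol_exec[OF assms(1,2), of s \<sigma>]
      by (intro exec_CondF) simp_all
  qed
  moreover have "exec (emit js) ?\<sigma> (length l * (3 * length js + 3) + 1) ((push_all js l ?\<sigma>)(2 := []))"
    using snoc by (intro snoc.IH) auto
  moreover have "nonblank (top_cell (\<sigma> 2))" using snoc.prems by (auto simp: nonblank_def)
  ultimately have "exec (emit js) \<sigma> (Suc (Suc (3 * length js + 1) + (length l * (3 * length js + 3) + 1)))
      ((push_all js l ?\<sigma>)(2 := []))"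
    unfolding emit_def by (intro exec_LoopT)
  moreover have "(push_all js l ?\<sigma>)(2 := []) = (push_all js (l @ [s]) \<sigma>)(2 := [])"
    using assms by (auto simp: push_all_def fun_eq_iff)
  moreover have "Suc (Suc (3 * length js + 1) + (length l * (3 * length js + 3) + 1)) =
      length (l @ [s]) * (3 * length js + 3) + 1" by (simp add: algebra_simps)
  ultimately show ?case by (simp only:)
qed

text \<open>Moving a stack onto another one reverses it, so two passes are made, with tape 2 in
  between. No target deletes the tree, one target moves it, two targets copy it.\<close>

definition transfer :: "nat \<Rightarrow> nat list \<Rightarrow> 's com" where
  "transfer i js = collect i ;; emit js"

lemma transfer_exec:
  assumes "i \<notin> {2, 5}" "\<sigma> i = tree_code d @ r" "\<sigma> 5 = []" "\<sigma> 2 = []"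
    "2 \<notin> set js" "distinct js" "length js \<le> 2"
  shows "\<exists>t\<le>24 * tree_size d. exec (transfer i js) \<sigma> t (push_all js (tree_code d) (\<sigma>(i := r)))"
proof -
  let ?\<sigma> = "\<sigma>(i := r, 2 := rev (tree_code d) @ \<sigma> 2)"
  obtain t where t: "t \<le> 9 * tree_size d + 4" "exec (collect i) \<sigma> t ?\<sigma>"
    using collect_exec assms by blast
  have "exec (emit js) ?\<sigma> (length (tree_code d :: 'a cell list) * (3 * length js + 3) + 1)
      ((push_all js (tree_code d) ?\<sigma>)(2 := []))"
    using assms set_tree_code by (intro emit_exec) auto
  moreover have "(push_all js (tree_code d) ?\<sigma>)(2 := []) = push_all js (tree_code d) (\<sigma>(i := r))"
    using assms by (auto simp: push_all_def fun_eq_iff)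
  ultimately have 1: "exec (transfer i js) \<sigma> (Suc (t + (tree_size d * (3 * length js + 3) + 1)))
      (push_all js (tree_code d) (\<sigma>(i := r)))"
    unfolding transfer_def using t by (intro exec_Seq) auto
  have "tree_size d * (3 * length js + 3) \<le> tree_size d * 9" using assms(7) by (intro mult_left_mono) auto
  moreover have "1 \<le> tree_size d" using tree_size_pos[of d] by linarith
  ultimately have "Suc (t + (tree_size d * (3 * length js + 3) + 1)) \<le> 24 * tree_size d" using t(1) by linarith
  then show ?thesis using 1 by blast
qed

text \<open>The shape of the memory between two operations: the scratch tapes 1 to 5 are empty
  again.\<close>

definition work_state :: "'s cell list \<Rightarrow> 's cell list \<Rightarrow> 's cell list \<Rightarrow> nat \<Rightarrow> 's cell list" where
  "work_state inp m out = (\<lambda>_. [])(0 := inp, 6 := m, 7 := out)"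

definition trees_code :: "tree list \<Rightarrow> 's cell list" where
  "trees_code xs = concat (map tree_code xs)"

lemma trees_code_simps [simp]:
  "trees_code [] = []" "trees_code (x # xs) = tree_code x @ trees_code xs"
  "trees_code (xs @ ys) = trees_code xs @ trees_code ys"
  by (auto simp: trees_code_def)

text \<open>The program replaces the trees \<open>xs\<close> on top of the main stack (tape 6) by \<open>ys\<close>.\<close>

definition runs :: "'s com \<Rightarrow> tree list \<Rightarrow> tree list \<Rightarrow> nat \<Rightarrow> bool" where
  "runs c xs ys T \<longleftrightarrow> com_over work_symbols c \<and>
     (\<forall>inp r out. \<exists>t\<le>T. exec c (work_state inp (trees_code xs @ r) out) t
                           (work_state inp (trees_code ys @ r) out))"

lemma runs_Seq:
  assumes "runs a xs ys t1" "runs b ys zs t2"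
  shows "runs (a ;; b) xs zs (t1 + t2 + 1)"
  unfolding runs_def
proof (intro conjI allI)
  fix inp r out :: "'a cell list"
  obtain t where t: "t \<le> t1" "exec a (work_state inp (trees_code xs @ r) out) t (work_state inp (trees_code ys @ r) out)"
    using assms(1) unfolding runs_def by blast
  obtain t' where t': "t' \<le> t2" "exec b (work_state inp (trees_code ys @ r) out) t' (work_state inp (trees_code zs @ r) out)"
    using assms(2) unfolding runs_def by blast
  show "\<exists>t\<le>t1 + t2 + 1. exec (a ;; b) (work_state inp (trees_code xs @ r) out) t (work_state inp (trees_code zs @ r) out)"
    using exec_Seq[OF t(2) t'(2)] t(1) t'(1) by (intro exI[of _ "Suc (t + t')"]) auto
qed (use assms in \<open>auto simp: runs_def\<close>)

lemma runs_frame: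
  assumes "runs c xs ys T"
  shows "runs c (xs @ zs) (ys @ zs) T"
  using assms unfolding runs_def by (metis append_assoc trees_code_simps(3))

lemma runs_mono: "runs c xs ys T \<Longrightarrow> T \<le> T' \<Longrightarrow> runs c xs ys T'"
  unfolding runs_def by (meson le_trans)

lemma transfer_over: "i < 7 \<Longrightarrow> set js \<subseteq> {..<7} \<Longrightarrow> com_over work_symbols (transfer i js)"
proof -
  assume i: "i < 7" "set js \<subseteq> {..<7}"
  have "com_over work_symbols (emit_symbol js s)" if "s \<in> work_symbols" for s :: "'a cell"
    using i(2) that by (induction js) auto
  from this[of bit0] this[of bit1] show ?thesis using i(1) by (simp add: transfer_def collect_def emit_def)
qed

definition drop_com :: "'s com" where "drop_com = transfer 6 []"
definition dup_com :: "'s com" where "dup_com = transfer 6 [6, 3] ;; transfer 3 [6]"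
definition swap_com :: "'s com" where
  "swap_com = transfer 6 [3] ;; transfer 6 [4] ;; transfer 3 [6] ;; transfer 4 [6]"

lemma runs_drop: "runs drop_com [x] [] (24 * tree_size x)"
  unfolding runs_def drop_com_def
proof (intro conjI allI)
  fix inp r out :: "'a cell list"
  let ?\<sigma> = "work_state inp (trees_code [x] @ r) out"
  have "push_all [] (tree_code x) (?\<sigma>(6 := r)) = work_state inp (trees_code [] @ r) out"
    by (auto simp: push_all_def work_state_def fun_eq_iff)
  then show "\<exists>t\<le>24 * tree_size x. exec (transfer 6 []) ?\<sigma> t (work_state inp (trees_code [] @ r) out)"
    using transfer_exec[of 6 ?\<sigma> x r "[]"] by (simp add: work_state_def)
qed (simp add: transfer_over)

lemma runs_dup: "runs dup_com [x] [x, x] (49 * tree_size x)"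
  unfolding runs_def dup_com_def
proof (intro conjI allI)
  fix inp r out :: "'a cell list"
  let ?\<sigma> = "work_state inp (trees_code [x] @ r) out"
  let ?\<sigma>1 = "push_all [6, 3] (tree_code x) (?\<sigma>(6 := r))"
  let ?\<sigma>2 = "push_all [6] (tree_code x) (?\<sigma>1(3 := []))"
  obtain t1 where t1: "t1 \<le> 24 * tree_size x" "exec (transfer 6 [6, 3]) ?\<sigma> t1 ?\<sigma>1"
    using transfer_exec[of 6 ?\<sigma> x r "[6, 3]"] by (auto simp: work_state_def)
  obtain t2 where t2: "t2 \<le> 24 * tree_size x" "exec (transfer 3 [6]) ?\<sigma>1 t2 ?\<sigma>2"
    using transfer_exec[of 3 ?\<sigma>1 x "[]" "[6]"] by (auto simp: work_state_def push_all_def)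
  have "?\<sigma>2 = work_state inp (trees_code [x, x] @ r) out"
    by (auto simp: push_all_def work_state_def fun_eq_iff)
  then have "exec (transfer 6 [6, 3] ;; transfer 3 [6]) ?\<sigma> (Suc (t1 + t2)) (work_state inp (trees_code [x, x] @ r) out)"
    using exec_Seq[OF t1(2) t2(2)] by simp
  moreover have "Suc (t1 + t2) \<le> 49 * tree_size x" using t1(1) t2(1) tree_size_pos[of x] by linarith
  ultimately show "\<exists>t\<le>49 * tree_size x. exec (transfer 6 [6, 3] ;; transfer 3 [6]) ?\<sigma> t
      (work_state inp (trees_code [x, x] @ r) out)" by blast
qed (simp add: transfer_over)

lemma runs_swap: "runs swap_com [x, y] [y, x] (50 * (tree_size x + tree_size y))"
  unfolding runs_def swap_com_def
proof (intro conjI allI)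
  fix inp r out :: "'a cell list"
  let ?\<sigma> = "work_state inp (trees_code [x, y] @ r) out"
  let ?\<sigma>1 = "push_all [3] (tree_code x) (?\<sigma>(6 := tree_code y @ r))"
  let ?\<sigma>2 = "push_all [4] (tree_code y) (?\<sigma>1(6 := r))"
  let ?\<sigma>3 = "push_all [6] (tree_code x) (?\<sigma>2(3 := []))"
  let ?\<sigma>4 = "push_all [6] (tree_code y) (?\<sigma>3(4 := []))"
  obtain t1 where t1: "t1 \<le> 24 * tree_size x" "exec (transfer 6 [3]) ?\<sigma> t1 ?\<sigma>1"
    using transfer_exec[of 6 ?\<sigma> x "tree_code y @ r" "[3]"] by (auto simp: work_state_def)
  obtain t2 where t2: "t2 \<le> 24 * tree_size y" "exec (transfer 6 [4]) ?\<sigma>1 t2 ?\<sigma>2"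
    using transfer_exec[of 6 ?\<sigma>1 y r "[4]"] by (auto simp: work_state_def push_all_def)
  obtain t3 where t3: "t3 \<le> 24 * tree_size x" "exec (transfer 3 [6]) ?\<sigma>2 t3 ?\<sigma>3"
    using transfer_exec[of 3 ?\<sigma>2 x "[]" "[6]"] by (auto simp: work_state_def push_all_def)
  obtain t4 where t4: "t4 \<le> 24 * tree_size y" "exec (transfer 4 [6]) ?\<sigma>3 t4 ?\<sigma>4"
    using transfer_exec[of 4 ?\<sigma>3 y "[]" "[6]"] by (auto simp: work_state_def push_all_def)
  have "?\<sigma>4 = work_state inp (trees_code [y, x] @ r) out"
    by (auto simp: push_all_def work_state_def fun_eq_iff)
  then have "exec (transfer 6 [3] ;; transfer 6 [4] ;; transfer 3 [6] ;; transfer 4 [6]) ?\<sigma>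
      (Suc (t1 + Suc (t2 + Suc (t3 + t4)))) (work_state inp (trees_code [y, x] @ r) out)"
    using exec_Seq[OF t1(2) exec_Seq[OF t2(2) exec_Seq[OF t3(2) t4(2)]]] by simp
  moreover have "Suc (t1 + Suc (t2 + Suc (t3 + t4))) \<le> 50 * (tree_size x + tree_size y)"
    using t1(1) t2(1) t3(1) t4(1) tree_size_pos[of x] tree_size_pos[of y] unfolding distrib_left by linarith
  ultimately show "\<exists>t\<le>50 * (tree_size x + tree_size y).
      exec (transfer 6 [3] ;; transfer 6 [4] ;; transfer 3 [6] ;; transfer 4 [6]) ?\<sigma> t
      (work_state inp (trees_code [y, x] @ r) out)" by blast
qed (simp add: transfer_over)

lemma work_state_1 [simp]: "work_state inp m out 6 = m"
  by (auto simp: work_state_def)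

lemma work_state_push: "(work_state inp m out)(6 := s # work_state inp m out 6) = work_state inp (s # m) out"
  by (auto simp: work_state_def fun_eq_iff)

lemma work_state_pop: "(work_state inp m out)(6 := tl (work_state inp m out 6)) = work_state inp (tl m) out"
  by (auto simp: work_state_def fun_eq_iff)

lemma runs_leaf: "runs (Push 6 bit0) [] [Leaf] 2"
  unfolding runs_def
proof (intro conjI allI)
  fix inp r out :: "'a cell list"
  show "\<exists>t\<le>2. exec (Push 6 bit0) (work_state inp (trees_code [] @ r) out) t (work_state inp (trees_code [Leaf] @ r) out)"
    using exec_Push[of 6 bit0 "work_state inp (trees_code [] @ r) out", unfolded work_state_push]
    by (intro exI[of _ 2]) simp
qed simp

lemma runs_node: "runs (Push 6 bit1) [x, y] [Node x y] 2"
  unfolding runs_def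
proof (intro conjI allI)
  fix inp r out :: "'a cell list"
  show "\<exists>t\<le>2. exec (Push 6 bit1) (work_state inp (trees_code [x, y] @ r) out) t (work_state inp (trees_code [Node x y] @ r) out)"
    using exec_Push[of 6 bit1 "work_state inp (trees_code [x, y] @ r) out", unfolded work_state_push]
    by (intro exI[of _ 2]) simp
qed simp

lemma runs_unnode: "runs (Pop 6) [Node x y] [x, y] 1"
  unfolding runs_def
proof (intro conjI allI)
  fix inp r out :: "'a cell list"
  show "\<exists>t\<le>1. exec (Pop 6) (work_state inp (trees_code [Node x y] @ r) out) t (work_state inp (trees_code [x, y] @ r) out)"
    using exec_Pop[of 6 "work_state inp (trees_code [Node x y] @ r) out", unfolded work_state_pop]
    by (intro exI[of _ 1]) simp
qed simp

lemma runs_unleaf: "runs (Pop 6) [Leaf] [] 1"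
  unfolding runs_def
proof (intro conjI allI)
  fix inp r out :: "'a cell list"
  show "\<exists>t\<le>1. exec (Pop 6) (work_state inp (trees_code [Leaf] @ r) out) t (work_state inp (trees_code [] @ r) out)"
    using exec_Pop[of 6 "work_state inp (trees_code [Leaf] @ r) out", unfolded work_state_pop]
    by (intro exI[of _ 1]) simp
qed simp

lemma runs_Cond_Node:
  assumes "runs a (Node x y # xs) ys t" "com_over work_symbols b"
  shows "runs (Cond 6 (\<lambda>s. s = bit1) a b) (Node x y # xs) ys (t + 1)"
  unfolding runs_def
proof (intro conjI allI)
  fix inp r out :: "'a cell list"
  obtain t' where t': "t' \<le> t" "exec a (work_state inp (trees_code (Node x y # xs) @ r) out) t' (work_state inp (trees_code ys @ r) out)"
    using assms(1) unfolding runs_def by blast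
  show "\<exists>t'\<le>t + 1. exec (Cond 6 (\<lambda>s. s = bit1) a b) (work_state inp (trees_code (Node x y # xs) @ r) out) t'
      (work_state inp (trees_code ys @ r) out)"
    using t' by (intro exI[of _ "Suc t'"] conjI exec_CondT) auto
qed (use assms in \<open>auto simp: runs_def\<close>)

lemma runs_Cond_Leaf:
  assumes "runs b (Leaf # xs) ys t" "com_over work_symbols a"
  shows "runs (Cond 6 (\<lambda>s. s = bit1) a b) (Leaf # xs) ys (t + 1)"
  unfolding runs_def
proof (intro conjI allI)
  fix inp r out :: "'a cell list"
  obtain t' where t': "t' \<le> t" "exec b (work_state inp (trees_code (Leaf # xs) @ r) out) t' (work_state inp (trees_code ys @ r) out)"
    using assms(1) unfolding runs_def by blast
  show "\<exists>t'\<le>t + 1. exec (Cond 6 (\<lambda>s. s = bit1) a b) (work_state inp (trees_code (Leaf # xs) @ r) out) t'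
      (work_state inp (trees_code ys @ r) out)"
    using t' by (intro exI[of _ "Suc t'"] conjI exec_CondF) auto
qed (use assms in \<open>auto simp: runs_def\<close>)

section \<open>Equality tests and while loops on trees\<close>

definition bool_tree :: "bool \<Rightarrow> tree" where
  "bool_tree b = (if b then Node Leaf Leaf else Leaf)"

abbreviation compare_loop :: "'s com" where
  "compare_loop \<equiv> Loop 3 nonblank (Cond 3 (\<lambda>s. s = bit1)
     (Cond 4 (\<lambda>s. s = bit1) (Pop 3 ;; Pop 4) (Pop 3 ;; Pop 4 ;; Push 2 mark))
     (Cond 4 (\<lambda>s. s = bit0) (Pop 3 ;; Pop 4) (Pop 3 ;; Pop 4 ;; Push 2 mark)))"

text \<open>Each mismatch leaves a mark on tape 2. If the second word is too short, the blanks below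
  it count as mismatches; if it is too long, its rest stays on tape 4 and \<open>drain_loop\<close>
  turns it into further marks. The words are equal iff no mark is present in the end.\<close>

lemma compare_loop_exec:
  assumes "\<sigma> 3 = as" "\<sigma> 4 = bs" "set as \<subseteq> {bit0, bit1}"
  shows "\<exists>t n. t \<le> 9 * length as + 1 \<and> n \<le> length as \<and> (n = 0 \<longleftrightarrow> take (length as) bs = as) \<and>
    exec compare_loop \<sigma> t (\<sigma>(3 := [], 4 := drop (length as) bs, 2 := replicate n mark @ \<sigma> 2))"
  using assms
proof (induction as arbitrary: \<sigma> bs)
  case Nil
  have eq: "\<sigma>(3 := [], 4 := drop (length []) bs, 2 := replicate 0 mark @ \<sigma> 2) = \<sigma>"
    using Nil by (auto simp: fun_eq_iff)
  have "exec compare_loop \<sigma> 1 \<sigma>" using Nil by (intro exec_LoopF) (auto simp: nonblank_def)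
  then show ?case by (intro exI[of _ 1] exI[of _ 0]) (subst eq, simp)
next
  case (Cons s as)
  let ?P = "Cond 3 (\<lambda>s. s = bit1)
     (Cond 4 (\<lambda>s. s = bit1) (Pop 3 ;; Pop 4) (Pop 3 ;; Pop 4 ;; Push 2 mark))
     (Cond 4 (\<lambda>s. s = bit0) (Pop 3 ;; Pop 4) (Pop 3 ;; Pop 4 ;; Push 2 mark))"
  let ?b = "top_cell bs = s"
  let ?\<sigma> = "\<sigma>(3 := as, 4 := tl bs, 2 := (if ?b then [] else [mark]) @ \<sigma> 2)"
  have body: "\<exists>t\<le>8. exec ?P \<sigma> t ?\<sigma>"
  proof (cases ?b)
    case True
    have "exec (Pop 3 ;; Pop 4) \<sigma> (Suc (1 + 1)) ((\<sigma>(3 := tl (\<sigma> 3)))(4 := tl ((\<sigma>(3 := tl (\<sigma> 3))) 4)))"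
      by (rule exec_Seq[OF exec_Pop exec_Pop])
    moreover have "(\<sigma>(3 := tl (\<sigma> 3)))(4 := tl ((\<sigma>(3 := tl (\<sigma> 3))) 4)) = ?\<sigma>"
      using Cons.prems True by (auto simp: fun_eq_iff)
    ultimately have "exec (Pop 3 ;; Pop 4) \<sigma> (Suc (1 + 1)) ?\<sigma>" by (simp only:)
    moreover have "Suc (1 + 1) = 3" by simp
    ultimately have e: "exec (Pop 3 ;; Pop 4) \<sigma> 3 ?\<sigma>" by (simp only:)
    have "s = bit1 \<or> s = bit0" using Cons.prems by auto
    then have "exec ?P \<sigma> (Suc (Suc 3)) ?\<sigma>"
    proof
      assume "s = bit1"
      then show ?thesis using Cons.prems True by (intro exec_CondT e) auto
    next
      assume "s = bit0"
      then show ?thesis using Cons.prems True by (intro exec_CondF exec_CondT e) auto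
    qed
    then show ?thesis by (intro exI[of _ "Suc (Suc 3)"]) simp
  next
    case False
    let ?\<sigma>1 = "(\<sigma>(3 := tl (\<sigma> 3)))(4 := tl ((\<sigma>(3 := tl (\<sigma> 3))) 4))"
    have "exec (Pop 3 ;; Pop 4 ;; Push 2 mark) \<sigma> (Suc (1 + Suc (1 + 2))) (?\<sigma>1(2 := mark # ?\<sigma>1 2))"
      by (rule exec_Seq[OF exec_Pop exec_Seq[OF exec_Pop exec_Push]])
    moreover have "?\<sigma>1(2 := mark # ?\<sigma>1 2) = ?\<sigma>"
      using Cons.prems False by (auto simp: fun_eq_iff)
    ultimately have "exec (Pop 3 ;; Pop 4 ;; Push 2 mark) \<sigma> (Suc (1 + Suc (1 + 2))) ?\<sigma>" by (simp only:)
    moreover have "Suc (1 + Suc (1 + 2)) = 6" by simp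
    ultimately have e: "exec (Pop 3 ;; Pop 4 ;; Push 2 mark) \<sigma> 6 ?\<sigma>" by (simp only:)
    have "s = bit1 \<or> s = bit0" using Cons.prems by auto
    then have "exec ?P \<sigma> (Suc (Suc 6)) ?\<sigma>"
    proof
      assume "s = bit1"
      then show ?thesis using Cons.prems False
        by (intro exec_CondT[of "\<lambda>s. s = bit1" \<sigma> 3] exec_CondF e) auto
    next
      assume "s = bit0"
      then show ?thesis using Cons.prems False by (intro exec_CondF e) auto
    qed
    then show ?thesis by (intro exI[of _ "Suc (Suc 6)"]) simp
  qed
  then obtain t1 where t1: "t1 \<le> 8" "exec ?P \<sigma> t1 ?\<sigma>" by blast
  have IH: "\<exists>t n. t \<le> 9 * length as + 1 \<and> n \<le> length as \<and> (n = 0 \<longleftrightarrow> take (length as) (tl bs) = as) \<and>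
    exec compare_loop ?\<sigma> t (?\<sigma>(3 := [], 4 := drop (length as) (tl bs), 2 := replicate n mark @ ?\<sigma> 2))"
    using Cons.prems by (intro Cons.IH) auto
  then obtain t2 n where t2: "t2 \<le> 9 * length as + 1" "n \<le> length as" "n = 0 \<longleftrightarrow> take (length as) (tl bs) = as"
    "exec compare_loop ?\<sigma> t2 (?\<sigma>(3 := [], 4 := drop (length as) (tl bs), 2 := replicate n mark @ ?\<sigma> 2))" by blast
  let ?n = "n + (if ?b then 0 else 1)"
  have "?\<sigma>(3 := [], 4 := drop (length as) (tl bs), 2 := replicate n mark @ ?\<sigma> 2) =
      \<sigma>(3 := [], 4 := drop (length (s # as)) bs, 2 := replicate ?n mark @ \<sigma> 2)"
    by (auto simp: fun_eq_iff drop_Suc replicate_add)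
  then have "exec compare_loop \<sigma> (Suc (t1 + t2))
      (\<sigma>(3 := [], 4 := drop (length (s # as)) bs, 2 := replicate ?n mark @ \<sigma> 2))"
    using exec_LoopT[of nonblank \<sigma> 3 ?P t1 ?\<sigma> t2] t1 t2 Cons.prems by (auto simp: nonblank_def)
  moreover have "?n = 0 \<longleftrightarrow> take (length (s # as)) bs = s # as"
    using t2(3) Cons.prems by (cases bs) auto
  moreover have "Suc (t1 + t2) \<le> 9 * length (s # as) + 1" "?n \<le> length (s # as)" using t1(1) t2(1,2) by auto
  ultimately show ?case by (intro exI[of _ "Suc (t1 + t2)"] exI[of _ ?n] conjI)
qed

abbreviation drain_loop :: "'s com" where "drain_loop \<equiv> Loop 4 nonblank (Pop 4 ;; Push 2 mark)"

lemma drain_loop_exec: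
  "\<sigma> 4 = bs \<Longrightarrow> Blank \<notin> set bs \<Longrightarrow>
   exec drain_loop \<sigma> (5 * length bs + 1) (\<sigma>(4 := [], 2 := replicate (length bs) mark @ \<sigma> 2))"
proof (induction bs arbitrary: \<sigma>)
  case Nil
  have eq: "\<sigma>(4 := [], 2 := replicate (length []) mark @ \<sigma> 2) = \<sigma>" using Nil by (auto simp: fun_eq_iff)
  have "exec drain_loop \<sigma> 1 \<sigma>" using Nil by (intro exec_LoopF) (simp add: nonblank_def)
  then show ?case unfolding eq by simp
next
  case (Cons s bs)
  let ?\<sigma>1 = "\<sigma>(4 := tl (\<sigma> 4))"
  let ?\<sigma> = "?\<sigma>1(2 := mark # ?\<sigma>1 2)"
  have "exec (Pop 4 ;; Push 2 mark) \<sigma> (Suc (1 + 2)) ?\<sigma>" by (rule exec_Seq[OF exec_Pop exec_Push])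
  moreover have "exec drain_loop ?\<sigma> (5 * length bs + 1) (?\<sigma>(4 := [], 2 := replicate (length bs) mark @ ?\<sigma> 2))"
    using Cons.prems by (intro Cons.IH) auto
  moreover have "nonblank (top_cell (\<sigma> 4))" using Cons.prems by (auto simp: nonblank_def)
  ultimately have "exec drain_loop \<sigma> (Suc (Suc (1 + 2) + (5 * length bs + 1)))
      (?\<sigma>(4 := [], 2 := replicate (length bs) mark @ ?\<sigma> 2))" by (intro exec_LoopT)
  moreover have "?\<sigma>(4 := [], 2 := replicate (length bs) mark @ ?\<sigma> 2) =
      \<sigma>(4 := [], 2 := replicate (length (s # bs)) mark @ \<sigma> 2)"
    by (auto simp: fun_eq_iff replicate_app_Cons_same)
  moreover have "Suc (Suc (1 + 2) + (5 * length bs + 1)) = 5 * length (s # bs) + 1" by simp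
  ultimately show ?case by (simp only:)
qed

lemma clear_loop_exec:
  "\<sigma> 2 = replicate n mark \<Longrightarrow> exec (Loop 2 nonblank (Pop 2)) \<sigma> (2 * n + 1) (\<sigma>(2 := []))"
proof (induction n arbitrary: \<sigma>)
  case 0
  then have eq: "\<sigma>(2 := []) = \<sigma>" by (auto simp: fun_eq_iff)
  have "exec (Loop 2 nonblank (Pop 2)) \<sigma> 1 \<sigma>" using 0 by (intro exec_LoopF) (simp add: nonblank_def)
  then show ?case unfolding eq by simp
next
  case (Suc n)
  let ?\<sigma> = "\<sigma>(2 := tl (\<sigma> 2))"
  have "exec (Loop 2 nonblank (Pop 2)) ?\<sigma> (2 * n + 1) (?\<sigma>(2 := []))"
    using Suc.prems by (intro Suc.IH) auto
  moreover have "nonblank (top_cell (\<sigma> 2))" using Suc.prems by (auto simp: nonblank_def)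
  ultimately have "exec (Loop 2 nonblank (Pop 2)) \<sigma> (Suc (1 + (2 * n + 1))) (?\<sigma>(2 := []))"
    by (intro exec_LoopT[OF _ exec_Pop])
  moreover have "?\<sigma>(2 := []) = \<sigma>(2 := [])" "Suc (1 + (2 * n + 1)) = 2 * Suc n + 1" by auto
  ultimately show ?case by (simp only:)
qed

definition eq_com :: "'s com" where
  "eq_com = transfer 6 [3] ;; transfer 6 [4] ;; compare_loop ;; drain_loop ;;
     Cond 2 nonblank (Push 6 bit0) (Push 6 bit0 ;; Push 6 bit0 ;; Push 6 bit1) ;;
     Loop 2 nonblank (Pop 2)"

lemma runs_eq: "runs eq_com [x, y] [bool_tree (x = y)] (70 * (tree_size x + tree_size y))"
  unfolding runs_def
proof (intro conjI allI)
  fix inp r out :: "'a cell list"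
  let ?\<sigma> = "work_state inp (trees_code [x, y] @ r) out"
  let ?\<sigma>1 = "push_all [3] (tree_code x) (?\<sigma>(6 := tree_code y @ r))"
  let ?\<sigma>2 = "push_all [4] (tree_code y) (?\<sigma>1(6 := r))"
  let ?x = "tree_code x :: 'a cell list" and ?y = "tree_code y :: 'a cell list"
  obtain t1 where t1: "t1 \<le> 24 * tree_size x" "exec (transfer 6 [3]) ?\<sigma> t1 ?\<sigma>1"
    using transfer_exec[of 6 ?\<sigma> x "tree_code y @ r" "[3]"] by (auto simp: work_state_def)
  obtain t2 where t2: "t2 \<le> 24 * tree_size y" "exec (transfer 6 [4]) ?\<sigma>1 t2 ?\<sigma>2"
    using transfer_exec[of 6 ?\<sigma>1 y r "[4]"] by (auto simp: work_state_def push_all_def)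
  have \<sigma>2: "?\<sigma>2 3 = ?x" "?\<sigma>2 4 = ?y" "?\<sigma>2 2 = []" by (auto simp: work_state_def push_all_def)
  obtain t3 n where t3: "t3 \<le> 9 * length ?x + 1" "n \<le> length ?x" "n = 0 \<longleftrightarrow> take (length ?x) ?y = ?x"
    "exec compare_loop ?\<sigma>2 t3 (?\<sigma>2(3 := [], 4 := drop (length ?x) ?y, 2 := replicate n mark @ ?\<sigma>2 2))"
    using compare_loop_exec[OF \<sigma>2(1,2) set_tree_code] by blast
  let ?d = "drop (length ?x) ?y"
  let ?\<sigma>3 = "?\<sigma>2(3 := [], 4 := ?d, 2 := replicate n mark @ ?\<sigma>2 2)"
  let ?m = "length ?d + n"
  let ?\<sigma>4 = "?\<sigma>3(4 := [], 2 := replicate (length ?d) mark @ ?\<sigma>3 2)"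
  have "Blank \<notin> set ?d" using set_tree_code[of y] set_drop_subset[of "length ?x" ?y] by blast
  then have t4: "exec drain_loop ?\<sigma>3 (5 * length ?d + 1) ?\<sigma>4"
    by (intro drain_loop_exec) auto
  have m: "?\<sigma>4 2 = replicate ?m mark" using \<sigma>2 by (auto simp: replicate_add)
  have m0: "?m = 0 \<longleftrightarrow> x = y"
  proof -
    have "?m = 0 \<longleftrightarrow> take (length ?x) ?y = ?x \<and> length ?y \<le> length ?x" using t3(3) by auto
    also have "\<dots> \<longleftrightarrow> ?x = ?y" by (metis order_refl take_all)
    finally show ?thesis by (simp add: inj_tree_code)
  qed
  let ?\<sigma>5 = "?\<sigma>4(6 := tree_code (bool_tree (x = y)) @ r)"
  have r: "?\<sigma>4 6 = r" by (auto simp: push_all_def)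
  have "\<exists>t\<le>10. exec (Cond 2 nonblank (Push 6 bit0) (Push 6 bit0 ;; Push 6 bit0 ;; Push 6 bit1)) ?\<sigma>4 t ?\<sigma>5"
  proof (cases "x = y")
    case False
    then have "nonblank (top_cell (?\<sigma>4 2))" using m m0 by (cases ?m) (auto simp: nonblank_def)
    then have "exec (Cond 2 nonblank (Push 6 bit0) (Push 6 bit0 ;; Push 6 bit0 ;; Push 6 bit1)) ?\<sigma>4
        (Suc 2) (?\<sigma>4(6 := bit0 # ?\<sigma>4 6))" by (rule exec_CondT[OF _ exec_Push])
    then show ?thesis unfolding r using False by (intro exI[of _ "Suc 2"]) (simp add: bool_tree_def)
  next
    case True
    then have "\<not> nonblank (top_cell (?\<sigma>4 2))" using m m0 by (auto simp: nonblank_def)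
    then have "exec (Cond 2 nonblank (Push 6 bit0) (Push 6 bit0 ;; Push 6 bit0 ;; Push 6 bit1)) ?\<sigma>4
        (Suc (Suc (2 + Suc (2 + 2)))) (?\<sigma>4(6 := bit0 # ?\<sigma>4 6, 6 := bit0 # (?\<sigma>4(6 := bit0 # ?\<sigma>4 6)) 6,
          6 := bit1 # (?\<sigma>4(6 := bit0 # ?\<sigma>4 6, 6 := bit0 # (?\<sigma>4(6 := bit0 # ?\<sigma>4 6)) 6)) 6))"
      by (rule exec_CondF[OF _ exec_Seq[OF exec_Push exec_Seq[OF exec_Push exec_Push]]])
    then show ?thesis unfolding r using True
      by (intro exI[of _ "Suc (Suc (2 + Suc (2 + 2)))"]) (simp add: bool_tree_def)
  qed
  then obtain t5 where t5: "t5 \<le> 10"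
    "exec (Cond 2 nonblank (Push 6 bit0) (Push 6 bit0 ;; Push 6 bit0 ;; Push 6 bit1)) ?\<sigma>4 t5 ?\<sigma>5" by blast
  have t6: "exec (Loop 2 nonblank (Pop 2)) ?\<sigma>5 (2 * ?m + 1) (?\<sigma>5(2 := []))"
    using m by (intro clear_loop_exec) simp
  let ?t = "Suc (t1 + Suc (t2 + Suc (t3 + Suc ((5 * length ?d + 1) + Suc (t5 + (2 * ?m + 1))))))"
  have "exec eq_com ?\<sigma> ?t (?\<sigma>5(2 := []))"
    unfolding eq_com_def
    by (rule exec_Seq[OF t1(2) exec_Seq[OF t2(2) exec_Seq[OF t3(4) exec_Seq[OF t4 exec_Seq[OF t5(2) t6]]]]])
  moreover have "?\<sigma>5(2 := []) = work_state inp (trees_code [bool_tree (x = y)] @ r) out"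
    by (auto simp: push_all_def work_state_def fun_eq_iff)
  moreover have "?t \<le> 70 * (tree_size x + tree_size y)"
  proof -
    have "length ?d \<le> tree_size y" using length_tree_code[of y] by (metis diff_le_self length_drop)
    then show ?thesis
      using t1(1) t2(1) t3(1,2) t5(1) tree_size_pos[of x] tree_size_pos[of y]
      unfolding length_tree_code distrib_left by linarith
  qed
  ultimately show "\<exists>t\<le>70 * (tree_size x + tree_size y).
      exec eq_com ?\<sigma> t (work_state inp (trees_code [bool_tree (x = y)] @ r) out)" by auto
qed (simp add: eq_com_def transfer_over)

lemma drop_com_over: "com_over work_symbols drop_com"
  by (simp add: drop_com_def transfer_over)

text \<open>The test consumes its argument and is therefore applied to a copy. Its result decides on
  the next round by its leading symbol; \<open>True\<close> is dropped as a whole tree inside the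
  loop, \<open>False\<close> is the single symbol popped after it.\<close>

definition while_com :: "'s com \<Rightarrow> 's com \<Rightarrow> 's com" where
  "while_com test body = (dup_com ;; test) ;;
     (Loop 6 (\<lambda>s. s = bit1) (drop_com ;; body ;; dup_com ;; test) ;; Pop 6)"

lemma runs_Loop_step:
  assumes "runs a (Node x y # xs) ys t" "runs (Loop 6 (\<lambda>s. s = bit1) a) ys zs t'"
  shows "runs (Loop 6 (\<lambda>s. s = bit1) a) (Node x y # xs) zs (t + t' + 1)"
  unfolding runs_def
proof (intro conjI allI)
  fix inp r out :: "'a cell list"
  obtain u where u: "u \<le> t" "exec a (work_state inp (trees_code (Node x y # xs) @ r) out) u (work_state inp (trees_code ys @ r) out)"
    using assms(1) unfolding runs_def by blast
  obtain u' where u': "u' \<le> t'" "exec (Loop 6 (\<lambda>s. s = bit1) a) (work_state inp (trees_code ys @ r) out) u' (work_state inp (trees_code zs @ r) out)"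
    using assms(2) unfolding runs_def by blast
  show "\<exists>t''\<le>t + t' + 1. exec (Loop 6 (\<lambda>s. s = bit1) a) (work_state inp (trees_code (Node x y # xs) @ r) out) t''
      (work_state inp (trees_code zs @ r) out)"
    using exec_LoopT[of "\<lambda>s. s = bit1" _ 6, OF _ u(2) u'(2)] u(1) u'(1) by (intro exI[of _ "Suc (u + u')"]) auto
qed (use assms in \<open>auto simp: runs_def\<close>)

lemma runs_Loop_end:
  assumes "com_over work_symbols a"
  shows "runs (Loop 6 (\<lambda>s. s = bit1) a) (Leaf # xs) (Leaf # xs) 1"
  unfolding runs_def
proof (intro conjI allI)
  fix inp r out :: "'a cell list"
  show "\<exists>t\<le>1. exec (Loop 6 (\<lambda>s. s = bit1) a) (work_state inp (trees_code (Leaf # xs) @ r) out) t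
      (work_state inp (trees_code (Leaf # xs) @ r) out)"
    by (intro exI[of _ 1] conjI exec_LoopF) auto
qed (use assms in auto)

lemma runs_while:
  assumes test: "\<And>i. i \<le> m \<Longrightarrow> runs test [s i] [bool_tree (i < m)] t1"
    and body: "\<And>i. i < m \<Longrightarrow> runs body [s i] [s (Suc i)] t2"
    and size: "\<And>i. i \<le> m \<Longrightarrow> tree_size (s i) \<le> S"
    and over: "com_over work_symbols body"
  shows "runs (while_com test body) [s 0] [s m] ((m + 1) * (t1 + t2 + 49 * S + 90))"
proof -
  have over': "com_over work_symbols test" using test[of 0] by (simp add: runs_def)
  let ?B = "drop_com ;; body ;; dup_com ;; test"
  let ?L = "Loop 6 (\<lambda>s. s = bit1) ?B"
  have dt: "runs (dup_com ;; test) [s i] [bool_tree (i < m), s i] (49 * S + t1 + 1)" if "i \<le> m" for i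
    using runs_Seq[OF runs_mono[OF runs_dup] runs_frame[OF test[OF that], of "[s i]", simplified], of "49 * S"] size[OF that]
    by simp
  \<comment> \<open>Induction on the number \<open>i\<close> of rounds still to come, because
    \<open>runs_Loop_step\<close> adds a round in front.\<close>
  have loop: "runs ?L [bool_tree (m - i < m), s (m - i)] [Leaf, s m] (i * (t1 + t2 + 49 * S + 76) + 1)"
    if "i \<le> m" for i
    using that
  proof (induction i)
    case 0
    have "com_over work_symbols (dup_com :: 'a com)" by (simp add: dup_com_def transfer_over)
    then show ?case using runs_Loop_end[of ?B "[s m]"] over over' drop_com_over by (simp add: bool_tree_def)
  next
    case (Suc i)
    have eq: "Suc (m - Suc i) = m - i" using Suc.prems by auto
    have b: "runs body [s (m - Suc i)] [s (m - i)] t2" using body[of "m - Suc i", unfolded eq] Suc.prems by simp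
    \<comment> \<open>72 is 24 times the size 3 of the encoding of \<open>True\<close>.\<close>
    have d: "runs drop_com [Node Leaf Leaf, s (m - Suc i)] [s (m - Suc i)] 72"
      using runs_frame[OF runs_drop[of "Node Leaf Leaf"], of "[s (m - Suc i)]"] by simp
    have "runs ?B [Node Leaf Leaf, s (m - Suc i)] [bool_tree (m - i < m), s (m - i)]
        (72 + (t2 + (49 * S + t1 + 1) + 1) + 1)"
      by (intro runs_Seq[OF d] runs_Seq[OF b] dt) simp
    from runs_Loop_step[OF this Suc.IH]
    have "runs ?L [Node Leaf Leaf, s (m - Suc i)] [Leaf, s m]
        (72 + (t2 + (49 * S + t1 + 1) + 1) + 1 + (i * (t1 + t2 + 49 * S + 76) + 1) + 1)"
      using Suc.prems by simp
    moreover have "bool_tree (m - Suc i < m) = Node Leaf Leaf" using Suc.prems by (simp add: bool_tree_def)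
    ultimately show ?case by (simp add: algebra_simps)
  qed
  have p: "runs (Pop 6) [Leaf, s m] [s m] 1" using runs_frame[OF runs_unleaf, of "[s m]"] by simp
  have "runs (while_com test body) [s 0] [s m]
      ((49 * S + t1 + 1) + ((m * (t1 + t2 + 49 * S + 76) + 1) + 1 + 1) + 1)"
    unfolding while_com_def using runs_Seq[OF dt[OF le0] runs_Seq[OF loop[OF order_refl, simplified] p]] by simp
  then show ?thesis by (rule runs_mono) (simp add: algebra_simps)
qed

section \<open>Functions computable in polynomial time\<close>

text \<open>The commands \<open>com\<close> depend on the type of the input letters. Programs do
  not, so the notion of polynomial time below can quantify over them without fixing a tape
  alphabet.\<close>

datatype prog =
    PDup | PSwap | PDrop | PLeaf | PNode | PPop | PEq
  | PSeq prog prog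
  | PCase prog prog
  | PWhile prog prog

text \<open>Here the time is only an upper bound. The rule for loops takes the whole sequence of
  states together with uniform bounds, in the form in which iterations of functions supply
  them.\<close>

inductive prun :: "prog \<Rightarrow> tree list \<Rightarrow> tree list \<Rightarrow> nat \<Rightarrow> bool" where
  prun_mono: "prun p xs ys t \<Longrightarrow> t \<le> t' \<Longrightarrow> prun p xs ys t'"
| prun_frame: "prun p xs ys t \<Longrightarrow> prun p (xs @ zs) (ys @ zs) t"
| prun_Seq: "prun p xs ys t \<Longrightarrow> prun q ys zs t' \<Longrightarrow> prun (PSeq p q) xs zs (t + t' + 1)"
| prun_Dup: "prun PDup [x] [x, x] (49 * tree_size x)"
| prun_Swap: "prun PSwap [x, y] [y, x] (50 * (tree_size x + tree_size y))"
| prun_Drop: "prun PDrop [x] [] (24 * tree_size x)"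
| prun_Leaf: "prun PLeaf [] [Leaf] 2"
| prun_Node: "prun PNode [x, y] [Node x y] 2"
| prun_PopNode: "prun PPop [Node x y] [x, y] 1"
| prun_PopLeaf: "prun PPop [Leaf] [] 1"
| prun_Eq: "prun PEq [x, y] [bool_tree (x = y)] (70 * (tree_size x + tree_size y))"
| prun_CaseNode: "prun p (Node x y # xs) ys t \<Longrightarrow> prun (PCase p q) (Node x y # xs) ys (t + 1)"
| prun_CaseLeaf: "prun q (Leaf # xs) ys t \<Longrightarrow> prun (PCase p q) (Leaf # xs) ys (t + 1)"
| prun_While: "(\<And>i. i \<le> m \<Longrightarrow> prun p [s i] [bool_tree (i < m)] t1) \<Longrightarrow>
    (\<And>i. i < m \<Longrightarrow> prun q [s i] [s (Suc i)] t2) \<Longrightarrow> (\<And>i. i \<le> m \<Longrightarrow> tree_size (s i) \<le> S) \<Longrightarrow>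
    prun (PWhile p q) [s 0] [s m] ((m + 1) * (t1 + t2 + 49 * S + 90))"

fun prog_com :: "prog \<Rightarrow> 's com" where
  "prog_com PDup = dup_com"
| "prog_com PSwap = swap_com"
| "prog_com PDrop = drop_com"
| "prog_com PLeaf = Push 6 bit0"
| "prog_com PNode = Push 6 bit1"
| "prog_com PPop = Pop 6"
| "prog_com PEq = eq_com"
| "prog_com (PSeq p q) = prog_com p ;; prog_com q"
| "prog_com (PCase p q) = Cond 6 (\<lambda>s. s = bit1) (prog_com p) (prog_com q)"
| "prog_com (PWhile p q) = while_com (prog_com p) (prog_com q)"

lemma prog_com_over: "com_over work_symbols (prog_com p)"
  by (induction p) (auto simp: dup_com_def swap_com_def drop_com_def eq_com_def while_com_def transfer_over)

lemma prog_com_runs: "prun p xs ys t \<Longrightarrow> runs (prog_com p) xs ys t"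
proof (induction rule: prun.induct)
  case (prun_While m p s t1 q t2 S)
  show ?case unfolding prog_com.simps by (rule runs_while) (use prun_While prog_com_over in auto)
qed (auto intro: runs_mono runs_frame runs_Seq runs_dup runs_swap runs_drop runs_leaf runs_node runs_unnode
  runs_unleaf runs_eq runs_Cond_Node[simplified] runs_Cond_Leaf[simplified] simp: prog_com_over)

text \<open>Injectivity makes comparison of encodings the same as comparison of values, and later
  bounds the number of values of a given size.\<close>

class enc =
  fixes enc :: "'a \<Rightarrow> tree"
  assumes enc_inject: "enc x = enc y \<longleftrightarrow> x = y"

definition sz :: "'a :: enc \<Rightarrow> nat" where "sz x = tree_size (enc x)"

instantiation bool :: enc
begin
definition "enc_bool = bool_tree"
instance by standard (auto simp: enc_bool_def bool_tree_def)
end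

instantiation nat :: enc
begin
fun enc_nat :: "nat \<Rightarrow> tree" where
  "enc_nat 0 = Leaf"
| "enc_nat (Suc n) = Node Leaf (enc_nat n)"
instance
proof
  show "enc x = enc y \<longleftrightarrow> x = y" for x y :: nat
  proof (induction x arbitrary: y)
    case 0 then show ?case by (cases y) auto
  next
    case (Suc x) then show ?case by (cases y) auto
  qed
qed
end

instantiation prod :: (enc, enc) enc
begin
definition "enc_prod p = Node (enc (fst p)) (enc (snd p))"
instance by standard (auto simp: enc_prod_def enc_inject)
end

instantiation list :: (enc) enc
begin
fun enc_list :: "'a list \<Rightarrow> tree" where
  "enc_list [] = Leaf"
| "enc_list (x # xs) = Node (enc x) (enc_list xs)"
instance
proof
  show "enc x = enc y \<longleftrightarrow> x = y" for x y :: "'a list"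
  proof (induction x arbitrary: y)
    case Nil then show ?case by (cases y) auto
  next
    case (Cons a x) then show ?case by (cases y) (auto simp: enc_inject)
  qed
qed
end

lemma sz_pos [simp]: "0 < sz x" by (simp add: sz_def)

lemma sz_simps [simp]:
  "sz (a, b) = Suc (sz a + sz b)" "sz ([] :: 'a :: enc list) = 1" "sz (x # xs) = Suc (sz x + sz xs)"
  "sz (0 :: nat) = 1" "sz (Suc n) = sz n + 2"
  by (auto simp: sz_def enc_prod_def)

lemma sz_bool: "sz (b :: bool) \<le> 3"
  by (auto simp: sz_def enc_bool_def bool_tree_def)

lemma sz_nat: "sz (n :: nat) = 2 * n + 1"
  by (induction n) auto

lemma sz_append: "Suc (sz (xs @ ys)) = sz xs + sz ys"
  by (induction xs) auto

lemma sz_member: "x \<in> set xs \<Longrightarrow> sz x < sz xs"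
  by (induction xs) auto

lemma length_less_sz: "length xs < sz xs"
  by (induction xs) auto

lemma sz_fst: "sz (fst p) \<le> sz p" and sz_snd: "sz (snd p) \<le> sz p"
  by (cases p; simp)+

lemma sz_tl: "sz (tl xs) \<le> sz xs"
  by (cases xs) auto

lemma sz_list_bound: "(\<And>x. x \<in> set xs \<Longrightarrow> sz x \<le> b) \<Longrightarrow> sz xs \<le> 1 + length xs * (b + 1)"
  by (induction xs) (auto simp: algebra_simps intro: add_mono le_trans[OF add_mono])

text \<open>Polynomial bounds (\<open>pb\<close>) and polynomial time (\<open>pt\<close>) are measured in \<open>\<mu> x\<close> plus the size of the argument
  \<open>x\<close>. Arguments with \<open>\<mu> x = 0\<close> are outside the domain.\<close>

definition pb :: "('a :: enc \<Rightarrow> nat) \<Rightarrow> ('a \<Rightarrow> nat) \<Rightarrow> bool" where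
  "pb \<mu> g \<longleftrightarrow> (\<exists>k. \<forall>x. 0 < \<mu> x \<longrightarrow> g x \<le> (\<mu> x + sz x) ^ k)"

lemma pb_mono: "pb \<mu> g \<Longrightarrow> (\<And>x. 0 < \<mu> x \<Longrightarrow> f x \<le> g x) \<Longrightarrow> pb \<mu> f"
  unfolding pb_def by (meson le_trans)

text \<open>Since the base is at least 2, a bare power absorbs constant factors and sums, and
  polynomial bounds need no coefficients.\<close>

lemma pb_base: "0 < \<mu> x \<Longrightarrow> 2 \<le> \<mu> x + sz x"
  using sz_pos[of x] by linarith

lemma pb_mu: "pb \<mu> \<mu>" and pb_sz: "pb \<mu> sz"
  unfolding pb_def by (auto intro!: exI[of _ 1])

lemma pb_mult: "pb \<mu> f \<Longrightarrow> pb \<mu> g \<Longrightarrow> pb \<mu> (\<lambda>x. f x * g x)"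
  unfolding pb_def
proof (elim exE)
  fix k l assume "\<forall>x. 0 < \<mu> x \<longrightarrow> f x \<le> (\<mu> x + sz x) ^ k" "\<forall>x. 0 < \<mu> x \<longrightarrow> g x \<le> (\<mu> x + sz x) ^ l"
  then show "\<exists>k. \<forall>x. 0 < \<mu> x \<longrightarrow> f x * g x \<le> (\<mu> x + sz x) ^ k"
    by (intro exI[of _ "k + l"]) (auto simp: power_add intro: mult_mono)
qed

lemma pb_const: "pb \<mu> (\<lambda>_. n)"
  unfolding pb_def
proof (intro exI[of _ n] allI impI)
  fix x :: 'a assume "0 < \<mu> x"
  have "n \<le> 2 ^ n" by (simp add: less_imp_le)
  also have "\<dots> \<le> (\<mu> x + sz x) ^ n" by (intro power_mono pb_base) (auto simp: \<open>0 < \<mu> x\<close>)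
  finally show "n \<le> (\<mu> x + sz x) ^ n" .
qed

lemma pb_add:
  assumes "pb \<mu> f" "pb \<mu> g"
  shows "pb \<mu> (\<lambda>x. f x + g x)"
proof -
  have *: "pb \<mu> (\<lambda>x. h x + 1)" if h: "pb \<mu> h" for h
  proof -
    obtain k where k: "\<And>x. 0 < \<mu> x \<Longrightarrow> h x \<le> (\<mu> x + sz x) ^ k" using h unfolding pb_def by blast
    have "h x + 1 \<le> (\<mu> x + sz x) ^ Suc k" if "0 < \<mu> x" for x
    proof -
      have "1 \<le> (\<mu> x + sz x) ^ k" using pb_base[of \<mu> x, OF that] by (intro one_le_power) simp
      then have "h x + 1 \<le> 2 * (\<mu> x + sz x) ^ k" using k[OF that] by linarith
      also have "\<dots> \<le> (\<mu> x + sz x) * (\<mu> x + sz x) ^ k" by (rule mult_right_mono[OF pb_base[of \<mu> x, OF that]]) simp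
      finally show ?thesis by simp
    qed
    then show ?thesis unfolding pb_def by blast
  qed
  \<comment> \<open>A sum is at most the product of the two successors, which reduces addition to
    multiplication and adding 1.\<close>
  have "pb \<mu> (\<lambda>x. (f x + 1) * (g x + 1))" by (intro pb_mult * assms)
  then show ?thesis by (rule pb_mono) simp
qed

lemma pb_Suc: "pb \<mu> f \<Longrightarrow> pb \<mu> (\<lambda>x. Suc (f x))"
  using pb_add[OF _ pb_const[of \<mu> 1]] by simp

lemma pb_power: "pb \<mu> f \<Longrightarrow> pb \<mu> (\<lambda>x. f x ^ k)"
  by (induction k) (auto intro: pb_mult pb_const)

lemmas pb_intros = pb_mu pb_sz pb_mult pb_const pb_add pb_Suc pb_power

lemma pb_comp:
  assumes "pb \<nu> g" "pb \<mu> (\<lambda>x. \<nu> (f x))" "pb \<mu> (\<lambda>x. sz (f x))" "\<And>x. 0 < \<mu> x \<Longrightarrow> 0 < \<nu> (f x)"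
  shows "pb \<mu> (\<lambda>x. g (f x))"
proof -
  obtain k where k: "\<forall>y. 0 < \<nu> y \<longrightarrow> g y \<le> (\<nu> y + sz y) ^ k" using assms(1) unfolding pb_def by (rule exE)
  have "pb \<mu> (\<lambda>x. (\<nu> (f x) + sz (f x)) ^ k)" by (intro pb_power pb_add assms)
  then show ?thesis by (rule pb_mono) (simp add: k assms(4))
qed

text \<open>The size of the result belongs to the notion because the time of a composition evaluates
  the bound of the outer function at this size.\<close>

definition pt :: "('a :: enc \<Rightarrow> nat) \<Rightarrow> ('a \<Rightarrow> 'b :: enc) \<Rightarrow> bool" where
  "pt \<mu> f \<longleftrightarrow> pb \<mu> (\<lambda>x. sz (f x)) \<and>
     (\<exists>p T. pb \<mu> T \<and> (\<forall>x. 0 < \<mu> x \<longrightarrow> prun p [enc x] [enc (f x)] (T x)))"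

lemma pt_sz: "pt \<mu> f \<Longrightarrow> pb \<mu> (\<lambda>x. sz (f x))"
  by (simp add: pt_def)

lemma pt_cong:
  assumes "pt \<mu> f" "\<And>x. 0 < \<mu> x \<Longrightarrow> f x = g x"
  shows "pt \<mu> g"
proof -
  have "pb \<mu> (\<lambda>x. sz (g x))" by (rule pb_mono[OF pt_sz[OF assms(1)]]) (simp add: assms(2))
  moreover obtain p T where "pb \<mu> T" "\<forall>x. 0 < \<mu> x \<longrightarrow> prun p [enc x] [enc (f x)] (T x)"
    using assms(1) unfolding pt_def by (elim conjE exE)
  ultimately show ?thesis using assms(2) unfolding pt_def by (intro conjI exI[of _ p] exI[of _ T]) simp_all
qed

lemma pt_linear:
  assumes "\<And>x. prun p [enc x] [enc (f x)] (K * sz x + K)" "\<And>x. sz (f x) \<le> K * sz x + K"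
  shows "pt \<mu> f"
proof -
  have *: "pb \<mu> (\<lambda>x. K * sz x + K)" by (intro pb_intros)
  have "pb \<mu> (\<lambda>x. sz (f x))" by (rule pb_mono[OF *]) (rule assms(2))
  then show ?thesis unfolding pt_def using assms(1) * by (intro conjI exI[of _ p] exI[of _ "\<lambda>x. K * sz x + K"]) simp_all
qed

lemma pt_comp:
  assumes "pt \<nu> g" "pt \<mu> f" "pb \<mu> (\<lambda>x. \<nu> (f x))" "\<And>x. 0 < \<mu> x \<Longrightarrow> 0 < \<nu> (f x)"
  shows "pt \<mu> (\<lambda>x. g (f x))"
proof -
  obtain p T where p: "pb \<nu> T" "\<And>x. 0 < \<nu> x \<Longrightarrow> prun p [enc x] [enc (g x)] (T x)"
    using assms(1) unfolding pt_def by blast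
  obtain q U where q: "pb \<mu> U" "\<And>x. 0 < \<mu> x \<Longrightarrow> prun q [enc x] [enc (f x)] (U x)"
    using assms(2) unfolding pt_def by blast
  have "pb \<mu> (\<lambda>x. U x + T (f x) + 1)"
    by (intro pb_intros pb_comp[OF p(1)] assms q(1) pt_sz[OF assms(2)])
  moreover have "prun (PSeq q p) [enc x] [enc (g (f x))] (U x + T (f x) + 1)" if "0 < \<mu> x" for x
    using prun_Seq[OF q(2)[OF that] p(2)[OF assms(4)[OF that]]] .
  moreover have "pb \<mu> (\<lambda>x. sz (g (f x)))"
    by (intro pb_comp[OF pt_sz[OF assms(1)]] assms pt_sz[OF assms(2)])
  ultimately show ?thesis unfolding pt_def by blast
qed

lemma pt_comp1: "pt (\<lambda>_. 1) g \<Longrightarrow> pt \<mu> f \<Longrightarrow> pt \<mu> (\<lambda>x. g (f x))"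
  by (rule pt_comp[of "\<lambda>_. 1" g \<mu> f]) (simp_all add: pb_const)

lemma pt_id: "pt \<mu> (\<lambda>x. x)"
proof (rule pt_linear)
  fix x :: 'a
  show "prun (PSeq PDup PDrop) [enc x] [enc x] (100 * sz x + 100)"
    using prun_Seq[OF prun_Dup[of "enc x"] prun_frame[OF prun_Drop[of "enc x"], of "[enc x]", simplified]]
    by (auto simp: sz_def elim: prun_mono)
qed simp

fun push_tree :: "tree \<Rightarrow> prog" where
  "push_tree Leaf = PLeaf"
| "push_tree (Node a b) = PSeq (push_tree b) (PSeq (push_tree a) PNode)"

lemma prun_push_tree: "prun (push_tree d) [] [d] (5 * tree_size d)"
proof (induction d)
  case Leaf
  show ?case using prun_Leaf by (auto elim: prun_mono)
next
  case (Node a b)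
  have "prun (push_tree a) [b] [a, b] (5 * tree_size a)" using prun_frame[OF Node.IH(1), of "[b]"] by simp
  from prun_Seq[OF Node.IH(2) prun_Seq[OF this prun_Node]]
  show ?case by (auto elim: prun_mono)
qed

lemma prun_const: "prun (PSeq PDrop (push_tree d)) [x] [d] (24 * tree_size x + 5 * tree_size d + 1)"
  using prun_Seq[OF prun_Drop prun_push_tree] .

lemma pt_const: "pt \<mu> (\<lambda>_. c)"
proof (rule pt_linear)
  fix x :: 'a
  show "prun (PSeq PDrop (push_tree (enc c))) [enc x] [enc c] ((24 + 5 * sz c + 1) * sz x + (24 + 5 * sz c + 1))"
    using prun_const[of "enc c" "enc x"] by (rule prun_mono) (simp add: sz_def algebra_simps)
qed simp

text \<open>Pairs, conses, successors and equalities of two values all start from the stack \<open>[f x, g x]\<close>.\<close>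

lemma prun_two:
  assumes "pt \<mu> f" "pt \<mu> g"
  shows "\<exists>p T. pb \<mu> T \<and> (\<forall>x. 0 < \<mu> x \<longrightarrow> prun p [enc x] [enc (f x), enc (g x)] (T x))"
proof -
  obtain p T where p: "pb \<mu> T" "\<And>x. 0 < \<mu> x \<Longrightarrow> prun p [enc x] [enc (f x)] (T x)"
    using assms(1) unfolding pt_def by blast
  obtain q U where q: "pb \<mu> U" "\<And>x. 0 < \<mu> x \<Longrightarrow> prun q [enc x] [enc (g x)] (U x)"
    using assms(2) unfolding pt_def by blast
  let ?T = "\<lambda>x. 49 * sz x + (U x + (50 * (sz (g x) + sz x) + T x + 1) + 1) + 1"
  have "pb \<mu> ?T" by (intro pb_intros p q pt_sz[OF assms(2)])
  moreover have "prun (PSeq PDup (PSeq q (PSeq PSwap p))) [enc x] [enc (f x), enc (g x)] (?T x)" if "0 < \<mu> x" for x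
    using prun_Seq[OF prun_Dup[of "enc x"] prun_Seq[OF prun_frame[OF q(2)[OF that], of "[enc x]", simplified]
      prun_Seq[OF prun_Swap prun_frame[OF p(2)[OF that], of "[enc (g x)]", simplified]]]]
    by (simp add: sz_def)
  ultimately show ?thesis by blast
qed

lemma pt_node:
  assumes "pt \<mu> f" "pt \<mu> g" "\<And>x. enc (h x) = Node (enc (f x)) (enc (g x))"
  shows "pt \<mu> h"
proof -
  obtain p T where p: "pb \<mu> T" "\<And>x. 0 < \<mu> x \<Longrightarrow> prun p [enc x] [enc (f x), enc (g x)] (T x)"
    using prun_two[OF assms(1,2)] by blast
  have "pb \<mu> (\<lambda>x. T x + 2 + 1)" by (intro pb_intros p)
  moreover have "prun (PSeq p PNode) [enc x] [enc (h x)] (T x + 2 + 1)" if "0 < \<mu> x" for x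
    unfolding assms(3) by (rule prun_Seq[OF p(2)[OF that] prun_Node])
  moreover have "sz (h x) = Suc (sz (f x) + sz (g x))" for x by (simp add: sz_def assms(3))
  then have "pb \<mu> (\<lambda>x. sz (h x))" by (simp only:) (intro pb_intros pt_sz assms)
  ultimately show ?thesis unfolding pt_def by blast
qed

lemma pt_pair: "pt \<mu> f \<Longrightarrow> pt \<mu> g \<Longrightarrow> pt \<mu> (\<lambda>x. (f x, g x))"
  by (rule pt_node) (auto simp: enc_prod_def)

lemma pt_Cons: "pt \<mu> f \<Longrightarrow> pt \<mu> g \<Longrightarrow> pt \<mu> (\<lambda>x. f x # g x)"
  by (rule pt_node) auto

lemma pt_Suc: "pt \<mu> f \<Longrightarrow> pt \<mu> (\<lambda>x. Suc (f x))"
  by (rule pt_node[OF pt_const[of _ "0 :: nat"]]) auto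

lemma pt_eq:
  assumes "pt \<mu> f" "pt \<mu> g"
  shows "pt \<mu> (\<lambda>x. f x = g x)"
proof -
  obtain p T where p: "pb \<mu> T" "\<And>x. 0 < \<mu> x \<Longrightarrow> prun p [enc x] [enc (f x), enc (g x)] (T x)"
    using prun_two[OF assms(1,2)] by blast
  have "pb \<mu> (\<lambda>x. T x + 70 * (sz (f x) + sz (g x)) + 1)" by (intro pb_intros p pt_sz assms)
  moreover have "prun (PSeq p PEq) [enc x] [enc (f x = g x)] (T x + 70 * (sz (f x) + sz (g x)) + 1)" if "0 < \<mu> x" for x
    using prun_Seq[OF p(2)[OF that] prun_Eq] by (simp add: sz_def enc_bool_def enc_inject)
  moreover have "pb \<mu> (\<lambda>x. sz (f x = g x))" by (rule pb_mono[OF pb_const[of _ 3]]) (rule sz_bool)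
  ultimately show ?thesis unfolding pt_def by blast
qed

lemma pt_fst_base: "pt (\<lambda>_. 1) fst"
proof (rule pt_linear)
  fix x :: "'a \<times> 'b"
  obtain a b where x: "x = (a, b)" by fastforce
  show "prun (PSeq PPop (PSeq PSwap PDrop)) [enc x] [enc (fst x)] (100 * sz x + 100)"
    using prun_Seq[OF prun_PopNode[of "enc a" "enc b"] prun_Seq[OF prun_Swap prun_frame[OF prun_Drop, of _ "[enc a]", simplified]]]
    by (auto simp: sz_def x enc_prod_def elim: prun_mono)
  show "sz (fst x) \<le> 100 * sz x + 100" by (simp add: x)
qed

lemma pt_snd_base: "pt (\<lambda>_. 1) snd"
proof (rule pt_linear)
  fix x :: "'a \<times> 'b"
  obtain a b where x: "x = (a, b)" by fastforce
  show "prun (PSeq PPop PDrop) [enc x] [enc (snd x)] (100 * sz x + 100)"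
    using prun_Seq[OF prun_PopNode[of "enc a" "enc b"] prun_frame[OF prun_Drop, of _ "[enc b]", simplified]]
    by (auto simp: sz_def x enc_prod_def elim: prun_mono)
  show "sz (snd x) \<le> 100 * sz x + 100" by (simp add: x)
qed

lemmas pt_fst = pt_comp1[OF pt_fst_base]
lemmas pt_snd = pt_comp1[OF pt_snd_base]

lemma pt_hd_base: "pt (\<lambda>_. 1) (hd :: 'a :: enc list \<Rightarrow> 'a)"
proof (rule pt_linear)
  fix x :: "'a list"
  \<comment> \<open>The head of the empty list is an unspecified but fixed value, so its tree can be
    built into the program.\<close>
  let ?e = "hd [] :: 'a"
  let ?p = "PCase (PSeq PPop (PSeq PSwap PDrop)) (PSeq PDrop (push_tree (enc ?e)))"
  let ?K = "100 + 5 * sz ?e"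
  show "prun ?p [enc x] [enc (hd x)] (?K * sz x + ?K)"
  proof (cases x)
    case Nil
    have "prun ?p [Leaf] [enc ?e] (24 * tree_size Leaf + 5 * sz ?e + 1 + 1)"
      unfolding sz_def by (intro prun_CaseLeaf prun_const)
    then show ?thesis using Nil by (auto simp: sz_def elim!: prun_mono)
  next
    case (Cons a l)
    have "prun ?p [Node (enc a) (enc l)] [enc a] (1 + (50 * (tree_size (enc a) + tree_size (enc l)) + 24 * tree_size (enc l) + 1) + 1 + 1)"
      by (intro prun_CaseNode prun_Seq[OF prun_PopNode] prun_Seq[OF prun_Swap] prun_frame[OF prun_Drop, of _ "[enc a]", simplified])
    then show ?thesis using Cons by (auto simp: sz_def algebra_simps elim!: prun_mono)
  qed
  show "sz (hd x) \<le> ?K * sz x + ?K"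
  proof (cases x)
    case (Cons a l)
    have "1 * sz x \<le> ?K * sz x" by (intro mult_right_mono) auto
    then show ?thesis using Cons by simp
  qed simp
qed

lemma pt_tl_base: "pt (\<lambda>_. 1) (tl :: 'a :: enc list \<Rightarrow> 'a list)"
proof (rule pt_linear)
  fix x :: "'a list"
  let ?p = "PCase (PSeq PPop PDrop) (PSeq PPop PLeaf)"
  show "prun ?p [enc x] [enc (tl x)] (100 * sz x + 100)"
  proof (cases x)
    case Nil
    have "prun ?p [Leaf] [Leaf] (1 + 2 + 1 + 1)"
      by (intro prun_CaseLeaf prun_Seq[OF prun_PopLeaf] prun_Leaf)
    then show ?thesis using Nil by (auto simp: sz_def elim!: prun_mono)
  next
    case (Cons a l)
    have "prun ?p [Node (enc a) (enc l)] [enc l] (1 + 24 * tree_size (enc a) + 1 + 1)"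
      by (intro prun_CaseNode prun_Seq[OF prun_PopNode] prun_frame[OF prun_Drop, of _ "[enc l]", simplified])
    then show ?thesis using Cons by (auto simp: sz_def algebra_simps elim!: prun_mono)
  qed
  show "sz (tl x) \<le> 100 * sz x + 100" using sz_tl[of x] by simp
qed

lemmas pt_hd = pt_comp1[OF pt_hd_base]
lemmas pt_tl = pt_comp1[OF pt_tl_base]

lemma pt_if:
  assumes "pt \<mu> b" "pt \<mu> f" "pt \<mu> g"
  shows "pt \<mu> (\<lambda>x. if b x then f x else g x)"
proof -
  obtain r R where r: "pb \<mu> R" "\<And>x. 0 < \<mu> x \<Longrightarrow> prun r [enc x] [enc (b x)] (R x)"
    using assms(1) unfolding pt_def by blast
  obtain p T where p: "pb \<mu> T" "\<And>x. 0 < \<mu> x \<Longrightarrow> prun p [enc x] [enc (f x)] (T x)"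
    using assms(2) unfolding pt_def by blast
  obtain q U where q: "pb \<mu> U" "\<And>x. 0 < \<mu> x \<Longrightarrow> prun q [enc x] [enc (g x)] (U x)"
    using assms(3) unfolding pt_def by blast
  let ?p = "PSeq PDup (PSeq r (PCase (PSeq PDrop p) (PSeq PDrop q)))"
  let ?T = "\<lambda>x. 49 * sz x + (R x + (72 + (T x + U x) + 1 + 1) + 1) + 1"
  have "pb \<mu> ?T" by (intro pb_intros p q r)
  moreover have "prun ?p [enc x] [enc (if b x then f x else g x)] (?T x)" if x: "0 < \<mu> x" for x
    unfolding sz_def
  proof (intro prun_Seq[OF prun_Dup] prun_Seq[OF prun_frame[OF r(2)[OF x], of "[enc x]", simplified]])
    show "prun (PCase (PSeq PDrop p) (PSeq PDrop q)) [enc (b x), enc x] [enc (if b x then f x else g x)]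
        (72 + (T x + U x) + 1 + 1)"
    proof (cases "b x")
      case True
      have "prun (PCase (PSeq PDrop p) (PSeq PDrop q)) [Node Leaf Leaf, enc x] [enc (f x)] (24 * tree_size (Node Leaf Leaf) + T x + 1 + 1)"
        by (intro prun_CaseNode prun_Seq[OF prun_frame[OF prun_Drop, of _ "[enc x]", simplified]] p x)
      then show ?thesis using True by (auto simp: enc_bool_def bool_tree_def elim!: prun_mono)
    next
      case False
      have "prun (PCase (PSeq PDrop p) (PSeq PDrop q)) [Leaf, enc x] [enc (g x)] (24 * tree_size Leaf + U x + 1 + 1)"
        by (intro prun_CaseLeaf prun_Seq[OF prun_frame[OF prun_Drop, of _ "[enc x]", simplified]] q x)
      then show ?thesis using False by (auto simp: enc_bool_def bool_tree_def elim!: prun_mono)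
    qed
  qed
  moreover have "pb \<mu> (\<lambda>x. sz (f x) + sz (g x))" by (intro pb_intros pt_sz assms)
  then have "pb \<mu> (\<lambda>x. sz (if b x then f x else g x))" by (rule pb_mono) simp
  ultimately show ?thesis unfolding pt_def by blast
qed

lemma pt_not: "pt \<mu> b \<Longrightarrow> pt \<mu> (\<lambda>x. \<not> b x)"
  by (rule pt_cong[OF pt_if[OF _ pt_const[of _ False] pt_const[of _ True]]]) auto

lemma pt_conj:
  assumes "pt \<mu> a" "pt \<mu> b"
  shows "pt \<mu> (\<lambda>x. a x \<and> b x)"
  by (rule pt_cong[OF pt_if[OF assms pt_const[of _ False]]]) auto

lemma pt_disj:
  assumes "pt \<mu> a" "pt \<mu> b"
  shows "pt \<mu> (\<lambda>x. a x \<or> b x)"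
  by (rule pt_cong[OF pt_if[OF assms(1) pt_const[of _ True] assms(2)]]) auto

text \<open>Iteration as a total function, with no meaning if the test never fails. Every use
  exhibits a number of rounds after which the test fails for the first time.\<close>

definition whl :: "('a \<Rightarrow> bool) \<Rightarrow> ('a \<Rightarrow> 'a) \<Rightarrow> 'a \<Rightarrow> 'a" where
  "whl t b x = (b ^^ (LEAST i. \<not> t ((b ^^ i) x))) x"

lemma whl_eq:
  assumes "\<And>i. i < m \<Longrightarrow> t ((b ^^ i) x)" "\<not> t ((b ^^ m) x)"
  shows "whl t b x = (b ^^ m) x"
proof -
  have "(LEAST i. \<not> t ((b ^^ i) x)) = m" using assms by (intro Least_equality) (auto simp: not_less[symmetric])
  then show ?thesis by (simp add: whl_def)
qed

text \<open>Few rounds alone are not enough, since a polynomial body may square its argument each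
  time; \<open>N\<close> therefore also bounds all intermediate states and their measures. The test
  must be polynomial without a domain restriction, because it is also run on the last state, on
  which the body need not be defined.\<close>

lemma pt_whl:
  assumes t: "pt (\<lambda>_. 1) t" and b: "pt \<nu> b" and N: "pb \<mu> N"
    and run: "\<And>x. 0 < \<mu> x \<Longrightarrow> \<exists>m\<le>N x. \<not> t ((b ^^ m) x) \<and> (\<forall>i\<le>m. sz ((b ^^ i) x) \<le> N x) \<and>
      (\<forall>i<m. t ((b ^^ i) x) \<and> 0 < \<nu> ((b ^^ i) x) \<and> \<nu> ((b ^^ i) x) \<le> N x)"
  shows "pt \<mu> (whl t b)"
proof -
  obtain p T where p: "pb (\<lambda>_. 1) T" "\<And>x. prun p [enc x] [enc (t x)] (T x)"
    using t unfolding pt_def by auto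
  obtain q U where q: "pb \<nu> U" "\<And>x. 0 < \<nu> x \<Longrightarrow> prun q [enc x] [enc (b x)] (U x)"
    using b unfolding pt_def by blast
  obtain k where k: "\<And>x. T x \<le> (1 + sz x) ^ k" using p(1) unfolding pb_def by auto
  obtain l where l: "\<And>x. 0 < \<nu> x \<Longrightarrow> U x \<le> (\<nu> x + sz x) ^ l" using q(1) unfolding pb_def by auto
  let ?T = "\<lambda>x. (N x + 1) * ((1 + N x) ^ k + (N x + N x) ^ l + 49 * N x + 90)"
  have *: "prun (PWhile p q) [enc x] [enc (whl t b x)] (?T x) \<and> sz (whl t b x) \<le> N x" if x: "0 < \<mu> x" for x
  proof -
    obtain m where m: "m \<le> N x" "\<not> t ((b ^^ m) x)" "\<And>i. i \<le> m \<Longrightarrow> sz ((b ^^ i) x) \<le> N x"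
      "\<And>i. i < m \<Longrightarrow> t ((b ^^ i) x)" "\<And>i. i < m \<Longrightarrow> 0 < \<nu> ((b ^^ i) x)" "\<And>i. i < m \<Longrightarrow> \<nu> ((b ^^ i) x) \<le> N x"
      using run[OF x] by blast
    have e: "whl t b x = (b ^^ m) x" by (rule whl_eq) (use m in auto)
    let ?s = "\<lambda>i. enc ((b ^^ i) x)"
    have "prun (PWhile p q) [?s 0] [?s m] ((m + 1) * ((1 + N x) ^ k + (N x + N x) ^ l + 49 * N x + 90))"
    proof (rule prun_While)
      fix i assume i: "i \<le> m"
      have "t ((b ^^ i) x) = (i < m)" using i m(2,4) by (cases "i = m") auto
      then have "prun p [?s i] [bool_tree (i < m)] (T ((b ^^ i) x))" using p(2)[of "(b ^^ i) x"] by (simp add: enc_bool_def)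
      moreover have "T ((b ^^ i) x) \<le> (1 + N x) ^ k"
        using k[of "(b ^^ i) x"] power_mono[of "1 + sz ((b ^^ i) x)" "1 + N x" k] m(3)[OF i] by auto
      ultimately show "prun p [?s i] [bool_tree (i < m)] ((1 + N x) ^ k)" by (rule prun_mono)
      show "tree_size (?s i) \<le> N x" using m(3)[OF i] by (simp add: sz_def)
    next
      fix i assume i: "i < m"
      have "U ((b ^^ i) x) \<le> (N x + N x) ^ l"
        using l[of "(b ^^ i) x"] m(5,6)[OF i] m(3)[of i] i
          power_mono[of "\<nu> ((b ^^ i) x) + sz ((b ^^ i) x)" "N x + N x" l] by fastforce
      then show "prun q [?s i] [?s (Suc i)] ((N x + N x) ^ l)"
        using q(2)[OF m(5)[OF i]] by (auto elim: prun_mono)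
    qed
    then have "prun (PWhile p q) [enc x] [enc (whl t b x)] (?T x)"
      unfolding e using m(1) by (auto elim!: prun_mono intro!: mult_right_mono)
    then show ?thesis using m(3) e by auto
  qed
  have "pb \<mu> ?T" by (intro pb_intros N)
  moreover have "pb \<mu> (\<lambda>x. sz (whl t b x))" by (rule pb_mono[OF N]) (simp add: *)
  ultimately show ?thesis unfolding pt_def using * by (intro conjI exI[of _ "PWhile p q"] exI[of _ ?T]) simp_all
qed

section \<open>Folds and list functions in polynomial time\<close>

lemma foldl_whl:
  "snd (snd (whl (\<lambda>z. fst (snd z) \<noteq> []) (\<lambda>z. (fst z, tl (fst (snd z)), g (fst z) (hd (fst (snd z))) (snd (snd z)))) (c, xs, a)))
    = foldl (\<lambda>a x. g c x a) a xs" (is "?lhs = _")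
  and foldl_funpow: "i \<le> length xs \<Longrightarrow>
    ((\<lambda>z. (fst z, tl (fst (snd z)), g (fst z) (hd (fst (snd z))) (snd (snd z)))) ^^ i) (c, xs, a) =
    (c, drop i xs, foldl (\<lambda>a x. g c x a) a (take i xs))"
proof -
  let ?B = "\<lambda>z. (fst z, tl (fst (snd z)), g (fst z) (hd (fst (snd z))) (snd (snd z)))"
  show *: "(?B ^^ i) (c, xs, a) = (c, drop i xs, foldl (\<lambda>a x. g c x a) a (take i xs))" if "i \<le> length xs" for i
    using that
  proof (induction i)
    case (Suc i)
    then have "take (Suc i) xs = take i xs @ [hd (drop i xs)]" by (simp add: take_Suc_conv_app_nth hd_drop_conv_nth)
    then show ?case using Suc by (simp add: tl_drop drop_Suc)
  qed simp
  have "whl (\<lambda>z. fst (snd z) \<noteq> []) ?B (c, xs, a) = (?B ^^ length xs) (c, xs, a)"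
    by (rule whl_eq) (auto simp: *)
  then show "?lhs = foldl (\<lambda>a x. g c x a) a xs" by (simp add: *)
qed

lemma sz_drop: "sz (drop i xs) \<le> sz xs"
  by (induction xs arbitrary: i) (auto simp: drop_Cons' le_SucI trans_le_add2)

lemma pt_foldl:
  assumes g: "pt \<nu> (\<lambda>z. g (fst z) (fst (snd z)) (snd (snd z)))" and xs: "pt \<mu> xs" and a0: "pt \<mu> a0"
    and N: "pb \<mu> N"
    and sz: "\<And>c i. 0 < \<mu> c \<Longrightarrow> i \<le> length (xs c) \<Longrightarrow> sz (foldl (\<lambda>a x. g c x a) (a0 c) (take i (xs c))) \<le> N c"
    and dom: "\<And>c i. 0 < \<mu> c \<Longrightarrow> i < length (xs c) \<Longrightarrow>
      0 < \<nu> (c, xs c ! i, foldl (\<lambda>a x. g c x a) (a0 c) (take i (xs c))) \<and>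
      \<nu> (c, xs c ! i, foldl (\<lambda>a x. g c x a) (a0 c) (take i (xs c))) \<le> N c"
  shows "pt \<mu> (\<lambda>c. foldl (\<lambda>a x. g c x a) (a0 c) (xs c))"
proof -
  let ?B = "\<lambda>z. (fst z, tl (fst (snd z)), g (fst z) (hd (fst (snd z))) (snd (snd z)))"
  let ?t = "\<lambda>z. fst (snd z) \<noteq> []"
  \<comment> \<open>The body is only run on nonempty lists, so the empty ones are put outside its
    domain.\<close>
  let ?\<nu> = "\<lambda>z. if fst (snd z) = [] then 0 else \<nu> (fst z, hd (fst (snd z)), snd (snd z))"
  \<comment> \<open>The size bounds hold only along runs from a proper start; this measure vanishes
    at every other triple.\<close>
  let ?\<mu> = "\<lambda>z. if \<exists>c. 0 < \<mu> c \<and> z = (c, xs c, a0 c) then \<mu> (fst z) else 0"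
  have "pt ?\<nu> (\<lambda>z. (fst z, hd (fst (snd z)), snd (snd z)))"
    by (intro pt_pair pt_fst pt_snd pt_hd pt_id)
  moreover have "pb ?\<nu> (\<lambda>z. \<nu> (fst z, hd (fst (snd z)), snd (snd z)))"
    by (rule pb_mono[OF pb_mu]) (auto split: if_splits)
  ultimately have "pt ?\<nu> (\<lambda>z. g (fst z) (hd (fst (snd z))) (snd (snd z)))"
    using pt_comp[OF g, of ?\<nu> "\<lambda>z. (fst z, hd (fst (snd z)), snd (snd z))"] by (auto split: if_splits)
  then have B: "pt ?\<nu> ?B" by (intro pt_pair pt_fst pt_snd pt_tl pt_id)
  have t: "pt (\<lambda>_. 1) ?t" by (intro pt_not pt_eq pt_fst pt_snd pt_id pt_const)
  have pair: "pt \<mu> (\<lambda>c. (c, xs c, a0 c))" by (intro pt_pair pt_id xs a0)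
  let ?N = "\<lambda>z. sz z + N (fst z)"
  have N': "pb ?\<mu> ?N"
  proof -
    obtain k where k: "\<And>c. 0 < \<mu> c \<Longrightarrow> N c \<le> (\<mu> c + sz c) ^ k" using N unfolding pb_def by blast
    have "pb ?\<mu> (\<lambda>z. N (fst z))" unfolding pb_def
    proof (intro exI[of _ k] allI impI)
      fix z :: "'a \<times> 'b list \<times> 'c" assume "0 < ?\<mu> z"
      then obtain c where c: "0 < \<mu> c" "z = (c, xs c, a0 c)" by (auto split: if_splits)
      have "N c \<le> (\<mu> c + sz c) ^ k" using k c by blast
      also have "\<dots> \<le> (?\<mu> z + sz z) ^ k" using c by (intro power_mono) auto
      finally show "N (fst z) \<le> (?\<mu> z + sz z) ^ k" using c by simp
    qed
    then show ?thesis by (intro pb_intros)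
  qed
  have "pt ?\<mu> (whl ?t ?B)"
  proof (rule pt_whl[OF t B N'])
    fix z :: "'a \<times> 'b list \<times> 'c" assume "0 < ?\<mu> z"
    then obtain c where c: "0 < \<mu> c" "z = (c, xs c, a0 c)" by (auto split: if_splits)
    have f: "i \<le> length (xs c) \<Longrightarrow> (?B ^^ i) z = (c, drop i (xs c), foldl (\<lambda>a x. g c x a) (a0 c) (take i (xs c)))" for i
      unfolding c(2) by (rule foldl_funpow)
    show "\<exists>m\<le>?N z. \<not> ?t ((?B ^^ m) z) \<and> (\<forall>i\<le>m. sz ((?B ^^ i) z) \<le> ?N z) \<and>
      (\<forall>i<m. ?t ((?B ^^ i) z) \<and> 0 < ?\<nu> ((?B ^^ i) z) \<and> ?\<nu> ((?B ^^ i) z) \<le> ?N z)"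
    proof (intro exI[of _ "length (xs c)"] conjI allI impI)
      show "length (xs c) \<le> ?N z" using length_less_sz[of "xs c"] c by simp
      fix i assume i: "i \<le> length (xs c)"
      show "sz ((?B ^^ i) z) \<le> ?N z"
        using f[OF i] sz[OF c(1) i] sz_drop[of i "xs c"] c(2) by simp
    next
      fix i assume i: "i < length (xs c)"
      show "?t ((?B ^^ i) z)" "0 < ?\<nu> ((?B ^^ i) z)" "?\<nu> ((?B ^^ i) z) \<le> ?N z"
        using f[of i] i dom[OF c(1) i] c(2) by (auto simp: hd_drop_conv_nth)
    qed (simp add: f)
  qed
  then have "pt \<mu> (\<lambda>c. whl ?t ?B (c, xs c, a0 c))"
    by (rule pt_comp[OF _ pair]) (auto intro: pb_mono[OF pb_mu])
  from pt_snd[OF pt_snd[OF this]] show ?thesis unfolding foldl_whl .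
qed

lemma pt_foldl_context:
  assumes "pt (\<lambda>z. \<mu> (fst z)) (\<lambda>z. g (fst z) (fst (snd z)) (snd (snd z)))" "pt \<mu> xs" "pt \<mu> a0" "pb \<mu> N"
    "\<And>c i. 0 < \<mu> c \<Longrightarrow> i \<le> length (xs c) \<Longrightarrow> sz (foldl (\<lambda>a x. g c x a) (a0 c) (take i (xs c))) \<le> N c"
  shows "pt \<mu> (\<lambda>c. foldl (\<lambda>a x. g c x a) (a0 c) (xs c))"
proof (rule pt_foldl[OF assms(1-3)])
  show "pb \<mu> (\<lambda>c. N c + \<mu> c)" by (intro pb_add pb_mu assms(4))
  show "sz (foldl (\<lambda>a x. g c x a) (a0 c) (take i (xs c))) \<le> N c + \<mu> c" if "0 < \<mu> c" "i \<le> length (xs c)" for c i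
    using assms(5)[OF that] by simp
qed simp

text \<open>A member is smaller than its list, so a bound that depends on the member becomes one
  that depends on the context only.\<close>

lemma pb_context:
  assumes "pb (\<lambda>z. \<mu> (fst z)) h" "pt \<mu> xs"
  shows "\<exists>H. pb \<mu> H \<and> (\<forall>c x. 0 < \<mu> c \<longrightarrow> x \<in> set (xs c) \<longrightarrow> h (c, x) \<le> H c)"
proof -
  obtain k where k: "\<forall>z. 0 < \<mu> (fst z) \<longrightarrow> h z \<le> (\<mu> (fst z) + sz z) ^ k"
    using assms(1) unfolding pb_def by (rule exE)
  have "pb \<mu> (\<lambda>c. (\<mu> c + Suc (sz c + sz (xs c))) ^ k)"
    by (intro pb_power pb_add pb_mu pb_Suc pb_sz pt_sz[OF assms(2)])
  moreover have "h (c, x) \<le> (\<mu> c + Suc (sz c + sz (xs c))) ^ k" if "0 < \<mu> c" "x \<in> set (xs c)" for c x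
  proof -
    have "h (c, x) \<le> (\<mu> c + Suc (sz c + sz x)) ^ k" using spec[OF k, of "(c, x)"] that by simp
    also have "\<dots> \<le> (\<mu> c + Suc (sz c + sz (xs c))) ^ k" using sz_member[OF that(2)] by (intro power_mono) auto
    finally show ?thesis .
  qed
  ultimately show ?thesis by blast
qed

text \<open>The usual situation: one step enlarges the accumulator by an amount independent of the
  accumulator. The growth of the whole fold is then at most the length of the list times a uniform
  bound, and no estimate along the run has to be supplied.\<close>

lemma pt_foldl_add:
  assumes g: "pt (\<lambda>z. \<mu> (fst z)) (\<lambda>z. g (fst z) (fst (snd z)) (snd (snd z)))" and xs: "pt \<mu> xs" and a0: "pt \<mu> a0"
    and h: "pb (\<lambda>z. \<mu> (fst z)) h" and add: "\<And>c x a. 0 < \<mu> c \<Longrightarrow> sz (g c x a) \<le> sz a + h (c, x)"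
  shows "pt \<mu> (\<lambda>c. foldl (\<lambda>a x. g c x a) (a0 c) (xs c))"
proof -
  obtain H where H: "pb \<mu> H" "\<And>c x. 0 < \<mu> c \<Longrightarrow> x \<in> set (xs c) \<Longrightarrow> h (c, x) \<le> H c"
    using pb_context[OF h xs] by blast
  have bnd: "sz (foldl (\<lambda>a x. g c x a) a ys) \<le> sz a + length ys * H c" if "0 < \<mu> c" "set ys \<subseteq> set (xs c)" for c a ys
    using that(2)
  proof (induction ys arbitrary: a)
    case (Cons x ys)
    have "sz (foldl (\<lambda>a x. g c x a) a (x # ys)) \<le> sz (g c x a) + length ys * H c" using Cons by simp
    also have "\<dots> \<le> sz a + H c + length ys * H c" using add[OF that(1), of x a] H(2)[OF that(1), of x] Cons.prems by simp
    finally show ?case by simp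
  qed simp
  show ?thesis
  proof (rule pt_foldl_context[OF g xs a0])
    show "pb \<mu> (\<lambda>c. sz (a0 c) + sz (xs c) * H c)" by (intro pb_intros pt_sz xs a0 H)
    fix c i assume c: "0 < \<mu> c"
    have "sz (foldl (\<lambda>a x. g c x a) (a0 c) (take i (xs c))) \<le> sz (a0 c) + length (take i (xs c)) * H c"
      by (rule bnd[OF c]) (simp add: set_take_subset)
    also have "\<dots> \<le> sz (a0 c) + sz (xs c) * H c"
      using length_less_sz[of "xs c"] by (intro add_left_mono mult_right_mono) auto
    finally show "sz (foldl (\<lambda>a x. g c x a) (a0 c) (take i (xs c))) \<le> sz (a0 c) + sz (xs c) * H c" .
  qed
qed

lemma pt_rev: "pt \<mu> xs \<Longrightarrow> pt \<mu> (\<lambda>c. rev (xs c))"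
proof -
  assume xs: "pt \<mu> xs"
  have "pt \<mu> (\<lambda>c. foldl (\<lambda>a x. x # a) [] (xs c))"
    by (rule pt_foldl_add[where h = "\<lambda>z. Suc (sz z)"]) (intro pt_Cons pt_fst pt_snd pt_id xs pt_const pb_intros | simp)+
  moreover have "foldl (\<lambda>a x. x # a) [] ys = rev ys" for ys :: "'b list" by (simp add: rev_conv_fold foldl_conv_fold)
  ultimately show ?thesis by simp
qed

lemma pt_foldr_add:
  assumes "pt (\<lambda>z. \<mu> (fst z)) (\<lambda>z. g (fst z) (fst (snd z)) (snd (snd z)))" "pt \<mu> xs" "pt \<mu> a0"
    "pb (\<lambda>z. \<mu> (fst z)) h" "\<And>c x a. 0 < \<mu> c \<Longrightarrow> sz (g c x a) \<le> sz a + h (c, x)"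
  shows "pt \<mu> (\<lambda>c. foldr (g c) (xs c) (a0 c))"
  using pt_foldl_add[OF assms(1) pt_rev[OF assms(2)] assms(3-5)] by (simp add: foldr_conv_foldl)

text \<open>The context of a pointwise function is the first component of its argument.\<close>

lemma pt_context: "pt \<mu> f \<Longrightarrow> pt (\<lambda>z. \<mu> (fst z)) (\<lambda>z. f (fst z))"
  by (rule pt_comp[OF _ pt_fst[OF pt_id]]) (auto intro: pb_mu)

lemma pt_pairwise:
  assumes "pt (\<lambda>z. \<mu> (fst z)) (\<lambda>z. f (fst z) (snd z))"
  shows "pt (\<lambda>z. \<mu> (fst z)) (\<lambda>z. f (fst z) (fst (snd z)))"
proof -
  have "pt (\<lambda>z :: 'a \<times> 'b \<times> 'd. \<mu> (fst z)) (\<lambda>z. (fst z, fst (snd z)))" by (intro pt_pair pt_fst pt_snd pt_id)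
  from pt_comp[OF assms this] show ?thesis by (simp add: pb_mu)
qed

lemma foldr_Cons_map: "foldr (\<lambda>x a. f x # a) xs [] = map f xs"
  by (induction xs) auto

lemma pt_map:
  assumes "pt (\<lambda>z. \<mu> (fst z)) (\<lambda>z. f (fst z) (snd z))" "pt \<mu> xs"
  shows "pt \<mu> (\<lambda>c. map (f c) (xs c))"
proof -
  have "pt \<mu> (\<lambda>c. foldr (\<lambda>x a. f c x # a) (xs c) [])"
    by (rule pt_foldr_add[OF _ assms(2) pt_const, where h = "\<lambda>z. Suc (sz (f (fst z) (snd z)))"])
      (intro pt_Cons pt_pairwise[OF assms(1)] pt_snd pt_id pb_intros pt_sz[OF assms(1)] | simp)+
  then show ?thesis by (simp add: foldr_Cons_map)
qed

lemma pt_filter: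
  assumes "pt (\<lambda>z. \<mu> (fst z)) (\<lambda>z. P (fst z) (snd z))" "pt \<mu> xs"
  shows "pt \<mu> (\<lambda>c. filter (P c) (xs c))"
proof -
  have "pt \<mu> (\<lambda>c. foldr (\<lambda>x a. if P c x then x # a else a) (xs c) [])"
    by (rule pt_foldr_add[OF _ assms(2) pt_const, where h = "\<lambda>z. Suc (sz z)"])
      (intro pt_if pt_Cons pt_pairwise[OF assms(1)] pt_fst pt_snd pt_id pb_intros | simp)+
  moreover have "foldr (\<lambda>x a. if Q x then x # a else a) ys [] = filter Q ys" for Q and ys :: "'b list"
    by (induction ys) auto
  ultimately show ?thesis by simp
qed

lemma pt_list_ex:
  assumes "pt (\<lambda>z. \<mu> (fst z)) (\<lambda>z. P (fst z) (snd z))" "pt \<mu> xs"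
  shows "pt \<mu> (\<lambda>c. list_ex (P c) (xs c))"
proof -
  have "pt \<mu> (\<lambda>c. foldr (\<lambda>x a. P c x \<or> a) (xs c) False)"
    by (rule pt_foldr_add[OF _ assms(2) pt_const, where h = "\<lambda>_. 3"])
      (intro pt_disj pt_pairwise[OF assms(1)] pt_snd pt_id pb_intros trans_le_add2[OF sz_bool])+
  moreover have "foldr (\<lambda>x a. Q x \<or> a) ys False = list_ex Q ys" for Q and ys :: "'b list"
    by (induction ys) auto
  ultimately show ?thesis by simp
qed

lemma pt_list_all:
  assumes "pt (\<lambda>z. \<mu> (fst z)) (\<lambda>z. P (fst z) (snd z))" "pt \<mu> xs"
  shows "pt \<mu> (\<lambda>c. list_all (P c) (xs c))"
proof -
  have "pt \<mu> (\<lambda>c. \<not> list_ex (\<lambda>x. \<not> P c x) (xs c))"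
    by (intro pt_not pt_list_ex assms)
  then show ?thesis by (simp add: list_ex_iff list_all_iff)
qed

lemma pt_member: "pt \<mu> f \<Longrightarrow> pt \<mu> xs \<Longrightarrow> pt \<mu> (\<lambda>c. f c \<in> set (xs c))"
proof -
  assume f: "pt \<mu> f" and xs: "pt \<mu> xs"
  have "pt \<mu> (\<lambda>c. list_ex (\<lambda>x. f c = x) (xs c))"
    by (intro pt_list_ex pt_eq pt_context[OF f] xs pt_snd pt_id)
  then show ?thesis by (rule pt_cong) (auto simp: list_ex_iff)
qed

lemma pt_append: "pt \<mu> f \<Longrightarrow> pt \<mu> g \<Longrightarrow> pt \<mu> (\<lambda>c. f c @ g c)"
proof -
  assume f: "pt \<mu> f" and g: "pt \<mu> g"
  have "pt \<mu> (\<lambda>c. foldr (\<lambda>x a. x # a) (f c) (g c))"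
    by (rule pt_foldr_add[OF _ f g, where h = "\<lambda>z. Suc (sz z)"]) (intro pt_Cons pt_fst pt_snd pt_id pb_intros | simp)+
  moreover have "foldr (\<lambda>x a. x # a) xs ys = xs @ ys" for xs ys :: "'b list" by (induction xs) auto
  ultimately show ?thesis by simp
qed

lemma pt_concat: "pt \<mu> xs \<Longrightarrow> pt \<mu> (\<lambda>c. concat (xs c))"
proof -
  assume xs: "pt \<mu> xs"
  have "pt \<mu> (\<lambda>c. foldr (\<lambda>x a. x @ a) (xs c) [])"
  proof (rule pt_foldr_add[OF _ xs pt_const, where h = sz])
    show "sz (x @ a) \<le> sz a + sz (c, x)" for c :: 'a and x a :: "'b list" using sz_append[of x a] by simp
  qed (intro pt_append pt_fst pt_snd pt_id pb_intros)+
  moreover have "foldr (\<lambda>x a. x @ a) ys [] = concat ys" for ys :: "'b list list" by (induction ys) auto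
  ultimately show ?thesis by simp
qed

lemma pt_length: "pt \<mu> xs \<Longrightarrow> pt \<mu> (\<lambda>c. length (xs c))"
proof -
  assume xs: "pt \<mu> xs"
  have "pt \<mu> (\<lambda>c. foldr (\<lambda>_ a. Suc a) (xs c) 0)"
    by (rule pt_foldr_add[OF _ xs pt_const, where h = "\<lambda>_. 2"]) (intro pt_Suc pt_fst pt_snd pt_id pb_intros | simp)+
  moreover have "foldr (\<lambda>_ a. Suc a) ys 0 = length ys" for ys :: "'b list" by (induction ys) auto
  ultimately show ?thesis by simp
qed

lemma zip_foldl:
  "snd (foldl (\<lambda>a x. (tl (fst a), if fst a = [] then snd a else (x, hd (fst a)) # snd a)) (ys, r) xs) = rev (zip xs ys) @ r"
proof (induction xs arbitrary: ys r)
  case (Cons x xs)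
  then show ?case by (cases ys) (simp_all add: foldl_conv_fold[symmetric])
qed simp

lemma pt_zip: "pt \<mu> xs \<Longrightarrow> pt \<mu> ys \<Longrightarrow> pt \<mu> (\<lambda>c. zip (xs c) (ys c))"
proof -
  assume xs: "pt \<mu> xs" and ys: "pt \<mu> ys"
  have "pt \<mu> (\<lambda>c. foldl (\<lambda>a x. (tl (fst a), if fst a = [] then snd a else (x, hd (fst a)) # snd a)) (ys c, []) (xs c))"
  proof (rule pt_foldl_add[where h = "\<lambda>z. sz z + 3"])
    show "sz (tl (fst a), if fst a = [] then snd a else (x, hd (fst a)) # snd a) \<le> sz a + (sz (c, x) + 3)"
      for c :: 'a and x :: 'b and a :: "'c list \<times> ('b \<times> 'c) list"
      by (cases a; cases "fst a") auto
  qed (intro pt_pair pt_if pt_eq pt_Cons pt_fst pt_snd pt_hd pt_tl pt_id xs ys pt_const pb_intros)+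
  from pt_rev[OF pt_snd[OF this]] show ?thesis by (simp add: zip_foldl)
qed

lemmas pt_intros = pt_id pt_const pt_fst pt_snd pt_pair pt_Cons pt_Suc pt_eq pt_hd pt_tl pt_if pt_not
  pt_conj pt_disj pt_map pt_filter pt_list_ex pt_list_all pt_member pt_append pt_concat pt_length pt_zip pt_rev

section \<open>Parity games and safety games with counters\<close>

definition parity_win :: "(nat \<Rightarrow> nat) \<Rightarrow> bool" where
  "parity_win p \<longleftrightarrow> (\<exists>m. even m \<and> (\<exists>\<^sub>\<infinity>t. p t = m) \<and> (\<forall>\<^sub>\<infinity>t. p t \<le> m))"

lemma limsup_exists:
  fixes f :: "nat \<Rightarrow> nat"
  assumes "\<And>t. f t \<le> D"
  shows "\<exists>m. (\<exists>\<^sub>\<infinity>t. f t = m) \<and> (\<forall>\<^sub>\<infinity>t. f t \<le> m)"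
  using assms
proof (induction D arbitrary: f)
  case 0
  then show ?case by (intro exI[of _ 0]) (simp add: INFM_nat_le)
next
  case (Suc D)
  show ?case
  proof (cases "\<exists>\<^sub>\<infinity>t. f t = Suc D")
    case True
    then show ?thesis using Suc.prems by (intro exI[of _ "Suc D"]) (simp add: MOST_nat_le)
  next
    case False
    then obtain T where T: "\<And>t. T \<le> t \<Longrightarrow> f t \<noteq> Suc D" unfolding INFM_nat_le by blast
    have "f (t + T) \<le> D" for t using Suc.prems[of "t + T"] T[of "t + T"] by simp
    then obtain m where m: "\<exists>\<^sub>\<infinity>t. f (t + T) = m" "\<forall>\<^sub>\<infinity>t. f (t + T) \<le> m"
      using Suc.IH[of "\<lambda>t. f (t + T)"] by blast
    have "\<exists>\<^sub>\<infinity>t. f t = m" unfolding INFM_nat_le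
    proof
      fix s obtain t where "s \<le> t" "f (t + T) = m" using m(1) unfolding INFM_nat_le by blast
      then show "\<exists>n\<ge>s. f n = m" by (intro exI[of _ "t + T"]) simp
    qed
    moreover obtain s where s: "\<And>t. s \<le> t \<Longrightarrow> f (t + T) \<le> m" using m(2) unfolding MOST_nat_le by blast
    have "f t \<le> m" if "s + T \<le> t" for t using s[of "t - T"] that by simp
    then have "\<forall>\<^sub>\<infinity>t. f t \<le> m" unfolding MOST_nat_le by blast
    ultimately show ?thesis by blast
  qed
qed

lemma limsup_unique:
  fixes f :: "nat \<Rightarrow> nat"
  assumes "\<exists>\<^sub>\<infinity>t. f t = m" "\<forall>\<^sub>\<infinity>t. f t \<le> m" "\<exists>\<^sub>\<infinity>t. f t = m'" "\<forall>\<^sub>\<infinity>t. f t \<le> m'"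
  shows "m = m'"
proof -
  have le: "m \<le> m'" if m: "\<exists>\<^sub>\<infinity>t. f t = m" "\<forall>\<^sub>\<infinity>t. f t \<le> m'" for m m'
  proof -
    obtain T where T: "\<And>t. T \<le> t \<Longrightarrow> f t \<le> m'" using m(2) unfolding MOST_nat_le by auto
    obtain t where "T \<le> t" "f t = m" using m(1) unfolding INFM_nat_le by auto
    then show ?thesis using T by auto
  qed
  show ?thesis using le[OF assms(1,4)] le[OF assms(3,2)] by simp
qed

text \<open>The common end of the arguments on shortened histories, on counters and on the
  appearance record: each finds a bounded potential that eventually never falls but rises infinitely
  often.\<close>

lemma unbounded_counter:
  fixes c :: "nat \<Rightarrow> nat"
  assumes "\<And>t. T \<le> t \<Longrightarrow> c t \<le> c (Suc t)" "\<exists>\<^sub>\<infinity>t. P t" "\<And>t. T \<le> t \<Longrightarrow> P t \<Longrightarrow> c t < c (Suc t)"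
    "\<And>t. T \<le> t \<Longrightarrow> c t \<le> R"
  shows False
proof -
  have mono: "T \<le> t \<Longrightarrow> t \<le> u \<Longrightarrow> c t \<le> c u" for t u
  proof (induction u)
    case (Suc u)
    then show ?case using assms(1)[of u] by (cases "t = Suc u") auto
  qed simp
  have "\<exists>t\<ge>T. k \<le> c t" for k
  proof (induction k)
    case (Suc k)
    then obtain t where t: "T \<le> t" "k \<le> c t" by blast
    obtain u where u: "t \<le> u" "P u" using assms(2) unfolding INFM_nat_le by blast
    then have "k < c (Suc u)" using mono[of t u] assms(3)[of u] t by simp
    then show ?case using t u by (intro exI[of _ "Suc u"]) simp
  qed auto
  then show False using assms(4) by (metis Suc_n_not_le_n le_trans)
qed

text \<open>The environment keeps a virtual history that is shortened whenever it closes a cycle of odd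
  maximal priority. As the histories are of bounded length, the maximal priority seen infinitely often
  is odd: an even one would be dropped only with a cycle of larger odd priority.\<close>

lemma push_truncate:
  fixes \<pi> :: "nat \<Rightarrow> 'e list" and pr :: "'e \<Rightarrow> nat"
  assumes step: "\<And>t. \<pi> (Suc t) = \<pi> t @ [e t] \<or> (\<exists>i<length (\<pi> t). \<pi> (Suc t) = take (Suc i) (\<pi> t) \<and>
      odd (pr (e t)) \<and> (\<forall>x\<in>set (drop (Suc i) (\<pi> t)). pr x \<le> pr (e t)))"
    and len: "\<And>t. length (\<pi> t) \<le> R"
  shows "\<not> parity_win (\<lambda>t. pr (e t))"
proof
  assume "parity_win (\<lambda>t. pr (e t))"
  then obtain P T where P: "even P" "\<exists>\<^sub>\<infinity>t. pr (e t) = P" and T: "\<And>t. T \<le> t \<Longrightarrow> pr (e t) \<le> P"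
    unfolding parity_win_def MOST_nat_le by blast
  \<comment> \<open>From \<open>T\<close> on the history never gets shorter than \<open>m\<close>.
    Hence what lies below position \<open>m\<close> at time \<open>t0\<close> is never removed, and
    only the part above it varies.\<close>
  define m where "m = (LEAST l. \<exists>t\<ge>T. length (\<pi> t) = l)"
  have "\<exists>t\<ge>T. length (\<pi> t) = m" unfolding m_def by (rule LeastI_ex) blast
  then obtain t0 where t0: "T \<le> t0" "length (\<pi> t0) = m" by blast
  have m: "m \<le> length (\<pi> t)" if "T \<le> t" for t unfolding m_def by (rule Least_le) (use that in blast)
  have odd_less: "pr (e t) < P" if "T \<le> t" "odd (pr (e t))" for t
    using T[OF that(1)] that(2) P(1) by (cases "pr (e t) = P") auto
  have top: "\<forall>x\<in>set (drop m (\<pi> t)). pr x \<le> P" if "t0 \<le> t" for t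
    using that
  proof (induction rule: dec_induct)
    case base show ?case using t0 by simp
  next
    case (step t)
    from assms(1)[of t] show ?case
    proof (elim disjE exE conjE)
      assume "\<pi> (Suc t) = \<pi> t @ [e t]"
      then show ?thesis using step t0 T[of t] m[of t] by auto
    next
      fix i assume "\<pi> (Suc t) = take (Suc i) (\<pi> t)"
      then have "set (drop m (\<pi> (Suc t))) \<subseteq> set (drop m (\<pi> t))"
        by (simp add: drop_take set_take_subset)
      then show ?thesis using step by blast
    qed
  qed
  \<comment> \<open>Occurrences of \<open>P\<close> above position \<open>m\<close>. A cut removes
    only entries whose priority is at most an odd value below \<open>P\<close>, so it never lowers
    this number, while each event of priority \<open>P\<close> raises it.\<close>
  let ?c = "\<lambda>t. length (filter (\<lambda>x. pr x = P) (drop m (\<pi> t)))"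
  have "?c t \<le> ?c (Suc t) \<and> (pr (e t) = P \<longrightarrow> ?c t < ?c (Suc t))" if t: "t0 \<le> t" for t
    using assms(1)[of t]
  proof (elim disjE exE conjE)
    assume "\<pi> (Suc t) = \<pi> t @ [e t]"
    then show ?thesis using t0 m[of t] t by auto
  next
    fix i assume i: "i < length (\<pi> t)" "\<pi> (Suc t) = take (Suc i) (\<pi> t)" "odd (pr (e t))"
      "\<forall>x\<in>set (drop (Suc i) (\<pi> t)). pr x \<le> pr (e t)"
    have less: "pr (e t) < P" using odd_less[of t] i t t0 by auto
    have "m \<le> Suc i" using m[of "Suc t"] i t t0 by simp
    have "drop m (\<pi> t) = drop m (take (Suc i) (\<pi> t)) @ drop m (drop (Suc i - m) (drop m (\<pi> t))) @ []
      \<or> drop m (\<pi> t) = drop m (take (Suc i) (\<pi> t)) @ drop (Suc i) (\<pi> t)"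
      using \<open>m \<le> Suc i\<close> i(1) by (metis append_take_drop_id drop_append drop_drop drop_take le_add_diff_inverse2)
    then have "drop m (\<pi> t) = drop m (take (Suc i) (\<pi> t)) @ drop (Suc i) (\<pi> t)"
      using \<open>m \<le> Suc i\<close> by (metis append_take_drop_id drop_drop drop_take le_add_diff_inverse2)
    moreover have "filter (\<lambda>x. pr x = P) (drop (Suc i) (\<pi> t)) = []"
      using i(4) less by (auto simp: filter_empty_conv)
    ultimately show ?thesis using i(2) less by simp
  qed
  then show False
    using unbounded_counter[of t0 ?c "\<lambda>t. pr (e t) = P" R] P(2) len
    by (metis (no_types, lifting) diff_le_self le_trans length_drop length_filter_le)
qed

text \<open>The counter of level \<open>h\<close> counts the bad events of level \<open>h\<close> since the last event of larger
  level. The empty list marks an overflow.\<close>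

definition upd_counters :: "nat \<Rightarrow> nat \<Rightarrow> bool \<Rightarrow> nat list \<Rightarrow> nat list" where
  "upd_counters B h bad cs = (if cs = [] then [] else if bad \<and> hd (drop h cs) = B then []
     else replicate h 0 @ (if bad then Suc (hd (drop h cs)) else hd (drop h cs)) # tl (drop h cs))"

lemma upd_counters_nth:
  assumes "h < length cs" "upd_counters B h bad cs \<noteq> []"
  shows "length (upd_counters B h bad cs) = length cs"
    "j < length cs \<Longrightarrow> upd_counters B h bad cs ! j =
       (if j < h then 0 else if j = h \<and> bad then Suc (cs ! h) else cs ! j)"
proof -
  have hd: "hd (drop h cs) = cs ! h" using assms by (simp add: hd_drop_conv_nth)
  then have u: "upd_counters B h bad cs =
      replicate h 0 @ (if bad then Suc (cs ! h) else cs ! h) # drop (Suc h) cs"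
    using assms(2) by (auto simp: upd_counters_def tl_drop drop_Suc split: if_splits)
  show "length (upd_counters B h bad cs) = length cs" using assms(1) by (simp add: u)
  show "upd_counters B h bad cs ! j = (if j < h then 0 else if j = h \<and> bad then Suc (cs ! h) else cs ! j)"
    if "j < length cs"
  proof (cases "j \<le> h")
    case True
    then show ?thesis by (auto simp: u nth_append)
  next
    case False
    then obtain d where "j = Suc (h + d)" using less_imp_Suc_add not_le_imp_less by blast
    then show ?thesis using that by (simp add: u nth_append)
  qed
qed

lemma upd_counters_dead:
  "h < length cs \<Longrightarrow> upd_counters B h bad cs = [] \<longleftrightarrow> cs = [] \<or> bad \<and> cs ! h = B"
  by (auto simp: upd_counters_def hd_drop_conv_nth)

lemma upd_counters_le:
  assumes "h < length cs" "\<forall>c\<in>set cs. c \<le> B"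
  shows "\<forall>c\<in>set (upd_counters B h bad cs). c \<le> B"
proof (cases "upd_counters B h bad cs = []")
  case False
  note u = upd_counters_nth[OF assms(1) False]
  have nd: "\<not> (bad \<and> cs ! h = B)" using False upd_counters_dead[OF assms(1)] by blast
  show ?thesis
  proof
    fix c assume "c \<in> set (upd_counters B h bad cs)"
    then obtain j where j: "j < length cs" "c = upd_counters B h bad cs ! j" using u(1) by (auto simp: in_set_conv_nth)
    have "cs ! j \<le> B" "cs ! h \<le> B" using assms j by auto
    then show "c \<le> B" using j u(2)[OF j(1)] nd by (auto split: if_splits)
  qed
qed simp

definition priority :: "nat \<Rightarrow> bool \<Rightarrow> nat" where
  "priority h bad = 2 * h + (if bad then 1 else 0)"

text \<open>If the largest priority seen infinitely often were the odd number
  \<open>2 * j + 1\<close>, then from some time on no level above \<open>j\<close> would occur.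
  Counter \<open>j\<close> would no longer be reset, but it would be increased infinitely often
  without exceeding \<open>B\<close>.\<close>

lemma counters_sound:
  fixes h :: "nat \<Rightarrow> nat" and bad :: "nat \<Rightarrow> bool" and cs :: "nat \<Rightarrow> nat list"
  assumes cs0: "cs 0 = replicate (Suc n) 0" and step: "\<And>t. cs (Suc t) = upd_counters B (h t) (bad t) (cs t)"
    and alive: "\<And>t. cs t \<noteq> []" and h: "\<And>t. h t \<le> n"
  shows "parity_win (\<lambda>t. priority (h t) (bad t))"
proof -
  have len: "length (cs t) = Suc n" for t
  proof (induction t)
    case (Suc t)
    then show ?case using upd_counters_nth(1)[of "h t" "cs t" B "bad t"] h[of t] alive[of "Suc t"] step[of t] by simp
  qed (simp add: cs0)
  have le: "\<forall>c\<in>set (cs t). c \<le> B" for t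
  proof (induction t)
    case (Suc t)
    then show ?case unfolding step using h[of t] len[of t] by (intro upd_counters_le) auto
  qed (simp add: cs0)
  have "priority (h t) (bad t) \<le> 2 * n + 1" for t using h[of t] by (simp add: priority_def)
  then obtain m where m: "\<exists>\<^sub>\<infinity>t. priority (h t) (bad t) = m" "\<forall>\<^sub>\<infinity>t. priority (h t) (bad t) \<le> m"
    using limsup_exists[of "\<lambda>t. priority (h t) (bad t)"] by blast
  show ?thesis
  proof (cases "even m")
    case False
    then obtain j where j: "m = 2 * j + 1" using oddE by blast
    obtain T where T: "\<And>t. T \<le> t \<Longrightarrow> priority (h t) (bad t) \<le> m" using m(2) unfolding MOST_nat_le by blast
    have hj: "h t \<le> j" if "T \<le> t" for t using T[OF that] j by (auto simp: priority_def split: if_splits)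
    have "priority (h t) (bad t) = m \<longleftrightarrow> h t = j \<and> bad t" for t
      using j by (auto simp: priority_def split: if_splits) presburger+
    then have inf: "\<exists>\<^sub>\<infinity>t. h t = j \<and> bad t" using m(1) by simp
    then obtain t where "h t = j" unfolding INFM_nat_le by blast
    then have jn: "j \<le> n" using h[of t] by simp
    have nth: "cs (Suc t) ! j = (if j < h t then 0 else if j = h t \<and> bad t then Suc (cs t ! h t) else cs t ! j)" for t
      using upd_counters_nth(2)[of "h t" "cs t" B "bad t" j] alive[of "Suc t"] h[of t] len[of t] jn step[of t] by simp
    have False
    proof (rule unbounded_counter[of T "\<lambda>t. cs t ! j" "\<lambda>t. h t = j \<and> bad t" B])
      show "cs t ! j \<le> cs (Suc t) ! j" if "T \<le> t" for t using nth[of t] hj[OF that] by auto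
      show "cs t ! j < cs (Suc t) ! j" if "T \<le> t" "h t = j \<and> bad t" for t using nth[of t] that by auto
      show "cs t ! j \<le> B" for t using le[of t] len[of t] jn by auto
    qed (rule inf)
    then show ?thesis ..
  qed (use m in \<open>auto simp: parity_win_def\<close>)
qed

text \<open>The essential assumption is that the capacity \<open>B\<close> is at least the number of
  base states. Within a round the agent chooses \<open>x\<close> first and the environment answers
  with \<open>y\<close>.\<close>

locale counter_game =
  fixes step :: "'b \<Rightarrow> 'x \<Rightarrow> 'y \<Rightarrow> 'b" and b0 :: 'b and level :: "'b \<Rightarrow> nat" and bad :: "'b \<Rightarrow> bool"
    and Xs :: "'x set" and Ys :: "'y set" and n B :: nat and Bs :: "'b set"
  assumes Bs: "finite Bs" "card Bs \<le> B" "b0 \<in> Bs" "\<And>b x y. b \<in> Bs \<Longrightarrow> x \<in> Xs \<Longrightarrow> y \<in> Ys \<Longrightarrow> step b x y \<in> Bs"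
    and level: "\<And>b. b \<in> Bs \<Longrightarrow> level b \<le> n"
begin

definition pri :: "'b \<Rightarrow> nat" where "pri b = priority (level b) (bad b)"

definition est :: "'b \<times> nat list \<Rightarrow> 'x \<Rightarrow> 'y \<Rightarrow> 'b \<times> nat list" where
  "est e x y = (let b = step (fst e) x y in (b, upd_counters B (level b) (bad b) (snd e)))"

definition e0 :: "'b \<times> nat list" where "e0 = (b0, replicate (Suc n) 0)"

text \<open>The attractor of the environment with explicit rank: an overflow can be forced within
  \<open>r\<close> rounds.\<close>

fun lose :: "nat \<Rightarrow> 'b \<times> nat list \<Rightarrow> bool" where
  "lose 0 e \<longleftrightarrow> snd e = []"
| "lose (Suc r) e \<longleftrightarrow> snd e = [] \<or> (\<forall>x\<in>Xs. \<exists>y\<in>Ys. lose r (est e x y))"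

lemma lose_Suc: "lose r e \<Longrightarrow> lose (Suc r) e"
proof (induction r arbitrary: e)
  case (Suc r)
  then show ?case by (metis lose.simps(2))
qed simp

definition prune :: "('b \<times> nat list) set \<Rightarrow> ('b \<times> nat list) set" where
  "prune W = {e \<in> W. snd e \<noteq> [] \<and> (\<exists>x\<in>Xs. \<forall>y\<in>Ys. est e x y \<in> W)}"

lemma prune_iff: "e \<in> prune W \<longleftrightarrow> e \<in> W \<and> snd e \<noteq> [] \<and> (\<exists>x\<in>Xs. \<forall>y\<in>Ys. est e x y \<in> W)"
  by (simp add: prune_def)

text \<open>The round of pruning in which a position disappears bounds its rank: it disappears
  because every agent move has an answer leading to a position that disappeared earlier.\<close>

lemma lose_prune:
  assumes "\<And>e x y. e \<in> U \<Longrightarrow> x \<in> Xs \<Longrightarrow> y \<in> Ys \<Longrightarrow> est e x y \<in> U"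
  shows "e \<in> U \<Longrightarrow> e \<notin> (prune ^^ r) U \<Longrightarrow> lose r e"
proof (induction r arbitrary: e)
  case (Suc r)
  show ?case
  proof (cases "e \<in> (prune ^^ r) U")
    case True
    then have "snd e = [] \<or> (\<forall>x\<in>Xs. \<exists>y\<in>Ys. est e x y \<notin> (prune ^^ r) U)"
      using Suc.prems(2) by (auto simp: prune_iff)
    then show ?thesis using Suc assms by (metis lose.simps(2))
  qed (use Suc lose_Suc in blast)
qed simp

definition witness :: "('b \<times> nat list) list \<Rightarrow> nat \<Rightarrow> 'b \<Rightarrow> bool" where
  "witness \<rho> j a \<longleftrightarrow> bad a \<and> level a = j \<and>
     (\<exists>i<length \<rho>. fst (\<rho> ! i) = a \<and> (\<forall>k. i \<le> k \<and> k < length \<rho> \<longrightarrow> level (fst (\<rho> ! k)) \<le> j))"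

text \<open>The value of each counter is the size of a set of base states that occurred as bad
  events of this level with no larger level since. This distinctness turns an overflow into too many
  base states.\<close>

definition witnessed :: "('b \<times> nat list) list \<Rightarrow> bool" where
  "witnessed \<rho> \<longleftrightarrow> (\<forall>j\<le>n. \<exists>A\<subseteq>Bs. card A = snd (last \<rho>) ! j \<and> (\<forall>a\<in>A. witness \<rho> j a))"

text \<open>Entering \<open>b\<close> after the history closes a cycle through position
  \<open>i\<close> whose maximal priority, that of \<open>b\<close>, is odd. The environment then
  continues as if it were at position \<open>i\<close>.\<close>

definition rewinds :: "('b \<times> nat list) list \<Rightarrow> nat \<Rightarrow> 'b \<Rightarrow> bool" where
  "rewinds \<pi> i b \<longleftrightarrow> i < length \<pi> \<and> fst (\<pi> ! i) = b \<and> bad b \<and>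
     (\<forall>k. i < k \<and> k < length \<pi> \<longrightarrow> level (fst (\<pi> ! k)) \<le> level b)"

lemma witness_rewinds: "witness \<pi> j b \<Longrightarrow> \<exists>i. rewinds \<pi> i b"
  unfolding witness_def rewinds_def by auto

lemma witness_snoc:
  assumes "witness \<pi> j a" "level (fst e) \<le> j"
  shows "witness (\<pi> @ [e]) j a"
proof -
  obtain i where i: "i < length \<pi>" "fst (\<pi> ! i) = a" "\<forall>k. i \<le> k \<and> k < length \<pi> \<longrightarrow> level (fst (\<pi> ! k)) \<le> j"
    using assms(1) unfolding witness_def by auto
  have "level (fst ((\<pi> @ [e]) ! k)) \<le> j" if "i \<le> k" "k < length (\<pi> @ [e])" for k
    using i(3) that assms(2) by (cases "k < length \<pi>") (auto simp: nth_append)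
  moreover have "fst ((\<pi> @ [e]) ! i) = a" "i < length (\<pi> @ [e])" using i by (auto simp: nth_append)
  ultimately show ?thesis using assms(1) unfolding witness_def by blast
qed

lemma witness_new:
  assumes "bad (fst e)" "level (fst e) = j"
  shows "witness (\<pi> @ [e]) j (fst e)"
  unfolding witness_def using assms by (intro conjI exI[of _ "length \<pi>"]) (auto simp: nth_append)

text \<open>If the new state closes no bad cycle, it is not among the witnesses of its level, so an
  increased counter gains a new witness. The witnesses of larger levels survive, and reset counters
  need none.\<close>

lemma witnessed_snoc:
  assumes w: "witnessed \<pi>" "\<pi> \<noteq> []" and len: "length (snd (last \<pi>)) = Suc n"
    and b: "step (fst (last \<pi>)) x y \<in> Bs" and no: "\<And>i. \<not> rewinds \<pi> i (step (fst (last \<pi>)) x y)"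
  shows "length (snd (est (last \<pi>) x y)) = Suc n \<and> witnessed (\<pi> @ [est (last \<pi>) x y])"
proof -
  define b' where "b' = step (fst (last \<pi>)) x y"
  define cs where "cs = snd (last \<pi>)"
  let ?h = "level b'"
  let ?u = "upd_counters B ?h (bad b') cs"
  have b': "b' \<in> Bs" using b by (simp add: b'_def)
  have h: "?h \<le> n" using level[OF b'] .
  have e: "est (last \<pi>) x y = (b', ?u)" by (simp add: est_def Let_def b'_def cs_def)
  have A: "\<exists>A\<subseteq>Bs. card A = cs ! j \<and> b' \<notin> A \<and> (\<forall>a\<in>A. witness \<pi> j a)" if jn: "j \<le> n" for j
  proof -
    obtain A where A: "A \<subseteq> Bs" "card A = cs ! j" "\<forall>a\<in>A. witness \<pi> j a"
      using w(1) jn unfolding witnessed_def cs_def by auto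
    have "b' \<notin> A" using A(3) witness_rewinds[of \<pi> j b'] no unfolding b'_def by auto
    then show ?thesis using A by auto
  qed
  \<comment> \<open>An overflow would give \<open>B\<close> witnesses besides the new state, thus
    more than \<open>B\<close> base states.\<close>
  have alive: "?u \<noteq> []"
  proof
    assume "?u = []"
    then have "cs ! ?h = B" using upd_counters_dead[of ?h cs B "bad b'"] len h by (auto simp: cs_def)
    then obtain A where A': "A \<subseteq> Bs" "card A = B" "b' \<notin> A" using A[OF h] by auto
    have "finite A" using A'(1) Bs(1) by (rule finite_subset)
    then have "card (insert b' A) = Suc B" using A' by simp
    moreover have "card (insert b' A) \<le> card Bs" using A'(1) b' Bs(1) by (intro card_mono) auto
    ultimately show False using Bs(2) by simp
  qed
  have hl: "?h < length cs" using h len by (simp add: cs_def)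
  note u = upd_counters_nth[OF hl alive]
  have "witnessed (\<pi> @ [(b', ?u)])"
    unfolding witnessed_def
  proof (intro allI impI)
    fix j assume j: "j \<le> n"
    have uj: "?u ! j = (if j < ?h then 0 else if j = ?h \<and> bad b' then Suc (cs ! ?h) else cs ! j)"
      using u(2)[of j] len j by (simp add: cs_def)
    obtain A where A: "A \<subseteq> Bs" "card A = cs ! j" "b' \<notin> A" "\<forall>a\<in>A. witness \<pi> j a"
      using A[OF j] by auto
    have fin: "finite A" using A(1) Bs(1) by (rule finite_subset)
    consider "j < ?h" | "j = ?h" "bad b'" | "?h \<le> j" "\<not> (j = ?h \<and> bad b')" by linarith
    then have "\<exists>A\<subseteq>Bs. card A = ?u ! j \<and> (\<forall>a\<in>A. witness (\<pi> @ [(b', ?u)]) j a)"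
    proof cases
      case 1
      then show ?thesis using uj by (intro exI[of _ "{}"]) auto
    next
      case 2
      have "\<forall>a\<in>insert b' A. witness (\<pi> @ [(b', ?u)]) j a"
        using A(4) 2 witness_snoc[of \<pi> j _ "(b', ?u)"] witness_new[of "(b', ?u)" j \<pi>] by auto
      moreover have "card (insert b' A) = ?u ! j" using A(2,3) fin 2 uj by simp
      ultimately show ?thesis using A(1) b' by (intro exI[of _ "insert b' A"]) auto
    next
      case 3
      have "\<forall>a\<in>A. witness (\<pi> @ [(b', ?u)]) j a" using A(4) 3 witness_snoc[of \<pi> j _ "(b', ?u)"] by auto
      moreover have "card A = ?u ! j" using A(2) 3 uj by auto
      ultimately show ?thesis using A(1) by (intro exI[of _ A]) auto
    qed
    then show "\<exists>A\<subseteq>Bs. card A = snd (last (\<pi> @ [(b', ?u)])) ! j \<and> (\<forall>a\<in>A. witness (\<pi> @ [(b', ?u)]) j a)"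
      by simp
  qed
  then show ?thesis using u(1) len by (simp add: e cs_def)
qed

theorem environment_wins:
  assumes lose: "lose R e0" and \<sigma>: "\<And>u. set u \<subseteq> Ys \<Longrightarrow> \<sigma> u \<in> Xs"
  shows "\<exists>ys b. (\<forall>t. ys t \<in> Ys) \<and> b 0 = b0 \<and> (\<forall>t. b (Suc t) = step (b t) (\<sigma> (map ys [0..<t])) (ys t)) \<and>
    \<not> parity_win (\<lambda>t. pri (b (Suc t)))"
proof -
  \<comment> \<open>The rank falls by one with each position, so a history has at most
    \<open>R + 1\<close> entries. All prefixes satisfy the same conditions, hence cutting back to
    position \<open>i\<close> gives the rank \<open>R - i\<close> again. Rank 0 is never reached,
    because counters of length \<open>Suc n\<close> have not overflowed; the environment always has
    a next move.\<close>
  define inv where "inv \<pi> u \<longleftrightarrow> \<pi> \<noteq> [] \<and> set u \<subseteq> Ys \<and>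
     (\<forall>i<length \<pi>. i \<le> R \<and> lose (R - i) (\<pi> ! i) \<and> length (snd (\<pi> ! i)) = Suc n \<and> fst (\<pi> ! i) \<in> Bs \<and>
        witnessed (take (Suc i) \<pi>))" for \<pi> u
  \<comment> \<open>History and actual play agree in the current base state only; the counters are
    those of the shortened history. The agent strategy sees the actual moves
    \<open>u\<close>.\<close>
  define follows where "follows \<pi> u y \<pi>' \<longleftrightarrow> y \<in> Ys \<and> fst (last \<pi>') = step (fst (last \<pi>)) (\<sigma> u) y \<and>
     (\<pi>' = \<pi> @ [est (last \<pi>) (\<sigma> u) y] \<or> (\<exists>i. \<pi>' = take (Suc i) \<pi> \<and> rewinds \<pi> i (fst (last \<pi>'))))" for \<pi> u y \<pi>'
  have ex: "\<exists>y \<pi>'. follows \<pi> u y \<pi>' \<and> inv \<pi>' (u @ [y])" if i: "inv \<pi> u" for \<pi> u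
  proof -
    let ?m = "length \<pi> - 1"
    have \<pi>: "\<pi> \<noteq> []" "last \<pi> = \<pi> ! ?m" "?m < length \<pi>" using i by (auto simp: inv_def last_conv_nth)
    have "take (Suc ?m) \<pi> = \<pi>" using \<pi>(1) by simp
    then have last: "lose (R - ?m) (last \<pi>)" "length (snd (last \<pi>)) = Suc n" "fst (last \<pi>) \<in> Bs" "witnessed \<pi>" "?m \<le> R"
      using i \<pi>(3) unfolding inv_def \<pi>(2) by metis+
    have ne: "snd (last \<pi>) \<noteq> []" using last(2) by auto
    then have "R - ?m \<noteq> 0" using last(1) by (cases "R - ?m") auto
    moreover have "0 < length \<pi>" using \<pi>(1) by simp
    ultimately have R: "R - ?m = Suc (R - length \<pi>)" "length \<pi> \<le> R" using last(5) by arith+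
    have x: "\<sigma> u \<in> Xs" using \<sigma> i by (auto simp: inv_def)
    obtain y where y: "y \<in> Ys" "lose (R - length \<pi>) (est (last \<pi>) (\<sigma> u) y)"
      using last(1) ne x unfolding R(1) by auto
    let ?e = "est (last \<pi>) (\<sigma> u) y"
    let ?b = "step (fst (last \<pi>)) (\<sigma> u) y"
    have b: "fst ?e = ?b" "?b \<in> Bs" using Bs(4)[OF last(3) x y(1)] by (auto simp: est_def Let_def)
    show ?thesis
    proof (cases "\<exists>i. rewinds \<pi> i ?b")
      case True
      then obtain i where r: "rewinds \<pi> i ?b" by blast
      then have il: "i < length \<pi>" "fst (\<pi> ! i) = ?b" by (auto simp: rewinds_def)
      have l: "last (take (Suc i) \<pi>) = \<pi> ! i" using il by (simp add: take_Suc_conv_app_nth)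
      have "inv (take (Suc i) \<pi>) (u @ [y])"
        using i y(1) il by (auto simp: inv_def min_def)
      moreover have "follows \<pi> u y (take (Suc i) \<pi>)"
        unfolding follows_def using r y(1) il l by auto
      ultimately show ?thesis by blast
    next
      case False
      then have s: "length (snd ?e) = Suc n" "witnessed (\<pi> @ [?e])"
        using witnessed_snoc[OF last(4) \<pi>(1) last(2) b(2)] by auto
      have "inv (\<pi> @ [?e]) (u @ [y])"
        using i y s R(2) b by (auto simp: inv_def nth_append less_Suc_eq take_Suc_conv_app_nth)
      moreover have "follows \<pi> u y (\<pi> @ [?e])" using y(1) b by (simp add: follows_def)
      ultimately show ?thesis by blast
    qed
  qed
  \<comment> \<open>Dependent choice: the second component collects the environment moves of the
    actual play.\<close>
  define nxt where "nxt s = (SOME s'. \<exists>y. follows (fst s) (snd s) y (fst s') \<and> inv (fst s') (snd s') \<and> snd s' = snd s @ [y])" for s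
  define S where "S t = (nxt ^^ t) ([e0], [])" for t
  have w0: "witnessed [e0]" unfolding witnessed_def by (intro allI impI exI[of _ "{}"]) (auto simp: e0_def nth_Cons')
  have inv0: "inv [e0] []"
    using lose w0 Bs(3) by (auto simp: inv_def) (auto simp: e0_def)
  have nxt: "\<exists>y. follows (fst s) (snd s) y (fst (nxt s)) \<and> inv (fst (nxt s)) (snd (nxt s)) \<and> snd (nxt s) = snd s @ [y]"
    if "inv (fst s) (snd s)" for s
    unfolding nxt_def by (rule someI_ex) (use ex[OF that] in auto)
  have invS: "inv (fst (S t)) (snd (S t))" for t
  proof (induction t)
    case 0 then show ?case using inv0 by (simp add: S_def)
  next
    case (Suc t)
    have "S (Suc t) = nxt (S t)" by (simp add: S_def)
    then show ?case using nxt[OF Suc] by metis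
  qed
  have stepS: "\<exists>y. follows (fst (S t)) (snd (S t)) y (fst (S (Suc t))) \<and> snd (S (Suc t)) = snd (S t) @ [y]" for t
    using nxt[OF invS[of t]] by (auto simp: S_def)
  define ys where "ys t = last (snd (S (Suc t)))" for t
  have ys: "follows (fst (S t)) (snd (S t)) (ys t) (fst (S (Suc t)))" "snd (S (Suc t)) = snd (S t) @ [ys t]" for t
    using stepS[of t] by (auto simp: ys_def)
  have us: "snd (S t) = map ys [0..<t]" for t
    by (induction t) (use ys(2) in \<open>auto simp: S_def\<close>)
  let ?b = "\<lambda>t. fst (last (fst (S t)))"
  have "\<not> parity_win (\<lambda>t. pri (?b (Suc t)))"
  proof -
    let ?e = "\<lambda>t. last (fst (S (Suc t)))"
    have "\<not> parity_win (\<lambda>t. (\<lambda>e. pri (fst e)) (?e t))"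
    proof (rule push_truncate[where \<pi> = "\<lambda>t. fst (S t)" and R = "R + 1"])
      fix t
      show "length (fst (S t)) \<le> R + 1"
      proof -
        have "fst (S t) \<noteq> []" using invS[of t] by (simp add: inv_def)
        then have "length (fst (S t)) - 1 < length (fst (S t))" by simp
        then have "length (fst (S t)) - 1 \<le> R" using invS[of t] unfolding inv_def by auto
        then show ?thesis by simp
      qed
      show "fst (S (Suc t)) = fst (S t) @ [?e t] \<or> (\<exists>i<length (fst (S t)). fst (S (Suc t)) = take (Suc i) (fst (S t)) \<and>
        odd (pri (fst (?e t))) \<and> (\<forall>x\<in>set (drop (Suc i) (fst (S t))). pri (fst x) \<le> pri (fst (?e t))))"
        using ys(1)[of t] unfolding follows_def
      proof (elim conjE disjE exE)
        assume "fst (S (Suc t)) = fst (S t) @ [est (last (fst (S t))) (\<sigma> (snd (S t))) (ys t)]"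
        then show ?thesis by simp
      next
        fix i assume i: "fst (S (Suc t)) = take (Suc i) (fst (S t))" "rewinds (fst (S t)) i (fst (?e t))"
        have "pri (fst x) \<le> pri (fst (?e t))" if x: "x \<in> set (drop (Suc i) (fst (S t)))" for x
        proof -
          obtain k where "k < length (fst (S t)) - Suc i" "x = fst (S t) ! (Suc i + k)"
            using x by (auto simp: in_set_conv_nth)
          then have "level (fst x) \<le> level (fst (?e t))" using i(2) by (auto simp: rewinds_def)
          then show ?thesis using i(2) by (auto simp: rewinds_def pri_def priority_def)
        qed
        moreover have "odd (pri (fst (?e t)))" "i < length (fst (S t))"
          using i(2) by (auto simp: rewinds_def pri_def priority_def)
        ultimately show ?thesis using i(1) by blast
      qed
    qed
    then show ?thesis .
  qed
  moreover have "?b (Suc t) = step (?b t) (\<sigma> (map ys [0..<t])) (ys t)" "ys t \<in> Ys" for t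
    using ys(1)[of t] us[of t] by (auto simp: follows_def)
  moreover have "?b 0 = b0" by (simp add: S_def e0_def)
  ultimately show ?thesis by (intro exI[of _ ys] exI[of _ ?b]) blast
qed

end

text \<open>Each round before stabilisation removes an element, so the algorithm may prune once per
  position without testing whether a fixed point has been reached.\<close>

lemma descending_stable:
  fixes f :: "'a set \<Rightarrow> 'a set"
  assumes "finite U" "\<And>W. f W \<subseteq> W"
  shows "f ((f ^^ card U) U) = (f ^^ card U) U"
proof (rule ccontr)
  assume ne: "f ((f ^^ card U) U) \<noteq> (f ^^ card U) U"
  have stable: "f ((f ^^ i) U) = (f ^^ i) U \<Longrightarrow> i \<le> j \<Longrightarrow> (f ^^ j) U = (f ^^ i) U" for i j
  proof -
    assume eq: "f ((f ^^ i) U) = (f ^^ i) U" and "i \<le> j"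
    from \<open>i \<le> j\<close> show "(f ^^ j) U = (f ^^ i) U" by (induction rule: dec_induct) (simp_all add: eq)
  qed
  have sub: "(f ^^ i) U \<subseteq> U" for i by (induction i) (use assms(2) in auto)
  have "card ((f ^^ i) U) + i \<le> card U" if "i \<le> Suc (card U)" for i
    using that
  proof (induction i)
    case (Suc i)
    have "f ((f ^^ i) U) \<noteq> (f ^^ i) U" using stable[of i "card U"] ne Suc.prems by auto
    then have "f ((f ^^ i) U) \<subset> (f ^^ i) U" using assms(2) by blast
    then have "card (f ((f ^^ i) U)) < card ((f ^^ i) U)"
      using psubset_card_mono finite_subset[OF sub assms(1)] by blast
    then show ?case using Suc by simp
  qed simp
  from this[of "Suc (card U)"] show False by simp
qed

text \<open>\<open>lar\<close> stands for the latest appearance record.\<close>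

definition lar_move :: "'c set \<Rightarrow> 'c list \<Rightarrow> 'c list" where
  "lar_move M \<pi> = filter (\<lambda>i. i \<in> M) \<pi> @ filter (\<lambda>i. i \<notin> M) \<pi>"

text \<open>The prefix of the record that ends with its last element in \<open>M\<close>, empty if
  there is none. Its length serves as the level of the event.\<close>

definition lar_head :: "'c set \<Rightarrow> 'c list \<Rightarrow> 'c list" where
  "lar_head M \<pi> = foldr (\<lambda>i l. if i \<in> M \<or> l \<noteq> [] then i # l else l) \<pi> []"

lemma set_lar_move [simp]: "set (lar_move M \<pi>) = set \<pi>"
  by (auto simp: lar_move_def)

lemma length_lar_move [simp]: "length (lar_move M \<pi>) = length \<pi>"
  by (simp add: lar_move_def sum_length_filter_compl)

lemma distinct_lar_move: "distinct \<pi> \<Longrightarrow> distinct (lar_move M \<pi>)"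
  by (auto simp: lar_move_def)

lemma lar_head_prefix: "\<exists>r. \<pi> = lar_head M \<pi> @ r \<and> set r \<inter> M = {}"
proof (induction \<pi>)
  case (Cons i \<pi>)
  then obtain r where "\<pi> = lar_head M \<pi> @ r" "set r \<inter> M = {}" by blast
  then show ?case
    by (cases "i \<in> M \<or> lar_head M \<pi> \<noteq> []") (auto simp: lar_head_def intro: exI[of _ r] exI[of _ "i # \<pi>"])
qed (simp add: lar_head_def)

lemma lar_head_last: "lar_head M \<pi> \<noteq> [] \<Longrightarrow> last (lar_head M \<pi>) \<in> M"
  by (induction \<pi>) (auto simp: lar_head_def split: if_splits)

lemma lar_head_take: "lar_head M \<pi> = take (length (lar_head M \<pi>)) \<pi>" "length (lar_head M \<pi>) \<le> length \<pi>"
  using lar_head_prefix[of \<pi> M] by (metis append_eq_conv_conj, metis length_append le_add1)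

text \<open>An element that is not hit keeps all its predecessors and is overtaken by the hit
  elements behind it. If the last element of the record is hit, there is at least one of
  those.\<close>

lemma lar_move_position:
  assumes "distinct \<rho>" "a \<in> set \<rho>" "a \<notin> M"
  shows "length (takeWhile (\<lambda>i. i \<noteq> a) \<rho>) \<le> length (takeWhile (\<lambda>i. i \<noteq> a) (lar_move M \<rho>))"
    "last \<rho> \<in> M \<Longrightarrow> length (takeWhile (\<lambda>i. i \<noteq> a) \<rho>) < length (takeWhile (\<lambda>i. i \<noteq> a) (lar_move M \<rho>))"
proof -
  obtain xs ys where \<rho>: "\<rho> = xs @ a # ys" using assms(2) by (meson split_list)
  have a: "a \<notin> set xs" "a \<notin> set ys" using assms(1) \<rho> by auto
  have 1: "takeWhile (\<lambda>i. i \<noteq> a) (us @ a # vs) = us" if "a \<notin> set us" for us vs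
    using that by (simp add: takeWhile_append)
  have "lar_move M \<rho> = (filter (\<lambda>i. i \<in> M) xs @ filter (\<lambda>i. i \<in> M) ys @ filter (\<lambda>i. i \<notin> M) xs) @ a # filter (\<lambda>i. i \<notin> M) ys"
    using assms(3) by (simp add: lar_move_def \<rho>)
  then have 2: "takeWhile (\<lambda>i. i \<noteq> a) (lar_move M \<rho>) =
      filter (\<lambda>i. i \<in> M) xs @ filter (\<lambda>i. i \<in> M) ys @ filter (\<lambda>i. i \<notin> M) xs"
    using 1[of "filter (\<lambda>i. i \<in> M) xs @ filter (\<lambda>i. i \<in> M) ys @ filter (\<lambda>i. i \<notin> M) xs"] a by simp
  have 3: "length xs = length (filter (\<lambda>i. i \<in> M) xs) + length (filter (\<lambda>i. i \<notin> M) xs)"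
    by (simp add: sum_length_filter_compl)
  show "length (takeWhile (\<lambda>i. i \<noteq> a) \<rho>) \<le> length (takeWhile (\<lambda>i. i \<noteq> a) (lar_move M \<rho>))"
    using 1[OF a(1)] 2 3 \<rho> by simp
  show "length (takeWhile (\<lambda>i. i \<noteq> a) \<rho>) < length (takeWhile (\<lambda>i. i \<noteq> a) (lar_move M \<rho>))" if "last \<rho> \<in> M"
  proof -
    have "ys \<noteq> []" using that assms(3) \<rho> by auto
    then have "last ys \<in> set ys" "last ys \<in> M" using that \<rho> by auto
    then have "filter (\<lambda>i. i \<in> M) ys \<noteq> []" by (auto simp: filter_empty_conv)
    then have "0 < length (filter (\<lambda>i. i \<in> M) ys)" by simp
    then show ?thesis using 1[OF a(1)] 2 3 \<rho> by simp
  qed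
qed

text \<open>Let \<open>k\<close> be the largest length occurring infinitely often. Eventually
  nothing beyond position \<open>k\<close> is hit, so the first \<open>k\<close> entries keep the
  same set. Each of them is hit infinitely often: otherwise its position would never fall from some
  time on and would rise at every event of length \<open>k\<close>, while staying at most
  \<open>k\<close>. At such an event the prefix is exactly this set.\<close>

lemma lar_limit:
  fixes \<pi> :: "nat \<Rightarrow> 'c list"
  assumes "distinct (\<pi> 0)" and M: "\<And>t. M t \<subseteq> set (\<pi> 0)" and step: "\<And>t. \<pi> (Suc t) = lar_move (M t) (\<pi> t)"
  shows "\<exists>k. (\<exists>\<^sub>\<infinity>t. length (lar_head (M t) (\<pi> t)) = k) \<and> (\<forall>\<^sub>\<infinity>t. length (lar_head (M t) (\<pi> t)) \<le> k) \<and>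
    (\<forall>\<^sub>\<infinity>t. length (lar_head (M t) (\<pi> t)) = k \<longrightarrow> set (lar_head (M t) (\<pi> t)) = {i. \<exists>\<^sub>\<infinity>t. i \<in> M t})"
proof -
  let ?H = "\<lambda>t. lar_head (M t) (\<pi> t)"
  have p: "distinct (\<pi> t)" "length (\<pi> t) = length (\<pi> 0)" "set (\<pi> t) = set (\<pi> 0)" for t
    by (induction t) (use assms(1) in \<open>auto simp: step distinct_lar_move\<close>)
  have "length (?H t) \<le> length (\<pi> 0)" for t using lar_head_take(2)[of "M t" "\<pi> t"] p(2)[of t] by simp
  then obtain k where k: "\<exists>\<^sub>\<infinity>t. length (?H t) = k" "\<forall>\<^sub>\<infinity>t. length (?H t) \<le> k"
    using limsup_exists[of "\<lambda>t. length (?H t)"] by blast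
  then obtain T where T: "\<And>t. T \<le> t \<Longrightarrow> length (?H t) \<le> k" unfolding MOST_nat_le by blast
  obtain t1 where "length (?H t1) = k" using k(1) unfolding INFM_nat_le by blast
  then have kl: "k \<le> length (\<pi> 0)" using lar_head_take(2)[of "M t1" "\<pi> t1"] p(2)[of t1] by simp
  let ?\<rho> = "\<lambda>t. take k (\<pi> t)"
  have Mk: "M t \<subseteq> set (?\<rho> t)" "M t \<inter> set (drop k (\<pi> t)) = {}" if "T \<le> t" for t
  proof -
    define hh where "hh = ?H t"
    obtain r where r: "\<pi> t = hh @ r" "set r \<inter> M t = {}"
      using lar_head_prefix[of "\<pi> t" "M t"] by (auto simp: hh_def)
    have "length hh \<le> k" using T[OF that] by (simp add: hh_def)
    then have "drop k (\<pi> t) = drop (k - length hh) r" using r(1) by simp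
    then show d: "M t \<inter> set (drop k (\<pi> t)) = {}" using r(2) set_drop_subset[of "k - length hh" r] by auto
    have "M t \<subseteq> set (?\<rho> t) \<union> set (drop k (\<pi> t))" using M[of t] p(3)[of t] by (metis append_take_drop_id set_append)
    then show "M t \<subseteq> set (?\<rho> t)" using d by blast
  qed
  have \<rho>: "?\<rho> (Suc t) = lar_move (M t) (?\<rho> t)" if "T \<le> t" for t
  proof -
    have "filter (\<lambda>i. i \<in> M t) (drop k (\<pi> t)) = []" "filter (\<lambda>i. i \<notin> M t) (drop k (\<pi> t)) = drop k (\<pi> t)"
      using Mk(2)[OF that] by (auto simp: filter_empty_conv filter_id_conv)
    then have "lar_move (M t) (?\<rho> t @ drop k (\<pi> t)) = lar_move (M t) (?\<rho> t) @ drop k (\<pi> t)"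
      unfolding lar_move_def filter_append by simp
    then have "\<pi> (Suc t) = lar_move (M t) (?\<rho> t) @ drop k (\<pi> t)" using step[of t] by simp
    then show ?thesis using kl p(2)[of t] by simp
  qed
  have A: "set (?\<rho> t) = set (?\<rho> T)" if "T \<le> t" for t
    using that by (induction rule: dec_induct) (auto simp: \<rho>)
  have Inf: "set (?\<rho> T) = {i. \<exists>\<^sub>\<infinity>t. i \<in> M t}"
  proof (intro equalityI subsetI CollectI)
    fix i assume "i \<in> {i. \<exists>\<^sub>\<infinity>t. i \<in> M t}"
    then obtain t where "T \<le> t" "i \<in> M t" unfolding INFM_nat_le by blast
    then show "i \<in> set (?\<rho> T)" using Mk(1)[of t] A[of t] by blast
  next
    fix a assume a: "a \<in> set (?\<rho> T)"
    show "\<exists>\<^sub>\<infinity>t. a \<in> M t"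
    proof (rule ccontr)
      assume "\<not> (\<exists>\<^sub>\<infinity>t. a \<in> M t)"
      then obtain T' where T': "\<And>t. T' \<le> t \<Longrightarrow> a \<notin> M t" unfolding INFM_nat_le by blast
      let ?c = "\<lambda>t. length (takeWhile (\<lambda>i. i \<noteq> a) (?\<rho> t))"
      have pos: "?c t \<le> ?c (Suc t)" "length (?H t) = k \<Longrightarrow> ?c t < ?c (Suc t)" if t: "max T T' \<le> t" for t
      proof -
        have t': "T \<le> t" "T' \<le> t" using t by auto
        have d: "distinct (?\<rho> t)" "a \<in> set (?\<rho> t)" using p(1)[of t] a A[OF t'(1)] by auto
        show "?c t \<le> ?c (Suc t)" unfolding \<rho>[OF t'(1)] by (rule lar_move_position(1)[OF d T'[OF t'(2)]])
        show "?c t < ?c (Suc t)" if h: "length (?H t) = k"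
        proof -
          have e: "?\<rho> t = ?H t" using lar_head_take(1)[of "M t" "\<pi> t"] h by simp
          have "?H t \<noteq> []" using d(2) e by auto
          then have "last (?\<rho> t) \<in> M t" unfolding e by (rule lar_head_last)
          then show ?thesis unfolding \<rho>[OF t'(1)] by (rule lar_move_position(2)[OF d T'[OF t'(2)]])
        qed
      qed
      have "?c t \<le> k" for t using length_takeWhile_le[of "\<lambda>i. i \<noteq> a" "?\<rho> t"] by (simp add: min_def split: if_splits)
      then show False using unbounded_counter[of "max T T'" ?c "\<lambda>t. length (?H t) = k" k] pos k(1) by blast
    qed
  qed
  have "set (?H t) = {i. \<exists>\<^sub>\<infinity>t. i \<in> M t}" if "T \<le> t" "length (?H t) = k" for t
    using lar_head_take(1)[of "M t" "\<pi> t"] that A[OF that(1)] Inf by simp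
  then have "\<forall>\<^sub>\<infinity>t. length (?H t) = k \<longrightarrow> set (?H t) = {i. \<exists>\<^sub>\<infinity>t. i \<in> M t}" unfolding MOST_nat_le by blast
  then show ?thesis using k by blast
qed

section \<open>Formulas as parity automata\<close>

text \<open>Letters are numbered so that the programs can work on lists of natural numbers.\<close>

fun letter_code :: "('a \<Rightarrow> nat) \<Rightarrow> 'a letter \<Rightarrow> nat" where
  "letter_code g A_Not = 0"
| "letter_code g A_Or = 1"
| "letter_code g A_And = 2"
| "letter_code g A_Yesterday = 3"
| "letter_code g A_Since = 4"
| "letter_code g (A_Quant All_Prefixes) = 5"
| "letter_code g (A_Quant Some_Prefix) = 6"
| "letter_code g (A_Quant Inf_Many_Prefixes) = 7"
| "letter_code g (A_Quant Almost_All_Prefixes) = 8"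
| "letter_code g A_State = 9"
| "letter_code g A_Edge = 10"
| "letter_code g A_Tick = 11"
| "letter_code g A_Next = 12"
| "letter_code g A_Until = 13"
| "letter_code g (A_Atom p) = 14 + g p"

definition formula_code :: "('a \<Rightarrow> nat) \<Rightarrow> 'a ppltl \<Rightarrow> nat list" where
  "formula_code g \<phi> = map (letter_code g) (ppltl_code \<phi>)"

definition word_code :: "('a \<Rightarrow> nat) \<Rightarrow> 'a ppltl plus \<Rightarrow> nat list" where
  "word_code g \<Psi> = map (letter_code g) (plus_code ppltl_code \<Psi>)"

lemma formula_code_simps [simp]:
  "formula_code g (PAtom p) = [14 + g p]"
  "formula_code g (PNot \<phi>) = 0 # formula_code g \<phi>"
  "formula_code g (POr \<phi> \<psi>) = 1 # formula_code g \<phi> @ formula_code g \<psi>"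
  "formula_code g (PAnd \<phi> \<psi>) = 2 # formula_code g \<phi> @ formula_code g \<psi>"
  "formula_code g (PYesterday \<phi>) = 3 # formula_code g \<phi>"
  "formula_code g (PSince \<phi> \<psi>) = 4 # formula_code g \<phi> @ formula_code g \<psi>"
  by (auto simp: formula_code_def)

lemma word_code_simps [simp]:
  "word_code g (Quant Q \<phi>) = letter_code g (A_Quant Q) # formula_code g \<phi>"
  "word_code g (Or_plus \<Psi>1 \<Psi>2) = 1 # word_code g \<Psi>1 @ word_code g \<Psi>2"
  "word_code g (And_plus \<Psi>1 \<Psi>2) = 2 # word_code g \<Psi>1 @ word_code g \<Psi>2"
  "word_code g (Not_plus \<Psi>) = 0 # word_code g \<Psi>"
  by (auto simp: word_code_def formula_code_def)

lemma quant_code: "letter_code g (A_Quant Q) \<in> {5, 6, 7, 8}"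
  by (cases Q) auto

text \<open>Nodes rather than formulas: repetitions are kept and the order is that of the Polish
  notation, so the entries correspond to the letters of the word.\<close>

fun subformulas :: "'a ppltl \<Rightarrow> 'a ppltl list" where
  "subformulas (PAtom p) = [PAtom p]"
| "subformulas (PNot \<phi>) = PNot \<phi> # subformulas \<phi>"
| "subformulas (POr \<phi> \<psi>) = POr \<phi> \<psi> # subformulas \<phi> @ subformulas \<psi>"
| "subformulas (PAnd \<phi> \<psi>) = PAnd \<phi> \<psi> # subformulas \<phi> @ subformulas \<psi>"
| "subformulas (PYesterday \<phi>) = PYesterday \<phi> # subformulas \<phi>"
| "subformulas (PSince \<phi> \<psi>) = PSince \<phi> \<psi> # subformulas \<phi> @ subformulas \<psi>"

lemma length_subformulas: "length (subformulas \<phi>) = length (formula_code g \<phi>)"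
  by (induction \<phi>) auto

lemma hd_subformulas: "\<exists>l. subformulas \<phi> = \<phi> # l"
  by (cases \<phi>) auto

section \<open>Truth values of past formulas, updated letter by letter\<close>

definition hd_or :: "'b \<Rightarrow> 'b list \<Rightarrow> 'b" where
  "hd_or d l = (if l = [] then d else hd l)"

lemma hd_or_Cons [simp]: "hd_or d (x # l) = x"
  by (simp add: hd_or_def)

text \<open>One pass over the formula in Polish notation computes the truth values of all its nodes from
  their previous values. The stack holds pairs of the new and the old value of a node.\<close>

definition truth_step :: "nat list \<Rightarrow> nat \<times> bool \<Rightarrow> (bool \<times> bool) list \<times> bool list \<Rightarrow> (bool \<times> bool) list \<times> bool list" where
  "truth_step a p s =
     (let x = hd_or (False, False) (fst s); y = hd_or (False, False) (tl (fst s));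
          v = (if fst p = 0 then \<not> fst x
               else if fst p = 1 then fst x \<or> fst y
               else if fst p = 2 then fst x \<and> fst y
               else if fst p = 3 then snd x
               else if fst p = 4 then fst y \<or> (fst x \<and> snd p)
               else fst p \<in> set a);
          st = (if fst p \<in> set [1, 2, 4] then tl (tl (fst s))
                else if fst p \<in> set [0, 3, 5, 6, 7, 8] then tl (fst s) else fst s)
      in ((v, snd p) # st, v # snd s))"

definition truth_update :: "nat list \<Rightarrow> nat list \<Rightarrow> bool list \<Rightarrow> bool list" where
  "truth_update w a v = snd (foldr (truth_step a) (zip w v) ([], []))"

text \<open>Only the values at the nodes of formulas on finite traces matter, not those above them.\<close>

fun node_values :: "('a ppltl \<Rightarrow> bool) \<Rightarrow> 'a ppltl plus \<Rightarrow> bool list \<Rightarrow> bool" where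
  "node_values f (Quant Q \<phi>) v \<longleftrightarrow> (\<exists>b. v = b # map f (subformulas \<phi>))"
| "node_values f (Or_plus \<Psi>1 \<Psi>2) v \<longleftrightarrow> (\<exists>b v1 v2. v = b # v1 @ v2 \<and> node_values f \<Psi>1 v1 \<and> node_values f \<Psi>2 v2)"
| "node_values f (And_plus \<Psi>1 \<Psi>2) v \<longleftrightarrow> (\<exists>b v1 v2. v = b # v1 @ v2 \<and> node_values f \<Psi>1 v1 \<and> node_values f \<Psi>2 v2)"
| "node_values f (Not_plus \<Psi>) v \<longleftrightarrow> (\<exists>b v1. v = b # v1 \<and> node_values f \<Psi> v1)"

lemma node_values_length: "node_values f \<Psi> v \<Longrightarrow> length v = length (word_code g \<Psi>)"
  by (induction \<Psi> arbitrary: v) (fastforce simp: length_subformulas[of _ g])+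

text \<open>The fold reads the word from the right, so the operands, the first one on top, are on
  the stack when their operator is met. \<open>s\<close> and \<open>f\<close> stand for the new and
  the old values and are only assumed to satisfy the one-step expansion laws. The stack and the
  output are arbitrary to allow the composition of subwords; \<open>x\<close> is existential, since
  the values above the quantifiers are arbitrary.\<close>

lemma truth_step_word:
  assumes s: "\<And>p. p \<in> AP \<Longrightarrow> s (PAtom p) \<longleftrightarrow> 14 + g p \<in> set a" "\<And>\<phi>. s (PNot \<phi>) \<longleftrightarrow> \<not> s \<phi>"
    "\<And>\<phi> \<psi>. s (POr \<phi> \<psi>) \<longleftrightarrow> s \<phi> \<or> s \<psi>" "\<And>\<phi> \<psi>. s (PAnd \<phi> \<psi>) \<longleftrightarrow> s \<phi> \<and> s \<psi>"
    "\<And>\<phi>. s (PYesterday \<phi>) \<longleftrightarrow> f \<phi>" "\<And>\<phi> \<psi>. s (PSince \<phi> \<psi>) \<longleftrightarrow> s \<psi> \<or> (s \<phi> \<and> f (PSince \<phi> \<psi>))"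
  shows "\<forall>\<phi>\<in>set_plus \<Psi>. set_ppltl \<phi> \<subseteq> AP \<Longrightarrow> node_values f \<Psi> v \<Longrightarrow>
    \<exists>x v'. foldr (truth_step a) (zip (word_code g \<Psi>) v) (st, out) = (x # st, v' @ out) \<and> node_values s \<Psi> v'"
proof (induction \<Psi> arbitrary: v st out)
  case (Quant Q \<phi>)
  have formula: "set_ppltl \<phi> \<subseteq> AP \<Longrightarrow> foldr (truth_step a) (zip (formula_code g \<phi>) (map f (subformulas \<phi>))) (st, out) =
    ((s \<phi>, f \<phi>) # st, map s (subformulas \<phi>) @ out)" for st out
  proof (induction \<phi> arbitrary: st out)
    case (PAtom p) then show ?case by (simp add: truth_step_def Let_def s)
  next
    case (PNot \<phi>) then show ?case by simp (simp add: truth_step_def Let_def s)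
  next
    case (PYesterday \<phi>) then show ?case by simp (simp add: truth_step_def Let_def s)
  next
    case (POr \<phi> \<psi>) then show ?case by (simp add: length_subformulas[of _ g]) (simp add: truth_step_def Let_def s)
  next
    case (PAnd \<phi> \<psi>) then show ?case by (simp add: length_subformulas[of _ g]) (simp add: truth_step_def Let_def s)
  next
    case (PSince \<phi> \<psi>) then show ?case by (simp add: length_subformulas[of _ g]) (simp add: truth_step_def Let_def s)
  qed
  obtain b where v: "v = b # map f (subformulas \<phi>)" using Quant by auto
  let ?x = "letter_code g (A_Quant Q) \<in> set a"
  have "foldr (truth_step a) (zip (word_code g (Quant Q \<phi>)) v) (st, out) =
      truth_step a (letter_code g (A_Quant Q), b) ((s \<phi>, f \<phi>) # st, map s (subformulas \<phi>) @ out)"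
    using formula Quant.prems by (simp add: v)
  also have "\<dots> = ((?x, b) # st, (?x # map s (subformulas \<phi>)) @ out)"
    using quant_code[of g Q] by (auto simp: truth_step_def Let_def)
  finally show ?case by (intro exI[of _ "(?x, b)"] exI[of _ "?x # map s (subformulas \<phi>)"]) simp
next
  case (Or_plus \<Psi>1 \<Psi>2)
  obtain b v1 v2 where v: "v = b # v1 @ v2" "node_values f \<Psi>1 v1" "node_values f \<Psi>2 v2" using Or_plus.prems by auto
  obtain x2 v2' where 2: "foldr (truth_step a) (zip (word_code g \<Psi>2) v2) (st, out) = (x2 # st, v2' @ out)" "node_values s \<Psi>2 v2'"
    using Or_plus.IH(2)[OF _ v(3)] Or_plus.prems by fastforce
  obtain x1 v1' where 1: "foldr (truth_step a) (zip (word_code g \<Psi>1) v1) (x2 # st, v2' @ out) = (x1 # x2 # st, v1' @ v2' @ out)" "node_values s \<Psi>1 v1'"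
    using Or_plus.IH(1)[OF _ v(2)] Or_plus.prems by fastforce
  let ?x = "fst x1 \<or> fst x2"
  have "foldr (truth_step a) (zip (word_code g (Or_plus \<Psi>1 \<Psi>2)) v) (st, out) = truth_step a (1, b) (x1 # x2 # st, v1' @ v2' @ out)"
    using 1 2 v(1) node_values_length[OF v(2), of g] by simp
  also have "\<dots> = ((?x, b) # st, (?x # v1' @ v2') @ out)" by (simp add: truth_step_def Let_def)
  finally have "foldr (truth_step a) (zip (word_code g (Or_plus \<Psi>1 \<Psi>2)) v) (st, out) = ((?x, b) # st, (?x # v1' @ v2') @ out)" .
  moreover have "node_values s (Or_plus \<Psi>1 \<Psi>2) (?x # v1' @ v2')"
    using 1(2) 2(2) unfolding node_values.simps by blast
  ultimately show ?case by blast
next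
  case (And_plus \<Psi>1 \<Psi>2)
  obtain b v1 v2 where v: "v = b # v1 @ v2" "node_values f \<Psi>1 v1" "node_values f \<Psi>2 v2" using And_plus.prems by auto
  obtain x2 v2' where 2: "foldr (truth_step a) (zip (word_code g \<Psi>2) v2) (st, out) = (x2 # st, v2' @ out)" "node_values s \<Psi>2 v2'"
    using And_plus.IH(2)[OF _ v(3)] And_plus.prems by fastforce
  obtain x1 v1' where 1: "foldr (truth_step a) (zip (word_code g \<Psi>1) v1) (x2 # st, v2' @ out) = (x1 # x2 # st, v1' @ v2' @ out)" "node_values s \<Psi>1 v1'"
    using And_plus.IH(1)[OF _ v(2)] And_plus.prems by fastforce
  let ?x = "fst x1 \<and> fst x2"
  have "foldr (truth_step a) (zip (word_code g (And_plus \<Psi>1 \<Psi>2)) v) (st, out) = truth_step a (2, b) (x1 # x2 # st, v1' @ v2' @ out)"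
    using 1 2 v(1) node_values_length[OF v(2), of g] by simp
  also have "\<dots> = ((?x, b) # st, (?x # v1' @ v2') @ out)" by (simp add: truth_step_def Let_def)
  finally have "foldr (truth_step a) (zip (word_code g (And_plus \<Psi>1 \<Psi>2)) v) (st, out) = ((?x, b) # st, (?x # v1' @ v2') @ out)" .
  moreover have "node_values s (And_plus \<Psi>1 \<Psi>2) (?x # v1' @ v2')"
    using 1(2) 2(2) unfolding node_values.simps by blast
  ultimately show ?case by blast
next
  case (Not_plus \<Psi>)
  obtain b v1 where v: "v = b # v1" "node_values f \<Psi> v1" using Not_plus.prems by auto
  obtain x1 v1' where 1: "foldr (truth_step a) (zip (word_code g \<Psi>) v1) (st, out) = (x1 # st, v1' @ out)" "node_values s \<Psi> v1'"
    using Not_plus.IH[OF _ v(2)] Not_plus.prems by fastforce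
  have "foldr (truth_step a) (zip (word_code g (Not_plus \<Psi>)) v) (st, out) = truth_step a (0, b) (x1 # st, v1' @ out)"
    using 1 v(1) by simp
  also have "\<dots> = ((\<not> fst x1, b) # st, ((\<not> fst x1) # v1') @ out)" by (simp add: truth_step_def Let_def)
  finally show ?case using 1(2) by (intro exI[of _ "(\<not> fst x1, b)"] exI[of _ "(\<not> fst x1) # v1'"]) simp
qed

lemma node_values_False: "node_values (\<lambda>_. False) \<Psi> (replicate (length (word_code g \<Psi>)) False)"
proof (induction \<Psi>)
  case (Quant Q \<phi>)
  have "map (\<lambda>_. False) (subformulas \<phi>) = replicate (length (formula_code g \<phi>)) False"
    using length_subformulas[of \<phi> g] by (metis map_replicate_const)
  then show ?case by auto
qed (auto simp: replicate_add)

definition decode :: "('a \<Rightarrow> nat) \<Rightarrow> 'a set \<Rightarrow> nat list \<Rightarrow> 'a set" where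
  "decode g AP a = {p \<in> AP. 14 + g p \<in> set a}"

lemma ppltl_sat_append: "i < length t \<Longrightarrow> ppltl_sat (t @ r) i \<phi> = ppltl_sat t i \<phi>"
  by (induction \<phi> arbitrary: i) (auto simp: nth_append)

lemma ppltl_sat_since:
  "ppltl_sat t i (PSince \<phi> \<psi>) \<longleftrightarrow> ppltl_sat t i \<psi> \<or>
     (ppltl_sat t i \<phi> \<and> 0 < i \<and> ppltl_sat t (i - 1) (PSince \<phi> \<psi>))"
proof
  assume "ppltl_sat t i (PSince \<phi> \<psi>)"
  then obtain j where j: "j \<le> i" "ppltl_sat t j \<psi>" "\<forall>k. j < k \<and> k \<le> i \<longrightarrow> ppltl_sat t k \<phi>" by auto
  show "ppltl_sat t i \<psi> \<or> (ppltl_sat t i \<phi> \<and> 0 < i \<and> ppltl_sat t (i - 1) (PSince \<phi> \<psi>))"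
  proof (cases "j = i")
    case False
    then have "j \<le> i - 1" "0 < i" using j(1) by auto
    then show ?thesis using j False by auto
  qed (use j in simp)
next
  assume "ppltl_sat t i \<psi> \<or> (ppltl_sat t i \<phi> \<and> 0 < i \<and> ppltl_sat t (i - 1) (PSince \<phi> \<psi>))"
  then show "ppltl_sat t i (PSince \<phi> \<psi>)"
  proof (elim disjE conjE)
    assume "ppltl_sat t i \<phi>" "0 < i" "ppltl_sat t (i - 1) (PSince \<phi> \<psi>)"
    then obtain j where j: "j \<le> i - 1" "ppltl_sat t j \<psi>" "\<forall>k. j < k \<and> k \<le> i - 1 \<longrightarrow> ppltl_sat t k \<phi>" by auto
    have "ppltl_sat t k \<phi>" if "j < k" "k \<le> i" for k
      using j(3) that \<open>ppltl_sat t i \<phi>\<close> by (cases "k = i") auto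
    moreover have "j \<le> i" using j(1) by simp
    ultimately show ?thesis using j(2) unfolding ppltl_sat.simps by blast
  qed auto
qed

text \<open>Making everything false on the empty trace gives the strong reading of Yesterday and the
  base case of Since at the first position, and it justifies the initial vector of the
  monitor.\<close>

definition truth :: "('a \<Rightarrow> nat) \<Rightarrow> 'a set \<Rightarrow> nat list list \<Rightarrow> 'a ppltl \<Rightarrow> bool" where
  "truth g AP as \<phi> \<longleftrightarrow> as \<noteq> [] \<and> ppltl_sat (map (decode g AP) as) (length as - 1) \<phi>"

definition truth_values :: "nat list \<Rightarrow> nat list list \<Rightarrow> bool list" where
  "truth_values w as = foldl (\<lambda>v a. truth_update w a v) (map (\<lambda>_. False) w) as"

lemma truth_values_correct:
  assumes "\<forall>\<phi>\<in>set_plus \<Psi>. set_ppltl \<phi> \<subseteq> AP"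
  shows "node_values (truth g AP as) \<Psi> (truth_values (word_code g \<Psi>) as)"
proof (induction as rule: rev_induct)
  case Nil
  have "map (\<lambda>_. False) (word_code g \<Psi>) = replicate (length (word_code g \<Psi>)) False" by (simp add: map_replicate_const)
  then show ?case using node_values_False[of \<Psi> g] by (simp add: truth_values_def truth_def)
next
  case (snoc a as)
  let ?t = "map (decode g AP) as" and ?f = "truth g AP as" and ?s = "truth g AP (as @ [a])"
  have s: "?s \<phi> = ppltl_sat (?t @ [decode g AP a]) (length ?t) \<phi>" for \<phi> by (simp add: truth_def)
  have f: "?f \<phi> \<longleftrightarrow> 0 < length ?t \<and> ppltl_sat (?t @ [decode g AP a]) (length ?t - 1) \<phi>" for \<phi>
    using ppltl_sat_append[of "length ?t - 1" ?t "[decode g AP a]" \<phi>] by (auto simp: truth_def)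
  have "\<exists>x v'. foldr (truth_step a) (zip (word_code g \<Psi>) (truth_values (word_code g \<Psi>) as)) ([], []) = (x # [], v' @ []) \<and>
      node_values ?s \<Psi> v'"
  proof (rule truth_step_word[OF _ _ _ _ _ _ assms snoc])
    show "?s (PAtom p) \<longleftrightarrow> 14 + g p \<in> set a" if "p \<in> AP" for p using that by (simp add: s nth_append decode_def)
    show "?s (PSince \<phi> \<psi>) \<longleftrightarrow> ?s \<psi> \<or> (?s \<phi> \<and> ?f (PSince \<phi> \<psi>))" for \<phi> \<psi>
      unfolding s f by (rule ppltl_sat_since)
    show "?s (PYesterday \<phi>) \<longleftrightarrow> ?f \<phi>" for \<phi> unfolding s f by simp
  qed (simp_all add: s)
  then show ?case by (auto simp: truth_values_def truth_update_def)
qed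

text \<open>A mark at a quantifier node signals a prefix that satisfies (\<open>\<exists>\<close>, \<open>\<exists>\<^sup>\<infinity>\<close>) or violates
  (\<open>\<forall>\<close>, \<open>\<forall>\<^sup>\<infinity>\<close>) its formula. For \<open>\<exists>\<close> and \<open>\<forall>\<close> a mark persists, so that in all four cases
  only the marks seen infinitely often matter.\<close>

definition mark_step :: "nat \<times> bool \<times> bool \<Rightarrow> bool \<times> bool list \<Rightarrow> bool \<times> bool list" where
  "mark_step p s = (snd (snd p),
     (if fst p = 5 then fst (snd p) \<or> \<not> fst s
      else if fst p = 6 then fst (snd p) \<or> fst s
      else if fst p = 7 then fst s
      else if fst p = 8 then \<not> fst s
      else False) # snd s)"

definition mark_update :: "nat list \<Rightarrow> bool list \<Rightarrow> bool list \<Rightarrow> bool list" where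
  "mark_update w m u = snd (foldr mark_step (zip w (zip m u)) (False, []))"

fun next_mark :: "prefix_quantifier \<Rightarrow> bool \<Rightarrow> bool \<Rightarrow> bool" where
  "next_mark All_Prefixes m b \<longleftrightarrow> m \<or> \<not> b"
| "next_mark Some_Prefix m b \<longleftrightarrow> m \<or> b"
| "next_mark Inf_Many_Prefixes m b \<longleftrightarrow> b"
| "next_mark Almost_All_Prefixes m b \<longleftrightarrow> \<not> b"

text \<open>The layout of the mark vector: the same positions as in the word, filled at the
  quantifier nodes.\<close>

fun slots :: "'a ppltl plus \<Rightarrow> (prefix_quantifier \<times> 'a ppltl) option list" where
  "slots (Quant Q \<phi>) = Some (Q, \<phi>) # map (\<lambda>_. None) (subformulas \<phi>)"
| "slots (Or_plus \<Psi>1 \<Psi>2) = None # slots \<Psi>1 @ slots \<Psi>2"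
| "slots (And_plus \<Psi>1 \<Psi>2) = None # slots \<Psi>1 @ slots \<Psi>2"
| "slots (Not_plus \<Psi>) = None # slots \<Psi>"

definition slot_value :: "(prefix_quantifier \<Rightarrow> 'a ppltl \<Rightarrow> bool) \<Rightarrow> (prefix_quantifier \<times> 'a ppltl) option \<Rightarrow> bool" where
  "slot_value F c = (case c of None \<Rightarrow> False | Some (Q, \<phi>) \<Rightarrow> F Q \<phi>)"

lemma slot_value_simps [simp]: "slot_value F None = False" "slot_value F (Some (Q, \<phi>)) = F Q \<phi>"
  by (auto simp: slot_value_def)

lemma length_slots: "length (slots \<Psi>) = length (word_code g \<Psi>)"
  by (induction \<Psi>) (auto simp: length_subformulas[of _ g])

lemma formula_code_no_quant: "set (formula_code g \<phi>) \<inter> {5, 6, 7, 8} = {}"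
  by (induction \<phi>) auto

lemma mark_step_formula:
  assumes "set w \<inter> {5, 6, 7, 8} = {}" "length w = length m" "length w = length u"
  shows "foldr mark_step (zip w (zip m u)) (x, out) = (hd_or x u, map (\<lambda>_. False) w @ out)"
  using assms
proof (induction w arbitrary: m u)
  case (Cons l w)
  then obtain c m' d u' where "m = c # m'" "u = d # u'" by (metis Suc_length_conv)
  then show ?case using Cons by (auto simp: mark_step_def)
qed (simp add: hd_or_def)

text \<open>The Boolean handed from right to left is the truth value of the node just read. At a
  quantifier this is the root of its formula.\<close>

lemma mark_step_word:
  assumes "node_values s \<Psi> u"
  shows "\<exists>y. foldr mark_step (zip (word_code g \<Psi>) (zip (map (slot_value F) (slots \<Psi>)) u)) (x, out) =
    (y, map (slot_value (\<lambda>Q \<phi>. next_mark Q (F Q \<phi>) (s \<phi>))) (slots \<Psi>) @ out)"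
  using assms
proof (induction \<Psi> arbitrary: u x out)
  case (Quant Q \<phi>)
  obtain b where u: "u = b # map s (subformulas \<phi>)" using Quant by auto
  obtain l where l: "subformulas \<phi> = \<phi> # l" using hd_subformulas by blast
  let ?m = "map (\<lambda>_. False) (subformulas \<phi>)"
  have eq: "map (\<lambda>_. False) (formula_code g \<phi>) = ?m"
    by (simp only: map_replicate_const length_subformulas[of \<phi> g])
  have "foldr mark_step (zip (formula_code g \<phi>) (zip ?m (map s (subformulas \<phi>)))) (x, out) =
      (hd_or x (map s (subformulas \<phi>)), ?m @ out)"
    unfolding eq[symmetric]
    by (rule mark_step_formula[OF formula_code_no_quant]) (simp_all add: length_subformulas[of _ g])
  moreover have "hd_or x (map s (subformulas \<phi>)) = s \<phi>" by (simp add: l)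
  ultimately have "foldr mark_step (zip (word_code g (Quant Q \<phi>)) (zip (map (slot_value F) (slots (Quant Q \<phi>))) u)) (x, out) =
      mark_step (letter_code g (A_Quant Q), F Q \<phi>, b) (s \<phi>, ?m @ out)"
    by (simp add: u comp_def)
  also have "\<dots> = (b, map (slot_value (\<lambda>Q \<phi>. next_mark Q (F Q \<phi>) (s \<phi>))) (slots (Quant Q \<phi>)) @ out)"
    by (cases Q) (simp_all add: mark_step_def comp_def)
  finally show ?case by blast
next
  case (Or_plus \<Psi>1 \<Psi>2)
  then obtain b u1 u2 where u: "u = b # u1 @ u2" "node_values s \<Psi>1 u1" "node_values s \<Psi>2 u2" by auto
  let ?F = "slot_value (\<lambda>Q \<phi>. next_mark Q (F Q \<phi>) (s \<phi>))"
  obtain y2 where 2: "foldr mark_step (zip (word_code g \<Psi>2) (zip (map (slot_value F) (slots \<Psi>2)) u2)) (x, out) =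
      (y2, map ?F (slots \<Psi>2) @ out)" using Or_plus.IH(2)[OF u(3)] by blast
  obtain y1 where 1: "foldr mark_step (zip (word_code g \<Psi>1) (zip (map (slot_value F) (slots \<Psi>1)) u1)) (y2, map ?F (slots \<Psi>2) @ out) =
      (y1, map ?F (slots \<Psi>1) @ map ?F (slots \<Psi>2) @ out)" using Or_plus.IH(1)[OF u(2)] by blast
  show ?case using node_values_length[OF u(2), of g]
    by (simp add: u(1) length_slots[of _ g] 1 2) (simp add: mark_step_def)
next
  case (And_plus \<Psi>1 \<Psi>2)
  then obtain b u1 u2 where u: "u = b # u1 @ u2" "node_values s \<Psi>1 u1" "node_values s \<Psi>2 u2" by auto
  let ?F = "slot_value (\<lambda>Q \<phi>. next_mark Q (F Q \<phi>) (s \<phi>))"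
  obtain y2 where 2: "foldr mark_step (zip (word_code g \<Psi>2) (zip (map (slot_value F) (slots \<Psi>2)) u2)) (x, out) =
      (y2, map ?F (slots \<Psi>2) @ out)" using And_plus.IH(2)[OF u(3)] by blast
  obtain y1 where 1: "foldr mark_step (zip (word_code g \<Psi>1) (zip (map (slot_value F) (slots \<Psi>1)) u1)) (y2, map ?F (slots \<Psi>2) @ out) =
      (y1, map ?F (slots \<Psi>1) @ map ?F (slots \<Psi>2) @ out)" using And_plus.IH(1)[OF u(2)] by blast
  show ?case using node_values_length[OF u(2), of g]
    by (simp add: u(1) length_slots[of _ g] 1 2) (simp add: mark_step_def)
next
  case (Not_plus \<Psi>)
  then obtain b u1 where u: "u = b # u1" "node_values s \<Psi> u1" by auto
  obtain y where "foldr mark_step (zip (word_code g \<Psi>) (zip (map (slot_value F) (slots \<Psi>)) u1)) (x, out) =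
      (y, map (slot_value (\<lambda>Q \<phi>. next_mark Q (F Q \<phi>) (s \<phi>))) (slots \<Psi>) @ out)" using Not_plus.IH[OF u(2)] by blast
  then show ?case by (simp add: u(1)) (simp add: mark_step_def)
qed

text \<open>The formulas on finite traces are evaluated along with the rest, to values without
  meaning. Each leaves exactly one entry on the stack, which its quantifier replaces by the mark.
  For 5 and 8, the two universal quantifiers, the mark signals violation and is negated.\<close>

definition eval_step :: "nat \<times> bool \<Rightarrow> bool list \<Rightarrow> bool list" where
  "eval_step p st =
     (if fst p = 0 then (\<not> hd_or False st) # tl st
      else if fst p = 1 then (hd_or False st \<or> hd_or False (tl st)) # tl (tl st)
      else if fst p = 2 then (hd_or False st \<and> hd_or False (tl st)) # tl (tl st)
      else if fst p = 3 then st
      else if fst p = 4 then tl st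
      else if fst p = 5 \<or> fst p = 8 then (\<not> snd p) # tl st
      else if fst p = 6 \<or> fst p = 7 then snd p # tl st
      else False # st)"

definition eval_marks :: "nat list \<Rightarrow> bool list \<Rightarrow> bool" where
  "eval_marks w m = hd_or False (foldr eval_step (zip w m) [])"

fun eval_plus :: "(prefix_quantifier \<Rightarrow> 'a ppltl \<Rightarrow> bool) \<Rightarrow> 'a ppltl plus \<Rightarrow> bool" where
  "eval_plus F (Quant Q \<phi>) \<longleftrightarrow> (if Q = All_Prefixes \<or> Q = Almost_All_Prefixes then \<not> F Q \<phi> else F Q \<phi>)"
| "eval_plus F (Or_plus \<Psi>1 \<Psi>2) \<longleftrightarrow> eval_plus F \<Psi>1 \<or> eval_plus F \<Psi>2"
| "eval_plus F (And_plus \<Psi>1 \<Psi>2) \<longleftrightarrow> eval_plus F \<Psi>1 \<and> eval_plus F \<Psi>2"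
| "eval_plus F (Not_plus \<Psi>) \<longleftrightarrow> \<not> eval_plus F \<Psi>"

lemma eval_step_formula:
  "length m = length (formula_code g \<phi>) \<Longrightarrow> \<exists>x. foldr eval_step (zip (formula_code g \<phi>) m) st = x # st"
proof (induction \<phi> arbitrary: m st)
  case (PAtom p) then show ?case by (cases m) (auto simp: eval_step_def)
next
  case (PNot \<phi>)
  then obtain b m' where m: "m = b # m'" "length m' = length (formula_code g \<phi>)" by (cases m) auto
  then show ?case using PNot.IH[OF m(2), of st] by (auto simp: eval_step_def)
next
  case (PYesterday \<phi>)
  then obtain b m' where m: "m = b # m'" "length m' = length (formula_code g \<phi>)" by (cases m) auto
  then show ?case using PYesterday.IH[OF m(2), of st] by (auto simp: eval_step_def)
next
  case (POr \<phi> \<psi>)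
  define m1 where "m1 = take (length (formula_code g \<phi>)) (tl m)"
  define m2 where "m2 = drop (length (formula_code g \<phi>)) (tl m)"
  have m: "m = hd m # m1 @ m2" "length m1 = length (formula_code g \<phi>)" "length m2 = length (formula_code g \<psi>)"
    using POr.prems by (cases m; auto simp: m1_def m2_def)+
  obtain x where x: "foldr eval_step (zip (formula_code g \<psi>) m2) st = x # st" using POr.IH(2)[OF m(3)] by blast
  obtain y where y: "foldr eval_step (zip (formula_code g \<phi>) m1) (x # st) = y # x # st" using POr.IH(1)[OF m(2)] by blast
  show ?case by (subst m(1)) (use x y m(2) in \<open>auto simp: eval_step_def\<close>)
next
  case (PAnd \<phi> \<psi>)
  define m1 where "m1 = take (length (formula_code g \<phi>)) (tl m)"
  define m2 where "m2 = drop (length (formula_code g \<phi>)) (tl m)"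
  have m: "m = hd m # m1 @ m2" "length m1 = length (formula_code g \<phi>)" "length m2 = length (formula_code g \<psi>)"
    using PAnd.prems by (cases m; auto simp: m1_def m2_def)+
  obtain x where x: "foldr eval_step (zip (formula_code g \<psi>) m2) st = x # st" using PAnd.IH(2)[OF m(3)] by blast
  obtain y where y: "foldr eval_step (zip (formula_code g \<phi>) m1) (x # st) = y # x # st" using PAnd.IH(1)[OF m(2)] by blast
  show ?case by (subst m(1)) (use x y m(2) in \<open>auto simp: eval_step_def\<close>)
next
  case (PSince \<phi> \<psi>)
  define m1 where "m1 = take (length (formula_code g \<phi>)) (tl m)"
  define m2 where "m2 = drop (length (formula_code g \<phi>)) (tl m)"
  have m: "m = hd m # m1 @ m2" "length m1 = length (formula_code g \<phi>)" "length m2 = length (formula_code g \<psi>)"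
    using PSince.prems by (cases m; auto simp: m1_def m2_def)+
  obtain x where x: "foldr eval_step (zip (formula_code g \<psi>) m2) st = x # st" using PSince.IH(2)[OF m(3)] by blast
  obtain y where y: "foldr eval_step (zip (formula_code g \<phi>) m1) (x # st) = y # x # st" using PSince.IH(1)[OF m(2)] by blast
  show ?case by (subst m(1)) (use x y m(2) in \<open>auto simp: eval_step_def\<close>)
qed

lemma eval_step_word:
  "foldr eval_step (zip (word_code g \<Psi>) (map (slot_value F) (slots \<Psi>))) st = eval_plus F \<Psi> # st"
proof (induction \<Psi> arbitrary: st)
  case (Quant Q \<phi>)
  obtain x where "foldr eval_step (zip (formula_code g \<phi>) (map (\<lambda>_. False) (subformulas \<phi>))) st = x # st"
    using eval_step_formula[of "map (\<lambda>_. False) (subformulas \<phi>)" g \<phi> st] by (auto simp: length_subformulas[of _ g])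
  then have "foldr eval_step (zip (word_code g (Quant Q \<phi>)) (map (slot_value F) (slots (Quant Q \<phi>)))) st =
      eval_step (letter_code g (A_Quant Q), F Q \<phi>) (x # st)"
    by (simp add: comp_def)
  also have "\<dots> = eval_plus F (Quant Q \<phi>) # st" by (cases Q) (simp_all add: eval_step_def)
  finally show ?case .
qed (auto simp: eval_step_def length_slots[of _ g])

lemma eval_marks_correct: "eval_marks (word_code g \<Psi>) (map (slot_value F) (slots \<Psi>)) = eval_plus F \<Psi>"
  by (simp add: eval_marks_def eval_step_word)

text \<open>Prefixes of different lengths are different, so infinitely many prefixes means
  infinitely many positions.\<close>

lemma quant_lang_prefixes:
  fixes \<tau> :: "nat \<Rightarrow> 'a set" and Z :: "'a set list set"
  assumes "\<tau> \<in> infinite_traces AP"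
  defines "s \<equiv> \<lambda>t. map \<tau> [0..<Suc t] \<in> Z"
  shows "\<tau> \<in> quant_lang AP All_Prefixes Z \<longleftrightarrow> (\<forall>t. s t)"
    "\<tau> \<in> quant_lang AP Some_Prefix Z \<longleftrightarrow> (\<exists>t. s t)"
    "\<tau> \<in> quant_lang AP Inf_Many_Prefixes Z \<longleftrightarrow> (\<exists>\<^sub>\<infinity>t. s t)"
    "\<tau> \<in> quant_lang AP Almost_All_Prefixes Z \<longleftrightarrow> \<not> (\<exists>\<^sub>\<infinity>t. \<not> s t)"
proof -
  let ?f = "\<lambda>t. map \<tau> [0..<Suc t]"
  have p: "nonempty_prefixes \<tau> = range ?f"
    unfolding nonempty_prefixes_def by (auto simp del: upt_Suc intro: gr0_implies_Suc dest!: gr0_implies_Suc)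
  have inj: "inj ?f" by (rule injI) (metis diff_zero length_map length_upt Suc_inject)
  have image: "infinite {t \<in> nonempty_prefixes \<tau>. P t} \<longleftrightarrow> (\<exists>\<^sub>\<infinity>t. P (?f t))" for P
  proof -
    have "{t \<in> nonempty_prefixes \<tau>. P t} = ?f ` {t. P (?f t)}" unfolding p by blast
    then show ?thesis using finite_image_iff[OF inj_on_subset[OF inj]] by (simp add: frequently_cofinite)
  qed
  show "\<tau> \<in> quant_lang AP All_Prefixes Z \<longleftrightarrow> (\<forall>t. s t)" "\<tau> \<in> quant_lang AP Some_Prefix Z \<longleftrightarrow> (\<exists>t. s t)"
    using assms(1) by (auto simp: p s_def simp del: upt_Suc)
  show "\<tau> \<in> quant_lang AP Inf_Many_Prefixes Z \<longleftrightarrow> (\<exists>\<^sub>\<infinity>t. s t)"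
    using assms(1) image[of "\<lambda>t. t \<in> Z"] by (simp add: s_def del: upt_Suc)
  show "\<tau> \<in> quant_lang AP Almost_All_Prefixes Z \<longleftrightarrow> \<not> (\<exists>\<^sub>\<infinity>t. \<not> s t)"
  proof -
    have "finite {t \<in> nonempty_prefixes \<tau>. t \<notin> Z} \<longleftrightarrow> \<not> (\<exists>\<^sub>\<infinity>t. \<not> s t)"
      using image[of "\<lambda>t. t \<notin> Z"] unfolding s_def by blast
    then show ?thesis using assms(1) by simp
  qed
qed

text \<open>The sequence of marks for given truth values \<open>s t \<phi>\<close> of the formulas on the prefix of length
  \<open>t + 1\<close>.\<close>

fun marks :: "(nat \<Rightarrow> 'a ppltl \<Rightarrow> bool) \<Rightarrow> nat \<Rightarrow> prefix_quantifier \<Rightarrow> 'a ppltl \<Rightarrow> bool" where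
  "marks s 0 Q \<phi> = False"
| "marks s (Suc t) Q \<phi> = next_mark Q (marks s t Q \<phi>) (s t \<phi>)"

lemma eval_plus_marks:
  fixes \<tau> :: "nat \<Rightarrow> 'a set"
  assumes \<tau>: "\<tau> \<in> infinite_traces AP"
    and s: "\<And>t \<phi>. \<phi> \<in> set_plus \<Psi> \<Longrightarrow> s t \<phi> \<longleftrightarrow> map \<tau> [0..<Suc t] \<in> lang \<phi>"
  shows "eval_plus (\<lambda>Q \<phi>. \<exists>\<^sub>\<infinity>t. marks s (Suc t) Q \<phi>) \<Psi> \<longleftrightarrow> \<tau> \<in> plus_lang lang AP \<Psi>"
  using s
proof (induction \<Psi>)
  case (Quant Q \<phi>)
  have q: "s t \<phi> \<longleftrightarrow> map \<tau> [0..<Suc t] \<in> lang \<phi>" for t using Quant by simp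
  have some: "marks s t Some_Prefix \<phi> \<longleftrightarrow> (\<exists>i<t. s i \<phi>)" for t
    by (induction t) (auto simp: less_Suc_eq)
  have all: "marks s t All_Prefixes \<phi> \<longleftrightarrow> (\<exists>i<t. \<not> s i \<phi>)" for t
    by (induction t) (auto simp: less_Suc_eq)
  \<comment> \<open>A persistent mark is present infinitely often iff it is ever set.\<close>
  have inf: "(\<exists>\<^sub>\<infinity>t. \<exists>i<Suc t. P i) \<longleftrightarrow> (\<exists>i. P i)" for P :: "nat \<Rightarrow> bool"
    unfolding INFM_nat_le by (metis le_SucI le_add1 le_add2 less_Suc_eq_le)
  show ?case
  proof (cases Q)
    case All_Prefixes
    then show ?thesis using quant_lang_prefixes(1)[OF \<tau>, of "lang \<phi>"] q
      by (simp add: all inf del: marks.simps upt_Suc quant_lang.simps)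
  next
    case Some_Prefix
    then show ?thesis using quant_lang_prefixes(2)[OF \<tau>, of "lang \<phi>"] q
      by (simp add: some inf del: marks.simps upt_Suc quant_lang.simps)
  next
    case Inf_Many_Prefixes
    then show ?thesis using quant_lang_prefixes(3)[OF \<tau>, of "lang \<phi>"] q
      by (simp del: upt_Suc quant_lang.simps)
  next
    case Almost_All_Prefixes
    then show ?thesis using quant_lang_prefixes(4)[OF \<tau>, of "lang \<phi>"] q
      by (simp del: upt_Suc quant_lang.simps)
  qed
qed (use \<tau> in auto)

text \<open>A base state consists of the state of a monitor for the formulas on finite traces, the marks, the
  latest appearance record, its prefix hit last, and whether this prefix falsifies the formula.\<close>

type_synonym 'm base = "'m \<times> bool list \<times> nat list \<times> nat list \<times> bool"

definition ids :: "nat list \<Rightarrow> nat list" where "ids w = [0..<length w]"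

definition marked :: "nat list \<Rightarrow> bool list \<Rightarrow> nat list" where
  "marked w m = map fst (filter snd (zip (ids w) m))"

definition base_update :: "nat list \<Rightarrow> 'm \<Rightarrow> bool list \<Rightarrow> 'm base \<Rightarrow> 'm base" where
  "base_update w ms u b =
     (let m = mark_update w (fst (snd b)) u; \<pi> = fst (snd (snd b)); M = set (marked w m); H = lar_head M \<pi>
      in (ms, m, lar_move M \<pi>, H, \<not> eval_marks w (map (\<lambda>i. i \<in> set H) (ids w))))"

definition base_init :: "nat list \<Rightarrow> 'm \<Rightarrow> 'm base" where
  "base_init w ms = (ms, map (\<lambda>_. False) w, ids w, [], False)"

definition level :: "'m base \<Rightarrow> nat" where "level b = length (fst (snd (snd (snd b))))"
definition bad :: "'m base \<Rightarrow> bool" where "bad b = snd (snd (snd (snd b)))"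

lemma set_marked: "length m = length w \<Longrightarrow> set (marked w m) = {i. i < length w \<and> m ! i}"
proof -
  assume m: "length m = length w"
  have "set (marked w m) = {i. (i, True) \<in> set (zip [0..<length w] m)}"
    by (force simp: marked_def ids_def)
  moreover have "(i, True) \<in> set (zip [0..<length w] m) \<longleftrightarrow> i < length w \<and> m ! i" for i
    using m by (auto simp: in_set_zip intro!: exI[of _ i])
  ultimately show ?thesis by simp
qed

text \<open>By \<open>lar_limit\<close> some level \<open>k\<close> occurs infinitely often and no
  larger one does, and late hits of length \<open>k\<close> show exactly the nodes marked infinitely
  often. Their flag is therefore the falsity of the formula on the trace, and it decides the parity
  of the limit. \<open>dir\<close>, the identity or reversal, is the direction in which the monitor
  reads the trace.\<close>

theorem base_parity:
  fixes b :: "nat \<Rightarrow> 'm base" and as :: "nat \<Rightarrow> nat list" and g :: "'a \<Rightarrow> nat" and AP :: "'a set"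
  defines "\<tau> \<equiv> \<lambda>i. decode g AP (as i)"
  assumes over: "\<forall>\<phi>\<in>set_plus \<Psi>. set_ppltl \<phi> \<subseteq> AP"
    and w: "w = word_code g \<Psi>"
    and b0: "b 0 = base_init w ms0"
    and step: "\<And>t. b (Suc t) = base_update w (ms t) (truth_values w (dir (map as [0..<Suc t]))) (b t)"
    and dir: "\<And>t. length (dir (map as [0..<Suc t])) = Suc t"
    and lang: "\<And>\<phi> t. \<phi> \<in> set_plus \<Psi> \<Longrightarrow> map \<tau> [0..<Suc t] \<in> lang \<phi> \<longleftrightarrow>
      ppltl_sat (map (decode g AP) (dir (map as [0..<Suc t]))) t \<phi>"
  shows "parity_win (\<lambda>t. priority (level (b (Suc t))) (bad (b (Suc t)))) \<longleftrightarrow> \<tau> \<in> plus_lang lang AP \<Psi>"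
proof -
  let ?n = "length w"
  define s where "s t = truth g AP (dir (map as [0..<Suc t]))" for t
  define m where "m t = map (slot_value (marks s t)) (slots \<Psi>)" for t
  have len: "length (m t) = ?n" for t by (simp add: m_def length_slots[of _ g] w)
  have u: "node_values (s t) \<Psi> (truth_values w (dir (map as [0..<Suc t])))" for t
    unfolding s_def w by (rule truth_values_correct[OF over])
  have mark: "mark_update w (m t) (truth_values w (dir (map as [0..<Suc t]))) = m (Suc t)" for t
    using mark_step_word[OF u[of t], of g "marks s t" False "[]"]
    by (auto simp: mark_update_def m_def w slot_value_def cong: option.case_cong)
  have bm: "fst (snd (b t)) = m t" for t
  proof (induction t)
    case 0
    have "map (\<lambda>_. False) w = map (slot_value (marks s 0)) (slots \<Psi>)"
      by (rule nth_equalityI) (auto simp: length_slots[of _ g] w slot_value_def split: option.splits)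
    then show ?case by (simp add: b0 base_init_def m_def)
  next
    case (Suc t)
    then show ?case by (simp add: step base_update_def Let_def mark del: upt_Suc)
  qed
  define M where "M t = set (marked w (m (Suc t)))" for t
  define \<pi> where "\<pi> t = fst (snd (snd (b t)))" for t
  have \<pi>: "\<pi> 0 = ids w" "\<pi> (Suc t) = lar_move (M t) (\<pi> t)" for t
    by (simp_all add: \<pi>_def b0 base_init_def step base_update_def Let_def bm mark M_def del: upt_Suc)
  have M: "M t = {i. i < ?n \<and> m (Suc t) ! i}" for t
    unfolding M_def by (rule set_marked) (simp add: len)
  have H: "fst (snd (snd (snd (b (Suc t))))) = lar_head (M t) (\<pi> t)" for t
    by (simp add: \<pi>_def step base_update_def Let_def bm mark M_def del: upt_Suc)
  have bad: "bad (b (Suc t)) \<longleftrightarrow> \<not> eval_marks w (map (\<lambda>i. i \<in> set (lar_head (M t) (\<pi> t))) (ids w))" for t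
    by (simp add: bad_def \<pi>_def step base_update_def Let_def bm mark M_def del: upt_Suc)
  obtain k where k: "\<exists>\<^sub>\<infinity>t. length (lar_head (M t) (\<pi> t)) = k" "\<forall>\<^sub>\<infinity>t. length (lar_head (M t) (\<pi> t)) \<le> k"
    "\<forall>\<^sub>\<infinity>t. length (lar_head (M t) (\<pi> t)) = k \<longrightarrow> set (lar_head (M t) (\<pi> t)) = {i. \<exists>\<^sub>\<infinity>t. i \<in> M t}"
  proof -
    have "distinct (\<pi> 0)" "M t \<subseteq> set (\<pi> 0)" for t by (auto simp: \<pi>(1) M ids_def)
    from lar_limit[of \<pi> M, OF this \<pi>(2)] show ?thesis using that by blast
  qed
  let ?F = "\<lambda>Q \<phi>. \<exists>\<^sub>\<infinity>t. marks s (Suc t) Q \<phi>"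
  have "\<tau> \<in> infinite_traces AP" by (auto simp: infinite_traces_def \<tau>_def decode_def)
  then have F: "eval_plus ?F \<Psi> \<longleftrightarrow> \<tau> \<in> plus_lang lang AP \<Psi>"
  proof (rule eval_plus_marks)
    fix t \<phi> assume "\<phi> \<in> set_plus \<Psi>"
    then show "s t \<phi> \<longleftrightarrow> map \<tau> [0..<Suc t] \<in> lang \<phi>"
      using dir[of t] by (auto simp: s_def truth_def lang simp del: upt_Suc)
  qed
  have slot_inf: "(\<exists>\<^sub>\<infinity>t. slot_value (marks s (Suc t)) c) \<longleftrightarrow> slot_value ?F c" for c
    by (cases c) (auto simp: slot_value_def simp del: marks.simps split: prod.splits)
  have Inf: "map (\<lambda>i. i \<in> {i. \<exists>\<^sub>\<infinity>t. i \<in> M t}) (ids w) = map (slot_value ?F) (slots \<Psi>)"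
  proof (rule nth_equalityI)
    show "length (map (\<lambda>i. i \<in> {i. \<exists>\<^sub>\<infinity>t. i \<in> M t}) (ids w)) = length (map (slot_value ?F) (slots \<Psi>))"
      by (simp add: ids_def w length_slots[of _ g])
    fix i assume "i < length (map (\<lambda>i. i \<in> {i. \<exists>\<^sub>\<infinity>t. i \<in> M t}) (ids w))"
    then have i: "i < ?n" "i < length (slots \<Psi>)" by (auto simp: ids_def w length_slots[of _ g])
    then have "(\<exists>\<^sub>\<infinity>t. i \<in> M t) \<longleftrightarrow> (\<exists>\<^sub>\<infinity>t. slot_value (marks s (Suc t)) (slots \<Psi> ! i))"
      by (simp add: M m_def del: marks.simps)
    then show "map (\<lambda>i. i \<in> {i. \<exists>\<^sub>\<infinity>t. i \<in> M t}) (ids w) ! i = map (slot_value ?F) (slots \<Psi>) ! i"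
      using i slot_inf by (simp add: ids_def del: marks.simps)
  qed
  define bd where "bd \<longleftrightarrow> \<not> \<tau> \<in> plus_lang lang AP \<Psi>"
  obtain T where T: "\<And>t. T \<le> t \<Longrightarrow> length (lar_head (M t) (\<pi> t)) \<le> k"
    "\<And>t. T \<le> t \<Longrightarrow> length (lar_head (M t) (\<pi> t)) = k \<Longrightarrow> set (lar_head (M t) (\<pi> t)) = {i. \<exists>\<^sub>\<infinity>t. i \<in> M t}"
  proof -
    from eventually_conj[OF k(2,3)] show ?thesis using that unfolding MOST_nat_le by blast
  qed
  have bd: "bad (b (Suc t)) = bd" if "T \<le> t" "level (b (Suc t)) = k" for t
  proof -
    have "set (lar_head (M t) (\<pi> t)) = {i. \<exists>\<^sub>\<infinity>t. i \<in> M t}" using T(2) that by (simp add: level_def H)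
    then have "bad (b (Suc t)) \<longleftrightarrow> \<not> eval_marks w (map (slot_value ?F) (slots \<Psi>))" unfolding bad Inf[symmetric] by simp
    then show ?thesis using eval_marks_correct[of g \<Psi> ?F] F by (simp add: w bd_def)
  qed
  let ?p = "\<lambda>t. priority (level (b (Suc t))) (bad (b (Suc t)))"
  have 1: "\<exists>\<^sub>\<infinity>t. ?p t = priority k bd" unfolding INFM_nat_le
  proof
    fix N
    obtain t where "max N T \<le> t" "length (lar_head (M t) (\<pi> t)) = k" using k(1) unfolding INFM_nat_le by blast
    then show "\<exists>n\<ge>N. ?p n = priority k bd" using bd[of t] by (intro exI[of _ t]) (simp add: level_def H)
  qed
  have 2: "\<forall>\<^sub>\<infinity>t. ?p t \<le> priority k bd" unfolding MOST_nat_le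
  proof (intro exI[of _ T] allI impI)
    fix t assume t: "T \<le> t"
    have "level (b (Suc t)) \<le> k" using T(1)[OF t] by (simp add: level_def H)
    then show "?p t \<le> priority k bd" using bd[OF t] by (cases "level (b (Suc t)) = k") (auto simp: priority_def)
  qed
  show ?thesis
  proof
    assume "parity_win ?p"
    then obtain q where q: "even q" "\<exists>\<^sub>\<infinity>t. ?p t = q" "\<forall>\<^sub>\<infinity>t. ?p t \<le> q" unfolding parity_win_def by blast
    then have "q = priority k bd" using limsup_unique[OF q(2,3) 1 2] by simp
    then show "\<tau> \<in> plus_lang lang AP \<Psi>" using q(1) by (auto simp: priority_def bd_def split: if_splits)
  next
    assume "\<tau> \<in> plus_lang lang AP \<Psi>"
    then have "even (priority k bd)" by (simp add: priority_def bd_def)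
    then show "parity_win ?p" unfolding parity_win_def using 1 2 by blast
  qed
qed

section \<open>Polynomial time for the automaton\<close>

lemma pt_fun2:
  assumes "pt (\<lambda>_. 1) (\<lambda>z. F (fst z) (snd z))" "pt \<nu> f" "pt \<nu> g"
  shows "pt \<nu> (\<lambda>x. F (f x) (g x))"
  using pt_comp1[OF assms(1) pt_pair[OF assms(2,3)]] by simp

lemma pt_fun3:
  assumes "pt (\<lambda>_. 1) (\<lambda>z. F (fst z) (fst (snd z)) (snd (snd z)))" "pt \<nu> f" "pt \<nu> g" "pt \<nu> h"
  shows "pt \<nu> (\<lambda>x. F (f x) (g x) (h x))"
  using pt_comp1[OF assms(1) pt_pair[OF assms(2) pt_pair[OF assms(3,4)]]] by simp

lemma pt_fun4:
  assumes "pt (\<lambda>_. 1) (\<lambda>z. F (fst z) (fst (snd z)) (fst (snd (snd z))) (snd (snd (snd z))))"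
    "pt \<nu> f" "pt \<nu> g" "pt \<nu> h" "pt \<nu> i"
  shows "pt \<nu> (\<lambda>x. F (f x) (g x) (h x) (i x))"
  using pt_comp1[OF assms(1) pt_pair[OF assms(2) pt_pair[OF assms(3) pt_pair[OF assms(4,5)]]]] by simp

lemma pt_app1:
  assumes "pt \<mu> F" "pt (\<lambda>x. \<mu> (w x)) w"
  shows "pt (\<lambda>x. \<mu> (w x)) (\<lambda>x. F (w x))"
  by (rule pt_comp[OF assms]) (auto intro: pb_mu)

lemma pt_app2:
  assumes "pt (\<lambda>z. \<mu> (fst z)) (\<lambda>z. F (fst z) (snd z))" "pt (\<lambda>x. \<mu> (w x)) w" "pt (\<lambda>x. \<mu> (w x)) f"
  shows "pt (\<lambda>x. \<mu> (w x)) (\<lambda>x. F (w x) (f x))"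
  using pt_comp[OF assms(1) pt_pair[OF assms(2,3)]] by (simp add: pb_mu)

lemma pt_app3:
  assumes "pt (\<lambda>z. \<mu> (fst z)) (\<lambda>z. F (fst z) (fst (snd z)) (snd (snd z)))" "pt (\<lambda>x. \<mu> (w x)) w"
    "pt (\<lambda>x. \<mu> (w x)) f" "pt (\<lambda>x. \<mu> (w x)) g"
  shows "pt (\<lambda>x. \<mu> (w x)) (\<lambda>x. F (w x) (f x) (g x))"
  using pt_comp[OF assms(1) pt_pair[OF assms(2) pt_pair[OF assms(3,4)]]] by (simp add: pb_mu)

lemma sz_pair: "sz p = Suc (sz (fst p) + sz (snd p))"
  by (cases p) simp

lemma sz_tl2: "sz (tl (tl xs)) \<le> sz xs"
  using sz_tl[of xs] sz_tl[of "tl xs"] by simp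

lemma pt_truth_step: "pt (\<lambda>_. 1) (\<lambda>z. truth_step (fst z) (fst (snd z)) (snd (snd z)))"
  unfolding truth_step_def Let_def hd_or_def by (intro pt_intros)

lemma sz_truth_step: "sz (truth_step a p s) \<le> sz s + 20"
proof -
  obtain v st where e: "truth_step a p s = ((v, snd p) # st, v # snd s)" "sz st \<le> sz (fst s)"
  proof -
    show ?thesis
      by (rule that[of _ "if fst p \<in> set [1, 2, 4] then tl (tl (fst s))
          else if fst p \<in> set [0, 3, 5, 6, 7, 8] then tl (fst s) else fst s"])
        (simp_all only: truth_step_def Let_def, simp add: sz_tl sz_tl2)
  qed
  show ?thesis using e(2) sz_bool[of v] sz_bool[of "snd p"] by (simp add: e(1) sz_pair[of s])
qed

lemma pt_truth_update_base: "pt (\<lambda>_. 1) (\<lambda>z. truth_update (fst z) (fst (snd z)) (snd (snd z)))"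
  unfolding truth_update_def
proof (intro pt_snd pt_foldr_add[where h = "\<lambda>_. 20"])
  show "pt (\<lambda>z. 1) (\<lambda>z. truth_step (fst (snd (fst z))) (fst (snd z)) (snd (snd z)))"
    by (intro pt_fun3[OF pt_truth_step] pt_intros)
qed (intro pt_intros pb_const sz_truth_step)+

lemmas pt_truth_update = pt_fun3[OF pt_truth_update_base]

lemma pt_mark_step: "pt (\<lambda>_. 1) (\<lambda>z. mark_step (fst z) (snd z))"
  unfolding mark_step_def by (intro pt_intros)

lemma pt_mark_update_base: "pt (\<lambda>_. 1) (\<lambda>z. mark_update (fst z) (fst (snd z)) (snd (snd z)))"
  unfolding mark_update_def
proof (intro pt_snd pt_foldr_add[where h = "\<lambda>_. 20"])
  show "pt (\<lambda>z. 1) (\<lambda>z. mark_step (fst (snd z)) (snd (snd z)))"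
    by (intro pt_fun2[OF pt_mark_step] pt_intros)
  show "sz (mark_step p s) \<le> sz s + 20" for p s
  proof -
    obtain b where "mark_step p s = (snd (snd p), b # snd s)" by (simp add: mark_step_def)
    then show ?thesis using sz_bool[of "snd (snd p)"] sz_bool[of b] by (simp add: sz_pair[of s])
  qed
qed (intro pt_intros pb_const)+

lemmas pt_mark_update = pt_fun3[OF pt_mark_update_base]

lemma pt_eval_step: "pt (\<lambda>_. 1) (\<lambda>z. eval_step (fst z) (snd z))"
  unfolding eval_step_def hd_or_def by (intro pt_intros)

lemma sz_eval_step: "sz (eval_step p s) \<le> sz s + 20"
proof -
  have *: "sz (b # tl s) \<le> sz s + 20" "sz (b # tl (tl s)) \<le> sz s + 20" "sz (b # s) \<le> sz s + 20" for b :: bool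
    using sz_bool[of b] sz_tl[of s] sz_tl2[of s] by simp_all
  have "sz s \<le> sz s + 20" "sz (tl s) \<le> sz s + 20" using sz_tl[of s] by simp_all
  with * show ?thesis unfolding eval_step_def by (simp del: sz_simps split: if_split)
qed

lemma pt_eval_marks_base: "pt (\<lambda>_. 1) (\<lambda>z. eval_marks (fst z) (snd z))"
  unfolding eval_marks_def hd_or_def
proof (intro pt_if pt_eq pt_hd pt_const)
  show "pt (\<lambda>_. 1) (\<lambda>z. foldr eval_step (zip (fst z) (snd z)) [])"
  proof (intro pt_foldr_add[where h = "\<lambda>_. 20"])
    show "pt (\<lambda>z. 1) (\<lambda>z. eval_step (fst (snd z)) (snd (snd z)))"
      by (intro pt_fun2[OF pt_eval_step] pt_intros)
  qed (intro pt_intros pb_const sz_eval_step)+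
  then show "pt (\<lambda>_. 1) (\<lambda>z. foldr eval_step (zip (fst z) (snd z)) [])" .
qed

lemmas pt_eval_marks = pt_fun2[OF pt_eval_marks_base]

lemma sz_upt: "sz [0..<n] \<le> 1 + n * (2 * n + 2)"
proof -
  have "sz [0..<n] \<le> 1 + length [0..<n] * ((2 * n + 1) + 1)"
    by (rule sz_list_bound) (simp add: sz_nat)
  then show ?thesis by simp
qed

lemma pt_ids_base: "pt (\<lambda>_. 1) ids"
proof -
  let ?g = "\<lambda>a (_ :: nat). a @ [length a]"
  have fold: "foldl ?g [] w = [0..<length w]" for w by (induction w rule: rev_induct) auto
  have "pt (\<lambda>_. 1) (\<lambda>w. foldl ?g [] w)"
  proof (rule pt_foldl_context)
    show "pb (\<lambda>_. 1) (\<lambda>w :: nat list. 1 + sz w * (2 * sz w + 2))" by (intro pb_intros)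
    fix w :: "nat list" and i assume i: "i \<le> length w"
    then have "i \<le> sz w" using length_less_sz[of w] by simp
    then have "1 + i * (2 * i + 2) \<le> 1 + sz w * (2 * sz w + 2)" by (intro add_left_mono mult_le_mono) auto
    then show "sz (foldl ?g [] (take i w)) \<le> 1 + sz w * (2 * sz w + 2)"
      using sz_upt[of i] i by (simp add: fold min_def)
  qed (intro pt_intros)+
  then show ?thesis by (simp add: fold ids_def[abs_def])
qed

lemmas pt_ids = pt_comp1[OF pt_ids_base]

lemma pt_marked: "pt \<mu> f \<Longrightarrow> pt \<mu> g \<Longrightarrow> pt \<mu> (\<lambda>x. marked (f x) (g x))"
  unfolding marked_def by (intro pt_intros pt_ids)

lemma pt_lar_head_base: "pt (\<lambda>_. 1) (\<lambda>z. lar_head (set (fst z)) (snd z :: 'a :: enc list))"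
  unfolding lar_head_def
proof (intro pt_foldr_add[where h = "\<lambda>z. Suc (sz z)"])
  show "sz (if i \<in> set (fst c) \<or> l \<noteq> [] then i # l else l) \<le> sz l + Suc (sz (c, i))" for c :: "'a list \<times> 'a list" and i l by simp
qed (intro pt_intros pb_intros)+

lemma pt_lar_move: "pt \<mu> f \<Longrightarrow> pt \<mu> g \<Longrightarrow> pt \<mu> (\<lambda>x. lar_move (set (f x)) (g x))"
  unfolding lar_move_def by (intro pt_intros pt_context)

lemma pt_base_update_base:
  "pt (\<lambda>_. 1) (\<lambda>z. base_update (fst z) (fst (snd z)) (fst (snd (snd z))) (snd (snd (snd z))))"
  unfolding base_update_def Let_def
  by (intro pt_intros pt_mark_update pt_marked pt_lar_move pt_fun2[OF pt_lar_head_base] pt_eval_marks pt_ids)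

lemmas pt_base_update = pt_fun4[OF pt_base_update_base]

definition update_counters :: "nat \<Rightarrow> nat list \<Rightarrow> bool \<Rightarrow> nat list \<Rightarrow> nat list" where
  "update_counters B H fl cs = (let r = foldl (\<lambda>r _. tl r) cs H in
     if cs = [] then [] else if fl \<and> hd r = B then []
     else map (\<lambda>_. 0) H @ (if fl then Suc (hd r) else hd r) # tl r)"

lemma foldl_tl: "foldl (\<lambda>r _. tl r) cs H = drop (length H) cs"
  by (induction H arbitrary: cs) (auto simp: drop_Suc)

lemma update_counters_eq: "update_counters B H fl cs = upd_counters B (length H) fl cs"
  by (simp add: update_counters_def upd_counters_def foldl_tl map_replicate_const Let_def)

lemma pt_foldl_tl: "pt \<mu> f \<Longrightarrow> pt \<mu> h \<Longrightarrow> pt \<mu> (\<lambda>c. foldl (\<lambda>r _. tl r) (f c) (h c))"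
  by (rule pt_foldl_add[where h = "\<lambda>_. 0"]) (auto intro!: pt_intros pb_const simp: sz_tl)

lemma pt_update_counters:
  "pt \<mu> b \<Longrightarrow> pt \<mu> h \<Longrightarrow> pt \<mu> d \<Longrightarrow> pt \<mu> c \<Longrightarrow> pt \<mu> (\<lambda>x. update_counters (b x) (h x) (d x) (c x))"
  unfolding update_counters_def Let_def by (intro pt_intros pt_foldl_tl)

text \<open>The position of \<open>x\<close> in \<open>xs\<close> written in unary, directly in the
  output alphabet: 11 is the number of \<open>A_Tick\<close>.\<close>

definition ticks :: "'a \<Rightarrow> 'a list \<Rightarrow> nat list" where
  "ticks x xs = foldr (\<lambda>y l. if y = x then [] else 11 # l) xs []"

lemma pt_ticks_base: "pt (\<lambda>_. 1) (\<lambda>z. ticks (fst z) (snd z :: 'a :: enc list))"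
  unfolding ticks_def
proof (intro pt_foldr_add[where h = "\<lambda>_. 1 + sz (11 :: nat)"])
  show "sz (if y = fst c then [] else 11 # l) \<le> sz l + (1 + sz (11 :: nat))" for c :: "'a \<times> 'a list" and y and l :: "nat list"
    using sz_pos[of l] by (auto simp del: sz_pos)
qed (intro pt_intros pb_intros)+

lemmas pt_ticks = pt_fun2[OF pt_ticks_base]

lemma whl_context: "whl (\<lambda>z. t (snd z)) (\<lambda>z. (fst z, b (fst z) (snd z))) (c, s) = (c, whl t (b c) s)"
proof -
  have "((\<lambda>z. (fst z, b (fst z) (snd z))) ^^ i) (c, s) = (c, (b c ^^ i) s)" for i
    by (induction i) auto
  then show ?thesis by (simp add: whl_def)
qed

lemma pt_whl_context:
  assumes t: "pt (\<lambda>_. 1) t" and b: "pt (\<lambda>z. \<mu> (fst z)) (\<lambda>z. b (fst z) (snd z))" and s: "pt \<mu> s" and N: "pb \<mu> N"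
    and run: "\<And>c. 0 < \<mu> c \<Longrightarrow> \<exists>m\<le>N c. \<not> t ((b c ^^ m) (s c)) \<and> (\<forall>i<m. t ((b c ^^ i) (s c))) \<and>
      (\<forall>i\<le>m. sz ((b c ^^ i) (s c)) \<le> N c)"
  shows "pt \<mu> (\<lambda>c. whl t (b c) (s c))"
proof -
  let ?t = "\<lambda>z. t (snd z)" and ?b = "\<lambda>z. (fst z, b (fst z) (snd z))"
  let ?\<mu> = "\<lambda>z. if snd z = s (fst z) then \<mu> (fst z) else 0"
  have f: "(?b ^^ i) (c, x) = (c, (b c ^^ i) x)" for i c x by (induction i) auto
  obtain k where k: "\<And>c. 0 < \<mu> c \<Longrightarrow> N c \<le> (\<mu> c + sz c) ^ k" using N unfolding pb_def by (rule exE) blast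
  let ?N = "\<lambda>z. sz z + (\<mu> (fst z) + N (fst z))"
  have "pt ?\<mu> (whl ?t ?b)"
  proof (rule pt_whl)
    show "pt (\<lambda>_. 1) ?t" by (rule pt_comp1[OF t pt_snd[OF pt_id]])
    show "pt (\<lambda>z. \<mu> (fst z)) ?b" by (intro pt_pair pt_fst pt_id b)
    have "pb ?\<mu> (\<lambda>z. N (fst z))" unfolding pb_def
    proof (intro exI[of _ k] allI impI)
      fix z assume z: "0 < ?\<mu> z"
      then have "N (fst z) \<le> (\<mu> (fst z) + sz (fst z)) ^ k" using k[of "fst z"] by (simp split: if_splits)
      also have "\<dots> \<le> (?\<mu> z + sz z) ^ k" using z sz_fst[of z] by (intro power_mono) (simp_all split: if_splits)
      finally show "N (fst z) \<le> (?\<mu> z + sz z) ^ k" .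
    qed
    moreover have "pb ?\<mu> (\<lambda>z. \<mu> (fst z))" by (rule pb_mono[OF pb_mu]) (simp split: if_splits)
    ultimately show "pb ?\<mu> ?N" by (intro pb_add pb_sz)
    fix z assume "0 < ?\<mu> z"
    then obtain c where c: "z = (c, s c)" "0 < \<mu> c" by (cases z) (simp split: if_splits)
    obtain m where m: "m \<le> N c" "\<not> t ((b c ^^ m) (s c))" "\<forall>i<m. t ((b c ^^ i) (s c))" "\<forall>i\<le>m. sz ((b c ^^ i) (s c)) \<le> N c"
      using run[OF c(2)] by blast
    show "\<exists>m\<le>?N z. \<not> ?t ((?b ^^ m) z) \<and> (\<forall>i\<le>m. sz ((?b ^^ i) z) \<le> ?N z) \<and>
      (\<forall>i<m. ?t ((?b ^^ i) z) \<and> 0 < \<mu> (fst ((?b ^^ i) z)) \<and> \<mu> (fst ((?b ^^ i) z)) \<le> ?N z)"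
      unfolding c(1) f using m c(2) by (intro exI[of _ m]) (simp add: le_SucI trans_le_add2 add_le_mono)
  qed
  moreover have "pt \<mu> (\<lambda>c. (c, s c))" by (intro pt_pair pt_id s)
  ultimately have "pt \<mu> (\<lambda>c. whl ?t ?b (c, s c))" by (rule pt_comp) (simp_all add: pb_mu)
  from pt_snd[OF this] show ?thesis unfolding whl_context by simp
qed

section \<open>Worklist search for the reachable states\<close>

lemma whl_measure:
  fixes f :: "'s \<Rightarrow> nat"
  assumes "\<And>s. I s \<Longrightarrow> t s \<Longrightarrow> I (b s) \<and> f (b s) < f s" "I s"
  shows "\<exists>m\<le>f s. \<not> t ((b ^^ m) s) \<and> (\<forall>i<m. t ((b ^^ i) s)) \<and> (\<forall>i\<le>m. I ((b ^^ i) s) \<and> f ((b ^^ i) s) \<le> f s)"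
  using assms(2)
proof (induction "f s" arbitrary: s rule: less_induct)
  case less
  show ?case
  proof (cases "t s")
    case True
    have s: "I (b s)" "f (b s) < f s" using assms(1)[OF less.prems True] by auto
    obtain m where m: "m \<le> f (b s)" "\<not> t ((b ^^ m) (b s))" "\<forall>i<m. t ((b ^^ i) (b s))"
      "\<forall>i\<le>m. I ((b ^^ i) (b s)) \<and> f ((b ^^ i) (b s)) \<le> f (b s)"
      using less.hyps[OF s(2,1)] by auto
    have shift: "(b ^^ Suc i) s = (b ^^ i) (b s)" for i by (simp add: funpow_swap1)
    show ?thesis
    proof (intro exI[of _ "Suc m"] conjI allI impI)
      show "Suc m \<le> f s" using m(1) s(2) by simp
      show "\<not> t ((b ^^ Suc m) s)" unfolding shift by (rule m(2))
      show "t ((b ^^ i) s)" if "i < Suc m" for i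
        using that m(3) True by (cases i) (simp_all only: shift, simp_all)
      have all: "I ((b ^^ i) s) \<and> f ((b ^^ i) s) \<le> f s" if i: "i \<le> Suc m" for i
      proof (cases i)
        case (Suc j)
        then have "I ((b ^^ j) (b s)) \<and> f ((b ^^ j) (b s)) \<le> f (b s)" using m(4) i by simp
        then show ?thesis unfolding Suc shift using s(2) by simp
      qed (use less.prems in simp)
      show "I ((b ^^ i) s)" "f ((b ^^ i) s) \<le> f s" if "i \<le> Suc m" for i using all[OF that] by auto
    qed
  qed (use less.prems in auto)
qed

text \<open>Elements are tested when they leave the worklist, which may contain duplicates; this
  keeps a step free of searches through the successors.\<close>

definition reach_step :: "('s \<Rightarrow> 's list) \<Rightarrow> 's list \<times> 's list \<Rightarrow> 's list \<times> 's list" where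
  "reach_step f z = (if hd (fst z) \<in> set (snd z) then (tl (fst z), snd z)
     else (f (hd (fst z)) @ tl (fst z), hd (fst z) # snd z))"

definition reach :: "('s \<Rightarrow> 's list) \<Rightarrow> 's \<Rightarrow> 's list" where
  "reach f s = snd (whl (\<lambda>z. fst z \<noteq> []) (reach_step f) ([s], []))"

context
  fixes f :: "'s \<Rightarrow> 's list" and s :: 's and U :: "'s set" and L :: nat
  assumes U: "finite U" "s \<in> U" "\<And>x. x \<in> U \<Longrightarrow> set (f x) \<subseteq> U" and L: "\<And>x. length (f x) \<le> L"
begin

definition reach_inv :: "'s list \<times> 's list \<Rightarrow> bool" where
  "reach_inv z \<longleftrightarrow> set (fst z) \<subseteq> U \<and> set (snd z) \<subseteq> U \<and> distinct (snd z) \<and> s \<in> set (fst z) \<union> set (snd z) \<and>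
     (\<forall>x\<in>set (snd z). set (f x) \<subseteq> set (fst z) \<union> set (snd z))"

text \<open>A visit lengthens the worklist by less than \<open>L + 1\<close>, and this is what every
  element not yet visited contributes.\<close>

definition reach_measure :: "'s list \<times> 's list \<Rightarrow> nat" where
  "reach_measure z = (card U - card (set (snd z))) * (L + 1) + length (fst z)"

lemma reach_run:
  "\<exists>m\<le>card U * (L + 1) + 1. \<not> fst ((reach_step f ^^ m) ([s], [])) \<noteq> [] \<and>
     (\<forall>i<m. fst ((reach_step f ^^ i) ([s], [])) \<noteq> []) \<and>
     (\<forall>i\<le>m. reach_inv ((reach_step f ^^ i) ([s], [])) \<and>
        length (fst ((reach_step f ^^ i) ([s], []))) \<le> card U * (L + 1) + 1)"
proof -
  have step: "reach_inv (reach_step f z) \<and> reach_measure (reach_step f z) < reach_measure z"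
    if z: "reach_inv z" "fst z \<noteq> []" for z
  proof -
    obtain x xs W where zz: "z = (x # xs, W)" using z(2) by (metis neq_Nil_conv prod.collapse)
    show ?thesis
    proof (cases "x \<in> set W")
      case True
      then show ?thesis using z unfolding zz by (auto simp: reach_inv_def reach_step_def reach_measure_def)
    next
      case False
      have x: "x \<in> U" "set W \<subseteq> U" using z unfolding zz by (auto simp: reach_inv_def)
      have "card (insert x (set W)) \<le> card U" by (rule card_mono) (use x U(1) in auto)
      moreover have "card (insert x (set W)) = Suc (card (set W))" using False by simp
      ultimately have "card U - card (set W) = Suc (card U - Suc (card (set W)))" by simp
      then have "reach_measure (reach_step f z) < reach_measure z"
        using False L[of x] unfolding zz by (simp add: reach_step_def reach_measure_def)
      moreover have "reach_inv (reach_step f z)"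
        using z False U(3)[OF x(1)] unfolding zz reach_inv_def reach_step_def by auto
      ultimately show ?thesis by simp
    qed
  qed
  have "reach_inv ([s], [])" using U(2) by (simp add: reach_inv_def)
  from whl_measure[of reach_inv "\<lambda>z. fst z \<noteq> []" "reach_step f" reach_measure, OF step this]
  obtain m where m: "m \<le> reach_measure ([s], [])" "\<not> fst ((reach_step f ^^ m) ([s], [])) \<noteq> []"
    "\<forall>i<m. fst ((reach_step f ^^ i) ([s], [])) \<noteq> []"
    "\<forall>i\<le>m. reach_inv ((reach_step f ^^ i) ([s], [])) \<and> reach_measure ((reach_step f ^^ i) ([s], [])) \<le> reach_measure ([s], [])"
    by auto
  have 0: "reach_measure ([s], []) = card U * (L + 1) + 1" by (simp add: reach_measure_def)
  have "length (fst ((reach_step f ^^ i) ([s], []))) \<le> card U * (L + 1) + 1" if "i \<le> m" for i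
    using m(4) that unfolding 0 by (auto simp: reach_measure_def dest!: spec[of _ i])
  then show ?thesis using m unfolding 0 by blast
qed

lemma reach_correct:
  "distinct (reach f s)" "s \<in> set (reach f s)" "set (reach f s) \<subseteq> U"
  "x \<in> set (reach f s) \<Longrightarrow> set (f x) \<subseteq> set (reach f s)"
proof -
  obtain m where m: "\<not> fst ((reach_step f ^^ m) ([s], [])) \<noteq> []" "\<forall>i<m. fst ((reach_step f ^^ i) ([s], [])) \<noteq> []"
    "reach_inv ((reach_step f ^^ m) ([s], []))" using reach_run by auto
  have "whl (\<lambda>z. fst z \<noteq> []) (reach_step f) ([s], []) = (reach_step f ^^ m) ([s], [])"
    by (rule whl_eq) (use m in auto)
  then have inv: "reach_inv (fst ((reach_step f ^^ m) ([s], [])), reach f s)" using m(3) by (simp add: reach_def)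
  show "distinct (reach f s)" "s \<in> set (reach f s)" "set (reach f s) \<subseteq> U"
    "x \<in> set (reach f s) \<Longrightarrow> set (f x) \<subseteq> set (reach f s)"
    using inv m(1) unfolding reach_inv_def by auto
qed

end

lemma pt_reach_step: "pt (\<lambda>z. \<mu> (fst z)) (\<lambda>z. f (fst z) (snd z)) \<Longrightarrow>
  pt (\<lambda>z. \<mu> (fst z)) (\<lambda>z. reach_step (f (fst z)) (snd z))"
proof -
  assume f: "pt (\<lambda>z. \<mu> (fst z)) (\<lambda>z. f (fst z) (snd z))"
  show ?thesis unfolding reach_step_def
    by (intro pt_intros pt_app2[OF f])
qed

lemma pt_reach:
  assumes f: "pt (\<lambda>z. \<mu> (fst z)) (\<lambda>z. f (fst z) (snd z))" and s: "pt \<mu> s" and N: "pb \<mu> N"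
    and L: "\<And>c x. length (f c x) \<le> L"
    and U: "\<And>c. 0 < \<mu> c \<Longrightarrow> \<exists>U. finite U \<and> s c \<in> U \<and> (\<forall>x\<in>U. set (f c x) \<subseteq> U) \<and> card U \<le> N c \<and> (\<forall>x\<in>U. sz x \<le> N c)"
  shows "pt \<mu> (\<lambda>c. reach (f c) (s c))"
  unfolding reach_def
proof (intro pt_snd pt_whl_context pt_reach_step[OF f])
  let ?M = "\<lambda>c. N c * (L + 1) + 1"
  let ?N = "\<lambda>c. ?M c + Suc ((1 + ?M c * (N c + 1)) + (1 + N c * (N c + 1)))"
  show "pb \<mu> ?N" by (intro pb_intros N)
  fix c assume c: "0 < \<mu> c"
  obtain U where U: "finite U" "s c \<in> U" "\<forall>x\<in>U. set (f c x) \<subseteq> U" "card U \<le> N c" "\<forall>x\<in>U. sz x \<le> N c"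
    using U[OF c] by blast
  let ?z = "\<lambda>i. (reach_step (f c) ^^ i) ([s c], [])"
  have "\<exists>m\<le>card U * (L + 1) + 1. \<not> fst (?z m) \<noteq> [] \<and> (\<forall>i<m. fst (?z i) \<noteq> []) \<and>
     (\<forall>i\<le>m. reach_inv (f c) (s c) U (?z i) \<and> length (fst (?z i)) \<le> card U * (L + 1) + 1)"
    using U L by (intro reach_run) auto
  then obtain m where m: "m \<le> card U * (L + 1) + 1" "\<not> fst (?z m) \<noteq> []" "\<forall>i<m. fst (?z i) \<noteq> []"
    "\<forall>i\<le>m. reach_inv (f c) (s c) U (?z i) \<and> length (fst (?z i)) \<le> card U * (L + 1) + 1" by blast
  have le: "card U * (L + 1) + 1 \<le> ?M c" using U(4) by (intro add_right_mono mult_right_mono) auto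
  have "sz (?z i) \<le> ?N c" if "i \<le> m" for i
  proof -
    have inv: "reach_inv (f c) (s c) U (?z i)" "length (fst (?z i)) \<le> ?M c" using m(4) that le by (meson le_trans)+
    have sub: "set (fst (?z i)) \<subseteq> U" "set (snd (?z i)) \<subseteq> U" "distinct (snd (?z i))"
      using inv(1) reach_inv_def[of U "s c" "f c" L "?z i"] U L by auto
    have "sz (fst (?z i)) \<le> 1 + length (fst (?z i)) * (N c + 1)" by (rule sz_list_bound) (use sub U in auto)
    also have "\<dots> \<le> 1 + ?M c * (N c + 1)" using inv(2) by (intro add_left_mono mult_right_mono) auto
    finally have 1: "sz (fst (?z i)) \<le> 1 + ?M c * (N c + 1)" .
    have "length (snd (?z i)) \<le> card U" using sub U(1) by (metis card_mono distinct_card)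
    then have "length (snd (?z i)) \<le> N c" using U(4) by simp
    moreover have "sz (snd (?z i)) \<le> 1 + length (snd (?z i)) * (N c + 1)" by (rule sz_list_bound) (use sub U in auto)
    moreover have "length (snd (?z i)) * (N c + 1) \<le> N c * (N c + 1)" using calculation(1) by (intro mult_right_mono) auto
    ultimately have 2: "sz (snd (?z i)) \<le> 1 + N c * (N c + 1)" by linarith
    show ?thesis unfolding sz_pair[of "?z i"] using 1 2 by linarith
  qed
  moreover have "m \<le> ?N c" using m(1) le by linarith
  ultimately show "\<exists>m\<le>?N c. \<not> fst (?z m) \<noteq> [] \<and> (\<forall>i<m. fst (?z i) \<noteq> []) \<and> (\<forall>i\<le>m. sz (?z i) \<le> ?N c)"
    using m(2,3) by blast
qed (intro pt_intros s)+

text \<open>Encodings are binary words of length at most \<open>k\<close>. Thus a bound on the size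
  of a state yields the exponential bound on the number of states, without counting component by
  component.\<close>

lemma card_sz_le: "finite {x :: 'a :: enc. sz x \<le> k}" "card {x :: 'a :: enc. sz x \<le> k} \<le> 2 ^ (k + 1)"
proof -
  let ?f = "\<lambda>x :: 'a. tree_code (enc x) :: unit cell list"
  let ?A = "{bit0, bit1} :: unit cell set"
  let ?S = "{xs. set xs \<subseteq> ?A \<and> length xs \<le> k}"
  have inj: "inj_on ?f {x. sz x \<le> k}" by (auto simp: inj_on_def inj_tree_code enc_inject)
  have sub: "?f ` {x. sz x \<le> k} \<subseteq> ?S" using set_tree_code by (auto simp: sz_def)
  have fin: "finite ?S" by (rule finite_lists_length_le) simp
  show "finite {x :: 'a. sz x \<le> k}" using inj sub fin by (meson finite_imageD finite_subset)
  have "card {x :: 'a. sz x \<le> k} \<le> card ?S" by (rule card_inj_on_le[OF inj sub fin])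
  also have "card ?S = (\<Sum>i\<le>k. 2 ^ i)" by (subst card_lists_length_le) (auto simp: numeral_2_eq_2)
  also have "\<dots> \<le> 2 ^ (k + 1)" by (induction k) auto
  finally show "card {x :: 'a. sz x \<le> k} \<le> 2 ^ (k + 1)" .
qed

section \<open>The synthesis algorithm\<close>

text \<open>\<open>S\<close> bounds the monitor; the square covers the marks, the appearance record,
  its prefix with node numbers in unary, and the flag.\<close>

definition base_bound :: "(nat list \<Rightarrow> nat) \<Rightarrow> nat list \<Rightarrow> nat" where
  "base_bound S w = S w + 4 * (length w + 2)\<^sup>2"

text \<open>With s for the base bound and n for the length of the word: at most 2^(s + 1) base
  states, and at most 2^(s + 2) values for each of n + 1 counters. The value 0 puts words that
  encode no formula outside the domain.\<close>

definition game_bound :: "(nat list \<Rightarrow> bool) \<Rightarrow> (nat list \<Rightarrow> nat) \<Rightarrow> nat list \<Rightarrow> nat" where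
  "game_bound valid S w = (if valid w then 2 ^ ((base_bound S w + 3) * (length w + 3)) else 0)"

lemma length_mark_update: "length (mark_update w m u) \<le> length w"
proof -
  have "length (snd (foldr mark_step l s)) = length l + length (snd s)" for l s
    by (induction l) (auto simp: mark_step_def)
  then show ?thesis by (simp add: mark_update_def)
qed

lemma sz_bool_list: "sz (l :: bool list) \<le> 1 + length l * 4"
  using sz_list_bound[of l 3] sz_bool by simp

lemma sz_nat_list: "(\<And>k. k \<in> set l \<Longrightarrow> k \<le> n) \<Longrightarrow> sz (l :: nat list) \<le> 1 + length l * (2 * n + 2)"
  using sz_list_bound[of l "2 * n + 1"] by (simp add: sz_nat)

lemma sz_filter: "sz (filter P xs) \<le> sz xs"
  by (induction xs) auto

lemma foldl_iterate: "foldl (\<lambda>a _. f a) a xs = (f ^^ length xs) a"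
  by (induction xs arbitrary: a) (simp_all add: funpow_swap1)

lemma ticks_index: "ticks x xs = replicate (length (takeWhile (\<lambda>y. y \<noteq> x) xs)) 11"
  by (induction xs) (auto simp: ticks_def)

lemma takeWhile_index:
  "e \<in> set xs \<Longrightarrow> length (takeWhile (\<lambda>z. z \<noteq> e) xs) < length xs \<and> xs ! length (takeWhile (\<lambda>z. z \<noteq> e) xs) = e"
  by (induction xs) auto

text \<open>The algorithm for an abstract monitor: after reading \<open>as\<close>, its output is
  the vector of truth values for \<open>dir as\<close>. Steps and outputs are polynomial in the
  monitor state, but the initial state only in the size of the game, since a table of functions is
  exponentially large from the start.\<close>

locale synthesis =
  fixes Xs Ys :: "nat list list"
    and minit :: "nat list \<Rightarrow> 'm :: enc" and mstep :: "nat list \<Rightarrow> 'm \<Rightarrow> nat list \<Rightarrow> 'm"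
    and mout :: "nat list \<Rightarrow> 'm \<Rightarrow> bool list"
    and valid :: "nat list \<Rightarrow> bool" and S :: "nat list \<Rightarrow> nat"
    and dir :: "nat list list \<Rightarrow> nat list list"
  assumes minit: "pt (game_bound valid S) minit"
    and mstep: "pt (\<lambda>_. 1) (\<lambda>z. mstep (fst z) (fst (snd z)) (snd (snd z)))"
    and mout: "pt (\<lambda>_. 1) (\<lambda>z. mout (fst z) (snd z))"
    and S: "\<And>w as. valid w \<Longrightarrow> sz (foldl (mstep w) (minit w) as) \<le> S w"
    and mout_truth: "\<And>w as. valid w \<Longrightarrow> mout w (foldl (mstep w) (minit w) as) = truth_values w (dir as)"
    and length_dir: "\<And>as. length (dir as) = length as"
begin

abbreviation \<mu> :: "nat list \<Rightarrow> nat" where "\<mu> \<equiv> game_bound valid S"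

text \<open>As the atoms are fixed, the letters are constants of the program and contribute constant
  factors only.\<close>

definition Ls :: "nat list list" where "Ls = concat (map (\<lambda>x. map (\<lambda>y. x @ y) Ys) Xs)"

lemma set_Ls: "set Ls = {x @ y | x y. x \<in> set Xs \<and> y \<in> set Ys}"
  by (auto simp: Ls_def)

definition bstep :: "nat list \<Rightarrow> 'm base \<Rightarrow> nat list \<Rightarrow> 'm base" where
  "bstep w b a = base_update w (mstep w (fst b) a) (mout w (mstep w (fst b) a)) b"

definition binit :: "nat list \<Rightarrow> 'm base" where "binit w = base_init w (minit w)"

text \<open>Computed before the safety game, because the number of reachable base states is the
  capacity of the counters.\<close>

definition bases :: "nat list \<Rightarrow> 'm base list" where
  "bases w = reach (\<lambda>b. map (bstep w b) Ls) (binit w)"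

definition estep :: "nat list \<Rightarrow> 'm base \<times> nat list \<Rightarrow> nat list \<Rightarrow> 'm base \<times> nat list" where
  "estep w e a = (bstep w (fst e) a, update_counters (length (bases w))
     (fst (snd (snd (snd (bstep w (fst e) a))))) (bad (bstep w (fst e) a)) (snd e))"

definition einit :: "nat list \<Rightarrow> 'm base \<times> nat list" where
  "einit w = (binit w, map (\<lambda>_. 0) (0 # w))"

definition exts :: "nat list \<Rightarrow> ('m base \<times> nat list) list" where
  "exts w = reach (\<lambda>e. map (estep w e) Ls) (einit w)"

definition good_moves :: "nat list \<Rightarrow> ('m base \<times> nat list) list \<Rightarrow> 'm base \<times> nat list \<Rightarrow> nat list list" where
  "good_moves w W e = filter (\<lambda>x. list_all (\<lambda>y. estep w e (x @ y) \<in> set W) Ys) Xs"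

definition prune_list :: "nat list \<Rightarrow> ('m base \<times> nat list) list \<Rightarrow> ('m base \<times> nat list) list" where
  "prune_list w W = filter (\<lambda>e. snd e \<noteq> [] \<and> good_moves w W e \<noteq> []) W"

text \<open>The second \<open>exts w\<close> only counts rounds: one per position, which suffices by
  \<open>descending_stable\<close>.\<close>

definition win :: "nat list \<Rightarrow> ('m base \<times> nat list) list" where
  "win w = foldl (\<lambda>W _. prune_list w W) (exts w) (exts w)"

definition pick :: "nat list \<Rightarrow> 'm base \<times> nat list \<Rightarrow> nat list" where
  "pick w e = hd (good_moves w (win w) e)"

text \<open>State 0 of a transducer is initial, hence the initial position in front. Its second
  occurrence is harmless, as edges point to first occurrences.\<close>

definition states :: "nat list \<Rightarrow> ('m base \<times> nat list) list" where
  "states w = einit w # win w"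

definition edge_word :: "nat list \<Rightarrow> 'm base \<times> nat list \<Rightarrow> nat list \<Rightarrow> nat list" where
  "edge_word w e y = 10 # y @ ticks (estep w e (pick w e @ y)) (states w)"

definition state_word :: "nat list \<Rightarrow> 'm base \<times> nat list \<Rightarrow> nat list" where
  "state_word w e = 9 # pick w e @ concat (map (edge_word w e) Ys)"

definition solve :: "nat list \<Rightarrow> nat list \<times> bool" where
  "solve w = (if einit w \<in> set (win w) then (concat (map (state_word w) (states w)), True) else ([], False))"

section \<open>Size of the state spaces\<close>

definition base_space :: "nat list \<Rightarrow> 'm base set" where
  "base_space w = {b. (\<exists>as. fst b = foldl (mstep w) (minit w) as) \<and> length (fst (snd b)) \<le> length w \<and>
     length (fst (snd (snd b))) = length w \<and> set (fst (snd (snd b))) \<subseteq> {..<length w} \<and>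
     length (fst (snd (snd (snd b)))) \<le> length w \<and> set (fst (snd (snd (snd b)))) \<subseteq> {..<length w}}"

lemma binit_space: "binit w \<in> base_space w"
  by (auto simp: base_space_def binit_def base_init_def ids_def intro: exI[of _ "[]"])

lemma bstep_space:
  assumes "b \<in> base_space w"
  shows "bstep w b a \<in> base_space w"
proof -
  obtain as where "fst b = foldl (mstep w) (minit w) as" using assms by (auto simp: base_space_def)
  then have "mstep w (fst b) a = foldl (mstep w) (minit w) (as @ [a])" by simp
  then have 1: "\<exists>as. fst (bstep w b a) = foldl (mstep w) (minit w) as"
    unfolding bstep_def base_update_def Let_def by (metis fst_conv)
  let ?M = "set (marked w (mark_update w (fst (snd b)) (mout w (mstep w (fst b) a))))" and ?\<pi> = "fst (snd (snd b))"
  have h: "length (lar_head ?M ?\<pi>) \<le> length ?\<pi>" "set (lar_head ?M ?\<pi>) \<subseteq> set ?\<pi>"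
    using lar_head_take(2)[of ?M ?\<pi>] set_take_subset[of "length (lar_head ?M ?\<pi>)" ?\<pi>] lar_head_take(1)[of ?M ?\<pi>] by simp_all
  show ?thesis
    using assms 1 h length_mark_update[of w "fst (snd b)" "mout w (mstep w (fst b) a)"]
    by (auto simp: base_space_def bstep_def base_update_def Let_def)
qed

lemma sz_base:
  assumes "valid w" "b \<in> base_space w"
  shows "sz b \<le> base_bound S w"
proof -
  obtain ms m \<pi> H d where b: "b = (ms, m, \<pi>, H, d)" by (metis prod.collapse)
  let ?n = "length w"
  have "sz ms \<le> S w" using assms S[of w] by (auto simp: b base_space_def)
  moreover have "sz m \<le> 1 + ?n * 4"
  proof -
    have "length m * 4 \<le> ?n * 4" using assms(2) by (auto simp: b base_space_def)
    then show ?thesis using sz_bool_list[of m] by linarith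
  qed
  moreover have "sz l \<le> 1 + ?n * (2 * ?n + 2)" if l: "length l \<le> ?n" "set l \<subseteq> {..<?n}" for l :: "nat list"
  proof -
    have "sz l \<le> 1 + length l * (2 * ?n + 2)" by (rule sz_nat_list) (use l in auto)
    also have "\<dots> \<le> 1 + ?n * (2 * ?n + 2)" using l(1) by (intro add_left_mono mult_right_mono) auto
    finally show ?thesis .
  qed
  then have "sz \<pi> \<le> 1 + ?n * (2 * ?n + 2)" "sz H \<le> 1 + ?n * (2 * ?n + 2)"
    using assms(2) by (auto simp: b base_space_def)
  moreover have "sz d \<le> 3" by (rule sz_bool)
  ultimately have "sz b \<le> S w + (10 + ?n * 4 + 2 * (?n * (2 * ?n + 2)))" by (simp add: b)
  also have "10 + ?n * 4 + 2 * (?n * (2 * ?n + 2)) \<le> 4 * (?n + 2)\<^sup>2" by (simp add: power2_eq_square algebra_simps)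
  finally show ?thesis by (simp add: base_bound_def)
qed

lemma level_space: "b \<in> base_space w \<Longrightarrow> level b \<le> length w"
  by (simp add: base_space_def level_def)

lemma finite_base_space:
  assumes "valid w"
  shows "finite (base_space w)" "card (base_space w) \<le> 2 ^ (base_bound S w + 1)"
proof -
  let ?A = "{b :: 'm base. sz b \<le> base_bound S w}"
  have sub: "base_space w \<subseteq> ?A" using sz_base[OF assms] by blast
  show "finite (base_space w)" by (rule finite_subset[OF sub card_sz_le(1)])
  have "card (base_space w) \<le> card ?A" by (rule card_mono[OF card_sz_le(1) sub])
  also have "\<dots> \<le> 2 ^ (base_bound S w + 1)" by (rule card_sz_le(2))
  finally show "card (base_space w) \<le> 2 ^ (base_bound S w + 1)" .
qed

lemma bases_correct:
  assumes "valid w"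
  shows "distinct (bases w)" "binit w \<in> set (bases w)" "set (bases w) \<subseteq> base_space w"
    "b \<in> set (bases w) \<Longrightarrow> a \<in> set Ls \<Longrightarrow> bstep w b a \<in> set (bases w)"
    "length (bases w) \<le> 2 ^ (base_bound S w + 1)"
proof -
  have closed: "set (map (bstep w x) Ls) \<subseteq> base_space w" if "x \<in> base_space w" for x using bstep_space[OF that] by auto
  have len: "length (map (bstep w x) Ls) \<le> length Ls" for x by simp
  note r = reach_correct[of "base_space w" "binit w" "\<lambda>b. map (bstep w b) Ls" "length Ls",
      OF finite_base_space(1)[OF assms] binit_space closed len, folded bases_def]
  show d: "distinct (bases w)" "binit w \<in> set (bases w)" and s: "set (bases w) \<subseteq> base_space w"
    using r(1-3) by auto
  show "b \<in> set (bases w) \<Longrightarrow> a \<in> set Ls \<Longrightarrow> bstep w b a \<in> set (bases w)"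
    using r(4)[of b] by auto
  have "length (bases w) \<le> card (base_space w)"
    using card_mono[OF finite_base_space(1)[OF assms] s] distinct_card[OF d(1)] by simp
  then show "length (bases w) \<le> 2 ^ (base_bound S w + 1)" using finite_base_space(2)[OF assms] by simp
qed

definition ext_space :: "nat list \<Rightarrow> ('m base \<times> nat list) set" where
  "ext_space w = base_space w \<times>
     insert [] {cs. set cs \<subseteq> {..length (bases w)} \<and> length cs = Suc (length w)}"

lemma einit_space: "einit w \<in> ext_space w"
  by (auto simp: ext_space_def einit_def binit_space)

lemma estep_space:
  assumes "e \<in> ext_space w"
  shows "estep w e a \<in> ext_space w"
proof -
  let ?b = "bstep w (fst e) a" and ?cs = "snd e"
  let ?u = "upd_counters (length (bases w)) (level ?b) (bad ?b) ?cs"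
  have b: "?b \<in> base_space w" using assms bstep_space by (auto simp: ext_space_def)
  have u: "estep w e a = (?b, ?u)" by (simp add: estep_def update_counters_eq level_def)
  have "?u \<in> insert [] {cs. set cs \<subseteq> {..length (bases w)} \<and> length cs = Suc (length w)}"
  proof (cases "?cs = []")
    case True
    then show ?thesis by (simp add: upd_counters_def)
  next
    case False
    then have cs: "set ?cs \<subseteq> {..length (bases w)}" "length ?cs = Suc (length w)" using assms by (auto simp: ext_space_def)
    have h: "level ?b < length ?cs" using level_space[OF b] cs(2) by simp
    have "\<forall>c\<in>set ?u. c \<le> length (bases w)" by (rule upd_counters_le[OF h]) (use cs in auto)
    then show ?thesis using upd_counters_nth(1)[OF h, of "length (bases w)" "bad ?b"] cs(2) by auto
  qed
  then show ?thesis using b unfolding u ext_space_def by simp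
qed

lemma finite_ext_space:
  assumes "valid w"
  shows "finite (ext_space w)" "card (ext_space w) \<le> \<mu> w"
proof -
  let ?B = "length (bases w)" and ?n = "length w" and ?s = "base_bound S w"
  let ?C = "{cs. set cs \<subseteq> {..?B} \<and> length cs = Suc ?n}"
  have fin: "finite ?C" by (rule finite_lists_length_eq) simp
  then show "finite (ext_space w)" unfolding ext_space_def by (intro finite_cartesian_product finite_base_space(1) assms) simp
  have "card ?C = Suc ?B ^ Suc ?n" by (subst card_lists_length_eq) auto
  also have "\<dots> \<le> (2 ^ (?s + 2)) ^ Suc ?n"
  proof (rule power_mono)
    have "1 \<le> (2 :: nat) ^ (?s + 1)" by simp
    moreover have "(2 :: nat) ^ (?s + 2) = 2 ^ (?s + 1) + 2 ^ (?s + 1)" by simp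
    ultimately show "Suc ?B \<le> 2 ^ (?s + 2)" using bases_correct(5)[OF assms] by linarith
  qed simp
  finally have C: "card ?C \<le> 2 ^ ((?s + 2) * Suc ?n)" by (simp only: power_mult)
  have "card (insert [] ?C) = Suc (card ?C)" using fin by simp
  also have "\<dots> \<le> 2 ^ ((?s + 2) * Suc ?n) + 2 ^ ((?s + 2) * Suc ?n)"
    using C one_le_power[of "2 :: nat" "(?s + 2) * Suc ?n"] by linarith
  also have "\<dots> = 2 ^ ((?s + 2) * Suc ?n + 1)" by simp
  finally have "card (ext_space w) \<le> 2 ^ (?s + 1) * 2 ^ ((?s + 2) * Suc ?n + 1)"
    unfolding ext_space_def card_cartesian_product using finite_base_space(2)[OF assms] by (intro mult_le_mono)
  also have "\<dots> = 2 ^ ((?s + 2) * (?n + 2))" by (simp only: power_add[symmetric]) (simp add: algebra_simps)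
  also have "\<dots> \<le> 2 ^ ((?s + 3) * (?n + 3))" by (intro power_increasing mult_le_mono) auto
  finally show "card (ext_space w) \<le> \<mu> w" using assms by (simp add: game_bound_def)
qed

lemma base_bound_le: "valid w \<Longrightarrow> base_bound S w \<le> \<mu> w \<and> 2 ^ (base_bound S w + 1) \<le> \<mu> w"
proof -
  assume v: "valid w"
  let ?s = "base_bound S w"
  have "?s + 1 \<le> (?s + 3) * 1" by simp
  also have "\<dots> \<le> (?s + 3) * (length w + 3)" by (intro mult_left_mono) auto
  finally have 1: "(2 :: nat) ^ (?s + 1) \<le> \<mu> w" using v by (simp only: game_bound_def if_True) (intro power_increasing, auto)
  moreover have "?s + 1 < 2 ^ (?s + 1)" by (rule less_exp)
  ultimately show ?thesis by linarith
qed

lemma sz_ext: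
  assumes "valid w" "e \<in> ext_space w"
  shows "sz e \<le> 2 + \<mu> w + (sz w + 1) * (2 * \<mu> w + 2)"
proof -
  obtain b cs where e: "e = (b, cs)" by fastforce
  have b: "sz b \<le> \<mu> w" using sz_base[OF assms(1), of b] assms base_bound_le by (fastforce simp: e ext_space_def)
  have B: "length (bases w) \<le> \<mu> w" using bases_correct(5)[OF assms(1)] base_bound_le[OF assms(1)] by linarith
  have "sz cs \<le> 1 + length cs * (2 * \<mu> w + 2)"
    by (rule sz_nat_list) (use assms(2) B in \<open>auto simp: e ext_space_def\<close>)
  also have "\<dots> \<le> 1 + (sz w + 1) * (2 * \<mu> w + 2)"
    using assms(2) length_less_sz[of w] by (intro add_left_mono mult_right_mono) (auto simp: e ext_space_def)
  finally show ?thesis using b by (simp add: e)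
qed

lemma exts_correct:
  assumes "valid w"
  shows "distinct (exts w)" "einit w \<in> set (exts w)" "set (exts w) \<subseteq> ext_space w"
    "e \<in> set (exts w) \<Longrightarrow> a \<in> set Ls \<Longrightarrow> estep w e a \<in> set (exts w)"
proof -
  have closed: "set (map (estep w x) Ls) \<subseteq> ext_space w" if "x \<in> ext_space w" for x using estep_space[OF that] by auto
  have len: "length (map (estep w x) Ls) \<le> length Ls" for x by simp
  note r = reach_correct[of "ext_space w" "einit w" "\<lambda>e. map (estep w e) Ls" "length Ls",
      OF finite_ext_space(1)[OF assms] einit_space closed len, folded exts_def]
  show "distinct (exts w)" "einit w \<in> set (exts w)" "set (exts w) \<subseteq> ext_space w"
    using r(1-3) by auto
  show "e \<in> set (exts w) \<Longrightarrow> a \<in> set Ls \<Longrightarrow> estep w e a \<in> set (exts w)"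
    using r(4)[of e] by auto
qed

section \<open>Running time of the algorithm\<close>

lemma valid_iff: "0 < \<mu> w \<longleftrightarrow> valid w"
  by (simp add: game_bound_def)

lemma pt_bstep: "pt (\<lambda>_. 1) (\<lambda>z. bstep (fst z) (fst (snd z)) (snd (snd z)))"
  unfolding bstep_def by (intro pt_base_update pt_fun3[OF mstep] pt_fun2[OF mout] pt_intros)

lemma pt_binit: "pt \<mu> binit"
proof -
  have "pt \<mu> (\<lambda>w. base_init w (minit w))" unfolding base_init_def by (intro pt_intros pt_ids minit)
  then show ?thesis by (simp add: binit_def[abs_def])
qed

lemma pt_bases: "pt \<mu> bases"
proof -
  have "pt \<mu> (\<lambda>w. reach (\<lambda>b. map (bstep w b) Ls) (binit w))"
  proof (rule pt_reach[OF _ pt_binit, where N = "\<lambda>w. \<mu> w" and L = "length Ls"])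
    show "pt (\<lambda>z. \<mu> (fst z)) (\<lambda>z. map (bstep (fst z) (snd z)) Ls)"
      by (intro pt_map pt_const pt_fun3[OF pt_bstep] pt_fst pt_snd pt_id)
    show "\<exists>U. finite U \<and> binit c \<in> U \<and> (\<forall>x\<in>U. set (map (bstep c x) Ls) \<subseteq> U) \<and> card U \<le> \<mu> c \<and> (\<forall>x\<in>U. sz x \<le> \<mu> c)"
      if "0 < \<mu> c" for c
    proof (intro exI[of _ "base_space c"] conjI ballI)
      have v: "valid c" using that by (simp add: valid_iff)
      show "finite (base_space c)" "binit c \<in> base_space c" by (rule finite_base_space(1)[OF v], rule binit_space)
      show "card (base_space c) \<le> \<mu> c" using finite_base_space(2)[OF v] base_bound_le[OF v] by linarith
      fix x assume x: "x \<in> base_space c"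
      show "set (map (bstep c x) Ls) \<subseteq> base_space c" using bstep_space[OF x] by auto
      show "sz x \<le> \<mu> c" using sz_base[OF v x] base_bound_le[OF v] by linarith
    qed
  qed (simp_all add: pb_mu)
  then show ?thesis by (simp add: bases_def[abs_def])
qed

lemma pt_estep: "pt (\<lambda>z. \<mu> (fst z)) (\<lambda>z. estep (fst z) (fst (snd z)) (snd (snd z)))"
  unfolding estep_def bad_def
  by (intro pt_pair pt_update_counters pt_length pt_app1[OF pt_bases] pt_fun3[OF pt_bstep] pt_fst pt_snd pt_id)

lemma pt_einit: "pt \<mu> einit"
proof -
  have "pt \<mu> (\<lambda>w. (binit w, map (\<lambda>_. 0 :: nat) (0 # w)))"
    by (intro pt_pair pt_map pt_Cons pt_const pt_id pt_binit)
  then show ?thesis by (simp add: einit_def[abs_def])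
qed

lemma pt_exts: "pt \<mu> exts"
proof -
  let ?N = "\<lambda>w. \<mu> w + (2 + \<mu> w + (sz w + 1) * (2 * \<mu> w + 2))"
  have "pt \<mu> (\<lambda>w. reach (\<lambda>e. map (estep w e) Ls) (einit w))"
  proof (rule pt_reach[OF _ pt_einit, where N = ?N and L = "length Ls"])
    show "pt (\<lambda>z. \<mu> (fst z)) (\<lambda>z. map (estep (fst z) (snd z)) Ls)"
      by (intro pt_map pt_const pt_app3[OF pt_estep] pt_fst pt_snd pt_id)
    show "pb \<mu> ?N" by (intro pb_intros)
    show "\<exists>U. finite U \<and> einit c \<in> U \<and> (\<forall>x\<in>U. set (map (estep c x) Ls) \<subseteq> U) \<and> card U \<le> ?N c \<and> (\<forall>x\<in>U. sz x \<le> ?N c)"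
      if "0 < \<mu> c" for c
    proof (intro exI[of _ "ext_space c"] conjI ballI)
      have v: "valid c" using that by (simp add: valid_iff)
      show "finite (ext_space c)" "einit c \<in> ext_space c" by (rule finite_ext_space(1)[OF v], rule einit_space)
      show "card (ext_space c) \<le> ?N c" using finite_ext_space(2)[OF v] by linarith
      fix x assume x: "x \<in> ext_space c"
      show "set (map (estep c x) Ls) \<subseteq> ext_space c" using estep_space[OF x] by auto
      show "sz x \<le> ?N c" using sz_ext[OF v x] by linarith
    qed
  qed simp
  then show ?thesis by (simp add: exts_def[abs_def])
qed

lemma pt_good_moves: "pt (\<lambda>z. \<mu> (fst z)) (\<lambda>z. good_moves (fst z) (fst (snd z)) (snd (snd z)))"
  unfolding good_moves_def
  by (intro pt_filter pt_list_all pt_member pt_app3[OF pt_estep] pt_append pt_fst pt_snd pt_id pt_const)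

lemma pt_prune_list: "pt (\<lambda>z. \<mu> (fst z)) (\<lambda>z. prune_list (fst z) (snd z))"
  unfolding prune_list_def
  by (intro pt_filter pt_conj pt_not pt_eq pt_app3[OF pt_good_moves] pt_fst pt_snd pt_id pt_const)

lemma pt_win: "pt \<mu> win"
proof -
  have "pt \<mu> (\<lambda>w. foldl (\<lambda>W _. prune_list w W) (exts w) (exts w))"
  proof (rule pt_foldl_context[OF _ pt_exts pt_exts pt_sz[OF pt_exts]])
    show "pt (\<lambda>z. \<mu> (fst z)) (\<lambda>z. prune_list (fst z) (snd (snd z)))"
      by (intro pt_app2[OF pt_prune_list] pt_fst pt_snd pt_id)
    have "sz ((prune_list w ^^ i) W) \<le> sz W" for w i W
    proof (induction i)
      case (Suc i)
      have "sz (prune_list w ((prune_list w ^^ i) W)) \<le> sz ((prune_list w ^^ i) W)"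
        unfolding prune_list_def[of w "(prune_list w ^^ i) W"] by (rule sz_filter)
      then show ?case using Suc by simp
    qed simp
    then show "sz (foldl (\<lambda>W _. prune_list c W) (exts c) (take i (exts c))) \<le> sz (exts c)" for c i
      by (simp add: foldl_iterate)
  qed
  then show ?thesis by (simp add: win_def[abs_def])
qed

lemma pt_pick: "pt (\<lambda>z. \<mu> (fst z)) (\<lambda>z. pick (fst z) (snd z))"
  unfolding pick_def by (intro pt_hd pt_app3[OF pt_good_moves] pt_app1[OF pt_win] pt_fst pt_snd pt_id)

lemma pt_states: "pt \<mu> states"
proof -
  have "pt \<mu> (\<lambda>w. einit w # win w)" by (intro pt_Cons pt_einit pt_win)
  then show ?thesis by (simp add: states_def[abs_def])
qed

lemma pt_edge_word: "pt (\<lambda>z. \<mu> (fst z)) (\<lambda>z. edge_word (fst z) (fst (snd z)) (snd (snd z)))"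
  unfolding edge_word_def
  by (intro pt_Cons pt_append pt_ticks pt_app3[OF pt_estep] pt_app2[OF pt_pick] pt_app1[OF pt_states] pt_fst pt_snd pt_id pt_const)

lemma pt_state_word: "pt (\<lambda>z. \<mu> (fst z)) (\<lambda>z. state_word (fst z) (snd z))"
  unfolding state_word_def
  by (intro pt_Cons pt_append pt_concat pt_map pt_app3[OF pt_edge_word] pt_app2[OF pt_pick] pt_fst pt_snd pt_id pt_const)

lemma pt_solve: "pt \<mu> solve"
proof -
  have "pt \<mu> (\<lambda>w. if einit w \<in> set (win w) then (concat (map (state_word w) (states w)), True) else ([], False))"
    by (intro pt_if pt_member pt_pair pt_concat pt_map pt_state_word pt_states pt_einit pt_win pt_const)
  then show ?thesis by (simp add: solve_def[abs_def])
qed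

section \<open>Meaning of the computed winning region\<close>

lemma game:
  assumes "valid w"
  shows "counter_game (\<lambda>b x y. bstep w b (x @ y)) (binit w) level (set Xs) (set Ys) (length w) (length (bases w)) (set (bases w))"
proof
  show "card (set (bases w)) \<le> length (bases w)" by (rule card_length)
  show "bstep w b (x @ y) \<in> set (bases w)" if "b \<in> set (bases w)" "x \<in> set Xs" "y \<in> set Ys" for b x y
    using bases_correct(4)[OF assms that(1)] that(2,3) set_Ls by blast
  show "level b \<le> length w" if "b \<in> set (bases w)" for b
    using bases_correct(3)[OF assms] that level_space by blast
qed (use bases_correct(2)[OF assms] in auto)

lemma good_moves_iff: "x \<in> set (good_moves w W e) \<longleftrightarrow> x \<in> set Xs \<and> (\<forall>y\<in>set Ys. estep w e (x @ y) \<in> set W)"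
  by (auto simp: good_moves_def list_all_iff)

text \<open>\<open>win w\<close> is a fixed point of pruning, so the successors under a good move
  stay in the same set and the choice can be repeated forever.\<close>

lemma win_step:
  assumes "valid w" "e \<in> set (win w)"
  shows "snd e \<noteq> []" "pick w e \<in> set Xs" "y \<in> set Ys \<Longrightarrow> estep w e (pick w e @ y) \<in> set (win w)"
    "e \<in> ext_space w"
proof -
  let ?f = "\<lambda>W. {e \<in> W. snd e \<noteq> [] \<and> (\<exists>x\<in>set Xs. \<forall>y\<in>set Ys. estep w e (x @ y) \<in> W)}"
  have f: "set (prune_list w W) = ?f (set W)" for W
  proof -
    have "good_moves w W e \<noteq> [] \<longleftrightarrow> (\<exists>x\<in>set Xs. \<forall>y\<in>set Ys. estep w e (x @ y) \<in> set W)" for e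
      using good_moves_iff[of _ w W e] by (metis ex_in_conv set_empty)
    then show ?thesis by (auto simp: prune_list_def)
  qed
  have iter: "set ((prune_list w ^^ i) W) = (?f ^^ i) (set W)" for i W by (induction i) (simp_all add: f)
  have w: "set (win w) = (?f ^^ card (set (exts w))) (set (exts w))"
    unfolding win_def foldl_iterate iter using distinct_card[OF exts_correct(1)[OF assms(1)]] by simp
  have "?f (set (win w)) = set (win w)" unfolding w by (rule descending_stable) auto
  then have e: "e \<in> ?f (set (win w))" using assms(2) by simp
  then show "snd e \<noteq> []" by simp
  obtain x where "x \<in> set (good_moves w (win w) e)" using e good_moves_iff by blast
  then have "pick w e \<in> set (good_moves w (win w) e)" unfolding pick_def by (intro hd_in_set) auto
  then show "pick w e \<in> set Xs" "y \<in> set Ys \<Longrightarrow> estep w e (pick w e @ y) \<in> set (win w)"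
    using good_moves_iff by blast+
  have sub: "set ((prune_list w ^^ i) W) \<subseteq> set W" for i W by (induction i) (auto simp: prune_list_def[of w "(prune_list w ^^ _) W"])
  then show "e \<in> ext_space w" using assms exts_correct(3)[OF assms(1)] unfolding win_def foldl_iterate by blast
qed

text \<open>The initial position was pruned within \<open>length (exts w)\<close> rounds. This
  bounds its rank, so \<open>environment_wins\<close> applies.\<close>

lemma not_win_environment:
  assumes v: "valid w" and not_win: "einit w \<notin> set (win w)" and \<sigma>: "\<And>u. set u \<subseteq> set Ys \<Longrightarrow> \<sigma> u \<in> set Xs"
  shows "\<exists>ys b. (\<forall>t. ys t \<in> set Ys) \<and> b 0 = binit w \<and>
    (\<forall>t. b (Suc t) = bstep w (b t) (\<sigma> (map ys [0..<t]) @ ys t)) \<and>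
    \<not> parity_win (\<lambda>t. priority (level (b (Suc t))) (bad (b (Suc t))))"
proof -
  interpret G: counter_game "\<lambda>b x y. bstep w b (x @ y)" "binit w" level bad "set Xs" "set Ys" "length w"
    "length (bases w)" "set (bases w)" by (rule game[OF v])
  have est: "G.est e x y = estep w e (x @ y)" for e x y
    by (simp add: G.est_def estep_def update_counters_eq level_def Let_def)
  have e0: "G.e0 = einit w" by (simp add: G.e0_def einit_def map_replicate_const)
  have f: "set (prune_list w W) = G.prune (set W)" for W
  proof -
    have "good_moves w W e \<noteq> [] \<longleftrightarrow> (\<exists>x\<in>set Xs. \<forall>y\<in>set Ys. estep w e (x @ y) \<in> set W)" for e
      using good_moves_iff[of _ w W e] by (metis ex_in_conv set_empty)
    then show ?thesis by (auto simp: prune_list_def G.prune_def est)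
  qed
  have iter: "set ((prune_list w ^^ i) W) = (G.prune ^^ i) (set W)" for i W by (induction i) (simp_all add: f)
  have lose: "G.lose (length (exts w)) G.e0"
  proof (rule G.lose_prune)
    show "G.e0 \<in> set (exts w)" unfolding e0 by (rule exts_correct(2)[OF v])
    show "G.e0 \<notin> (G.prune ^^ length (exts w)) (set (exts w))"
      using not_win unfolding e0 win_def foldl_iterate iter .
    show "G.est e x y \<in> set (exts w)" if "e \<in> set (exts w)" "x \<in> set Xs" "y \<in> set Ys" for e x y
      using exts_correct(4)[OF v that(1)] that(2,3) set_Ls unfolding est by blast
  qed
  from G.environment_wins[OF lose, of \<sigma>] \<sigma> show ?thesis unfolding G.pri_def by simp
qed

lemma bstep_trajectory:
  assumes v: "valid w" and b: "b 0 = binit w" "\<And>t. b (Suc t) = bstep w (b t) (as t)"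
  shows "fst (b t) = foldl (mstep w) (minit w) (map as [0..<t])"
    "b (Suc t) = base_update w (foldl (mstep w) (minit w) (map as [0..<Suc t])) (truth_values w (dir (map as [0..<Suc t]))) (b t)"
proof -
  show f: "fst (b t) = foldl (mstep w) (minit w) (map as [0..<t])" for t
    by (induction t) (simp_all add: b binit_def base_init_def bstep_def base_update_def Let_def)
  have m: "mstep w (fst (b t)) (as t) = foldl (mstep w) (minit w) (map as [0..<Suc t])" by (simp add: f)
  show "b (Suc t) = base_update w (foldl (mstep w) (minit w) (map as [0..<Suc t])) (truth_values w (dir (map as [0..<Suc t]))) (b t)"
    unfolding b(2) bstep_def m mout_truth[OF v] ..
qed

end

text \<open>Connects number lists with sets of atoms. Each subset of \<open>Y\<close> has exactly
  one list in \<open>Ys0\<close>, so that an input of the transducer selects a single edge.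
  \<open>d\<close> is the counterpart of \<open>dir\<close> on traces.\<close>

locale synthesis_instance = synthesis Xs Ys minit mstep mout valid S dir
  for Xs Ys and minit :: "nat list \<Rightarrow> 'm :: enc" and mstep mout valid S dir +
  fixes X Y :: "'a set" and g :: "'a \<Rightarrow> nat" and Xs0 Ys0 :: "'a list list"
    and d :: "'a set list \<Rightarrow> 'a set list" and \<Psi> :: "'a ppltl plus" and w :: "nat list"
    and lang :: "'a ppltl \<Rightarrow> 'a set list set"
  assumes inj: "inj_on g (X \<union> Y)" and disj: "X \<inter> Y = {}"
    and Xs: "Xs = map (map (\<lambda>p. 14 + g p)) Xs0" and Ys: "Ys = map (map (\<lambda>p. 14 + g p)) Ys0"
    and Xs0: "set ` set Xs0 = Pow X" and Ys0: "set ` set Ys0 = Pow Y" "inj_on set (set Ys0)"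
    and over: "\<Psi> \<in> ppltl_plus_over (X \<union> Y)" and w: "w = word_code g \<Psi>" and v: "valid w"
    and lang: "\<And>\<phi>. lang \<phi> = {t \<in> finite_traces (X \<union> Y). ppltl_sat (d t) (length t - 1) \<phi>}"
    and d: "\<And>as. d (map (decode g (X \<union> Y)) as) = map (decode g (X \<union> Y)) (dir as)"
begin

abbreviation code :: "'a list \<Rightarrow> nat list" where "code \<equiv> map (\<lambda>p. 14 + g p)"
abbreviation dec :: "nat list \<Rightarrow> 'a set" where "dec \<equiv> decode g (X \<union> Y)"

lemma dec_code: "set l \<subseteq> X \<union> Y \<Longrightarrow> dec (code l) = set l"
proof -
  assume l: "set l \<subseteq> X \<union> Y"
  have "p \<in> set l" if "p \<in> X \<union> Y" "q \<in> set l" "g p = g q" for p q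
    using inj_onD[OF inj that(3,1)] l that(2) by blast
  then show ?thesis using l by (auto simp: decode_def)
qed

lemma X_code: "x \<in> set Xs \<longleftrightarrow> (\<exists>l\<in>set Xs0. x = code l)" and Y_code: "y \<in> set Ys \<longleftrightarrow> (\<exists>l\<in>set Ys0. y = code l)"
  unfolding Xs Ys by auto

lemma map_Ys: "map h Ys = map (\<lambda>y. h (code y)) Ys0"
  unfolding Ys by simp

lemma dec_append: "dec (a @ b) = dec a \<union> dec b"
  by (auto simp: decode_def)

lemma X_lists: "l \<in> set Xs0 \<Longrightarrow> set l \<subseteq> X" and Y_lists: "l \<in> set Ys0 \<Longrightarrow> set l \<subseteq> Y"
  using Xs0 Ys0 by blast+

lemma dec_X: "x \<in> set Xs \<Longrightarrow> dec x \<subseteq> X" and dec_Y: "y \<in> set Ys \<Longrightarrow> dec y \<subseteq> Y"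
proof -
  assume "x \<in> set Xs"
  then obtain l where "l \<in> set Xs0" "x = code l" using X_code by blast
  then show "dec x \<subseteq> X" using X_lists[of l] dec_code[of l] by auto
next
  assume "y \<in> set Ys"
  then obtain l where "l \<in> set Ys0" "y = code l" using Y_code by blast
  then show "dec y \<subseteq> Y" using Y_lists[of l] dec_code[of l] by auto
qed

lemma parity_iff:
  assumes b: "b 0 = binit w" "\<And>t. b (Suc t) = bstep w (b t) (as t)"
  shows "parity_win (\<lambda>t. priority (level (b (Suc t))) (bad (b (Suc t)))) \<longleftrightarrow>
    (\<lambda>i. dec (as i)) \<in> plus_lang lang (X \<union> Y) \<Psi>"
proof (rule base_parity[where dir = dir and ms = "\<lambda>t. foldl (mstep w) (minit w) (map as [0..<Suc t])"])
  show "\<forall>\<phi>\<in>set_plus \<Psi>. set_ppltl \<phi> \<subseteq> X \<union> Y" using over by (simp add: ppltl_plus_over_def)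
  show "b 0 = base_init w (minit w)" using b(1) by (simp add: binit_def)
  show "map (\<lambda>i. dec (as i)) [0..<Suc t] \<in> lang \<phi> \<longleftrightarrow> ppltl_sat (map dec (dir (map as [0..<Suc t]))) t \<phi>" for \<phi> t
  proof -
    have "map (\<lambda>i. dec (as i)) [0..<Suc t] = map dec (map as [0..<Suc t])" by simp
    moreover have "map dec (map as [0..<Suc t]) \<in> finite_traces (X \<union> Y)" by (auto simp: finite_traces_def decode_def)
    ultimately show ?thesis unfolding lang by (simp only: mem_Collect_eq d) simp
  qed
  show "length (dir (map as [0..<Suc t])) = Suc t" for t unfolding length_dir by simp
qed (rule w, rule bstep_trajectory(2)[OF v b])

lemma not_win_unrealizable:
  assumes "einit w \<notin> set (win w)"
  shows "\<not> winning_strategy X Y (plus_lang lang (X \<union> Y) \<Psi>) \<sigma>"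
proof
  assume \<sigma>: "winning_strategy X Y (plus_lang lang (X \<union> Y) \<Psi>) \<sigma>"
  \<comment> \<open>Strategies work on sets and the game on lists that code them, so a listed code
    of each move is chosen.\<close>
  define \<sigma>' where "\<sigma>' u = (SOME x. x \<in> set Xs \<and> dec x = \<sigma> (map dec u))" for u
  have s: "\<sigma>' u \<in> set Xs \<and> dec (\<sigma>' u) = \<sigma> (map dec u)" if "set u \<subseteq> set Ys" for u
    unfolding \<sigma>'_def
  proof (rule someI_ex)
    have "dec y \<in> Pow Y" if "y \<in> set u" for y using dec_Y \<open>set u \<subseteq> set Ys\<close> that by blast
    then have "map dec u \<in> lists (Pow Y)" by (simp add: in_lists_conv_set del: Pow_iff)
    then have "\<sigma> (map dec u) \<in> Pow X" using \<sigma> by (auto simp: winning_strategy_def strategy_def)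
    then obtain l where l: "l \<in> set Xs0" "set l = \<sigma> (map dec u)" using Xs0 by (metis imageE)
    then have "dec (code l) = \<sigma> (map dec u)" using dec_code[of l] X_lists[of l] by auto
    then show "\<exists>x. x \<in> set Xs \<and> dec x = \<sigma> (map dec u)" using l(1) X_code by blast
  qed
  obtain ys b where yb: "\<forall>t. ys t \<in> set Ys" "b 0 = binit w" "\<forall>t. b (Suc t) = bstep w (b t) (\<sigma>' (map ys [0..<t]) @ ys t)"
    "\<not> parity_win (\<lambda>t. priority (level (b (Suc t))) (bad (b (Suc t))))"
    using not_win_environment[OF v assms, of \<sigma>'] s by blast
  let ?as = "\<lambda>t. \<sigma>' (map ys [0..<t]) @ ys t"
  let ?\<tau> = "\<lambda>i. dec (?as i)"
  have u: "set (map ys [0..<t]) \<subseteq> set Ys" for t using yb(1) by auto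
  have x: "dec (\<sigma>' (map ys [0..<t])) \<subseteq> X" "dec (ys t) \<subseteq> Y" for t using dec_X s[OF u] dec_Y yb(1) by blast+
  have \<tau>: "?\<tau> t \<inter> X = dec (\<sigma>' (map ys [0..<t]))" "?\<tau> t \<inter> Y = dec (ys t)" for t
    using x[of t] disj unfolding dec_append by blast+
  have "?\<tau> t \<inter> X = \<sigma> (map (\<lambda>j. ?\<tau> j \<inter> Y) [0..<t])" for t
    unfolding \<tau> using s[OF u, of t] by (simp add: comp_def)
  then have "?\<tau> \<in> outcomes X Y \<sigma>" by (auto simp: outcomes_def infinite_traces_def decode_def)
  then have "?\<tau> \<in> plus_lang lang (X \<union> Y) \<Psi>" using \<sigma> by (auto simp: winning_strategy_def)
  then show False using parity_iff[of b ?as] yb by blast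
qed

section \<open>The transducer of a winning region\<close>

definition decl :: "nat list \<Rightarrow> 'a list" where
  "decl l = map (\<lambda>k. inv_into (X \<union> Y) g (k - 14)) l"

lemma decl_code: "set l \<subseteq> X \<union> Y \<Longrightarrow> decl (code l) = l"
  using inj by (induction l) (auto simp: decl_def)

definition index :: "_ \<Rightarrow> nat" where
  "index e = length (takeWhile (\<lambda>z. z \<noteq> e) (states w))"

lemma index: "e \<in> set (states w) \<Longrightarrow> index e < length (states w) \<and> states w ! index e = e"
  unfolding index_def by (rule takeWhile_index)

text \<open>The table behind the output of \<open>solve\<close>, with the list codes turned back
  into lists of atoms.\<close>

definition D :: "'a transducer" where
  "D = map (\<lambda>e. (decl (pick w e), map (\<lambda>y. (y, index (estep w e (pick w e @ code y)))) Ys0)) (states w)"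

context
  assumes win: "einit w \<in> set (win w)"
begin

lemma states_win: "set (states w) = set (win w)"
  using win by (auto simp: states_def)

lemma pick_list: "e \<in> set (states w) \<Longrightarrow> \<exists>l\<in>set Xs0. pick w e = code l \<and> decl (pick w e) = l \<and> set l \<subseteq> X"
proof -
  assume "e \<in> set (states w)"
  then obtain l where l: "l \<in> set Xs0" "pick w e = code l" using win_step(2)[OF v] states_win X_code by blast
  moreover have "set l \<subseteq> X" using X_lists[OF l(1)] .
  moreover have "decl (pick w e) = l" unfolding l(2) by (rule decl_code) (use X_lists[OF l(1)] in blast)
  ultimately show ?thesis by blast
qed

lemma edge_target: "e \<in> set (states w) \<Longrightarrow> y \<in> set Ys0 \<Longrightarrow> estep w e (pick w e @ code y) \<in> set (states w)"
  using win_step(3)[OF v] states_win Y_code by blast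

lemma transducer_D: "transducer X Y D"
proof -
  have len: "length D = length (states w)" by (simp add: D_def)
  have ent: "set (decl (pick w e)) \<subseteq> X \<and>
      (\<forall>(ys, q)\<in>set (map (\<lambda>y. (y, index (estep w e (pick w e @ code y)))) Ys0). set ys \<subseteq> Y \<and> q < length D) \<and>
      (\<forall>V\<subseteq>Y. \<exists>!q. \<exists>ys. (ys, q) \<in> set (map (\<lambda>y. (y, index (estep w e (pick w e @ code y)))) Ys0) \<and> set ys = V)"
    if e: "e \<in> set (states w)" for e
  proof -
    define h where "h y = index (estep w e (pick w e @ code y))" for y
    have h: "h y < length D" if y: "y \<in> set Ys0" for y
      unfolding h_def len by (rule conjunct1[OF index[OF edge_target[OF e y]]])
    have "set (decl (pick w e)) \<subseteq> X"
    proof -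
      obtain l where "decl (pick w e) = l" "set l \<subseteq> X" using pick_list[OF e] by blast
      then show ?thesis by simp
    qed
    moreover have "\<forall>(ys, q)\<in>set (map (\<lambda>y. (y, h y)) Ys0). set ys \<subseteq> Y \<and> q < length D"
    proof -
      have "set y \<subseteq> Y \<and> h y < length D" if "y \<in> set Ys0" for y using Y_lists[OF that] h[OF that] by (rule conjI)
      then show ?thesis by simp
    qed
    moreover have "\<forall>V\<subseteq>Y. \<exists>!q. \<exists>ys. (ys, q) \<in> set (map (\<lambda>y. (y, h y)) Ys0) \<and> set ys = V"
    proof (intro allI impI)
      fix V assume "V \<subseteq> Y"
      then have "V \<in> set ` set Ys0" unfolding Ys0(1) by (rule PowI)
      then obtain y where y: "y \<in> set Ys0" "V = set y" by (rule imageE)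
      have u: "y' = y" if y': "y' \<in> set Ys0" "set y' = V" for y'
        by (rule inj_onD[OF Ys0(2) _ y'(1) y(1)]) (simp add: y'(2) y(2))
      show "\<exists>!q. \<exists>ys. (ys, q) \<in> set (map (\<lambda>y. (y, h y)) Ys0) \<and> set ys = V"
      proof (rule ex1I[of _ "h y"])
        show "\<exists>ys. (ys, h y) \<in> set (map (\<lambda>y. (y, h y)) Ys0) \<and> set ys = V"
          by (rule exI[of _ y]) (simp add: y)
        fix q assume "\<exists>ys. (ys, q) \<in> set (map (\<lambda>y. (y, h y)) Ys0) \<and> set ys = V"
        then obtain ys where "(ys, q) \<in> set (map (\<lambda>y. (y, h y)) Ys0)" "set ys = V" by (elim exE conjE)
        then have "ys \<in> set Ys0" "q = h ys" by auto
        then show "q = h y" using u[of ys] \<open>set ys = V\<close> by simp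
      qed
    qed
    ultimately show ?thesis unfolding h_def by (intro conjI)
  qed
  have ne: "D \<noteq> []" by (simp add: D_def states_def)
  show ?thesis unfolding transducer_def
  proof (intro conjI ballI)
    show "D \<noteq> []" by (rule ne)
    fix s assume "s \<in> set D"
    then have "s \<in> (\<lambda>e. (decl (pick w e), map (\<lambda>y. (y, index (estep w e (pick w e @ code y)))) Ys0)) ` set (states w)"
      unfolding D_def set_map .
    then obtain e where e: "e \<in> set (states w)"
      "s = (decl (pick w e), map (\<lambda>y. (y, index (estep w e (pick w e @ code y)))) Ys0)" by (rule imageE)
    show "case s of (out, edges) \<Rightarrow> set out \<subseteq> X \<and> (\<forall>(ys, q)\<in>set edges. set ys \<subseteq> Y \<and> q < length D) \<and>
        (\<forall>V\<subseteq>Y. \<exists>!q. \<exists>ys. (ys, q) \<in> set edges \<and> set ys = V)"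
      unfolding e(2) prod.case by (rule ent[OF e(1)])
  qed
qed

lemma transducer_step_D:
  assumes q: "q < length (states w)" and y: "y \<in> set Ys0"
  shows "transducer_step D q (set y) = index (estep w (states w ! q) (pick w (states w ! q) @ code y))"
proof -
  have u: "y' = y" if "y' \<in> set Ys0" "set y' = set y" for y' using Ys0(2) that y by (metis inj_onD)
  show ?thesis unfolding transducer_step_def
    by (rule the_equality) (use q y u in \<open>auto simp: D_def\<close>)
qed

lemma step_target:
  assumes q: "q < length (states w)" and y: "y \<in> set Ys0"
  shows "transducer_step D q (set y) < length (states w)"
    "states w ! transducer_step D q (set y) = estep w (states w ! q) (pick w (states w ! q) @ code y)"
  using index[OF edge_target[OF nth_mem[OF q] y]] by (simp_all add: transducer_step_D[OF q y])

lemma foldl_step_D: "u \<in> lists (Pow Y) \<Longrightarrow> q < length (states w) \<Longrightarrow> foldl (transducer_step D) q u < length (states w)"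
proof (induction u arbitrary: q)
  case (Cons V u)
  then have "V \<in> Pow Y" by simp
  then obtain y where "y \<in> set Ys0" "set y = V" using Ys0(1) by (metis imageE)
  then show ?case using Cons step_target(1)[OF Cons.prems(2)] by auto
qed simp

lemma strategy_D: "q < length (states w) \<Longrightarrow> set (fst (D ! q)) = set (decl (pick w (states w ! q)))"
  by (simp add: D_def)

text \<open>Every outcome traces a play inside the winning region. Its counters never overflow, so
  \<open>counters_sound\<close> gives the parity condition and \<open>parity_iff\<close> the
  formula.\<close>

lemma winning_D: "winning_strategy X Y (plus_lang lang (X \<union> Y) \<Psi>) (transducer_strategy D)"
  unfolding winning_strategy_def
proof (intro conjI subsetI)
  have len: "0 < length (states w)" by (simp add: states_def)
  show "strategy X Y (transducer_strategy D)" unfolding strategy_def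
  proof
    fix u assume "u \<in> lists (Pow Y)"
    then have q: "foldl (transducer_step D) 0 u < length (states w)" using foldl_step_D len by blast
    show "transducer_strategy D u \<subseteq> X"
      unfolding transducer_strategy_def strategy_D[OF q] using pick_list[OF nth_mem[OF q]] by auto
  qed
  fix \<tau> assume \<tau>: "\<tau> \<in> outcomes X Y (transducer_strategy D)"
  define q where "q i = foldl (transducer_step D) 0 (map (\<lambda>j. \<tau> j \<inter> Y) [0..<i])" for i
  have q: "q i < length (states w)" for i unfolding q_def by (rule foldl_step_D[OF _ len]) auto
  define e where "e i = states w ! q i" for i
  have e: "e i \<in> set (states w)" for i unfolding e_def by (rule nth_mem[OF q])
  have "\<exists>y\<in>set Ys0. set y = \<tau> i \<inter> Y" for i
  proof -
    have "\<tau> i \<inter> Y \<in> set ` set Ys0" unfolding Ys0(1) by blast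
    then show ?thesis by (metis imageE)
  qed
  then obtain y where y: "\<And>i. y i \<in> set Ys0" "\<And>i. set (y i) = \<tau> i \<inter> Y" by metis
  let ?as = "\<lambda>i. pick w (e i) @ code (y i)"
  have "q (Suc i) = transducer_step D (q i) (set (y i))" for i by (simp add: q_def y(2))
  then have step: "e (Suc i) = estep w (e i) (?as i)" for i
    using step_target(2)[OF q y(1)] by (simp add: e_def)
  have e0: "e 0 = einit w" by (simp add: e_def q_def states_def)
  have dec: "dec (?as i) = \<tau> i" for i
  proof -
    obtain l where l: "pick w (e i) = code l" "decl (pick w (e i)) = l" "set l \<subseteq> X" using pick_list[OF e] by blast
    have "\<tau> i \<inter> X = transducer_strategy D (map (\<lambda>j. \<tau> j \<inter> Y) [0..<i])" using \<tau> by (simp add: outcomes_def)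
    also have "\<dots> = set l" unfolding transducer_strategy_def using strategy_D[OF q, of i] l(2) by (simp add: q_def e_def)
    finally have "dec (pick w (e i)) = \<tau> i \<inter> X" using l dec_code[of l] by auto
    moreover have "dec (code (y i)) = \<tau> i \<inter> Y" using dec_code[of "y i"] y(2)[of i] by auto
    moreover have "\<tau> i \<subseteq> X \<union> Y" using \<tau> by (auto simp: outcomes_def infinite_traces_def)
    ultimately show ?thesis unfolding dec_append by blast
  qed
  let ?b = "\<lambda>i. fst (e i)"
  have b: "?b 0 = binit w" "?b (Suc i) = bstep w (?b i) (?as i)" for i
    by (simp_all add: e0 einit_def step estep_def)
  have "parity_win (\<lambda>t. priority (level (?b (Suc t))) (bad (?b (Suc t))))"
  proof (rule counters_sound[where cs = "\<lambda>t. snd (e t)" and n = "length w" and B = "length (bases w)"])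
    show "snd (e 0) = replicate (Suc (length w)) 0" by (simp add: e0 einit_def map_replicate_const)
    show "snd (e (Suc t)) = upd_counters (length (bases w)) (level (?b (Suc t))) (bad (?b (Suc t))) (snd (e t))" for t
      by (simp add: step estep_def update_counters_eq level_def)
    show "snd (e t) \<noteq> []" for t using win_step(1)[OF v] e states_win by auto
    show "level (?b (Suc t)) \<le> length w" for t
      using win_step(4)[OF v, of "e (Suc t)"] e[of "Suc t"] states_win level_space by (auto simp: ext_space_def)
  qed
  then show "\<tau> \<in> plus_lang lang (X \<union> Y) \<Psi>" using parity_iff[of ?b ?as, OF b] dec by simp
qed

text \<open>The unary targets agree, because \<open>ticks\<close> and \<open>index\<close> both stop
  at the first occurrence.\<close>

lemma code_D: "map (letter_code g) (transducer_code D) = concat (map (state_word w) (states w))"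
proof -
  have "map (letter_code g) (state_code (decl (pick w e), map (\<lambda>y. (y, index (estep w e (pick w e @ code y)))) Ys0)) = state_word w e"
    if e: "e \<in> set (states w)" for e
  proof -
    obtain l where l: "pick w e = code l" "decl (pick w e) = l" using pick_list[OF e] by blast
    have at: "map (letter_code g) (edge_code (y, k)) = 10 # code y @ replicate k 11" for y k
      by (simp add: edge_code_def comp_def)
    have "map (letter_code g) (edge_code (y, index (estep w e (pick w e @ code y)))) = edge_word w e (code y)" for y
      unfolding at edge_word_def ticks_index index_def ..
    then show ?thesis unfolding state_word_def state_code_def
      by (simp add: l(1) l(2)[unfolded l(1)] map_concat comp_def map_Ys)
  qed
  then show ?thesis unfolding transducer_code_def D_def map_concat
    by (intro arg_cong[of _ _ concat]) (simp add: comp_def)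
qed

end

theorem solve_correct:
  "snd (solve w) \<longleftrightarrow> (\<exists>\<sigma>. winning_strategy X Y (plus_lang lang (X \<union> Y) \<Psi>) \<sigma>)"
  "snd (solve w) \<Longrightarrow> \<exists>D. transducer X Y D \<and> map (letter_code g) (transducer_code D) = fst (solve w) \<and>
     winning_strategy X Y (plus_lang lang (X \<union> Y) \<Psi>) (transducer_strategy D)"
proof -
  have 1: "einit w \<in> set (win w)" if "snd (solve w)" using that by (simp add: solve_def split: if_splits)
  show 2: "\<exists>D. transducer X Y D \<and> map (letter_code g) (transducer_code D) = fst (solve w) \<and>
     winning_strategy X Y (plus_lang lang (X \<union> Y) \<Psi>) (transducer_strategy D)" if "snd (solve w)"
    using transducer_D[OF 1[OF that]] winning_D[OF 1[OF that]] code_D[OF 1[OF that]] 1[OF that]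
    by (intro exI[of _ D]) (simp add: solve_def)
  show "snd (solve w) \<longleftrightarrow> (\<exists>\<sigma>. winning_strategy X Y (plus_lang lang (X \<union> Y) \<Psi>) \<sigma>)"
  proof
    show "snd (solve w)" if "\<exists>\<sigma>. winning_strategy X Y (plus_lang lang (X \<union> Y) \<Psi>) \<sigma>"
      using that not_win_unrealizable by (auto simp: solve_def)
  qed (use 2 in blast)
qed

end

section \<open>Parsing and monitors\<close>

text \<open>The grammar between parser and formulas. The flag separates formulas on infinite traces
  from those on finite ones, as both share the letters 0, 1, 2 of the Boolean connectives.\<close>

inductive coded :: "nat list \<Rightarrow> bool \<Rightarrow> nat list \<Rightarrow> bool" for As where
  coded_atom: "l \<in> set As \<Longrightarrow> coded As False [l]"
| coded_not: "coded As b u \<Longrightarrow> coded As b (0 # u)"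
| coded_binary: "coded As b u \<Longrightarrow> coded As b v \<Longrightarrow> l \<in> {1, 2} \<Longrightarrow> coded As b (l # u @ v)"
| coded_yesterday: "coded As False u \<Longrightarrow> coded As False (3 # u)"
| coded_since: "coded As False u \<Longrightarrow> coded As False v \<Longrightarrow> coded As False (4 # u @ v)"
| coded_quant: "coded As False u \<Longrightarrow> l \<in> {5, 6, 7, 8} \<Longrightarrow> coded As True (l # u)"

text \<open>The stack of the parser holds \<open>True\<close> for a formula on infinite traces and \<open>False\<close> for one on finite
  traces.\<close>

definition parse_step :: "nat list \<Rightarrow> nat \<Rightarrow> bool \<times> bool list \<Rightarrow> bool \<times> bool list" where
  "parse_step As l s =
     (fst s \<and> (if l = 0 then snd s \<noteq> []
       else if l \<in> set [1, 2] then snd s \<noteq> [] \<and> tl (snd s) \<noteq> [] \<and> hd (snd s) = hd (tl (snd s))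
       else if l = 4 then snd s \<noteq> [] \<and> tl (snd s) \<noteq> [] \<and> hd (snd s) = False \<and> hd (tl (snd s)) = False
       else if l \<in> set [3, 5, 6, 7, 8] then snd s \<noteq> [] \<and> hd (snd s) = False
       else l \<in> set As),
      if l \<in> set [0, 3] then snd s
      else if l \<in> set [1, 2, 4] then tl (snd s)
      else if l \<in> set [5, 6, 7, 8] then True # tl (snd s) else False # snd s)"

definition parses :: "nat list \<Rightarrow> nat list \<Rightarrow> bool" where
  "parses As w \<longleftrightarrow> foldr (parse_step As) w (True, []) = (True, [True])"

lemma coded_parse:
  "coded As b u \<Longrightarrow> \<forall>l\<in>set As. 14 \<le> l \<Longrightarrow> foldr (parse_step As) u (True, st) = (True, b # st)"
proof (induction arbitrary: st rule: coded.induct)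
  case (coded_atom l)
  then have "14 \<le> l" by blast
  then have "l \<noteq> 0" "l \<noteq> 1" "l \<noteq> 2" "l \<noteq> 3" "l \<noteq> 4" "l \<noteq> 5" "l \<noteq> 6" "l \<noteq> 7" "l \<noteq> 8" by simp_all
  then show ?case using coded_atom(1) by (simp add: parse_step_def)
qed (auto simp: parse_step_def)

text \<open>As long as no error has occurred, the stack describes a division of the word read so far
  into complete formulas of the recorded kinds.\<close>

lemma parse_coded:
  assumes "\<forall>l\<in>set As. 14 \<le> l"
  shows "foldr (parse_step As) w (True, []) = (True, st) \<Longrightarrow>
    \<exists>us. w = concat us \<and> list_all2 (coded As) st us"
proof (induction w arbitrary: st)
  case (Cons l w)
  obtain ok st' where s: "foldr (parse_step As) w (True, []) = (ok, st')" by fastforce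
  have e: "parse_step As l (ok, st') = (True, st)" using Cons.prems s by simp
  then have ok: "ok = True" by (auto simp: parse_step_def)
  then obtain us where us: "w = concat us" "list_all2 (coded As) st' us" using Cons.IH s by auto
  note e = e[unfolded ok]
  consider "l \<in> {0, 3, 5, 6, 7, 8}" | "l \<in> {1, 2, 4}" | "l \<in> set As" "l \<notin> {0, 1, 2, 3, 4, 5, 6, 7, 8}"
    using e by (auto simp: parse_step_def split: if_splits)
  then show ?case
  proof cases
    case 1
    then have "st' \<noteq> []" using e by (auto simp: parse_step_def)
    then obtain b st1 u us1 where 2: "st' = b # st1" "us = u # us1" "coded As b u" "list_all2 (coded As) st1 us1"
      using us(2) by (cases st'; cases us) auto
    have "\<exists>b'. st = b' # st1 \<and> coded As b' (l # u)"
      using e 1 2(3) by (intro exI[of _ "if l = 0 \<or> l = 3 then b else True"]) (auto simp: parse_step_def 2(1) intro: coded.intros)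
    then show ?thesis using us(1) 2 by (auto intro!: exI[of _ "(l # u) # us1"])
  next
    case 2
    then have "st' \<noteq> []" "tl st' \<noteq> []" using e by (auto simp: parse_step_def)
    then obtain b st1 c where "st' = b # c # st1" by (metis list.collapse)
    moreover have "b = c" using e 2 by (auto simp: parse_step_def calculation split: if_splits)
    ultimately obtain u v us1 where 3: "st' = b # b # st1" "us = u # v # us1" "coded As b u" "coded As b v"
        "list_all2 (coded As) st1 us1"
      using us(2) by (auto simp: list_all2_Cons1)
    have "st = b # st1 \<and> coded As b (l # u @ v)"
      using e 2 3(3,4) by (auto simp: parse_step_def 3(1) intro: coded.intros)
    then show ?thesis using us(1) 3 by (auto intro!: exI[of _ "(l # u @ v) # us1"])
  next
    case 3
    then have "st = False # st'" "coded As False [l]" using e by (auto simp: parse_step_def intro: coded.intros)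
    then show ?thesis using us by (auto intro!: exI[of _ "[l] # us"])
  qed
qed auto

lemma parses_coded:
  assumes "\<forall>l\<in>set As. 14 \<le> l"
  shows "parses As w \<longleftrightarrow> coded As True w"
  using parse_coded[OF assms, of w "[True]"] coded_parse[OF _ assms, of True w "[]"]
  by (auto simp: parses_def list_all2_Cons1)

lemma coded_formulas:
  "coded As b u \<Longrightarrow> set As = (\<lambda>p. 14 + g p) ` AP \<Longrightarrow>
    (if b then \<exists>\<Psi>\<in>ppltl_plus_over AP. u = word_code g \<Psi>
     else \<exists>\<phi>. set_ppltl \<phi> \<subseteq> AP \<and> u = formula_code g \<phi>)"
proof (induction rule: coded.induct)
  case (coded_atom l)
  then obtain p where "p \<in> AP" "l = 14 + g p" by auto
  then show ?case by (auto intro!: exI[of _ "PAtom p"])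
next
  case (coded_not b u)
  show ?case
  proof (cases b)
    case True
    then obtain \<Psi> where "\<Psi> \<in> ppltl_plus_over AP" "u = word_code g \<Psi>" using coded_not by auto
    then show ?thesis using True by (auto simp: ppltl_plus_over_def intro!: exI[of _ "Not_plus \<Psi>"])
  next
    case False
    then obtain \<phi> where "set_ppltl \<phi> \<subseteq> AP" "u = formula_code g \<phi>" using coded_not by auto
    then show ?thesis using False by (auto intro!: exI[of _ "PNot \<phi>"])
  qed
next
  case (coded_binary b u v l)
  show ?case
  proof (cases b)
    case True
    then obtain \<Psi> \<Psi>' where p: "\<Psi> \<in> ppltl_plus_over AP" "u = word_code g \<Psi>" "\<Psi>' \<in> ppltl_plus_over AP" "v = word_code g \<Psi>'"
      using coded_binary by auto
    then have "Or_plus \<Psi> \<Psi>' \<in> ppltl_plus_over AP" "And_plus \<Psi> \<Psi>' \<in> ppltl_plus_over AP" by (auto simp: ppltl_plus_over_def)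
    then show ?thesis using True coded_binary(3) p(2,4) word_code_simps(2,3)[of g \<Psi> \<Psi>', symmetric]
      by (auto simp del: word_code_simps)
  next
    case False
    then obtain \<phi> \<phi>' where p: "set_ppltl \<phi> \<subseteq> AP" "u = formula_code g \<phi>" "set_ppltl \<phi>' \<subseteq> AP" "v = formula_code g \<phi>'"
      using coded_binary by auto
    then have "set_ppltl (POr \<phi> \<phi>') \<subseteq> AP" "set_ppltl (PAnd \<phi> \<phi>') \<subseteq> AP" by auto
    then show ?thesis using False coded_binary(3) p(2,4) formula_code_simps(3,4)[of g \<phi> \<phi>', symmetric]
      by (auto simp del: ppltl.set formula_code_simps)
  qed
next
  case (coded_yesterday u)
  then obtain \<phi> where "set_ppltl \<phi> \<subseteq> AP" "u = formula_code g \<phi>" by auto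
  then show ?case by (auto intro!: exI[of _ "PYesterday \<phi>"])
next
  case (coded_since u v)
  then obtain \<phi> \<phi>' where "set_ppltl \<phi> \<subseteq> AP" "u = formula_code g \<phi>" "set_ppltl \<phi>' \<subseteq> AP" "v = formula_code g \<phi>'" by auto
  then show ?case by (auto intro!: exI[of _ "PSince \<phi> \<phi>'"])
next
  case (coded_quant u l)
  then obtain \<phi> where p: "set_ppltl \<phi> \<subseteq> AP" "u = formula_code g \<phi>" by auto
  obtain Q where "letter_code g (A_Quant Q) = l"
    using coded_quant(2) letter_code.simps(6-9)[of g] by (metis empty_iff insert_iff)
  moreover have "Quant Q \<phi> \<in> ppltl_plus_over AP" using p(1) by (simp add: ppltl_plus_over_def)
  ultimately show ?case using p(2) word_code_simps(1)[of g Q \<phi>, symmetric] by (auto simp del: word_code_simps)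
qed

lemma formula_code_coded:
  "set As = (\<lambda>p. 14 + g p) ` AP \<Longrightarrow> set_ppltl \<phi> \<subseteq> AP \<Longrightarrow> coded As False (formula_code g \<phi>)"
  by (induction \<phi>) (auto intro: coded.intros)

lemma word_code_coded:
  "set As = (\<lambda>p. 14 + g p) ` AP \<Longrightarrow> \<Psi> \<in> ppltl_plus_over AP \<Longrightarrow> coded As True (word_code g \<Psi>)"
proof (induction \<Psi>)
  case (Quant Q \<phi>)
  then have "set_ppltl \<phi> \<subseteq> AP" by (simp add: ppltl_plus_over_def)
  then show ?case unfolding word_code_simps by (intro coded_quant formula_code_coded[OF Quant(1)] quant_code)
next
  case (Or_plus \<Psi>1 \<Psi>2)
  then have "\<Psi>1 \<in> ppltl_plus_over AP" "\<Psi>2 \<in> ppltl_plus_over AP" by (auto simp: ppltl_plus_over_def)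
  then show ?case using Or_plus by (auto intro: coded_binary)
next
  case (And_plus \<Psi>1 \<Psi>2)
  then have "\<Psi>1 \<in> ppltl_plus_over AP" "\<Psi>2 \<in> ppltl_plus_over AP" by (auto simp: ppltl_plus_over_def)
  then show ?case using And_plus by (auto intro: coded_binary)
next
  case (Not_plus \<Psi>)
  then have "\<Psi> \<in> ppltl_plus_over AP" by (auto simp: ppltl_plus_over_def)
  then show ?case using Not_plus by (auto intro: coded_not)
qed

lemma parses_iff:
  assumes "set As = (\<lambda>p. 14 + g p) ` AP"
  shows "parses As w \<longleftrightarrow> (\<exists>\<Psi>\<in>ppltl_plus_over AP. w = word_code g \<Psi>)"
proof -
  have "\<forall>l\<in>set As. 14 \<le> l" using assms by auto
  then show ?thesis using parses_coded coded_formulas[OF _ assms, of True w] word_code_coded[OF assms] by auto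
qed

lemma pt_parses: "pt (\<lambda>_. 1) (parses As)"
  unfolding parses_def
proof (intro pt_eq pt_const)
  show "pt (\<lambda>_. 1) (\<lambda>w. foldr (parse_step As) w (True, []))"
  proof (rule pt_foldr_add[where h = "\<lambda>_. 20"])
    show "pt (\<lambda>z. 1) (\<lambda>z :: nat list \<times> nat \<times> bool \<times> bool list. parse_step As (fst (snd z)) (snd (snd z)))"
      unfolding parse_step_def by (intro pt_intros)
    show "sz (parse_step As l s) \<le> sz s + 20" for l s
    proof -
      obtain b c where "parse_step As l s = (b, if l \<in> set [0, 3] then snd s
        else if l \<in> set [1, 2, 4] then tl (snd s)
        else if l \<in> set [5, 6, 7, 8] then True # tl (snd s) else False # snd s)" by (simp add: parse_step_def)
      then show ?thesis using sz_bool[of b] sz_bool[of True] sz_bool[of False] sz_tl[of "snd s"]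
        by (simp add: sz_pair[of s] split: if_split)
    qed
  qed (intro pt_intros pb_const)+
qed

text \<open>Outside its domain \<open>pt\<close> promises nothing, not even termination. There the
  program for \<open>f\<close> is given a fixed argument \<open>d\<close> of the domain instead, and
  its result is replaced by \<open>e\<close>.\<close>

lemma pt_guarded:
  assumes f: "pt \<mu> f" and c: "pt (\<lambda>_. 1) c" and dom: "\<And>w. c w \<longleftrightarrow> 0 < \<mu> w" and d: "0 < \<mu> d"
  shows "pt (\<lambda>w. if c w then \<mu> w else 1) (\<lambda>w. if c w then f w else e)"
proof -
  let ?\<nu> = "\<lambda>w. if c w then \<mu> w else 1"
  have c': "pt ?\<nu> c" using pt_comp1[OF c pt_id] by simp
  have "pt ?\<nu> (\<lambda>w. f (if c w then w else d))"
  proof (rule pt_comp[OF f])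
    show "pt ?\<nu> (\<lambda>w. if c w then w else d)" by (intro pt_if c' pt_intros)
    show "pb ?\<nu> (\<lambda>w. \<mu> (if c w then w else d))"
      by (rule pb_mono[OF pb_add[OF pb_mu pb_const[of _ "\<mu> d"]]]) auto
    show "0 < \<mu> (if c w then w else d)" for w using dom d by auto
  qed
  from pt_if[OF c' this pt_const[of _ e]] show ?thesis by (rule pt_cong) simp
qed

section \<open>Monitors for traces and for reversed traces\<close>

lemma length_truth_update: "length (truth_update w a v) = min (length w) (length v)"
proof -
  have "length (snd (foldr (truth_step a) l s)) = length l + length (snd s)" for l s
    by (induction l) (auto simp: truth_step_def Let_def)
  then show ?thesis by (simp add: truth_update_def)
qed

lemma pt_falses: "pt \<mu> (\<lambda>w :: nat list. map (\<lambda>_. False) w)"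
  by (intro pt_intros)

definition vector_monitor_bound :: "nat list \<Rightarrow> nat" where
  "vector_monitor_bound w = 1 + length w * 4"

lemma vector_monitor: "synthesis (map (\<lambda>_. False)) (\<lambda>w v a. truth_update w a v) (\<lambda>_ v. v) valid vector_monitor_bound id"
proof
  show "pt (\<lambda>_. 1) (\<lambda>z. truth_update (fst z) (snd (snd z)) (fst (snd z)))"
    by (intro pt_truth_update pt_intros)
  have "length (foldl (\<lambda>v a. truth_update w a v) v as) \<le> length w" if "length v \<le> length w" for w v as
    using that by (induction as arbitrary: v) (auto simp: length_truth_update)
  then have "length (foldl (\<lambda>v a. truth_update w a v) (map (\<lambda>_. False) w) as) * 4 \<le> length w * 4" for w as by simp
  then show "sz (foldl (\<lambda>v a. truth_update w a v) (map (\<lambda>_. False) w) as) \<le> vector_monitor_bound w" for w as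
    unfolding vector_monitor_bound_def using sz_bool_list le_trans add_le_cancel_left by metis
qed (simp_all add: truth_values_def pt_falses pt_intros)

text \<open>A monitor for the reversed trace cannot keep the current truth values. Its state is the table of the
  function that maps the truth values before reading the reversed trace to those after it.\<close>

definition vectors :: "nat list \<Rightarrow> bool list list" where
  "vectors w = foldl (\<lambda>vs _. map (Cons False) vs @ map (Cons True) vs) [[]] w"

definition lookup :: "(bool list \<times> bool list) list \<Rightarrow> bool list \<Rightarrow> bool list" where
  "lookup T v = foldr (\<lambda>p r. if fst p = v then snd p else r) T []"

definition table_init :: "nat list \<Rightarrow> (bool list \<times> bool list) list" where
  "table_init w = map (\<lambda>v. (v, v)) (vectors w)"

definition table_update :: "nat list \<Rightarrow> (bool list \<times> bool list) list \<Rightarrow> nat list \<Rightarrow> (bool list \<times> bool list) list" where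
  "table_update w T a = map (\<lambda>p. (fst p, lookup T (truth_update w a (fst p)))) T"

text \<open>2^n rows, each with two Boolean vectors of encoded size at most 4 n + 1, for a word of
  length n.\<close>

definition table_bound :: "nat list \<Rightarrow> nat" where
  "table_bound w = 1 + 2 ^ length w * (length w * 8 + 4)"

lemma vectors: "set (vectors w) = {v. length v = length w}" "length (vectors w) = 2 ^ length w"
proof (induction w rule: rev_induct)
  case Nil
  { case 1 show ?case by (auto simp: vectors_def) }
  { case 2 show ?case by (auto simp: vectors_def) }
next
  case (snoc l w)
  have e: "vectors (w @ [l]) = map (Cons False) (vectors w) @ map (Cons True) (vectors w)" by (simp add: vectors_def)
  { case 1
    have "v \<in> Cons False ` {v. length v = length w} \<union> Cons True ` {v. length v = length w}"
      if "length v = Suc (length w)" for v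
    proof (cases v)
      case (Cons b u) then show ?thesis using that by (cases b) auto
    qed (use that in simp)
    then show ?case unfolding e set_append set_map snoc(1) by auto }
  { case 2 show ?case unfolding e by (simp add: snoc(2)) }
qed

lemma lookup_table: "v \<in> set vs \<Longrightarrow> lookup (map (\<lambda>v. (v, f v)) vs) v = f v"
  unfolding lookup_def by (induction vs) auto

lemma pt_lookup_base: "pt (\<lambda>_. 1) (\<lambda>z. lookup (fst z) (snd z))"
  unfolding lookup_def
proof (rule pt_foldr_add[where h = sz])
  show "sz (if fst p = snd c then snd p else r) \<le> sz r + sz (c, p)"
    for c :: "(bool list \<times> bool list) list \<times> bool list" and p :: "bool list \<times> bool list" and r
    using sz_snd[of p] by simp
qed (intro pt_intros pb_intros)+

text \<open>A letter appended to the trace comes first in the reversed trace. It acts before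
  everything the table already describes, so a row is updated by applying the letter to its key and
  looking up the result in the old table.\<close>

lemma foldl_table:
  "foldl (table_update w) (table_init w) as = map (\<lambda>v. (v, foldr (truth_update w) as v)) (vectors w)"
proof (induction as rule: rev_induct)
  case Nil show ?case by (simp add: table_init_def)
next
  case (snoc a as)
  have "truth_update w a v \<in> set (vectors w)" if "v \<in> set (vectors w)" for v
    using that by (simp add: vectors length_truth_update)
  then have "table_update w (map (\<lambda>v. (v, foldr (truth_update w) as v)) (vectors w)) a =
      map (\<lambda>v. (v, foldr (truth_update w) (as @ [a]) v)) (vectors w)"
    by (simp add: table_update_def lookup_table)
  moreover have "foldl (table_update w) (table_init w) (as @ [a]) = table_update w (foldl (table_update w) (table_init w) as) a"
    by simp
  ultimately show ?case unfolding snoc by simp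
qed

lemma length_foldr_truth_update: "length v = length w \<Longrightarrow> length (foldr (truth_update w) as v) = length w"
  by (induction as) (auto simp: length_truth_update)

lemma table_monitor: "synthesis table_init table_update (\<lambda>w T. lookup T (map (\<lambda>_. False) w)) valid table_bound rev"
proof
  show "pt (game_bound valid table_bound) table_init"
    unfolding table_init_def vectors_def
  proof (intro pt_map pt_pair pt_snd pt_id pt_foldl_context)
    show "pb (game_bound valid table_bound) (\<lambda>w. 1 + game_bound valid table_bound w * (length w * 4 + 2))"
      by (intro pb_intros pt_sz[OF pt_length[OF pt_id], THEN pb_mono]) (simp add: sz_nat)
    fix w :: "nat list" and i assume w: "0 < game_bound valid table_bound w" "i \<le> length w"
    \<comment> \<open>Writing down all vectors takes exponential time; it is polynomial in the bound
      on the game, which is at least this large.\<close>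
    have b: "2 ^ length w \<le> game_bound valid table_bound w"
    proof -
      have "length w \<le> 1 * (length w + 3)" by simp
      also have "\<dots> \<le> (base_bound table_bound w + 3) * (length w + 3)" by (intro mult_right_mono) auto
      finally show ?thesis using w(1) by (simp add: game_bound_def split: if_splits)
    qed
    have "sz (vectors (take i w)) \<le> 1 + length (vectors (take i w)) * ((1 + i * 4) + 1)"
    proof (rule sz_list_bound)
      fix v assume "v \<in> set (vectors (take i w))"
      then show "sz v \<le> 1 + i * 4" using w(2) sz_bool_list[of v] by (simp add: vectors min_absorb2)
    qed
    also have "\<dots> = 1 + 2 ^ i * (i * 4 + 2)" using w(2) by (simp add: vectors min_absorb2)
    also have "\<dots> \<le> 1 + 2 ^ length w * (length w * 4 + 2)" using w(2) by (intro add_left_mono mult_mono power_increasing) auto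
    also have "\<dots> \<le> 1 + game_bound valid table_bound w * (length w * 4 + 2)" using b by (intro add_left_mono mult_right_mono) auto
    finally show "sz (foldl (\<lambda>vs _. map (Cons False) vs @ map (Cons True) vs) [[]] (take i w)) \<le>
      1 + game_bound valid table_bound w * (length w * 4 + 2)" by (simp add: vectors_def)
  qed (intro pt_intros)+
  show "pt (\<lambda>_. 1) (\<lambda>z. table_update (fst z) (fst (snd z)) (snd (snd z)))"
    unfolding table_update_def by (intro pt_map pt_pair pt_fun2[OF pt_lookup_base] pt_truth_update pt_intros)
  show "pt (\<lambda>_. 1) (\<lambda>z. lookup (snd z) (map (\<lambda>_. False) (fst z)))"
    by (intro pt_fun2[OF pt_lookup_base] pt_intros)
  show "sz (foldl (table_update w) (table_init w) as) \<le> table_bound w" for w as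
  proof -
    have "sz (foldl (table_update w) (table_init w) as) \<le>
      1 + length (foldl (table_update w) (table_init w) as) * ((length w * 8 + 3) + 1)"
    proof (rule sz_list_bound)
      fix p assume "p \<in> set (foldl (table_update w) (table_init w) as)"
      then obtain v where v: "length v = length w" "p = (v, foldr (truth_update w) as v)" by (auto simp: foldl_table vectors)
      show "sz p \<le> length w * 8 + 3"
        using v(1) sz_bool_list[of v] sz_bool_list[of "foldr (truth_update w) as v"]
        by (simp add: v(2) length_foldr_truth_update)
    qed
    then show ?thesis by (simp add: foldl_table vectors table_bound_def add.commute)
  qed
  show "lookup (foldl (table_update w) (table_init w) as) (map (\<lambda>_. False) w) = truth_values w (rev as)" for w as
  proof -
    have "map (\<lambda>_. False) w \<in> set (vectors w)" by (simp add: vectors)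
    then show ?thesis unfolding foldl_table by (simp add: lookup_table truth_values_def foldr_conv_foldl)
  qed
qed simp

section \<open>Mirror images of future formulas\<close>

fun past :: "'a ltlf \<Rightarrow> 'a ppltl" where
  "past (LAtom p) = PAtom p"
| "past (LNot \<phi>) = PNot (past \<phi>)"
| "past (LOr \<phi> \<psi>) = POr (past \<phi>) (past \<psi>)"
| "past (LAnd \<phi> \<psi>) = PAnd (past \<phi>) (past \<psi>)"
| "past (LNext \<phi>) = PYesterday (past \<phi>)"
| "past (LUntil \<phi> \<psi>) = PSince (past \<phi>) (past \<psi>)"

text \<open>Mirroring a formula merely renames letters of its word, so an LTLf input needs no
  translation by the machine: only the numbering of the input letters changes. Swapping in both
  directions keeps the renaming injective.\<close>

fun past_letter :: "'a letter \<Rightarrow> 'a letter" where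
  "past_letter A_Next = A_Yesterday"
| "past_letter A_Yesterday = A_Next"
| "past_letter A_Until = A_Since"
| "past_letter A_Since = A_Until"
| "past_letter l = l"

lemma past_letter_involution [simp]: "past_letter (past_letter l) = l"
  by (cases l) auto

lemma ppltl_code_past: "ppltl_code (past \<phi>) = map past_letter (ltlf_code \<phi>)"
  by (induction \<phi>) auto

lemma plus_code_past: "plus_code ppltl_code (map_plus past \<Psi>) = map past_letter (plus_code ltlf_code \<Psi>)"
  by (induction \<Psi>) (auto simp: ppltl_code_past)

lemma set_past: "set_ppltl (past \<phi>) = set_ltlf \<phi>"
  by (induction \<phi>) auto

text \<open>Ensures that every word accepted by the parser for past formulas comes from an LTLf
  formula.\<close>

lemma surj_past: "\<exists>\<psi>. past \<psi> = \<phi>"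
  by (induction \<phi>) (metis past.simps)+

lemma past_over: "map_plus past \<Psi> \<in> ppltl_plus_over AP \<longleftrightarrow> \<Psi> \<in> ltlf_plus_over AP"
  by (simp add: ppltl_plus_over_def ltlf_plus_over_def plus.set_map set_past)

lemma surj_map_past: "\<exists>\<Psi>'. map_plus past \<Psi>' = \<Psi>"
proof (induction \<Psi>)
  case (Quant Q \<phi>) then show ?case using surj_past[of \<phi>] by (metis plus.map(1))
qed (metis plus.map)+

text \<open>Position \<open>i\<close> becomes \<open>length t - 1 - i\<close>, which exchanges last
  and first position; strong Next and strong Yesterday fail at corresponding places.\<close>

lemma ppltl_sat_past: "i < length t \<Longrightarrow> ppltl_sat (rev t) (length t - 1 - i) (past \<phi>) \<longleftrightarrow> ltlf_sat t i \<phi>"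
proof (induction \<phi> arbitrary: i)
  case (LAtom p)
  then show ?case by (simp add: rev_nth)
next
  case (LNext \<phi>)
  have "0 < length t - 1 - i \<longleftrightarrow> Suc i < length t" using LNext.prems by auto
  moreover have "length t - 1 - i - 1 = length t - 1 - Suc i" by simp
  ultimately show ?case using LNext.IH[of "Suc i"] by auto
next
  case (LUntil \<phi> \<psi>)
  let ?f = "\<lambda>j. length t - 1 - j"
  have inv: "?f (?f j) = j" "?f j < length t" if "j < length t" for j using that by auto
  show ?case
  proof
    assume "ppltl_sat (rev t) (?f i) (past (LUntil \<phi> \<psi>))"
    then obtain j where j: "j \<le> ?f i" "ppltl_sat (rev t) j (past \<psi>)" "\<And>k. j < k \<Longrightarrow> k \<le> ?f i \<Longrightarrow> ppltl_sat (rev t) k (past \<phi>)" by auto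
    have l: "j < length t" using j(1) LUntil.prems by simp
    have "i \<le> ?f j" using j(1) LUntil.prems by simp
    moreover have "ltlf_sat t (?f j) \<psi>" using LUntil.IH(2)[OF inv(2)[OF l]] j(2) inv(1)[OF l] by simp
    moreover have "ltlf_sat t k \<phi>" if k: "i \<le> k" "k < ?f j" for k
    proof -
      have "k < length t" "j < ?f k" "?f k \<le> ?f i" using k l by auto
      then show ?thesis using LUntil.IH(1) j(3) by blast
    qed
    ultimately show "ltlf_sat t i (LUntil \<phi> \<psi>)" using inv(2)[OF l] by auto
  next
    assume "ltlf_sat t i (LUntil \<phi> \<psi>)"
    then obtain j where j: "i \<le> j" "j < length t" "ltlf_sat t j \<psi>" "\<And>k. i \<le> k \<Longrightarrow> k < j \<Longrightarrow> ltlf_sat t k \<phi>" by auto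
    have "?f j \<le> ?f i" using j(1) by simp
    moreover have "ppltl_sat (rev t) (?f j) (past \<psi>)" using LUntil.IH(2)[OF j(2)] j(3) by simp
    moreover have "ppltl_sat (rev t) k (past \<phi>)" if k: "?f j < k" "k \<le> ?f i" for k
    proof -
      have l: "k < length t" using k(2) LUntil.prems by linarith
      have "i \<le> ?f k" "?f k < j" using k l j(2) LUntil.prems by auto
      then show ?thesis using LUntil.IH(1)[OF inv(2)[OF l]] j(4) inv(1)[OF l] by simp
    qed
    ultimately show "ppltl_sat (rev t) (?f i) (past (LUntil \<phi> \<psi>))" by auto
  qed
qed auto

lemma plus_lang_map: "plus_lang L AP (map_plus h \<Psi>) = plus_lang (\<lambda>\<phi>. L (h \<phi>)) AP \<Psi>"
  by (induction \<Psi>) auto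

section \<open>Input and output\<close>

lemma exec_main:
  "exec (Push 6 s) (work_state inp m out) 2 (work_state inp (s # m) out)"
  "exec (Pop 6) (work_state inp (s # m) out) 1 (work_state inp m out)"
  "exec (Pop 0) (work_state (s # inp) m out) 1 (work_state inp m out)"
  "exec (Out s) (work_state inp m out) 1 (work_state inp m (out @ [s]))"
proof -
  show "exec (Push 6 s) (work_state inp m out) 2 (work_state inp (s # m) out)"
    using exec_Push[of 6 s "work_state inp m out"] unfolding work_state_push .
  show "exec (Pop 6) (work_state inp (s # m) out) 1 (work_state inp m out)"
    using exec_Pop[of 6 "work_state inp (s # m) out"] unfolding work_state_pop by simp
  have "(work_state (s # inp) m out)(0 := tl (work_state (s # inp) m out 0)) = work_state inp m out"
    by (auto simp: work_state_def fun_eq_iff)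
  then show "exec (Pop 0) (work_state (s # inp) m out) 1 (work_state inp m out)"
    using exec_Pop[of 0 "work_state (s # inp) m out"] by simp
  have "(work_state inp m out)(7 := work_state inp m out 7 @ [s]) = work_state inp m (out @ [s])"
    by (auto simp: work_state_def fun_eq_iff)
  then show "exec (Out s) (work_state inp m out) 1 (work_state inp m (out @ [s]))"
    using exec_Out[of s "work_state inp m out"] by simp
qed

lemma work_state_0 [simp]: "work_state inp m out 0 = inp" and work_state_7 [simp]: "work_state inp m out 7 = out"
  by (auto simp: work_state_def)

text \<open>A chain of tests, one per letter of the finite alphabet. \<open>bit1\<close> is pushed
  last, so that the number becomes the head of the list under it.\<close>

fun read_letter :: "('s \<Rightarrow> nat) \<Rightarrow> 's list \<Rightarrow> 's com" where
  "read_letter cin [] = Push 6 bit0"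
| "read_letter cin (l # ls) =
     Cond 0 (\<lambda>s. s = Letter l) (prog_com (push_tree (enc (cin l))) ;; Push 6 bit1) (read_letter cin ls)"

lemma read_letter_over: "com_over work_symbols (read_letter cin ls)"
  by (induction ls) (auto simp: prog_com_over)

lemma read_letter_exec:
  "\<exists>K. \<forall>l\<in>set ls. \<forall>inp m out. \<exists>t\<le>K. exec (read_letter cin ls) (work_state (Letter l # inp) m out) t
     (work_state (Letter l # inp) (bit1 # tree_code (enc (cin l)) @ m) out)"
proof (induction ls)
  case (Cons a ls)
  then obtain K where K: "\<And>l inp m out. l \<in> set ls \<Longrightarrow> \<exists>t\<le>K. exec (read_letter cin ls) (work_state (Letter l # inp) m out) t
     (work_state (Letter l # inp) (bit1 # tree_code (enc (cin l)) @ m) out)" by blast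
  let ?p = "prog_com (push_tree (enc (cin a)))" and ?s = "5 * tree_size (enc (cin a))"
  have "\<exists>t\<le>K + ?s + 4. exec (read_letter cin (a # ls)) (work_state (Letter l # inp) m out) t
     (work_state (Letter l # inp) (bit1 # tree_code (enc (cin l)) @ m) out)"
    if l: "l \<in> set (a # ls)" for l inp m out
  proof (cases "l = a")
    case True
    obtain t where t: "t \<le> ?s" "exec ?p (work_state (Letter a # inp) m out) t
        (work_state (Letter a # inp) (tree_code (enc (cin a)) @ m) out)"
      using prog_com_runs[OF prun_push_tree[of "enc (cin a)"]] unfolding runs_def by fastforce
    have "exec (read_letter cin (a # ls)) (work_state (Letter a # inp) m out) (Suc (Suc (t + 2)))
      (work_state (Letter a # inp) (bit1 # tree_code (enc (cin a)) @ m) out)"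
      unfolding read_letter.simps by (intro exec_CondT exec_Seq[OF t(2)] exec_main) simp
    then show ?thesis using t(1) True by (intro exI[of _ "Suc (Suc (t + 2))"]) auto
  next
    case False
    then obtain t where t: "t \<le> K" "exec (read_letter cin ls) (work_state (Letter l # inp) m out) t
        (work_state (Letter l # inp) (bit1 # tree_code (enc (cin l)) @ m) out)" using K[of l inp m out] l by auto
    have "exec (read_letter cin (a # ls)) (work_state (Letter l # inp) m out) (Suc t)
      (work_state (Letter l # inp) (bit1 # tree_code (enc (cin l)) @ m) out)"
      unfolding read_letter.simps by (intro exec_CondF t(2)) (simp add: False)
    then show ?thesis using t(1) by (intro exI[of _ "Suc t"]) simp
  qed
  then show ?case by blast
qed simp

text \<open>Each letter is put in front of the list read so far, so the word arrives
  reversed.\<close>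

definition read_com :: "('s \<Rightarrow> nat) \<Rightarrow> 's list \<Rightarrow> 's com" where
  "read_com cin ls = Push 6 bit0 ;; Loop 0 nonblank (read_letter cin ls ;; Pop 0)"

lemma read_com_exec:
  "\<exists>K. \<forall>w. set w \<subseteq> set ls \<longrightarrow> (\<exists>t\<le>length w * K + K. exec (read_com cin ls) (work_state (map Letter w) [] []) t
     (work_state [] (tree_code (enc (rev (map cin w)))) []))"
proof -
  obtain K where K: "\<And>l inp m out. l \<in> set ls \<Longrightarrow> \<exists>t\<le>K. exec (read_letter cin ls) (work_state (Letter l # inp) m out) t
     (work_state (Letter l # inp) (bit1 # tree_code (enc (cin l)) @ m) out)" using read_letter_exec by meson
  let ?c = "Loop 0 nonblank (read_letter cin ls ;; Pop 0)"
  have loop: "\<exists>t\<le>length w * (K + 3) + 1. exec ?c (work_state (map Letter w) (tree_code (enc ns)) out) t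
      (work_state [] (tree_code (enc (rev (map cin w) @ ns))) out)" if "set w \<subseteq> set ls" for w ns out
    using that
  proof (induction w arbitrary: ns)
    case Nil
    have "exec ?c (work_state [] (tree_code (enc ns)) out) 1 (work_state [] (tree_code (enc ns)) out)"
      by (rule exec_LoopF) (simp add: nonblank_def)
    then show ?case by auto
  next
    case (Cons l w)
    obtain t where t: "t \<le> K" "exec (read_letter cin ls) (work_state (map Letter (l # w)) (tree_code (enc ns)) out) t
      (work_state (Letter l # map Letter w) (tree_code (enc (cin l # ns))) out)"
      using K[of l "map Letter w" "tree_code (enc ns)" out] Cons.prems by auto
    obtain t' where t': "t' \<le> length w * (K + 3) + 1" "exec ?c (work_state (map Letter w) (tree_code (enc (cin l # ns))) out) t'
      (work_state [] (tree_code (enc (rev (map cin w) @ cin l # ns))) out)" using Cons.IH[of "cin l # ns"] Cons.prems by auto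
    have "exec ?c (work_state (map Letter (l # w)) (tree_code (enc ns)) out) (Suc (Suc (t + 1) + t'))
      (work_state [] (tree_code (enc (rev (map cin w) @ cin l # ns))) out)"
      by (rule exec_LoopT[OF _ exec_Seq[OF t(2) exec_main(3)] t'(2)]) (simp add: nonblank_def)
    then show ?case using t(1) t'(1) by (intro exI[of _ "Suc (Suc (t + 1) + t')"]) simp
  qed
  have "\<exists>t\<le>length w * (K + 4) + (K + 4). exec (read_com cin ls) (work_state (map Letter w) [] []) t
     (work_state [] (tree_code (enc (rev (map cin w)))) [])" if w: "set w \<subseteq> set ls" for w
  proof -
    obtain t where t: "t \<le> length w * (K + 3) + 1" "exec ?c (work_state (map Letter w) [bit0] []) t
      (work_state [] (tree_code (enc (rev (map cin w)))) [])" using loop[OF w, of "[]" "[]"] by auto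
    have "exec (read_com cin ls) (work_state (map Letter w) [] []) (Suc (2 + t)) (work_state [] (tree_code (enc (rev (map cin w)))) [])"
      unfolding read_com_def by (rule exec_Seq[OF _ t(2)]) (rule exec_main)
    then show ?thesis using t(1) by (intro exI[of _ "Suc (2 + t)"]) (simp add: algebra_simps)
  qed
  then show ?thesis by blast
qed

text \<open>The unary number is counted in the control, in the argument \<open>k\<close>; this is
  possible because \<open>m\<close> bounds the numbers of all letters.\<close>

fun write_letter :: "(nat \<Rightarrow> 's cell) \<Rightarrow> nat \<Rightarrow> nat \<Rightarrow> 's com" where
  "write_letter f 0 k = Out (f k)"
| "write_letter f (Suc m) k = Cond 6 (\<lambda>s. s = bit1) (Pop 6 ;; Pop 6 ;; write_letter f m (Suc k)) (Pop 6 ;; Out (f k))"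

lemma write_letter_exec:
  "n < m \<Longrightarrow> exec (write_letter f m k) (work_state inp (tree_code (enc n) @ r) out) (5 * n + 4) (work_state inp r (out @ [f (k + n)]))"
proof (induction m arbitrary: n k)
  case (Suc m)
  show ?case
  proof (cases n)
    case 0
    have "exec (write_letter f (Suc m) k) (work_state inp (bit0 # r) out) (Suc (Suc (1 + 1))) (work_state inp r (out @ [f k]))"
      unfolding write_letter.simps by (rule exec_CondF[OF _ exec_Seq[OF exec_main(2) exec_main(4)]]) simp
    then show ?thesis by (simp add: 0 numeral_eq_Suc)
  next
    case (Suc n')
    have "exec (write_letter f m (Suc k)) (work_state inp (tree_code (enc n') @ r) out) (5 * n' + 4) (work_state inp r (out @ [f (Suc k + n')]))"
      using Suc.IH[of n' "Suc k"] Suc.prems Suc by simp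
    then have "exec (write_letter f (Suc m) k) (work_state inp (bit1 # bit0 # tree_code (enc n') @ r) out)
        (Suc (Suc (1 + Suc (1 + (5 * n' + 4))))) (work_state inp r (out @ [f (Suc k + n')]))"
      unfolding write_letter.simps
      by (intro exec_CondT[OF _ exec_Seq[OF exec_main(2) exec_Seq[OF exec_main(2)]]]) simp_all
    then show ?thesis by (simp add: Suc)
  qed
qed simp

text \<open>The first pop opens the pair of answer and verdict, the last one removes the end of the
  answer list. The verdict remains on top, where the machine looks for it.\<close>

definition write_com :: "(nat \<Rightarrow> 's cell) \<Rightarrow> nat \<Rightarrow> 's com" where
  "write_com f m = Pop 6 ;; Loop 6 (\<lambda>s. s = bit1) (Pop 6 ;; write_letter f m 0) ;; Pop 6"

lemma write_com_exec:
  assumes "\<forall>n\<in>set ns. n < m"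
  shows "\<exists>t\<le>length ns * (5 * m + 7) + 6. exec (write_com f m) (work_state [] (tree_code (enc (ns, b))) []) t
    (work_state [] (tree_code (enc b)) (map f ns))"
proof -
  let ?c = "Loop 6 (\<lambda>s. s = bit1) (Pop 6 ;; write_letter f m 0)"
  have "\<exists>t\<le>length ns * (5 * m + 7) + 1. exec ?c (work_state [] (tree_code (enc ns) @ r) out) t
      (work_state [] (bit0 # r) (out @ map f ns))" for r out
    using assms
  proof (induction ns arbitrary: out)
    case Nil
    have "exec ?c (work_state [] (bit0 # r) out) 1 (work_state [] (bit0 # r) out)" by (rule exec_LoopF) simp
    then show ?case by auto
  next
    case (Cons n ns)
    obtain t where t: "t \<le> length ns * (5 * m + 7) + 1" "exec ?c (work_state [] (tree_code (enc ns) @ r) (out @ [f n])) t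
      (work_state [] (bit0 # r) ((out @ [f n]) @ map f ns))" using Cons.IH[of "out @ [f n]"] Cons.prems by auto
    have "exec (write_letter f m 0) (work_state [] (tree_code (enc n) @ tree_code (enc ns) @ r) out) (5 * n + 4)
        (work_state [] (tree_code (enc ns) @ r) (out @ [f n]))"
      using write_letter_exec[of n m f 0] Cons.prems by simp
    note s = exec_Seq[OF exec_main(2)[where s = bit1] this]
    have "exec ?c (work_state [] (bit1 # tree_code (enc n) @ tree_code (enc ns) @ r) out) (Suc (Suc (1 + (5 * n + 4)) + t))
      (work_state [] (bit0 # r) ((out @ [f n]) @ map f ns))"
      by (rule exec_LoopT[OF _ s t(2)]) simp
    moreover have "Suc (Suc (1 + (5 * n + 4)) + t) \<le> length (n # ns) * (5 * m + 7) + 1" using t(1) Cons.prems by simp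
    ultimately show ?case by (intro exI[of _ "Suc (Suc (1 + (5 * n + 4)) + t)"]) simp
  qed
  from this[of "tree_code (enc b)" "[]"] obtain t where t: "t \<le> length ns * (5 * m + 7) + 1"
    "exec ?c (work_state [] (tree_code (enc ns) @ tree_code (enc b)) []) t (work_state [] (bit0 # tree_code (enc b)) (map f ns))"
    by auto
  have "exec (write_com f m) (work_state [] (bit1 # tree_code (enc ns) @ tree_code (enc b)) []) (Suc (1 + Suc (t + 1)))
      (work_state [] (tree_code (enc b)) (map f ns))"
    unfolding write_com_def by (intro exec_Seq[OF _ exec_Seq[OF t(2)]] exec_main)
  then show ?thesis using t(1) by (intro exI[of _ "Suc (1 + Suc (t + 1))"]) (simp add: enc_prod_def)
qed

lemma com_over_mono: "com_over G c \<Longrightarrow> G \<subseteq> H \<Longrightarrow> com_over H c"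
  by (induction c) auto

lemma write_letter_over: "range f \<subseteq> G \<Longrightarrow> com_over G (write_letter f m k)"
  by (induction m arbitrary: k) auto

text \<open>The numberings of input and output letters are separate, as mirrored formulas are read
  with one numbering and transducers are written with another. The claim for all large
  \<open>T\<close> holds because halting configurations do not change.\<close>

lemma machine_exists:
  fixes cin cout :: "'s \<Rightarrow> nat"
  assumes A: "finite A" and F: "pt \<mu> F" and cout: "inj_on cout A"
    and dom: "\<And>w. 0 < \<mu> w"
    and out: "\<And>w. w \<in> lists A \<Longrightarrow> \<exists>v\<in>lists A. fst (F (map cin w)) = map cout v"
  shows "\<exists>M k. tm_over A M \<and> (\<forall>w\<in>lists A. \<forall>T > (\<mu> (map cin w) + sz (map cin w)) ^ k.
    fst (tm_run M w T) = (if snd (F (map cin w)) then tm_accept M else tm_reject M) \<and>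
    (\<forall>v\<in>lists A. fst (F (map cin w)) = map cout v \<longrightarrow> snd (last (snd (tm_run M w T))) = tape_content v))"
proof -
  \<comment> \<open>Undoes the reversal caused by reading.\<close>
  have "pt (\<lambda>x. \<mu> (rev x)) (\<lambda>x. F (rev x))"
    by (rule pt_comp[OF F pt_rev[OF pt_id] pb_mu]) (simp add: dom)
  then obtain p U where p: "pb (\<lambda>x. \<mu> (rev x)) U" "\<And>x. prun p [enc x] [enc (F (rev x))] (U x)"
    and szF: "pb (\<lambda>x. \<mu> (rev x)) (\<lambda>x. sz (F (rev x)))" unfolding pt_def using dom by blast
  obtain ls where ls: "set ls = A" using finite_list[OF A] by blast
  obtain K where K: "\<And>w. set w \<subseteq> A \<Longrightarrow> \<exists>t\<le>length w * K + K. exec (read_com cin ls) (work_state (map Letter w) [] []) t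
     (work_state [] (tree_code (enc (rev (map cin w)))) [])" using read_com_exec[of ls cin] unfolding ls by blast
  obtain m where m: "\<And>l. l \<in> A \<Longrightarrow> cout l < m" using A finite_nat_set_iff_bounded[of "cout ` A"] by blast
  define f where "f k = (if k \<in> cout ` A then Letter (inv_into A cout k) else Blank)" for k
  define G where "G = insert Blank (work_symbols \<union> Letter ` A)"
  define c where "c = read_com cin ls ;; prog_com p ;; write_com f m"
  have f: "f (cout l) = Letter l" if "l \<in> A" for l using that cout by (simp add: f_def)
  have "range f \<subseteq> G" by (auto simp: f_def G_def inv_into_into)
  moreover have "work_symbols \<subseteq> G" by (auto simp: G_def)
  ultimately have over: "com_over G c"
    unfolding c_def read_com_def write_com_def
    by (auto intro: com_over_mono[OF prog_com_over] com_over_mono[OF read_letter_over] write_letter_over)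
  define B where "B x = (sz x * K + K) + U x + (sz (F (rev x)) * (5 * m + 7) + 6) + 3" for x
  have "pb (\<lambda>x. \<mu> (rev x)) B" unfolding B_def by (intro pb_intros p szF)
  then obtain k where k: "\<And>x. B x \<le> (\<mu> (rev x) + sz x) ^ k" unfolding pb_def using dom by blast
  have run: "\<exists>t\<le>B (rev (map cin w)). exec c (work_state (map Letter w) [] []) t
      (work_state [] (tree_code (enc (snd (F (map cin w))))) (map f (fst (F (map cin w)))))" if w: "w \<in> lists A" for w
  proof -
    let ?x = "rev (map cin w)" and ?r = "F (map cin w)"
    obtain t1 where t1: "t1 \<le> length w * K + K" "exec (read_com cin ls) (work_state (map Letter w) [] []) t1
      (work_state [] (tree_code (enc ?x)) [])" using K[of w] w by (auto simp: in_lists_conv_set)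
    obtain t2 where t2: "t2 \<le> U ?x" "exec (prog_com p :: 's com) (work_state [] (tree_code (enc ?x)) []) t2
      (work_state [] (tree_code (enc ?r)) [])"
    proof -
      have "runs (prog_com p :: 's com) [enc ?x] [enc ?r] (U ?x)" using prog_com_runs[OF p(2), of ?x] by simp
      then show ?thesis using that unfolding runs_def by (metis append_Nil2 trees_code_simps(1,2))
    qed
    obtain v where v: "v \<in> lists A" "fst ?r = map cout v" using out[OF w] by blast
    then have "\<forall>n\<in>set (fst ?r). n < m" using m by auto
    from write_com_exec[OF this, of f "snd ?r"] obtain t3 where t3: "t3 \<le> length (fst ?r) * (5 * m + 7) + 6"
      "exec (write_com f m) (work_state [] (tree_code (enc ?r)) []) t3 (work_state [] (tree_code (enc (snd ?r))) (map f (fst ?r)))"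
      by auto
    have "length w \<le> sz ?x" using length_less_sz[of ?x] by simp
    then have n1: "length w * K \<le> sz ?x * K" by (rule mult_right_mono) simp
    have "length (fst ?r) \<le> sz ?r" using length_less_sz[of "fst ?r"] sz_fst[of ?r] by simp
    then have n2: "length (fst ?r) * (5 * m + 7) \<le> sz ?r * (5 * m + 7)" by (rule mult_right_mono) simp
    have "Suc (t1 + Suc (t2 + t3)) \<le> B ?x" unfolding B_def rev_rev_ident using t1(1) t2(1) t3(1) n1 n2 by linarith
    then show ?thesis unfolding c_def using exec_Seq[OF t1(2) exec_Seq[OF t2(2) t3(2)]] by blast
  qed
  have sz_rev: "sz (rev x) = sz x" for x :: "nat list"
  proof (induction x)
    case (Cons a x) then show ?case using sz_append[of "rev x" "[a]"] by simp
  qed simp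
  have "fst (tm_run (com_tm G c) w T) = (if snd (F (map cin w)) then tm_accept (com_tm G c) else tm_reject (com_tm G c)) \<and>
    (\<forall>v\<in>lists A. fst (F (map cin w)) = map cout v \<longrightarrow> snd (last (snd (tm_run (com_tm G c) w T))) = tape_content v)"
    if w: "w \<in> lists A" and T: "(\<mu> (map cin w) + sz (map cin w)) ^ k < T" for w T
  proof -
    let ?r = "F (map cin w)"
    let ?\<sigma> = "work_state [] (tree_code (enc (snd ?r))) (map f (fst ?r))"
    obtain t where t: "t \<le> B (rev (map cin w))" "exec c (work_state (map Letter w) [] []) t ?\<sigma>" using run[OF w] by blast
    have "t < T" using t(1) k[of "rev (map cin w)"] T by (simp add: sz_rev)
    moreover have "(\<lambda>_. [])(0 := map Letter w) = work_state (map Letter w) [] []" by (auto simp: work_state_def fun_eq_iff)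
    ultimately obtain tps where tps: "represents tps ?\<sigma>"
      "tm_run (com_tm G c) w T = (if top_cell (?\<sigma> 6) = Work 3 then 0 else 1, tps)"
      using tm_run_com_tm[OF over, of w t ?\<sigma> T] t(2) by auto
    have "top_cell (?\<sigma> 6) = Work 3 \<longleftrightarrow> snd ?r" by (simp add: enc_bool_def bool_tree_def)
    moreover have "snd (last tps) = tape_content v" if "v \<in> lists A" "fst ?r = map cout v" for v
    proof -
      have "map f (fst ?r) = map Letter v" using that f by (auto simp: in_lists_conv_set)
      moreover have "length tps = 8" "output_tape (map f (fst ?r)) (tps ! 7)"
        using tps(1) by (auto simp: represents_def)
      moreover from this have "last tps = tps ! 7" by (subst last_conv_nth) auto
      ultimately show ?thesis by (auto simp: output_tape_def tape_content_def fun_eq_iff)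
    qed
    ultimately show ?thesis by (simp add: tps(2)) (simp add: com_tm_def)
  qed
  moreover have "tm_over A (com_tm G c)" by (rule tm_over_com_tm[OF _ _ _ over]) (use A in \<open>auto simp: G_def\<close>)
  ultimately show ?thesis by blast
qed

section \<open>Time bounds\<close>

lemma inj_letter_code:
  assumes "inj_on g AP"
  shows "inj_on (letter_code g) (letters AP)"
proof -
  have atom: "letter_code g l = 14 + g p \<Longrightarrow> l \<in> letters AP \<Longrightarrow> p \<in> AP \<Longrightarrow> l = A_Atom p" for l p
  proof (cases l)
    case (A_Quant Q)
    then show "letter_code g l = 14 + g p \<Longrightarrow> l = A_Atom p" by (cases Q) auto
  qed (use assms in \<open>auto simp: letters_def inj_on_def\<close>)
  \<comment> \<open>A left inverse on the letters other than atoms; the default value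
    \<open>A_Tick\<close> takes care of 11.\<close>
  define dec :: "nat \<Rightarrow> 'a letter" where "dec = (\<lambda>_. A_Tick)(0 := A_Not, 1 := A_Or, 2 := A_And, 3 := A_Yesterday, 4 := A_Since,
    5 := A_Quant All_Prefixes, 6 := A_Quant Some_Prefix, 7 := A_Quant Inf_Many_Prefixes, 8 := A_Quant Almost_All_Prefixes,
    9 := A_State, 10 := A_Edge, 12 := A_Next, 13 := A_Until)"
  have dec: "(\<exists>p\<in>AP. l = A_Atom p) \<or> dec (letter_code g l) = l \<and> letter_code g l < 14" if "l \<in> letters AP" for l
  proof (cases l)
    case (A_Quant Q)
    then show ?thesis by (cases Q) (simp_all add: dec_def)
  qed (use that in \<open>auto simp: dec_def letters_def\<close>)
  show ?thesis
  proof (rule inj_onI)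
    fix l l' assume l: "l \<in> letters AP" "l' \<in> letters AP" "letter_code g l = letter_code g l'"
    from dec[OF l(1)] show "l = l'"
    proof
      assume "\<exists>p\<in>AP. l = A_Atom p"
      then obtain p where "p \<in> AP" "l = A_Atom p" by blast
      then show ?thesis using atom[of l' p] l by simp
    next
      assume a: "dec (letter_code g l) = l \<and> letter_code g l < 14"
      from dec[OF l(2)] show ?thesis
      proof
        assume "\<exists>p\<in>AP. l' = A_Atom p"
        then show ?thesis using a l(3) by auto
      qed (use a l(3) in metis)
    qed
  qed
qed

lemma ppltl_code_letters: "set_ppltl \<phi> \<subseteq> AP \<Longrightarrow> set (ppltl_code \<phi>) \<subseteq> letters AP"
  by (induction \<phi>) (auto simp: letters_def)

lemma plus_code_letters:
  "(\<And>\<phi>. \<phi> \<in> set_plus \<Psi> \<Longrightarrow> set (code \<phi>) \<subseteq> letters AP) \<Longrightarrow> set (plus_code code \<Psi>) \<subseteq> letters AP"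
  by (induction \<Psi>) (auto simp: letters_def)

lemma transducer_code_letters: "transducer X Y D \<Longrightarrow> transducer_code D \<in> lists (letters (X \<union> Y))"
proof -
  assume D: "transducer X Y D"
  have edge: "set (edge_code e) \<subseteq> letters (X \<union> Y)" if "set (fst e) \<subseteq> Y" for e
    using that by (auto simp: edge_code_def letters_def)
  have "set (state_code q) \<subseteq> letters (X \<union> Y)" if q: "q \<in> set D" for q
  proof -
    have edges: "set (fst e) \<subseteq> Y" if e: "e \<in> set (snd q)" for e
    proof -
      have "\<forall>(ys, k)\<in>set (snd q). set ys \<subseteq> Y \<and> k < length D" using D q unfolding transducer_def by fastforce
      from bspec[OF this e] show ?thesis by (cases e) simp
    qed
    have "set (fst q) \<subseteq> X" using D q unfolding transducer_def by fastforce
    then have "set (map A_Atom (fst q)) \<subseteq> letters (X \<union> Y)" by (auto simp: letters_def)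
    moreover have "set (concat (map edge_code (snd q))) \<subseteq> letters (X \<union> Y)" using edge[OF edges] by auto
    moreover have "A_State \<in> letters (X \<union> Y)" by (simp add: letters_def)
    ultimately show ?thesis by (simp add: state_code_def)
  qed
  then show ?thesis by (auto simp: transducer_code_def in_lists_conv_set)
qed

lemma subset_lists:
  assumes "finite X"
  shows "\<exists>L. set ` set L = Pow X \<and> inj_on set (set L)"
proof -
  obtain P where P: "set P = Pow X" using finite_list[of "Pow X"] assms by auto
  define h where "h V = (SOME l. set l = V)" for V :: "'a set"
  have h: "set (h V) = V" if V: "V \<in> set P" for V
  proof -
    have "V \<subseteq> X" using V P by simp
    then have "finite V" using assms by (rule finite_subset)
    from someI_ex[OF finite_list[OF this]] show ?thesis unfolding h_def .
  qed
  have "(\<lambda>V. set (h V)) ` set P = id ` set P" by (rule image_cong) (simp_all add: h)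
  then have 1: "set ` set (map h P) = Pow X" unfolding set_map image_image P by simp
  have 2: "inj_on set (set (map h P))"
  proof (rule inj_onI)
    fix a b assume "a \<in> set (map h P)" "b \<in> set (map h P)" "set a = set b"
    then obtain V W where "V \<in> set P" "a = h V" "W \<in> set P" "b = h W" unfolding set_map by (elim imageE)
    then show "a = b" using h[of V] h[of W] \<open>set a = set b\<close> by metis
  qed
  show ?thesis by (intro exI[of _ "map h P"] conjI 1 2)
qed

text \<open>A power of the bound on the game plus the size of the coded input, with \<open>C\<close>
  bounding the letter numbers. The final 1 makes the inequality strict for the halting step.\<close>

definition time_bound :: "(nat \<Rightarrow> nat) \<Rightarrow> nat \<Rightarrow> nat \<Rightarrow> nat \<Rightarrow> nat" where
  "time_bound s C k n = (2 ^ ((s n + 4 * (n + 2)\<^sup>2 + 3) * (n + 3)) + (1 + n * (2 * C + 2))) ^ k + 1"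

text \<open>Both logics at once: \<open>H\<close> sends a formula to the past formula it is solved
  as, and \<open>cin\<close> numbers its letters such that its word becomes the word of
  \<open>H \<Psi>\<close>.\<close>

lemma synthesis_solvable:
  fixes X Y :: "'a set" and cin :: "'a letter \<Rightarrow> nat" and minit :: "nat list \<Rightarrow> 'm :: enc" and H :: "'f \<Rightarrow> 'a ppltl plus"
  assumes fin: "finite (X \<union> Y)" and ne: "X \<union> Y \<noteq> {}" and disj: "X \<inter> Y = {}" and g: "inj_on g (X \<union> Y)"
    and As: "set As = (\<lambda>p. 14 + g p) ` (X \<union> Y)"
    and mon: "synthesis minit mstep mout (parses As) (\<lambda>w. s (length w)) dir"
    and lang: "\<And>\<phi>. lang \<phi> = {t \<in> finite_traces (X \<union> Y). ppltl_sat (d t) (length t - 1) \<phi>}"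
    and d: "\<And>as. d (map (decode g (X \<union> Y)) as) = map (decode g (X \<union> Y)) (dir as)"
    and cin: "inj_on cin (letters (X \<union> Y))"
    and H: "\<And>\<Psi>. \<Psi> \<in> F \<Longrightarrow> H \<Psi> \<in> ppltl_plus_over (X \<union> Y)"
      "\<And>\<Psi>'. \<Psi>' \<in> ppltl_plus_over (X \<union> Y) \<Longrightarrow> \<exists>\<Psi>\<in>F. H \<Psi> = \<Psi>'"
    and code: "\<And>\<Psi>. \<Psi> \<in> F \<Longrightarrow> map cin (pc \<Psi>) = word_code g (H \<Psi>)"
      "\<And>\<Psi>. \<Psi> \<in> F \<Longrightarrow> pc \<Psi> \<in> lists (letters (X \<union> Y))"
    and langF: "\<And>\<Psi>. langF \<Psi> = plus_lang lang (X \<union> Y) (H \<Psi>)"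
  shows "\<exists>M C k. tm_over (letters (X \<union> Y)) M \<and>
    solves_in_time M (letters (X \<union> Y)) (realizable_words pc F langF X Y) (strategy_answers pc F langF X Y) (time_bound s C k)"
proof -
  let ?A = "letters (X \<union> Y)" and ?code = "map (\<lambda>p. 14 + g p)"
  obtain Xs0 Ys0 where Xs0: "set ` set Xs0 = Pow X" and Ys0: "set ` set Ys0 = Pow Y" "inj_on set (set Ys0)"
    using subset_lists fin by (metis finite_Un)
  interpret synthesis "map ?code Xs0" "map ?code Ys0" minit mstep mout "parses As" "\<lambda>w. s (length w)" dir by (rule mon)
  have valid: "parses As w \<longleftrightarrow> (\<exists>\<Psi>\<in>ppltl_plus_over (X \<union> Y). w = word_code g \<Psi>)" for w by (rule parses_iff[OF As])
  obtain p where "p \<in> X \<union> Y" using ne by blast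
  then have "Quant Some_Prefix (PAtom p) \<in> ppltl_plus_over (X \<union> Y)" by (simp add: ppltl_plus_over_def)
  \<comment> \<open>A sample formula, needed as the replacement for inputs that do not parse; it
    exists because there is an atom.\<close>
  then obtain w0 where w0: "parses As w0" using valid by blast
  define alg where "alg w = (if parses As w then solve w else ([], False))" for w
  define \<nu> where "\<nu> w = (if parses As w then \<mu> w else 1)" for w
  have pt_alg: "pt \<nu> alg"
    unfolding alg_def \<nu>_def by (rule pt_guarded[OF pt_solve pt_parses, where d = w0]) (simp_all add: game_bound_def w0)
  have correct: "snd (solve (map cin (pc \<Psi>))) \<longleftrightarrow> (\<exists>\<sigma>. winning_strategy X Y (langF \<Psi>) \<sigma>)"
    "snd (solve (map cin (pc \<Psi>))) \<Longrightarrow> \<exists>D. transducer X Y D \<and> map (letter_code g) (transducer_code D) = fst (solve (map cin (pc \<Psi>))) \<and>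
     winning_strategy X Y (langF \<Psi>) (transducer_strategy D)" if \<Psi>: "\<Psi> \<in> F" for \<Psi>
  proof -
    interpret synthesis_instance "map ?code Xs0" "map ?code Ys0" minit mstep mout "parses As" "\<lambda>w. s (length w)" dir
      X Y g Xs0 Ys0 d "H \<Psi>" "map cin (pc \<Psi>)" lang
    proof
      show "parses As (map cin (pc \<Psi>))" unfolding valid code(1)[OF \<Psi>] using H(1)[OF \<Psi>] by blast
    qed (fact g disj Xs0 Ys0 H(1)[OF \<Psi>] code(1)[OF \<Psi>] lang d refl)+
    show "snd (solve (map cin (pc \<Psi>))) \<longleftrightarrow> (\<exists>\<sigma>. winning_strategy X Y (langF \<Psi>) \<sigma>)"
      "snd (solve (map cin (pc \<Psi>))) \<Longrightarrow> \<exists>D. transducer X Y D \<and> map (letter_code g) (transducer_code D) = fst (solve (map cin (pc \<Psi>))) \<and>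
       winning_strategy X Y (langF \<Psi>) (transducer_strategy D)"
      using solve_correct unfolding langF by blast+
  qed
  have inj_pc: "w = v" if "map cin w = map cin v" "w \<in> lists ?A" "v \<in> lists ?A" for w v
  proof -
    have "set w \<union> set v \<subseteq> ?A" using that(2,3) by (auto simp: in_lists_conv_set)
    from map_inj_on[OF that(1) inj_on_subset[OF cin this]] show ?thesis .
  qed
  have valid_word: "\<exists>\<Psi>\<in>F. w = pc \<Psi>" if w: "w \<in> lists ?A" "parses As (map cin w)" for w
  proof -
    obtain \<Psi> where \<Psi>: "\<Psi> \<in> F" "map cin w = map cin (pc \<Psi>)" using w(2) H(2) code(1) unfolding valid by metis
    have "w = pc \<Psi>" by (rule inj_pc[OF \<Psi>(2) w(1) code(2)[OF \<Psi>(1)]])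
    then show ?thesis using \<Psi>(1) by blast
  qed
  have parses_code: "parses As (map cin (pc \<Psi>))" if "\<Psi> \<in> F" for \<Psi> unfolding valid using code(1) H(1) that by blast
  have answer: "snd (alg (map cin w)) \<longleftrightarrow> w \<in> realizable_words pc F langF X Y" if w: "w \<in> lists ?A" for w
  proof
    assume "snd (alg (map cin w))"
    then have 1: "parses As (map cin w)" "snd (solve (map cin w))" by (auto simp: alg_def split: if_splits)
    then obtain \<Psi> where "\<Psi> \<in> F" "w = pc \<Psi>" using valid_word[OF w] by blast
    then show "w \<in> realizable_words pc F langF X Y" using correct(1)[of \<Psi>] 1(2) by (auto simp: realizable_words_def)
  next
    assume "w \<in> realizable_words pc F langF X Y"
    then obtain \<Psi> where "\<Psi> \<in> F" "w = pc \<Psi>" "\<exists>\<sigma>. winning_strategy X Y (langF \<Psi>) \<sigma>" by (auto simp: realizable_words_def)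
    then show "snd (alg (map cin w))" using correct(1)[of \<Psi>] parses_code[of \<Psi>] by (simp add: alg_def)
  qed
  have witness: "\<exists>v\<in>lists ?A. fst (alg (map cin w)) = map (letter_code g) v \<and> strategy_answers pc F langF X Y w v"
    if w: "w \<in> lists ?A" "snd (alg (map cin w))" for w
  proof -
    have 1: "parses As (map cin w)" "snd (solve (map cin w))" using w(2) by (auto simp: alg_def split: if_splits)
    then obtain \<Psi> where \<Psi>: "\<Psi> \<in> F" "w = pc \<Psi>" using valid_word[OF w(1)] by blast
    obtain D where D: "transducer X Y D" "map (letter_code g) (transducer_code D) = fst (solve (map cin w))"
      "winning_strategy X Y (langF \<Psi>) (transducer_strategy D)" using correct(2)[OF \<Psi>(1)] 1(2) \<Psi>(2) by blast
    have "fst (alg (map cin w)) = map (letter_code g) (transducer_code D)" using 1(1) D(2) by (simp add: alg_def)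
    moreover have "strategy_answers pc F langF X Y w (transducer_code D)" using \<Psi> D by (auto simp: strategy_answers_def)
    ultimately show ?thesis using transducer_code_letters[OF D(1)] by blast
  qed
  have out: "\<exists>v\<in>lists ?A. fst (alg (map cin w)) = map (letter_code g) v" if "w \<in> lists ?A" for w
  proof (cases "snd (alg (map cin w))")
    case False
    then have "fst (alg (map cin w)) = []" by (auto simp: alg_def solve_def split: if_splits)
    then show ?thesis by (intro bexI[of _ "[]"]) auto
  qed (use witness[OF that] in blast)
  have pos: "0 < \<nu> w" for w by (simp add: \<nu>_def game_bound_def)
  obtain M k where M: "tm_over ?A M" and run: "\<And>w T. w \<in> lists ?A \<Longrightarrow> (\<nu> (map cin w) + sz (map cin w)) ^ k < T \<Longrightarrow>
    fst (tm_run M w T) = (if snd (alg (map cin w)) then tm_accept M else tm_reject M) \<and>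
    (\<forall>v\<in>lists ?A. fst (alg (map cin w)) = map (letter_code g) v \<longrightarrow> snd (last (snd (tm_run M w T))) = tape_content v)"
    using machine_exists[OF finite_letters[OF fin] pt_alg inj_letter_code[OF g] pos out] by blast
  obtain C where C: "\<And>l. l \<in> ?A \<Longrightarrow> cin l \<le> C"
    using finite_letters[OF fin] finite_nat_set_iff_bounded_le[of "cin ` ?A"] by blast
  have time: "(\<nu> (map cin w) + sz (map cin w)) ^ k < time_bound s C k (length w)" if w: "w \<in> lists ?A" for w
  proof -
    have "sz (map cin w) \<le> 1 + length (map cin w) * (2 * C + 2)"
      by (rule sz_nat_list) (use w C in \<open>auto simp: in_lists_conv_set\<close>)
    moreover have "\<nu> (map cin w) \<le> 2 ^ ((s (length w) + 4 * (length w + 2)\<^sup>2 + 3) * (length w + 3))"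
      by (simp add: \<nu>_def game_bound_def base_bound_def)
    ultimately have "(\<nu> (map cin w) + sz (map cin w)) ^ k \<le>
      (2 ^ ((s (length w) + 4 * (length w + 2)\<^sup>2 + 3) * (length w + 3)) + (1 + length w * (2 * C + 2))) ^ k"
      by (intro power_mono add_mono) simp_all
    then show ?thesis by (simp add: time_bound_def)
  qed
  have "solves_in_time M ?A (realizable_words pc F langF X Y) (strategy_answers pc F langF X Y) (time_bound s C k)"
    unfolding solves_in_time_def decides_in_time_def
  proof (intro conjI ballI impI)
    fix w assume w: "w \<in> lists ?A"
    show "fst (tm_run M w (time_bound s C k (length w))) = (if w \<in> realizable_words pc F langF X Y then tm_accept M else tm_reject M)"
      using run[OF w time[OF w]] answer[OF w] by simp
    assume "w \<in> realizable_words pc F langF X Y"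
    then show "\<exists>v. strategy_answers pc F langF X Y w v \<and>
        snd (last (snd (tm_run M w (time_bound s C k (length w))))) = tape_content v"
      using run[OF w time[OF w]] answer[OF w] witness[OF w] by blast
  qed
  then show ?thesis using M by blast
qed

text \<open>The exponents in the complexity classes are bare powers, which absorb coefficients only
  from 2 on: there 2 n + 2 is at most 3 n, and this is at most n^3.\<close>

lemma polynomial_power:
  assumes "pb (\<lambda>_ :: nat. 1) q"
  shows "\<exists>K. \<forall>n\<ge>2. q n \<le> n ^ K"
proof -
  obtain k where k: "\<And>n. q n \<le> (1 + sz n) ^ k" using assms unfolding pb_def by auto
  have "q n \<le> n ^ (3 * k)" if "2 \<le> n" for n
  proof -
    have "1 + sz n \<le> n * 3" using that by (simp add: sz_nat)
    also have "\<dots> \<le> n * (n * n)" using mult_mono[OF that that] by (intro mult_left_mono) auto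
    finally have "(1 + sz n) ^ k \<le> (n ^ 3) ^ k" by (intro power_mono) (simp_all add: power3_eq_cube)
    then show ?thesis using k[of n] by (simp add: power_mult)
  qed
  then show ?thesis by blast
qed

lemma pb_nat: "pb (\<lambda>_ :: nat. 1) (\<lambda>n. n)"
  by (rule pb_mono[OF pb_sz]) (simp add: sz_nat)

lemma bigo_nat:
  fixes f h :: "nat \<Rightarrow> nat"
  assumes "\<And>n. 2 \<le> n \<Longrightarrow> f n \<le> h n"
  shows "(\<lambda>n. real (f n)) \<in> O(\<lambda>n. real (h n))"
proof (rule bigoI[where c = 1])
  show "\<forall>\<^sub>F n in at_top. norm (real (f n)) \<le> 1 * norm (real (h n))"
    by (rule eventually_mono[OF eventually_ge_at_top[of 2]]) (simp add: assms)
qed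

lemma less_power_two: "n \<le> (2 :: nat) ^ n"
  by (rule less_imp_le) (rule less_exp)

lemma time_bound_le:
  "time_bound s C k n \<le> 2 ^ (k * ((s n + 4 * (n + 2)\<^sup>2 + 3) * (n + 3) + (1 + n * (2 * C + 2))) + 1)"
proof -
  let ?e = "(s n + 4 * (n + 2)\<^sup>2 + 3) * (n + 3)" and ?r = "1 + n * (2 * C + 2)"
  have "(2 :: nat) ^ e + r \<le> 2 ^ (e + r)" for e r :: nat
  proof (induction r)
    case (Suc r)
    have "(1 :: nat) \<le> 2 ^ (e + r)" by simp
    then have "2 ^ e + Suc r \<le> 2 ^ (e + r) + 2 ^ (e + r)" using Suc by linarith
    then show ?case by simp
  qed simp
  from this[of ?e ?r] have "(2 ^ ?e + ?r) ^ k \<le> (2 ^ (?e + ?r)) ^ k" by (intro power_mono) auto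
  also have "((2 :: nat) ^ x) ^ k = 2 ^ (k * x)" for x by (simp add: power_mult[symmetric] mult.commute)
  finally have "(2 ^ ?e + ?r) ^ k + 1 \<le> 2 ^ (k * (?e + ?r)) + 2 ^ (k * (?e + ?r))" by (intro add_mono) auto
  moreover have "(2 :: nat) ^ x + 2 ^ x = 2 ^ (x + 1)" for x by simp
  ultimately show ?thesis unfolding time_bound_def by metis
qed

lemma time_bound_exp: "\<exists>K. (\<lambda>n. real (time_bound (\<lambda>n. 1 + n * 4) C k n)) \<in> O(\<lambda>n. 2 ^ (n ^ K))"
proof -
  let ?q = "\<lambda>n. k * ((1 + n * 4 + 4 * (n + 2)\<^sup>2 + 3) * (n + 3) + (1 + n * (2 * C + 2))) + 1"
  have "pb (\<lambda>_. 1) ?q" by (intro pb_intros pb_nat)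
  then obtain K where K: "\<And>n. 2 \<le> n \<Longrightarrow> ?q n \<le> n ^ K" using polynomial_power by meson
  have "time_bound (\<lambda>n. 1 + n * 4) C k n \<le> 2 ^ (n ^ K)" if "2 \<le> n" for n
  proof -
    have "time_bound (\<lambda>n. 1 + n * 4) C k n \<le> 2 ^ ?q n" by (rule time_bound_le)
    also have "\<dots> \<le> 2 ^ (n ^ K)" by (rule power_increasing[OF K[OF that]]) simp
    finally show ?thesis .
  qed
  from bigo_nat[where h = "\<lambda>n. 2 ^ (n ^ K)", OF this] show ?thesis by auto
qed

lemma time_bound_two_exp: "\<exists>K. (\<lambda>n. real (time_bound (\<lambda>n. 1 + 2 ^ n * (n * 8 + 4)) C k n)) \<in> O(\<lambda>n. 2 ^ (2 ^ (n ^ K)))"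
proof -
  let ?q = "\<lambda>n. k * (((n * 8 + 4) + (1 + 4 * (n + 2)\<^sup>2 + 3)) * (n + 3) + (1 + n * (2 * C + 2))) + 1"
  have "pb (\<lambda>_. 1) (\<lambda>n. n + ?q n)" by (intro pb_intros pb_nat)
  then obtain K where K: "\<And>n. 2 \<le> n \<Longrightarrow> n + ?q n \<le> n ^ K" using polynomial_power by meson
  \<comment> \<open>Pulls the single exponential \<open>N\<close> out of the exponent, leaving a
    polynomial factor; a product of 2^n with a polynomial q is at most 2^(n + q).\<close>
  have factor: "k * ((1 + N * a + b + 3) * c + r) + 1 \<le> N * (k * ((a + (1 + b + 3)) * c + r) + 1)" if "0 < N" for N a b c r :: nat
  proof -
    obtain m where "N = Suc m" using \<open>0 < N\<close> by (cases N) auto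
    then show ?thesis by (simp add: algebra_simps)
  qed
  have "time_bound (\<lambda>n. 1 + 2 ^ n * (n * 8 + 4)) C k n \<le> 2 ^ (2 ^ (n ^ K))" if n: "2 \<le> n" for n
  proof -
    have "k * ((1 + 2 ^ n * (n * 8 + 4) + 4 * (n + 2)\<^sup>2 + 3) * (n + 3) + (1 + n * (2 * C + 2))) + 1 \<le> 2 ^ n * ?q n"
      by (rule factor) simp
    also have "\<dots> \<le> 2 ^ n * 2 ^ ?q n" by (intro mult_left_mono less_power_two) simp
    also have "\<dots> = 2 ^ (n + ?q n)" by (simp only: power_add)
    also have "\<dots> \<le> 2 ^ (n ^ K)" by (rule power_increasing[OF K[OF n]]) simp
    finally have "(2 :: nat) ^ (k * ((1 + 2 ^ n * (n * 8 + 4) + 4 * (n + 2)\<^sup>2 + 3) * (n + 3) + (1 + n * (2 * C + 2))) + 1) \<le> 2 ^ (2 ^ (n ^ K))"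
      by (rule power_increasing) simp
    moreover have "time_bound (\<lambda>n. 1 + 2 ^ n * (n * 8 + 4)) C k n \<le>
        2 ^ (k * ((1 + 2 ^ n * (n * 8 + 4) + 4 * (n + 2)\<^sup>2 + 3) * (n + 3) + (1 + n * (2 * C + 2))) + 1)" by (rule time_bound_le)
    ultimately show ?thesis by (rule le_trans[rotated])
  qed
  from bigo_nat[where h = "\<lambda>n. 2 ^ (2 ^ (n ^ K))", OF this] show ?thesis by auto
qed

lemma realizable_words_lists:
  "(\<And>\<Psi>. \<Psi> \<in> F \<Longrightarrow> code \<Psi> \<in> lists A) \<Longrightarrow> realizable_words code F lang X Y \<subseteq> lists A"
  by (auto simp: realizable_words_def)

lemma solves_search_DTIME:
  assumes "tm_over A M" "solves_in_time M A L R f" "(\<lambda>n. real (f n)) \<in> O(T)" "L \<subseteq> lists A"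
  shows "L \<in> DTIME A T \<and> (L, R) \<in> search_DTIME A T"
  using assms unfolding DTIME_def search_DTIME_def solves_in_time_def by blast

theorem theorem4:
  fixes X Y :: "'a set"
  assumes "finite (X \<union> Y)" and "X \<union> Y \<noteq> {}" and "X \<inter> Y = {}"
  shows "(ltlf_plus_realizability X Y \<in> TWO_EXPTIME (letters (X \<union> Y)) \<and>
          ltlf_plus_synthesis X Y \<in> search_TWO_EXPTIME (letters (X \<union> Y))) \<and>
         (ppltl_plus_realizability X Y \<in> EXPTIME (letters (X \<union> Y)) \<and>
          ppltl_plus_synthesis X Y \<in> search_EXPTIME (letters (X \<union> Y)))"
proof -
  let ?AP = "X \<union> Y"
  obtain g :: "'a \<Rightarrow> nat" where g: "inj_on g ?AP" using finite_imp_inj_to_nat_seg[OF assms(1)] by blast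
  obtain As where As: "set As = (\<lambda>p. 14 + g p) ` ?AP" using finite_list assms(1) by (metis finite_imageI)
  have ppltl_words: "plus_code ppltl_code \<Psi> \<in> lists (letters ?AP)" if "\<Psi> \<in> ppltl_plus_over ?AP" for \<Psi>
  proof -
    have "set (plus_code ppltl_code \<Psi>) \<subseteq> letters ?AP"
      by (rule plus_code_letters, rule ppltl_code_letters) (use that in \<open>auto simp: ppltl_plus_over_def\<close>)
    then show ?thesis by (auto simp: in_lists_conv_set)
  qed
  have past_letters: "past_letter l \<in> letters ?AP \<longleftrightarrow> l \<in> letters ?AP" for l by (cases l) (auto simp: letters_def)
  have ltlf_words: "plus_code ltlf_code \<Psi> \<in> lists (letters ?AP)" if "\<Psi> \<in> ltlf_plus_over ?AP" for \<Psi>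
  proof -
    have "map past_letter (plus_code ltlf_code \<Psi>) \<in> lists (letters ?AP)"
      using ppltl_words past_over[of \<Psi> ?AP] that unfolding plus_code_past[symmetric] by blast
    then show ?thesis by (simp add: in_lists_conv_set past_letters)
  qed
  have "\<exists>M C k. tm_over (letters ?AP) M \<and> solves_in_time M (letters ?AP) (ppltl_plus_realizability X Y)
    (strategy_answers (plus_code ppltl_code) (ppltl_plus_over ?AP) (ppltl_plus_lang ?AP) X Y) (time_bound (\<lambda>n. 1 + n * 4) C k)"
    unfolding ppltl_plus_realizability_def
  proof (rule synthesis_solvable[OF assms g As vector_monitor[of "parses As", unfolded vector_monitor_bound_def],
      where lang = "ppltl_lang ?AP" and d = id and cin = "letter_code g" and H = id])
    show "ppltl_lang ?AP \<phi> = {t \<in> finite_traces ?AP. ppltl_sat (id t) (length t - 1) \<phi>}" for \<phi>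
      by (simp add: ppltl_lang_def)
  qed (auto simp: inj_letter_code[OF g] word_code_def ppltl_words ppltl_plus_lang_def simp del: lists_eq_set in_lists_conv_set)
  then obtain M C k where M: "tm_over (letters ?AP) M" "solves_in_time M (letters ?AP) (ppltl_plus_realizability X Y)
    (strategy_answers (plus_code ppltl_code) (ppltl_plus_over ?AP) (ppltl_plus_lang ?AP) X Y) (time_bound (\<lambda>n. 1 + n * 4) C k)"
    by blast
  obtain K where K: "(\<lambda>n. real (time_bound (\<lambda>n. 1 + n * 4) C k n)) \<in> O(\<lambda>n. 2 ^ (n ^ K))" using time_bound_exp by blast
  have "ppltl_plus_realizability X Y \<subseteq> lists (letters ?AP)"
    unfolding ppltl_plus_realizability_def by (rule realizable_words_lists[OF ppltl_words])
  from solves_search_DTIME[OF M K this]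
  have ppltl: "ppltl_plus_realizability X Y \<in> EXPTIME (letters ?AP)" "ppltl_plus_synthesis X Y \<in> search_EXPTIME (letters ?AP)"
    unfolding EXPTIME_def search_EXPTIME_def ppltl_plus_synthesis_def by blast+
  have "\<exists>M C k. tm_over (letters ?AP) M \<and> solves_in_time M (letters ?AP) (ltlf_plus_realizability X Y)
    (strategy_answers (plus_code ltlf_code) (ltlf_plus_over ?AP) (ltlf_plus_lang ?AP) X Y)
    (time_bound (\<lambda>n. 1 + 2 ^ n * (n * 8 + 4)) C k)"
    unfolding ltlf_plus_realizability_def
  \<comment> \<open>Composing the numbering with \<open>past_letter\<close> makes the machine read
    an LTLf word as the word of the mirrored formula.\<close>
  proof (rule synthesis_solvable[OF assms g As table_monitor[of "parses As", unfolded table_bound_def],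
      where lang = "\<lambda>\<phi>. {t \<in> finite_traces ?AP. ppltl_sat (rev t) (length t - 1) \<phi>}" and d = rev
        and cin = "\<lambda>l. letter_code g (past_letter l)" and H = "map_plus past"])
    show "inj_on (\<lambda>l. letter_code g (past_letter l)) (letters ?AP)"
    proof (rule inj_onI)
      fix l l' assume "l \<in> letters ?AP" "l' \<in> letters ?AP" "letter_code g (past_letter l) = letter_code g (past_letter l')"
      then have "past_letter l = past_letter l'" using inj_onD[OF inj_letter_code[OF g]] past_letters by blast
      then show "l = l'" by (metis past_letter_involution)
    qed
    show "map_plus past \<Psi> \<in> ppltl_plus_over ?AP" if "\<Psi> \<in> ltlf_plus_over ?AP" for \<Psi> using that past_over by blast
    show "\<exists>\<Psi>\<in>ltlf_plus_over ?AP. map_plus past \<Psi> = \<Psi>'" if "\<Psi>' \<in> ppltl_plus_over ?AP" for \<Psi>'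
      using surj_map_past[of \<Psi>'] past_over that by blast
    show "map (\<lambda>l. letter_code g (past_letter l)) (plus_code ltlf_code \<Psi>) = word_code g (map_plus past \<Psi>)" for \<Psi>
      by (simp add: word_code_def plus_code_past)
    show "plus_code ltlf_code \<Psi> \<in> lists (letters ?AP)" if "\<Psi> \<in> ltlf_plus_over ?AP" for \<Psi> by (rule ltlf_words[OF that])
    show "ltlf_plus_lang ?AP \<Psi> =
      plus_lang (\<lambda>\<phi>. {t \<in> finite_traces ?AP. ppltl_sat (rev t) (length t - 1) \<phi>}) ?AP (map_plus past \<Psi>)" for \<Psi>
    proof -
      have "ltlf_lang ?AP = (\<lambda>\<phi>. {t \<in> finite_traces ?AP. ppltl_sat (rev t) (length t - 1) (past \<phi>)})"
        using ppltl_sat_past[of 0] by (auto simp: ltlf_lang_def finite_traces_def fun_eq_iff)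
      then show ?thesis unfolding ltlf_plus_lang_def plus_lang_map by (rule arg_cong)
    qed
  qed (simp_all add: rev_map)
  then obtain M C k where M: "tm_over (letters ?AP) M" "solves_in_time M (letters ?AP) (ltlf_plus_realizability X Y)
    (strategy_answers (plus_code ltlf_code) (ltlf_plus_over ?AP) (ltlf_plus_lang ?AP) X Y)
    (time_bound (\<lambda>n. 1 + 2 ^ n * (n * 8 + 4)) C k)"
    by blast
  obtain K where K: "(\<lambda>n. real (time_bound (\<lambda>n. 1 + 2 ^ n * (n * 8 + 4)) C k n)) \<in> O(\<lambda>n. 2 ^ (2 ^ (n ^ K)))"
    using time_bound_two_exp by blast
  have "ltlf_plus_realizability X Y \<subseteq> lists (letters ?AP)"
    unfolding ltlf_plus_realizability_def by (rule realizable_words_lists[OF ltlf_words])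
  from solves_search_DTIME[OF M K this]
  have "ltlf_plus_realizability X Y \<in> TWO_EXPTIME (letters ?AP)" "ltlf_plus_synthesis X Y \<in> search_TWO_EXPTIME (letters ?AP)"
    unfolding TWO_EXPTIME_def search_TWO_EXPTIME_def ltlf_plus_synthesis_def by blast+
  with ppltl show ?thesis by blast
qed

end
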